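(* For any $T>0$ and any $(r,q)\in[1,\infty)\times(1,\infty)$ there exist $V_0\in\mathcal G_\sigma$ and $f\in L^r(0,T;L^q(\mathbb R^3))$ such that: (a) the Navier–Stokes problem (NS) with data $V_0,f$ admits a global Leray–Hopf solution $V\in C^0(\mathbb R_+;L^2(\mathbb R^3))$ which satisfies the energy equality (the energy inequality (EI) with equality sign) for all $t>0$; (b) there exists $\overline q>3$ such that $V\in L^{2s/(s-3)}_{\rm loc}(\mathbb R_+;L^s(\mathbb R^3))$ for all $s>\overline q$ and, hence, this solution is unique (in the class of Leray–Hopf solutions with the same data); (c) there exist a bounded strictly increasing sequence $\{T_m\}_{m\ge1}$ of positive instants $0<T_1<T_2<\dots<T_m<T$ and a sequence $\{\xi_m\}_{m\ge1}\subset\mathbb R^3$ such that the solution $V$ and its associated pressure $P$ satisfy $V,P\in C^1(\mathbb R^3\times\mathbb R_+)\cap C^\infty\big((\mathbb R^3\times\mathbb R_+)\setminus\bigcup_{m=1}^\infty\{(\xi_m,T_m)\}\big)$; (d) this solution satisfies $V(\xi,T_m)\equiv\nabla V(\xi,T_m)\equiv V_t(\xi,T_m)\equiv0$ in $\mathbb R^3$ for all $m\ge1$ and, for all $m\ge 1$, $$\lim_{t\to T_m}\|\Delta V(t)\|_{L^\infty(\mathbb R^3)}=\infty,$$ while the associated pressure $P$ satisfies $P\in L^2_{\rm loc}(\mathbb R_+;L^p(\mathbb R^3))$ for all $p\ge1$ and $\nabla P\in L^r_{\rm loc}(\mathbb R_+;L^q(\mathbb R^3))$.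
   Context: Notation: $\xi=(x,y,z)\in\mathbb R^3$, $\mathbb R_+=[0,\infty)$. $L^r_{\rm loc}(\mathbb R_+;X)$ denotes functions belonging to $L^r(0,S;X)$ for every $S>0$. $L^p_\sigma(\mathbb R^3)$ is the subspace of divergence-free vector fields in $L^p(\mathbb R^3)$. Set $$\mathcal G=\bigcap_{k\in\mathbb N}\bigcap_{q\in[2,\infty]}W^{k,q}(\mathbb R^3)\subset C^\infty(\mathbb R^3),\qquad \mathcal G_\sigma=\{V\in\mathcal G:\ \nabla\cdot V=0\text{ in }\mathbb R^3\}$$ (vector fields $\mathbb R^3\to\mathbb R^3$). Problem (NS): $V_t-\Delta V+(V\cdot\nabla)V+\nabla P=f$ and $\nabla\cdot V=0$ in $\mathbb R^3\times(0,\infty)$, $V(\xi,0)=V_0(\xi)$. Leray–Hopf solution: for $S>0$ let $\mathcal D_S=\{\phi\in C^\infty_c(\mathbb R^3\times[0,S)):\nabla\cdot\phi=0\}$ (vector-valued $\phi$). For $V_0\in L^2_\sigma(\mathbb R^3)$ and $f\in L^2(0,S;H^{-1}(\mathbb R^3))+L^1(0,S;L^2(\mathbb R^3))$, a vector field $V$ is a Leray–Hopf solution of (NS) in $\mathbb R^3\times(0,S)$ if $V\in L^\infty(0,S;L^2_\sigma(\mathbb R^3))\cap L^2(0,S;H^1(\mathbb R^3))$, $$\int_0^\infty\!\int_{\mathbb R^3}\big[\nabla V:\nabla\phi+(V\cdot\nabla)V\cdot\phi-V\cdot\phi_t\big]d\xi\,dt=\int_0^\infty\langle f,\phi\rangle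 dt+\int_{\mathbb R^3}V_0\cdot\phi(0)\,d\xi\quad\forall\phi\in\mathcal D_S,$$ and the energy inequality holds: $$\text{(EI)}\quad\|V(t)\|_{L^2(\mathbb R^3)}^2+2\int_0^t\|\nabla V(s)\|_{L^2(\mathbb R^3)}^2ds\le\|V_0\|_{L^2(\mathbb R^3)}^2+2\int_0^t\langle f(s),V(s)\rangle ds\quad\forall t\in(0,S].$$ It is a global Leray–Hopf solution if it is a Leray–Hopf solution in $\mathbb R^3\times(0,S)$ for every $S>0$ (in particular $f\in L^2(0,S;H^{-1}(\mathbb R^3))+L^1(0,S;L^2(\mathbb R^3))$ for every $S>0$). Associated pressure: a function $P\in L^1_{\rm loc}(\mathbb R^3\times(0,S))$ for every $S>0$ such that $(V,P)$ satisfies the first equation of (NS) in the distributional sense; it solves $-\Delta P=\nabla\cdot[(V\cdot\nabla)V-f]$ in the distributional sense in $\mathbb R^3$ for a.e. $t$. *)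

theory Defs
  imports "HOL-Analysis.Analysis" "HOL-Probability.Essential_Supremum"
begin

type_synonym R3 = "real^3"

text \<open>
  Time-dependent fields are curried with time first, \<open>u t \<xi>\<close>, so that \<open>u t\<close> is a field on space;
  subsets of space-time are written in the order \<open>(\<xi>, t)\<close>.
\<close>

abbreviation spacetime :: "(real \<Rightarrow> R3 \<Rightarrow> 'b) \<Rightarrow> R3 \<times> real \<Rightarrow> 'b" where
  "spacetime u \<equiv> (\<lambda>(x, t). u t x)"


section \<open>Classical derivatives and smoothness\<close>

definition pd :: "3 \<Rightarrow> (R3 \<Rightarrow> 'b::real_normed_vector) \<Rightarrow> R3 \<Rightarrow> 'b" where
  "pd i g x = vector_derivative (\<lambda>s. g (x + s *\<^sub>R axis i 1)) (at 0)"

definition pds :: "3 list \<Rightarrow> (R3 \<Rightarrow> 'b::real_normed_vector) \<Rightarrow> R3 \<Rightarrow> 'b" where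
  "pds \<alpha> g = foldr pd \<alpha> g"

definition grad :: "(R3 \<Rightarrow> 'b::real_normed_vector) \<Rightarrow> R3 \<Rightarrow> 'b^3" where
  "grad g x = (\<chi> i. pd i g x)"

definition divg :: "(R3 \<Rightarrow> R3) \<Rightarrow> R3 \<Rightarrow> real" where
  "divg V x = (\<Sum>i\<in>UNIV. pd i V x $ i)"

definition lap :: "(R3 \<Rightarrow> 'b::real_normed_vector) \<Rightarrow> R3 \<Rightarrow> 'b" where
  "lap g x = (\<Sum>i\<in>UNIV. pd i (pd i g) x)"

definition time_deriv :: "(real \<Rightarrow> R3 \<Rightarrow> 'b::real_normed_vector) \<Rightarrow> real \<Rightarrow> R3 \<Rightarrow> 'b" where
  "time_deriv u t x = vector_derivative (\<lambda>s. u s x) (at t)"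

text \<open>
  \<open>C\<^sup>k(A)\<close> with derivatives taken relative to \<open>A\<close>, so that for \<open>A = \<real>\<^sup>3 \<times> [0,\<infinity>)\<close> the derivatives are
  one-sided in time at \<open>t = 0\<close> and continuous up to \<open>t = 0\<close>.
\<close>

primrec C_on :: "nat \<Rightarrow> 'a::real_normed_vector set \<Rightarrow> ('a \<Rightarrow> 'b::real_normed_vector) \<Rightarrow> bool" where
  "C_on 0 A g \<longleftrightarrow> continuous_on A g"
| "C_on (Suc k) A g \<longleftrightarrow>
     (\<exists>D. (\<forall>z\<in>A. (g has_derivative D z) (at z within A)) \<and> (\<forall>h. C_on k A (\<lambda>z. D z h)))"

definition smooth_on :: "'a::real_normed_vector set \<Rightarrow> ('a \<Rightarrow> 'b::real_normed_vector) \<Rightarrow> bool" where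
  "smooth_on A g \<longleftrightarrow> (\<forall>k. C_on k A g)"

definition Cc_inf :: "'a::real_normed_vector set \<Rightarrow> ('a \<Rightarrow> 'b::real_normed_vector) set" where
  "Cc_inf A = {\<phi>. smooth_on A \<phi> \<and> (\<exists>K. compact K \<and> K \<subseteq> A \<and> (\<forall>z. z \<notin> K \<longrightarrow> \<phi> z = 0))}"


section \<open>Lebesgue and Sobolev spaces\<close>

text \<open>Only used with positive exponents \<open>a\<close>.\<close>

definition enn_powr :: "ennreal \<Rightarrow> real \<Rightarrow> ennreal" where
  "enn_powr x a = (if x = \<infinity> then \<infinity> else ennreal (enn2real x powr a))"

definition Lp_gauge :: "ennreal \<Rightarrow> 'a measure \<Rightarrow> ('a \<Rightarrow> ennreal) \<Rightarrow> ennreal" where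
  "Lp_gauge p M h =
     (if p = \<infinity> then esssup M h
      else enn_powr (\<integral>\<^sup>+ x. enn_powr (h x) (enn2real p) \<partial>M) (1 / enn2real p))"

definition Lp_norm :: "ennreal \<Rightarrow> (R3 \<Rightarrow> 'b::real_normed_vector) \<Rightarrow> ennreal" where
  "Lp_norm p g = Lp_gauge p lebesgue (\<lambda>x. ennreal (norm (g x)))"

definition Lp :: "ennreal \<Rightarrow> (R3 \<Rightarrow> 'b::real_normed_vector) set" where
  "Lp p = {g. g \<in> borel_measurable lebesgue \<and> Lp_norm p g < \<infinity>}"

abbreviation L2_norm :: "(R3 \<Rightarrow> 'b::real_normed_vector) \<Rightarrow> real" where
  "L2_norm g \<equiv> enn2real (Lp_norm 2 g)"

definition L1_loc :: "'a::euclidean_space set \<Rightarrow> ('a \<Rightarrow> 'b::euclidean_space) set" where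
  "L1_loc U = {g. \<forall>K. compact K \<longrightarrow> K \<subseteq> U \<longrightarrow> integrable (lebesgue_on K) g}"

text \<open>Divergence-free in the sense of distributions.\<close>

definition L2_sigma :: "(R3 \<Rightarrow> R3) set" where
  "L2_sigma = {V \<in> Lp 2. \<forall>\<phi> \<in> Cc_inf UNIV. (LINT x|lebesgue. V x \<bullet> grad \<phi> x) = 0}"

text \<open>
  A multi-index is encoded as the list of the directions of differentiation.
\<close>

definition weak_deriv ::
  "3 list \<Rightarrow> (R3 \<Rightarrow> 'b::euclidean_space) \<Rightarrow> (R3 \<Rightarrow> 'b) \<Rightarrow> bool" where
  "weak_deriv \<alpha> g h \<longleftrightarrow> g \<in> L1_loc UNIV \<and> h \<in> L1_loc UNIV \<and>
     (\<forall>\<phi> \<in> Cc_inf UNIV. (LINT x|lebesgue. pds \<alpha> \<phi> x *\<^sub>R g x) =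
        (- 1) ^ length \<alpha> *\<^sub>R (LINT x|lebesgue. \<phi> x *\<^sub>R h x))"

definition Sobolev :: "nat \<Rightarrow> ennreal \<Rightarrow> (R3 \<Rightarrow> 'b::euclidean_space) set" where
  "Sobolev k q = {g. \<forall>\<alpha>. length \<alpha> \<le> k \<longrightarrow> (\<exists>h \<in> Lp q. weak_deriv \<alpha> g h)}"

text \<open>
  A choice of the weak gradient, which is determined up to null sets; the \<open>j\<close>-th entry
  is the derivative in direction \<open>j\<close>.
\<close>

definition wgrad :: "(R3 \<Rightarrow> 'b::euclidean_space) \<Rightarrow> R3 \<Rightarrow> 'b^3" where
  "wgrad g x = (\<chi> j. (SOME h. weak_deriv [j] g h) x)"

text \<open>\<open>(V \<cdot> \<nabla>)V\<close> with weak derivatives.\<close>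

definition convect :: "(R3 \<Rightarrow> R3) \<Rightarrow> R3 \<Rightarrow> R3" where
  "convect V x = (\<Sum>j\<in>UNIV. (V x $ j) *\<^sub>R (wgrad V x $ j))"

abbreviation H1 :: "(R3 \<Rightarrow> R3) set" where
  "H1 \<equiv> Sobolev 1 2"

definition H1_norm :: "(R3 \<Rightarrow> R3) \<Rightarrow> ennreal" where
  "H1_norm g = enn_powr ((Lp_norm 2 g)\<^sup>2 + (Lp_norm 2 (wgrad g))\<^sup>2) (1/2)"

text \<open>
  The elements of the intersection of all \<open>W\<^sup>k\<^sup>,\<^sup>q\<close> are represented by their smooth representatives.
\<close>

definition G_space :: "(R3 \<Rightarrow> R3) set" where
  "G_space = {V. smooth_on UNIV V \<and> (\<forall>k. \<forall>q. 2 \<le> q \<longrightarrow> V \<in> Sobolev k q)}"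

definition G_sigma :: "(R3 \<Rightarrow> R3) set" where
  "G_sigma = {V \<in> G_space. \<forall>x. divg V x = 0}"


section \<open>The dual space of \<open>H\<^sup>1\<close>\<close>

definition H1_functional :: "((R3 \<Rightarrow> R3) \<Rightarrow> real) \<Rightarrow> bool" where
  "H1_functional l \<longleftrightarrow>
     (\<forall>\<phi>\<in>H1. \<forall>\<psi>\<in>H1. \<forall>a b. l (\<lambda>x. a *\<^sub>R \<phi> x + b *\<^sub>R \<psi> x) = a * l \<phi> + b * l \<psi>) \<and>
     (\<exists>C. \<forall>\<phi>\<in>H1. \<bar>l \<phi>\<bar> \<le> C * enn2real (H1_norm \<phi>))"

text \<open>
  The locally integrable field \<open>h\<close>, regarded as a distribution, extends to the bounded functional \<open>l\<close>.
  By density of the test fields in \<open>H\<^sup>1\<close>, \<open>l\<close> is uniquely determined on \<open>H\<^sup>1\<close>, but \<open>h \<bullet> \<phi>\<close> need not be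
  integrable for every \<open>\<phi>\<close> in \<open>H\<^sup>1\<close>.
\<close>

definition represents :: "(R3 \<Rightarrow> R3) \<Rightarrow> ((R3 \<Rightarrow> R3) \<Rightarrow> real) \<Rightarrow> bool" where
  "represents h l \<longleftrightarrow> h \<in> L1_loc UNIV \<and> H1_functional l \<and>
     (\<forall>\<phi> \<in> Cc_inf UNIV. l \<phi> = (LINT x|lebesgue. h x \<bullet> \<phi> x))"

definition Hm1 :: "(R3 \<Rightarrow> R3) set" where
  "Hm1 = {h. \<exists>l. represents h l}"

definition pairing :: "(R3 \<Rightarrow> R3) \<Rightarrow> (R3 \<Rightarrow> R3) \<Rightarrow> real" where
  "pairing h = (SOME l. represents h l)"

definition Hm1_norm :: "(R3 \<Rightarrow> R3) \<Rightarrow> ennreal" where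
  "Hm1_norm h = (SUP \<phi> \<in> {\<phi> \<in> H1. H1_norm \<phi> \<le> 1}. ennreal \<bar>pairing h \<phi>\<bar>)"


section \<open>Spaces of time-dependent fields\<close>

text \<open>
  \<open>L\<^sup>r(0,S;X)\<close> for a space \<open>X\<close> of fields with norm \<open>N\<close>. Strong measurability is expressed by joint
  measurability on \<open>\<real>\<^sup>3 \<times> (0,S)\<close>, which is the same thing for the separable spaces \<open>X\<close> of functions
  occurring here.
\<close>

definition Bochner ::
  "ennreal \<Rightarrow> real \<Rightarrow> (R3 \<Rightarrow> 'b::euclidean_space) set \<Rightarrow> ((R3 \<Rightarrow> 'b) \<Rightarrow> ennreal)
    \<Rightarrow> (real \<Rightarrow> R3 \<Rightarrow> 'b) set" where
  "Bochner r S X N = {u.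
     spacetime u \<in> borel_measurable (lebesgue_on (UNIV \<times> {0<..<S})) \<and>
     (AE t in lebesgue_on {0<..<S}. u t \<in> X) \<and>
     Lp_gauge r (lebesgue_on {0<..<S}) (\<lambda>t. N (u t)) < \<infinity>}"

abbreviation LrLq ::
  "ennreal \<Rightarrow> ennreal \<Rightarrow> real \<Rightarrow> (real \<Rightarrow> R3 \<Rightarrow> 'b::euclidean_space) set" where
  "LrLq r q S \<equiv> Bochner r S (Lp q) (Lp_norm q)"

abbreviation LrLq_loc ::
  "ennreal \<Rightarrow> ennreal \<Rightarrow> (real \<Rightarrow> R3 \<Rightarrow> 'b::euclidean_space) set" where
  "LrLq_loc r q \<equiv> {u. \<forall>S>0. u \<in> LrLq r q S}"

definition C0_L2 :: "(real \<Rightarrow> R3 \<Rightarrow> R3) set" where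
  "C0_L2 = {u. (\<forall>t\<ge>0. u t \<in> Lp 2) \<and>
     (\<forall>t\<ge>0. ((\<lambda>s. Lp_norm 2 (\<lambda>x. u s x - u t x)) \<longlongrightarrow> 0) (at t within {0..}))}"

text \<open>
  \<open>L\<^sup>2(0,S;H\<^sup>-\<^sup>1) + L\<^sup>1(0,S;L\<^sup>2)\<close>, for forces given by functions (then the first summand is a function too).
\<close>

definition forces :: "real \<Rightarrow> (real \<Rightarrow> R3 \<Rightarrow> R3) set" where
  "forces S = {f. \<exists>f1 \<in> Bochner 2 S Hm1 Hm1_norm. \<exists>f2 \<in> LrLq 1 2 S.
     AE t in lebesgue_on {0<..<S}. AE x in lebesgue. f t x = f1 t x + f2 t x}"


section \<open>Leray--Hopf solutions\<close>

definition test_fields :: "real \<Rightarrow> (real \<Rightarrow> R3 \<Rightarrow> R3) set" where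
  "test_fields S = {\<phi>. spacetime \<phi> \<in> Cc_inf (UNIV \<times> {0..<S}) \<and>
     (\<forall>t\<in>{0..<S}. \<forall>x. divg (\<phi> t) x = 0)}"

definition energy_lhs :: "(real \<Rightarrow> R3 \<Rightarrow> R3) \<Rightarrow> real \<Rightarrow> real" where
  "energy_lhs V t =
     (L2_norm (V t))\<^sup>2 + 2 * (LINT s|lebesgue_on {0<..<t}. (L2_norm (wgrad (V s)))\<^sup>2)"

definition energy_rhs ::
  "(R3 \<Rightarrow> R3) \<Rightarrow> (real \<Rightarrow> R3 \<Rightarrow> R3) \<Rightarrow> (real \<Rightarrow> R3 \<Rightarrow> R3) \<Rightarrow> real \<Rightarrow> real" where
  "energy_rhs V0 f V t =
     (L2_norm V0)\<^sup>2 + 2 * (LINT s|lebesgue_on {0<..<t}. pairing (f s) (V s))"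

text \<open>
  The energy inequality is imposed at every time, so \<open>V\<close> is a pointwise-in-time representative; the
  condition \<open>V t \<in> Lp 2\<close> makes the (real-valued) norm of \<open>V t\<close> meaningful.
\<close>

definition Leray_Hopf ::
  "real \<Rightarrow> (R3 \<Rightarrow> R3) \<Rightarrow> (real \<Rightarrow> R3 \<Rightarrow> R3) \<Rightarrow> (real \<Rightarrow> R3 \<Rightarrow> R3) \<Rightarrow> bool" where
  "Leray_Hopf S V0 f V \<longleftrightarrow>
     V0 \<in> L2_sigma \<and> f \<in> forces S \<and>
     V \<in> Bochner \<infinity> S L2_sigma (Lp_norm 2) \<and> V \<in> Bochner 2 S H1 H1_norm \<and>
     (\<forall>\<phi> \<in> test_fields S.
        (LINT t|lebesgue_on {0<..<S}. LINT x|lebesgue.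
           wgrad (V t) x \<bullet> grad (\<phi> t) x + convect (V t) x \<bullet> \<phi> t x
             - V t x \<bullet> time_deriv \<phi> t x)
        = (LINT t|lebesgue_on {0<..<S}. pairing (f t) (\<phi> t))
          + (LINT x|lebesgue. V0 x \<bullet> \<phi> 0 x)) \<and>
     (\<forall>t\<in>{0<..S}. V t \<in> Lp 2 \<and> energy_lhs V t \<le> energy_rhs V0 f V t)"

definition global_Leray_Hopf ::
  "(R3 \<Rightarrow> R3) \<Rightarrow> (real \<Rightarrow> R3 \<Rightarrow> R3) \<Rightarrow> (real \<Rightarrow> R3 \<Rightarrow> R3) \<Rightarrow> bool" where
  "global_Leray_Hopf V0 f V \<longleftrightarrow> (\<forall>S>0. Leray_Hopf S V0 f V)"

definition associated_pressure ::
  "(real \<Rightarrow> R3 \<Rightarrow> R3) \<Rightarrow> (real \<Rightarrow> R3 \<Rightarrow> R3) \<Rightarrow> (real \<Rightarrow> R3 \<Rightarrow> real) \<Rightarrow> bool" where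
  "associated_pressure f V P \<longleftrightarrow> (\<forall>S>0.
     spacetime P \<in> L1_loc (UNIV \<times> {0<..<S}) \<and>
     (\<forall>\<phi>. spacetime \<phi> \<in> Cc_inf (UNIV \<times> {0<..<S}) \<longrightarrow>
        (LINT t|lebesgue_on {0<..<S}. LINT x|lebesgue.
           - (V t x \<bullet> time_deriv \<phi> t x) - V t x \<bullet> lap (\<phi> t) x
             + convect (V t) x \<bullet> \<phi> t x - P t x * divg (\<phi> t) x)
        = (LINT t|lebesgue_on {0<..<S}. pairing (f t) (\<phi> t))))"

end

theory Submission
  imports Defs "HOL-Probability.Probability"
begin

text \<open>
  Let \<open>w\<close> be a smooth compactly supported swirl around an axis and
  \<open>B(y, s) = a(s) w(|s|\<^sup>-\<^sup>\<gamma> y)\<close> with \<open>a(s) \<approx> s\<^sup>2\<close> and \<open>\<gamma>\<close> slightly larger than 1. The bubble \<open>B\<close> is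
  divergence free, vanishes with its first derivatives at \<open>s = 0\<close>, is smooth except at the origin
  of space-time, and its Laplacian grows like \<open>|s|\<close> to the power \<open>2 - 2\<gamma>\<close>. Disjoint rescaled copies of
  \<open>B\<close> at the times \<open>\<tau>\<^sub>m\<close> and places \<open>\<xi>\<^sub>m\<close> form the velocity \<open>V\<close>; the initial value and the pressure
  are zero and the force is \<open>V\<^sub>t - \<Delta>V + (V \<cdot> \<nabla>)V\<close>, which lies in \<open>L\<^sup>r(0,T;L\<^sup>q)\<close> when
  \<open>\<gamma> = 1 + 1/(4r)\<close>.

  Uniqueness is weak-strong uniqueness: testing the weak form of a competitor \<open>W\<close> with \<open>\<theta>V\<close>, where
  \<open>\<theta>\<close> is a decreasing weight and \<open>V\<close> is first replaced by smooth cut-offs in time, and adding the two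
  energy relations yields \<open>\<integral> \<theta> \<parallel>W - V\<parallel>\<^sup>2 \<le> 0\<close>, as \<open>\<nabla>V\<close> is bounded.
\<close>

subsection \<open>Calculus of smooth functions\<close>

text \<open>The force is free, so the velocity is prescribed and \<open>forceB\<close> is what the
  equation leaves; it absorbs the whole convective term, which makes zero pressure admissible. The
  exponent is a compromise: the gradient of a bubble has size |s|^(2 - \<gamma>), which tends to 0
  and gives C^1, while the unbounded Laplacian must stay r-integrable; with the chosen \<gamma> its
  r-th power is of order |s|^(-1/2). Active times are disjoint, so each time slice is one bubble in
  a unit ball and every L^q norm is controlled by the supremum. Places are far apart, so that near t
  = T, where the instants accumulate, only one bubble is seen locally and smoothness survives. A
  factor \<open>kap m\<close> compensates the shrinking time scale. Two obstacles account for much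
  of the length: \<open>wgrad\<close> and \<open>pairing\<close> are arbitrary choices, to be
  identified by the fundamental lemma and by density in H^1; and V is no test field, being singular
  and of unbounded support, so competitors are tested with smooth cut-offs that obey the same bounds
  as V.\<close>

lemma C_on_SucI:
  assumes "\<And>z. z \<in> A \<Longrightarrow> (f has_derivative D z) (at z within A)" "\<And>h. C_on k A (\<lambda>z. D z h)"
  shows "C_on (Suc k) A f"
  using assms by auto

lemma C_on_SucE:
  assumes "C_on (Suc k) A f"
  obtains D where "\<And>z. z \<in> A \<Longrightarrow> (f has_derivative D z) (at z within A)" "\<And>h. C_on k A (\<lambda>z. D z h)"
  using assms by auto

lemma C_on_cong:
  assumes "C_on k A f" "\<And>z. z \<in> A \<Longrightarrow> f z = g z"
  shows "C_on k A g"
proof (cases k)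
  case 0
  then show ?thesis using assms by (auto cong: continuous_on_cong)
next
  case (Suc j)
  with assms(1) obtain D where D: "\<And>z. z \<in> A \<Longrightarrow> (f has_derivative D z) (at z within A)"
    "\<And>h. C_on j A (\<lambda>z. D z h)" by auto
  have "(g has_derivative D z) (at z within A)" if "z \<in> A" for z
    using has_derivative_transform[OF that _ D(1)[OF that]] assms(2) by metis
  then show ?thesis unfolding Suc using C_on_SucI D(2) by blast
qed

lemma C_on_subset: "C_on k A f \<Longrightarrow> B \<subseteq> A \<Longrightarrow> C_on k B f"
proof (induction k arbitrary: f)
  case 0
  then show ?case by (auto intro: continuous_on_subset)
next
  case (Suc k)
  then obtain D where D: "\<And>z. z \<in> A \<Longrightarrow> (f has_derivative D z) (at z within A)"
    "\<And>h. C_on k A (\<lambda>z. D z h)" by auto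
  have "(f has_derivative D z) (at z within B)" if "z \<in> B" for z
    using D(1) that Suc.prems(2) has_derivative_subset by blast
  then show ?case using Suc.IH[OF D(2) Suc.prems(2)] by (rule C_on_SucI)
qed

lemma C_on_continuous: "C_on k A f \<Longrightarrow> continuous_on A f"
proof (cases k)
  case (Suc j)
  assume "C_on k A f"
  then obtain D where "\<And>z. z \<in> A \<Longrightarrow> (f has_derivative D z) (at z within A)"
    using Suc by auto
  then show ?thesis by (rule has_derivative_continuous_on)
qed auto

lemma C_on_Suc_D: "C_on (Suc k) A f \<Longrightarrow> C_on k A f"
proof (induction k arbitrary: f)
  case 0
  show ?case using C_on_continuous[OF 0] by simp
next
  case (Suc k)
  from Suc.prems obtain D where D: "\<And>z. z \<in> A \<Longrightarrow> (f has_derivative D z) (at z within A)"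
    "\<And>h. C_on (Suc k) A (\<lambda>z. D z h)" by (rule C_on_SucE) blast
  show ?case using D(1) Suc.IH[OF D(2)] by (rule C_on_SucI)
qed

lemma C_on_mono: "C_on k A f \<Longrightarrow> j \<le> k \<Longrightarrow> C_on j A f"
  by (induction k) (auto simp: le_Suc_eq dest: C_on_Suc_D simp del: C_on.simps(2))

lemma C_on_const: "C_on k A (\<lambda>_. c)"
proof (induction k arbitrary: c)
  case (Suc k)
  show ?case by (rule C_on_SucI[of _ _ "\<lambda>_ _. 0"]) (auto intro: Suc)
qed auto

lemma C_on_bounded_linear:
  assumes L: "bounded_linear L" and f: "C_on k A f"
  shows "C_on k A (\<lambda>z. L (f z))"
  using f
proof (induction k arbitrary: f)
  case 0
  then show ?case using bounded_linear.continuous_on[OF L] by auto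
next
  case (Suc k)
  then obtain D where D: "\<And>z. z \<in> A \<Longrightarrow> (f has_derivative D z) (at z within A)"
    "\<And>h. C_on k A (\<lambda>z. D z h)" by auto
  have "((\<lambda>z. L (f z)) has_derivative (\<lambda>h. L (D z h))) (at z within A)" if "z \<in> A" for z
    using bounded_linear.has_derivative[OF L D(1)[OF that]] .
  then show ?case using Suc.IH[OF D(2)] by (rule C_on_SucI)
qed

lemma C_on_add:
  assumes "C_on k A f" "C_on k A g"
  shows "C_on k A (\<lambda>z. f z + g z)"
  using assms
proof (induction k arbitrary: f g)
  case 0
  then show ?case by (auto intro: continuous_intros)
next
  case (Suc k)
  from Suc.prems(1) obtain D where "\<And>z. z \<in> A \<Longrightarrow> (f has_derivative D z) (at z within A)"
    "\<And>h. C_on k A (\<lambda>z. D z h)" by (rule C_on_SucE) blast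
  moreover from Suc.prems(2) obtain E where "\<And>z. z \<in> A \<Longrightarrow> (g has_derivative E z) (at z within A)"
    "\<And>h. C_on k A (\<lambda>z. E z h)" by (rule C_on_SucE) blast
  ultimately show ?case
    by (intro C_on_SucI[of _ _ "\<lambda>z h. D z h + E z h"] has_derivative_add Suc.IH) auto
qed

lemma C_on_sum: "(\<And>i. i \<in> I \<Longrightarrow> C_on k A (f i)) \<Longrightarrow> C_on k A (\<lambda>z. \<Sum>i\<in>I. f i z)"
  by (induction I rule: infinite_finite_induct) (auto intro: C_on_const C_on_add)

lemma C_on_bilinear:
  assumes B: "bounded_bilinear pr" and "C_on k A f" "C_on k A g"
  shows "C_on k A (\<lambda>z. pr (f z) (g z))"
  using assms(2,3)
proof (induction k arbitrary: f g)
  case 0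
  then show ?case by (auto intro: bounded_bilinear.continuous_on[OF B])
next
  case (Suc k)
  from Suc.prems(1) obtain D where D: "\<And>z. z \<in> A \<Longrightarrow> (f has_derivative D z) (at z within A)"
    "\<And>h. C_on k A (\<lambda>z. D z h)" by (rule C_on_SucE) blast
  from Suc.prems(2) obtain E where E: "\<And>z. z \<in> A \<Longrightarrow> (g has_derivative E z) (at z within A)"
    "\<And>h. C_on k A (\<lambda>z. E z h)" by (rule C_on_SucE) blast
  have "((\<lambda>z. pr (f z) (g z)) has_derivative (\<lambda>h. pr (f z) (E z h) + pr (D z h) (g z))) (at z within A)"
    if "z \<in> A" for z
    using bounded_bilinear.FDERIV[OF B D(1)[OF that] E(1)[OF that]] .
  moreover have "C_on k A (\<lambda>z. pr (f z) (E z h) + pr (D z h) (g z))" for h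
    by (intro C_on_add Suc.IH D(2) E(2) C_on_Suc_D[OF Suc.prems(1)] C_on_Suc_D[OF Suc.prems(2)])
  ultimately show ?case by (rule C_on_SucI)
qed

lemmas C_on_scaleR = C_on_bilinear[OF bounded_bilinear_scaleR]
lemmas C_on_mult = C_on_bilinear[OF bounded_bilinear_mult]
lemmas C_on_inner = C_on_bilinear[OF bounded_bilinear_inner]

lemma C_on_linear: "bounded_linear L \<Longrightarrow> C_on k A L"
proof (cases k)
  case 0
  assume "bounded_linear L"
  then show ?thesis using 0 by (auto simp: linear_continuous_on)
next
  case (Suc j)
  assume "bounded_linear L"
  then show ?thesis unfolding Suc
    by (intro C_on_SucI[of _ _ "\<lambda>_. L"] C_on_const bounded_linear_imp_has_derivative)
qed

lemma C_on_id: "C_on k A (\<lambda>z. z)"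
  by (rule C_on_linear) (rule bounded_linear_ident)

lemma C_on_uminus: "C_on k A f \<Longrightarrow> C_on k A (\<lambda>z. - f z)"
  by (rule C_on_bounded_linear[OF bounded_linear_minus[OF bounded_linear_ident]])

lemma C_on_diff: "C_on k A f \<Longrightarrow> C_on k A g \<Longrightarrow> C_on k A (\<lambda>z. f z - g z)"
  using C_on_add[OF _ C_on_uminus] by fastforce

lemma C_on_Pair:
  assumes "C_on k A f" "C_on k A g"
  shows "C_on k A (\<lambda>z. (f z, g z))"
proof -
  have "C_on k A (\<lambda>z. (f z, 0) + (0, g z))"
    by (intro C_on_add C_on_bounded_linear[OF _ assms(1), of "\<lambda>x. (x, 0)"]
        C_on_bounded_linear[OF _ assms(2), of "\<lambda>x. (0, x)"] bounded_linear_Pair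
        bounded_linear_ident bounded_linear_zero)
  then show ?thesis by simp
qed

text \<open>The chain-rule derivative \<open>D (g z) (E z h)\<close> depends on z through the base
  point and through the direction, so the induction hypothesis does not apply to it as it stands.
  Expanding \<open>E z h\<close> in an orthonormal basis turns it into a finite sum of products of
  C^k functions; this is why the outer function lives on a Euclidean space.\<close>

lemma C_on_compose:
  fixes f :: "'a::euclidean_space \<Rightarrow> 'b::real_normed_vector"
    and g :: "'c::real_normed_vector \<Rightarrow> 'a"
  assumes "C_on k B f" "C_on k A g" "g ` A \<subseteq> B"
  shows "C_on k A (\<lambda>z. f (g z))"
  using assms(1,2)
proof (induction k arbitrary: f)
  case 0
  then show ?case using assms(3) by (auto intro: continuous_on_compose2)
next
  case (Suc k)
  from Suc.prems(1) obtain D where D: "\<And>z. z \<in> B \<Longrightarrow> (f has_derivative D z) (at z within B)"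
    "\<And>h. C_on k B (\<lambda>z. D z h)" by (rule C_on_SucE) blast
  from Suc.prems(2) obtain E where E: "\<And>z. z \<in> A \<Longrightarrow> (g has_derivative E z) (at z within A)"
    "\<And>h. C_on k A (\<lambda>z. E z h)" by (rule C_on_SucE) blast
  define F where "F z h = (\<Sum>b\<in>Basis. (E z h \<bullet> b) *\<^sub>R D (g z) b)" for z h
  have "((\<lambda>z. f (g z)) has_derivative F z) (at z within A)" if "z \<in> A" for z
  proof -
    have "(f has_derivative D (g z)) (at (g z) within B)"
      using D(1) assms(3) that by auto
    then have *: "(f has_derivative D (g z)) (at (g z) within g ` A)"
      by (rule has_derivative_subset[OF _ assms(3)])
    have "F z = (\<lambda>h. D (g z) (E z h))"
    proof
      fix h
      have lin: "linear (D (g z))" using * has_derivative_linear by blast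
      show "F z h = D (g z) (E z h)"
        unfolding F_def
        using linear_sum[OF lin, of "\<lambda>b. (E z h \<bullet> b) *\<^sub>R b" Basis]
        by (simp add: linear_cmul[OF lin] euclidean_representation)
    qed
    then show ?thesis using has_derivative_in_compose[OF E(1)[OF that] *] by simp
  qed
  moreover have "C_on k A (\<lambda>z. F z h)" for h
    unfolding F_def
    by (intro C_on_sum C_on_scaleR C_on_inner C_on_const D(2) E(2) Suc.IH C_on_Suc_D[OF Suc.prems(2)])
  ultimately show ?case by (rule C_on_SucI)
qed

text \<open>On an open set the derivative is unique, so the existential \<open>D\<close> of
  \<open>C_on\<close> can be replaced by \<open>frechet_derivative\<close>, which does not depend on
  the set.\<close>

lemma C_on_Suc_open:
  assumes "open A"
  shows "C_on (Suc k) A f \<longleftrightarrow>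
    (\<forall>z\<in>A. f differentiable at z) \<and> (\<forall>h. C_on k A (\<lambda>z. frechet_derivative f (at z) h))"
    (is "?l \<longleftrightarrow> ?r")
proof
  assume ?l
  then obtain D where D': "\<And>z. z \<in> A \<Longrightarrow> (f has_derivative D z) (at z within A)"
    and D2: "\<And>h. C_on k A (\<lambda>z. D z h)" by (rule C_on_SucE) blast
  have D: "(f has_derivative D z) (at z)" if "z \<in> A" for z
    using D'[OF that] unfolding at_within_open[OF that assms] .
  have "C_on k A (\<lambda>z. frechet_derivative f (at z) h)" for h
    by (rule C_on_cong[OF D2]) (rule fun_cong[OF frechet_derivative_at[OF D]])
  moreover have "\<forall>z\<in>A. f differentiable at z" using D differentiable_def by blast
  ultimately show ?r by blast
next
  assume r: ?r
  show ?l
  proof (rule C_on_SucI[of _ _ "\<lambda>z. frechet_derivative f (at z)"])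
    show "(f has_derivative frechet_derivative f (at z)) (at z within A)" if "z \<in> A" for z
      using r that unfolding at_within_open[OF that assms] by (simp add: frechet_derivative_works)
  qed (use r in blast)
qed

text \<open>Witnesses \<open>D\<close> of different neighbourhoods need not fit together; the
  canonical derivative of \<open>C_on_Suc_open\<close> is one global function, to which the
  induction hypothesis applies.\<close>

lemma C_on_local:
  assumes "\<And>z. z \<in> A \<Longrightarrow> \<exists>U. open U \<and> z \<in> U \<and> C_on k U f" and "open A"
  shows "C_on k A f"
  using assms(1)
proof (induction k arbitrary: f)
  case 0
  have "isCont f z" if z: "z \<in> A" for z
  proof -
    obtain U where U: "open U" "z \<in> U" "C_on 0 U f" using 0[OF z] by blast
    then show ?thesis using continuous_on_eq_continuous_at[OF U(1), of f] by simp
  qed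
  then show ?case by (simp add: continuous_at_imp_continuous_on)
next
  case (Suc k)
  have *: "\<exists>U. open U \<and> z \<in> U \<and> f differentiable at z \<and> (\<forall>h. C_on k U (\<lambda>z. frechet_derivative f (at z) h))"
    if z: "z \<in> A" for z
  proof -
    obtain U where U: "open U" "z \<in> U" "C_on (Suc k) U f" using Suc.prems[OF z] by blast
    then show ?thesis using C_on_Suc_open[OF U(1)] by blast
  qed
  show ?case unfolding C_on_Suc_open[OF assms(2)]
  proof (intro conjI allI)
    show "C_on k A (\<lambda>z. frechet_derivative f (at z) h)" for h
      by (rule Suc.IH) (use * in blast)
  qed (use * in blast)
qed

lemma smooth_onI: "(\<And>k. C_on k A f) \<Longrightarrow> smooth_on A f"
  by (simp add: smooth_on_def)

lemma smooth_onD: "smooth_on A f \<Longrightarrow> C_on k A f"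
  by (simp add: smooth_on_def)

lemma C_on_deriv_real:
  fixes f :: "real \<Rightarrow> real"
  assumes "\<And>x. x \<in> A \<Longrightarrow> (f has_real_derivative f' x) (at x within A)" "C_on k A f'"
  shows "C_on (Suc k) A f"
  by (rule C_on_SucI[of _ _ "\<lambda>x h. f' x * h"])
    (use assms C_on_mult[OF assms(2) C_on_const] in \<open>simp_all add: has_field_derivative_def\<close>)

lemma C_on_powr: "C_on k {0<..} (\<lambda>x::real. x powr a)"
proof (induction k arbitrary: a)
  case 0
  then show ?case by (auto intro!: continuous_intros)
next
  case (Suc k)
  have "C_on k {0<..} (\<lambda>x::real. a * x powr (a - 1))"
    by (rule C_on_mult[OF C_on_const Suc])
  moreover have "((\<lambda>x. x powr a) has_real_derivative a * x powr (a - 1)) (at x within {0<..})" if "x \<in> {0<..}" for x :: real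
    using that by (intro has_field_derivative_at_within[OF has_real_derivative_powr]) auto
  ultimately show ?case by (rule C_on_deriv_real[rotated])
qed

section \<open>The flat functions exp(-1/u) / u^k\<close>

text \<open>The powers in the denominator make the family closed under differentiation up to linear
  combinations, so that one induction gives smoothness of every member, at 0 as well. All bump
  functions below are built from \<open>flat 0\<close>.\<close>

definition flat :: "nat \<Rightarrow> real \<Rightarrow> real" where
  "flat k u = (if u > 0 then exp (- 1 / u) / u ^ k else 0)"

lemma flat_nonneg: "flat k u \<ge> 0"
  by (simp add: flat_def)

text \<open>One term of the exponential series suffices: (1/u)^k / k! \<le> exp(1/u).\<close>

lemma flat_le: "flat k u \<le> fact k"
proof (cases "u > 0")
  case True
  have "summable (\<lambda>n. inverse (fact n) * (1 / u) ^ n)" by (rule summable_exp)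
  then have "(\<Sum>n\<in>{k}. inverse (fact n) * (1 / u) ^ n) \<le> (\<Sum>n. inverse (fact n) * (1 / u) ^ n)"
    using True by (intro sum_le_suminf) auto
  then have "inverse (fact k) * (1 / u) ^ k \<le> exp (1 / u)"
    by (simp add: exp_def divide_inverse mult.commute)
  then show ?thesis using True by (simp add: flat_def exp_minus field_simps)
qed (auto simp: flat_def)

lemma flat_Suc: "flat (Suc k) u = flat k u / u"
  by (simp add: flat_def)

lemma flat_has_deriv: "(flat k has_real_derivative (flat (k + 2) u - k * flat (Suc k) u)) (at u)"
proof (cases u "0::real" rule: linorder_cases)
  case less
  have "((\<lambda>_. 0) has_real_derivative 0) (at u)" by simp
  then have "(flat k has_real_derivative 0) (at u)"
    by (rule has_field_derivative_transform_within[where d = "- u"])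
      (use less in \<open>auto simp: flat_def dist_real_def\<close>)
  then show ?thesis using less by (simp add: flat_def)
next
  case equal
  \<comment> \<open>At 0 the difference quotient of \<open>flat k\<close> is
    \<open>flat (Suc k)\<close> itself, and \<open>flat (Suc k) u\<close> is u times the bounded
    value \<open>flat (k + 2) u\<close> for u > 0.\<close>
  have "(flat (Suc k) \<longlongrightarrow> 0) (at 0)"
  proof (rule Lim_null_comparison)
    show "((\<lambda>u. fact (k + 2) * \<bar>u\<bar>) \<longlongrightarrow> (0::real)) (at 0)"
      by (auto intro!: tendsto_eq_intros)
    have "norm (flat (Suc k) u) \<le> fact (k + 2) * \<bar>u\<bar>" for u
    proof (cases "u > 0")
      case True
      then have "flat (Suc k) u = flat (k + 2) u * u" by (simp add: flat_def)
      then show ?thesis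
        using mult_right_mono[OF flat_le[of "k + 2" u], of u] True flat_nonneg[of "Suc k" u] by (simp del: fact_Suc)
    next
      case False
      then show ?thesis by (simp add: flat_def mult_nonneg_nonpos del: fact_Suc)
    qed
    then show "\<forall>\<^sub>F u in at 0. norm (flat (Suc k) u) \<le> fact (k + 2) * \<bar>u\<bar>" by simp
  qed
  then show ?thesis using equal
    by (simp add: has_field_derivative_iff flat_def[of _ 0] flip: flat_Suc)
next
  case greater
  have "((\<lambda>u. exp (- 1 / u) / u ^ k) has_real_derivative (flat (k + 2) u - k * flat (Suc k) u)) (at u)"
  proof -
    have E: "((\<lambda>u. exp (- 1 / u)) has_real_derivative exp (- 1 / u) / u\<^sup>2) (at u)"
      using greater by (auto intro!: derivative_eq_intros simp: power2_eq_square)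
    have "((\<lambda>u. u ^ k) has_real_derivative k * u ^ (k - 1)) (at u)"
      using greater by (auto intro!: derivative_eq_intros)
    moreover have "k * u ^ (k - 1) = k * u ^ k / u" using greater by (cases k) auto
    ultimately have P: "((\<lambda>u. u ^ k) has_real_derivative k * u ^ k / u) (at u)" by (simp only:)
    have "(exp (- 1 / u) / u\<^sup>2 * u ^ k - exp (- 1 / u) * (k * u ^ k / u)) / (u ^ k * u ^ k)
        = flat (k + 2) u - k * flat (Suc k) u"
      using greater by (simp add: flat_def divide_simps power_add) (simp add: algebra_simps power2_eq_square)
    then show ?thesis using DERIV_divide[OF E P] greater by simp
  qed
  then show ?thesis
    by (rule has_field_derivative_transform_within[where d = u])
      (use greater in \<open>auto simp: flat_def dist_real_def\<close>)
qed

lemma C_on_flat: "C_on n UNIV (flat k)"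
proof (induction n arbitrary: k)
  case 0
  have "continuous_on UNIV (flat k)"
    by (rule DERIV_continuous_on[OF has_field_derivative_at_within[OF flat_has_deriv]])
  then show ?case by simp
next
  case (Suc n)
  have "C_on n UNIV (\<lambda>u. flat (k + 2) u - k * flat (Suc k) u)"
    by (rule C_on_diff[OF Suc C_on_mult[OF C_on_const Suc]])
  then show ?case
    by (rule C_on_deriv_real[rotated]) (rule has_field_derivative_at_within[OF flat_has_deriv])
qed

section \<open>Partial derivatives of fields on space-time\<close>

lemma has_derivative_slice:
  fixes \<phi> :: "real \<Rightarrow> R3 \<Rightarrow> 'b::real_normed_vector"
  assumes "(spacetime \<phi> has_derivative D) (at (x, t) within UNIV \<times> I)" "t \<in> I"
  shows "(\<phi> t has_derivative (\<lambda>h. D (h, 0))) (at x)"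
    and "((\<lambda>s. \<phi> s x) has_vector_derivative D (0, 1)) (at t within I)"
proof -
  have "((\<lambda>y. (y, t)) has_derivative (\<lambda>h. (h, 0))) (at x)"
    by (auto intro!: derivative_eq_intros)
  moreover have "(spacetime \<phi> has_derivative D) (at (x, t) within range (\<lambda>y. (y, t)))"
    using assms by (intro has_derivative_subset[OF assms(1)]) auto
  ultimately show "(\<phi> t has_derivative (\<lambda>h. D (h, 0))) (at x)"
    using has_derivative_in_compose[of "\<lambda>y. (y, t)" "\<lambda>h. (h, 0)" x UNIV "spacetime \<phi>" D] by simp
  have "((\<lambda>s. (x, s)) has_derivative (\<lambda>h. (0, h))) (at t within I)"
    by (auto intro!: derivative_eq_intros)
  moreover have "(spacetime \<phi> has_derivative D) (at (x, t) within (\<lambda>s. (x, s)) ` I)"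
    by (intro has_derivative_subset[OF assms(1)]) auto
  ultimately have *: "((\<lambda>s. \<phi> s x) has_derivative (\<lambda>h. D (0, h))) (at t within I)"
    using has_derivative_in_compose[of "\<lambda>s. (x, s)" "\<lambda>h. (0, h)" t I "spacetime \<phi>" D] by simp
  have "(\<lambda>h. D (0, h)) = (\<lambda>h. h *\<^sub>R D (0, 1))"
  proof
    show "D (0, h) = h *\<^sub>R D (0, 1)" for h
      using linear_cmul[OF has_derivative_linear[OF assms(1)], of h "(0, 1)"] by (simp add: scaleR_prod_def)
  qed
  then show "((\<lambda>s. \<phi> s x) has_vector_derivative D (0, 1)) (at t within I)"
    using * unfolding has_vector_derivative_def by (simp only:)
qed

lemma pd_eq:
  assumes "(g has_derivative D) (at x)"
  shows "pd i g x = D (axis i 1)"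
proof -
  have "((\<lambda>s. x + s *\<^sub>R axis i 1) has_derivative (\<lambda>s. s *\<^sub>R axis i 1)) (at 0)"
    by (auto intro!: derivative_eq_intros)
  then have "((\<lambda>s. g (x + s *\<^sub>R axis i 1)) has_derivative (\<lambda>s. D (s *\<^sub>R axis i 1))) (at 0)"
    using has_derivative_compose[of "\<lambda>s. x + s *\<^sub>R axis i 1" _ 0 UNIV g D] assms by simp
  then have "((\<lambda>s. g (x + s *\<^sub>R axis i 1)) has_vector_derivative D (axis i 1)) (at 0)"
    by (simp add: has_vector_derivative_def linear_cmul[OF has_derivative_linear[OF assms]])
  then show ?thesis unfolding pd_def by (rule vector_derivative_at)
qed

lemma has_derivative_pd:
  fixes g :: "R3 \<Rightarrow> 'b::real_normed_vector"
  assumes "(g has_derivative D) (at x)"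
  shows "D h = (\<Sum>i\<in>UNIV. (h $ i) *\<^sub>R pd i g x)"
proof -
  have lin: "linear D" using assms has_derivative_linear by blast
  have "D h = D (\<Sum>i\<in>UNIV. (h $ i) *\<^sub>R axis i 1)"
    using basis_expansion[of h] by (simp add: scalar_mult_eq_scaleR)
  then show ?thesis by (simp add: linear_sum[OF lin] linear_cmul[OF lin] pd_eq[OF assms])
qed

lemma C_on_pd:
  assumes "C_on (Suc k) UNIV g" shows "C_on k UNIV (pd i g)"
proof -
  from assms obtain D where D: "\<And>z. (g has_derivative D z) (at z)" "\<And>h. C_on k UNIV (\<lambda>z. D z h)"
    by auto
  have "pd i g = (\<lambda>z. D z (axis i 1))" using pd_eq[OF D(1)] by auto
  with D(2) show ?thesis by simp
qed

lemma C_on_pd_spacetime: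
  assumes "C_on (Suc k) (UNIV \<times> I) (spacetime \<phi>)"
  shows "C_on k (UNIV \<times> I) (spacetime (\<lambda>t. pd i (\<phi> t)))"
proof -
  from assms obtain D where D: "\<And>z. z \<in> UNIV \<times> I \<Longrightarrow> (spacetime \<phi> has_derivative D z) (at z within UNIV \<times> I)"
    "\<And>h. C_on k (UNIV \<times> I) (\<lambda>z. D z h)"
    by auto
  have "D z (axis i 1, 0) = spacetime (\<lambda>t. pd i (\<phi> t)) z" if "z \<in> UNIV \<times> I" for z
  proof (cases z)
    case (Pair x t)
    then have "t \<in> I" "(spacetime \<phi> has_derivative D z) (at (x, t) within UNIV \<times> I)"
      using that D(1)[OF that] by auto
    from pd_eq[OF has_derivative_slice(1)[OF this(2,1)]] show ?thesis using Pair by simp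
  qed
  then show ?thesis using C_on_cong[OF D(2)] by blast
qed

text \<open>\<open>time_deriv\<close> is a two-sided derivative and agrees with the one relative to
  \<open>I\<close> at interior times; \<open>d\<close> extends it continuously to the end points
  that belong to \<open>I\<close>.\<close>

lemma C_on_time_deriv:
  assumes "C_on (Suc k) (UNIV \<times> I) (spacetime \<phi>)"
  obtains d where "C_on k (UNIV \<times> I) (spacetime d)"
    "\<And>t x. t \<in> I \<Longrightarrow> ((\<lambda>s. \<phi> s x) has_vector_derivative d t x) (at t within I)"
    "\<And>t x. t \<in> interior I \<Longrightarrow> time_deriv \<phi> t x = d t x"
proof -
  from assms obtain D where D: "\<And>z. z \<in> UNIV \<times> I \<Longrightarrow> (spacetime \<phi> has_derivative D z) (at z within UNIV \<times> I)"
    "\<And>h. C_on k (UNIV \<times> I) (\<lambda>z. D z h)"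
    by auto
  have 1: "((\<lambda>s. \<phi> s x) has_vector_derivative D (x, t) (0, 1)) (at t within I)" if "t \<in> I" for t x
    by (rule has_derivative_slice(2)[OF D(1) that]) (use that in simp)
  show ?thesis
  proof
    show "C_on k (UNIV \<times> I) (spacetime (\<lambda>t x. D (x, t) (0, 1)))"
      using D(2)[of "(0, 1)"] by (simp add: case_prod_unfold)
    show "time_deriv \<phi> t x = D (x, t) (0, 1)" if "t \<in> interior I" for t x
    proof -
      have "t \<in> I" using that interior_subset by blast
      from 1[OF this, of x] show ?thesis
        unfolding time_deriv_def at_within_interior[OF that] by (rule vector_derivative_at)
    qed
  qed (use 1 in auto)
qed

lemma C_on_slice:
  fixes \<phi> :: "real \<Rightarrow> R3 \<Rightarrow> 'b::real_normed_vector"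
  assumes "C_on k (UNIV \<times> I) (spacetime \<phi>)" "t \<in> I"
  shows "C_on k UNIV (\<phi> t)"
proof -
  have "C_on k UNIV (\<lambda>x. spacetime \<phi> (x, t))"
    using assms by (intro C_on_compose[OF assms(1)] C_on_Pair C_on_id C_on_const) auto
  then show ?thesis by simp
qed

section \<open>Bounded support and integration by parts\<close>

lemma lborel_integral_translate:
  fixes f :: "'a::euclidean_space \<Rightarrow> 'b::{banach, second_countable_topology}"
  assumes [measurable]: "f \<in> borel_measurable borel"
  shows "(LINT x|lborel. f (a + x)) = (LINT x|lborel. f x)"
  by (subst (2) lborel_distr_plus[of a, symmetric]) (simp add: integral_distr)

lemma lborel_nn_integral_translate:
  fixes f :: "'a::euclidean_space \<Rightarrow> ennreal"
  assumes [measurable]: "f \<in> borel_measurable borel"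
  shows "(\<integral>\<^sup>+ x. f (a + x) \<partial>lborel) = (\<integral>\<^sup>+ x. f x \<partial>lborel)"
  by (subst (2) lborel_distr_plus[of a, symmetric]) (simp add: nn_integral_distr)

text \<open>Coordinate by coordinate from the real-valued case. It replaces Lebesgue measurable
  fields by Borel ones before Fubini's theorem for \<open>lborel\<close> is applied.\<close>

lemma completion_borel_version:
  fixes g :: "'a \<Rightarrow> 'b::euclidean_space"
  assumes "g \<in> borel_measurable (completion M)"
  obtains g' where "g' \<in> borel_measurable M" "AE x in M. g x = g' x"
proof -
  have "\<forall>b. \<exists>g'\<in>borel_measurable M. (AE x in M. g x \<bullet> b = g' x)"
    using assms by (auto intro!: completion_ex_borel_measurable_real borel_measurable_inner)
  then obtain h where h: "\<And>b. h b \<in> borel_measurable M" "\<And>b. AE x in M. g x \<bullet> b = h b x"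
    by metis
  show ?thesis
  proof
    show "(\<lambda>x. \<Sum>b\<in>Basis. h b x *\<^sub>R b) \<in> borel_measurable M"
      using h(1) by measurable
    have "AE x in M. \<forall>b\<in>Basis. g x \<bullet> b = h b x"
      using h(2) by (simp add: AE_finite_all)
    then show "AE x in M. g x = (\<Sum>b\<in>Basis. h b x *\<^sub>R b)"
    proof (rule AE_mp, intro AE_I2 impI)
      fix x assume "\<forall>b\<in>Basis. g x \<bullet> b = h b x"
      then have "(\<Sum>b\<in>Basis. h b x *\<^sub>R b) = (\<Sum>b\<in>Basis. (g x \<bullet> b) *\<^sub>R b)" by simp
      then show "g x = (\<Sum>b\<in>Basis. h b x *\<^sub>R b)" by (simp add: euclidean_representation)
    qed
  qed
qed

text \<open>Bounded support stated without closure and without smoothness, so that it passes at once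
  to products and components; for smooth functions it is the support condition of
  \<open>Cc_inf UNIV\<close>.\<close>

definition bsupp :: "('a::real_normed_vector \<Rightarrow> 'b::zero) \<Rightarrow> bool" where
  "bsupp f \<longleftrightarrow> (\<exists>R. \<forall>x. R < norm x \<longrightarrow> f x = 0)"

lemma bsuppI: "(\<And>x. R < norm x \<Longrightarrow> f x = 0) \<Longrightarrow> bsupp f"
  by (auto simp: bsupp_def)

lemma bsuppE:
  assumes "bsupp f"
  obtains R where "R > 0" "\<And>x. R < norm x \<Longrightarrow> f x = 0"
proof -
  from assms obtain R where R: "\<And>x. R < norm x \<Longrightarrow> f x = 0" by (auto simp: bsupp_def)
  show ?thesis by (rule that[of "max R 1"]) (auto intro: R)
qed

lemma Cc_inf_UNIV_iff:
  fixes f :: "'a::euclidean_space \<Rightarrow> 'b::real_normed_vector"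
  shows "f \<in> Cc_inf UNIV \<longleftrightarrow> smooth_on UNIV f \<and> bsupp f"
proof
  assume "f \<in> Cc_inf UNIV"
  then obtain K where K: "smooth_on UNIV f" "compact K" "\<forall>z. z \<notin> K \<longrightarrow> f z = 0"
    by (auto simp: Cc_inf_def)
  then obtain R where "\<forall>x\<in>K. norm x \<le> R" using compact_imp_bounded bounded_iff by metis
  then have "bsupp f" using K(3) by (intro bsuppI[of R]) force
  with K show "smooth_on UNIV f \<and> bsupp f" by simp
next
  assume f: "smooth_on UNIV f \<and> bsupp f"
  then have "bsupp f" by simp
  then obtain R where R: "R > 0" "\<And>x. R < norm x \<Longrightarrow> f x = 0" by (rule bsuppE) blast
  have "compact (cball 0 R :: 'a set)" "\<forall>z. z \<notin> cball 0 R \<longrightarrow> f z = 0"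
    using R by auto
  with f show "f \<in> Cc_inf UNIV" unfolding Cc_inf_def by blast
qed

lemma bsupp_bounded:
  fixes f :: "'a::euclidean_space \<Rightarrow> 'b::real_normed_vector"
  assumes "continuous_on UNIV f" "bsupp f"
  obtains M where "M > 0" "\<And>x. norm (f x) \<le> M"
proof -
  from assms(2) obtain R where R: "R > 0" "\<And>x. R < norm x \<Longrightarrow> f x = 0" by (rule bsuppE) blast
  have "bounded (f ` cball 0 R)"
    by (intro compact_imp_bounded compact_continuous_image continuous_on_subset[OF assms(1)]) auto
  then obtain M where M: "M > 0" "\<And>x. x \<in> cball 0 R \<Longrightarrow> norm (f x) \<le> M"
    by (auto simp: bounded_pos)
  have "norm (f x) \<le> M" for x
    using M R(2)[of x] by (cases "norm x \<le> R") auto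
  with M show ?thesis by (intro that)
qed

lemma integrable_bsupp:
  fixes f :: "'a::euclidean_space \<Rightarrow> 'b::euclidean_space"
  assumes "continuous_on UNIV f" "bsupp f"
  shows "integrable lborel f" "integrable lebesgue f"
proof -
  from assms(2) obtain R where R: "R > 0" "\<And>x. R < norm x \<Longrightarrow> f x = 0" by (rule bsuppE) blast
  have "integrable lborel (\<lambda>x. indicator (cball 0 R) x *\<^sub>R f x)"
    by (intro borel_integrable_compact continuous_on_subset[OF assms(1)]) auto
  also have "(\<lambda>x. indicator (cball 0 R) x *\<^sub>R f x) = f"
    using R by (force simp: indicator_def)
  finally show *: "integrable lborel f" .
  then show "integrable lebesgue f"
    using integrable_completion[of f lborel] borel_measurable_integrable[OF *] by simp
qed

text \<open>By translation invariance the difference quotients of a compactly supported function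
  integrate to zero, hence so does the derivative.\<close>

lemma integral_derivative_eq_0:
  fixes f :: "'a::euclidean_space \<Rightarrow> 'b::euclidean_space"
  assumes D: "\<And>z. (f has_derivative D z) (at z)" and cont: "continuous_on UNIV (\<lambda>z. D z h)"
    and supp: "bsupp f"
  shows "bsupp (\<lambda>z. D z h)" "(LINT z|lborel. D z h) = 0"
proof -
  from supp obtain R where R: "R > 0" "\<And>x. R < norm x \<Longrightarrow> f x = 0" by (rule bsuppE) blast
  have contf: "continuous_on UNIV f"
    using D has_derivative_continuous_on[of UNIV f D] by simp
  then have [measurable]: "f \<in> borel_measurable borel" by (rule borel_measurable_continuous_onI)
  have [measurable]: "(\<lambda>z. D z h) \<in> borel_measurable borel"
    using cont by (rule borel_measurable_continuous_onI)
  have int: "integrable lborel f" using contf supp by (rule integrable_bsupp)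
  have D0: "D z h = 0" if "R < norm z" for z
  proof -
    have "open {z::'a. R < norm z}" by (intro open_Collect_less continuous_intros)
    then have "((\<lambda>_. 0) has_derivative D z) (at z)"
      by (rule has_derivative_transform_within_open[OF D]) (use R(2) that in auto)
    then have "D z = (\<lambda>_. 0)" by (rule has_derivative_unique) simp
    then show ?thesis by simp
  qed
  then show bs: "bsupp (\<lambda>z. D z h)" by (rule bsuppI)
  obtain M where M: "M > 0" "\<And>x. norm (D x h) \<le> M"
    using bsupp_bounded[OF cont bs] by blast
  define F where "F n z = real (Suc n) *\<^sub>R (f ((1 / real (Suc n)) *\<^sub>R h + z) - f z)" for n z
  have [measurable]: "F n \<in> borel_measurable borel" for n unfolding F_def by measurable
  have line: "((\<lambda>s. f (s *\<^sub>R h + z)) has_vector_derivative D (s *\<^sub>R h + z) h) (at s)" for s z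
  proof -
    have "((\<lambda>s. s *\<^sub>R h + z) has_derivative (\<lambda>r. r *\<^sub>R h)) (at s)"
      by (auto intro!: derivative_eq_intros)
    from has_derivative_compose[OF this D] show ?thesis
      using linear_cmul[OF has_derivative_linear[OF D]] by (simp add: has_vector_derivative_def)
  qed
  \<comment> \<open>The mean value inequality along the line in direction h bounds every difference
    quotient by the supremum of the derivative, which is the dominating constant.\<close>
  have lip: "norm (F n z) \<le> M" for n z
  proof -
    have "onorm (\<lambda>r. r *\<^sub>R D (s *\<^sub>R h + z) h) \<le> M" for s
      using M(2)[of "s *\<^sub>R h + z"] by (intro onorm_le) (simp add: mult.commute[of M] mult_left_mono)
    then have "norm (f ((1 / real (Suc n)) *\<^sub>R h + z) - f (0 *\<^sub>R h + z)) \<le> M * norm (1 / real (Suc n) - 0 :: real)"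
      using line[unfolded has_vector_derivative_def] by (intro differentiable_bound[of UNIV]) auto
    then have "real (Suc n) * norm (f ((1 / real (Suc n)) *\<^sub>R h + z) - f z) \<le> M" by (simp add: field_simps)
    then show ?thesis by (simp only: F_def norm_scaleR abs_of_nat)
  qed
  \<comment> \<open>All steps have length at most \<open>norm h\<close>, so one ball contains the
    supports of all quotients.\<close>
  have F0: "F n z = 0" if "R + norm h < norm z" for n z
  proof -
    have "norm z \<le> norm ((1 / real (Suc n)) *\<^sub>R h + z) + norm ((1 / real (Suc n)) *\<^sub>R h)"
      by (metis add.commute norm_triangle_sub add_diff_cancel norm_minus_commute)
    moreover have "norm ((1 / real (Suc n)) *\<^sub>R h) \<le> norm h"
      by (auto simp: field_simps mult_left_le_one_le)
    ultimately have "R < norm ((1 / real (Suc n)) *\<^sub>R h + z)" using that by linarith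
    moreover have "R < norm z" using that norm_ge_zero[of h] by linarith
    ultimately show ?thesis using R(2) by (simp add: F_def)
  qed
  have "(\<lambda>n. LINT z|lborel. F n z) \<longlonglongrightarrow> (LINT z|lborel. D z h)"
  proof (rule integral_dominated_convergence[where w = "\<lambda>z. M * indicator (cball 0 (R + norm h)) z"])
    show "integrable lborel (\<lambda>z::'a. M * indicator (cball 0 (R + norm h)) z)"
      using emeasure_lborel_cball_finite by (intro integrable_mult_right integrable_real_indicator) auto
    show "AE z in lborel. (\<lambda>n. F n z) \<longlonglongrightarrow> D z h"
    proof (rule AE_I2)
      fix z
      have l: "((\<lambda>s. norm (f (s *\<^sub>R h + z) - f z - s *\<^sub>R D z h) / \<bar>s\<bar>) \<longlongrightarrow> 0) (at 0)"
        using line[of z 0] by (simp add: has_vector_derivative_def has_derivative_at)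
      have "filterlim (\<lambda>n. 1 / real (Suc n)) (at 0) sequentially"
        unfolding filterlim_at using LIMSEQ_inverse_real_of_nat by (simp add: inverse_eq_divide)
      from filterlim_compose[OF l this]
      have "(\<lambda>n. norm (F n z - D z h)) \<longlonglongrightarrow> 0"
      proof (rule Lim_transform_eventually, intro always_eventually allI)
        fix n
        have "F n z - D z h = real (Suc n) *\<^sub>R (f ((1 / real (Suc n)) *\<^sub>R h + z) - f z - (1 / real (Suc n)) *\<^sub>R D z h)"
          by (simp add: F_def scaleR_diff_right)
        then show "norm (f ((1 / real (Suc n)) *\<^sub>R h + z) - f z - (1 / real (Suc n)) *\<^sub>R D z h) / \<bar>1 / real (Suc n)\<bar> = norm (F n z - D z h)"
          by simp
      qed
      then show "(\<lambda>n. F n z) \<longlonglongrightarrow> D z h"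
        by (rule LIM_zero_cancel[OF tendsto_norm_zero_cancel])
    qed
    show "AE z in lborel. norm (F n z) \<le> M * indicator (cball 0 (R + norm h)) z" for n
    proof (rule AE_I2)
      fix z show "norm (F n z) \<le> M * indicator (cball 0 (R + norm h)) z"
        using lip[of n z] F0[of z n] by (auto simp: indicator_def)
    qed
  qed auto
  moreover have "(LINT z|lborel. F n z) = 0" for n
  proof -
    have "integrable lborel (\<lambda>z. f ((1 / real (Suc n)) *\<^sub>R h + z))"
    proof (rule integrable_bsupp)
      show "continuous_on UNIV (\<lambda>z::'a. f ((1 / real (Suc n)) *\<^sub>R h + z))"
        by (intro continuous_on_compose2[OF contf] continuous_intros) auto
      show "bsupp (\<lambda>z::'a. f ((1 / real (Suc n)) *\<^sub>R h + z))"
      proof (rule bsuppI)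
        fix z :: 'a assume "R + norm ((1 / real (Suc n)) *\<^sub>R h) < norm z"
        moreover have "norm z \<le> norm ((1 / real (Suc n)) *\<^sub>R h + z) + norm ((1 / real (Suc n)) *\<^sub>R h)"
          by (metis add.commute norm_triangle_sub add_diff_cancel norm_minus_commute)
        ultimately show "f ((1 / real (Suc n)) *\<^sub>R h + z) = 0" by (intro R(2)) linarith
      qed
    qed
    with int lborel_integral_translate[of f "(1 / real (Suc n)) *\<^sub>R h"] show ?thesis
      unfolding F_def by simp
  qed
  ultimately show "(LINT z|lborel. D z h) = 0"
    by (simp add: LIMSEQ_const_iff)
qed

lemma C_on_1_derivative:
  assumes "C_on (Suc k) UNIV f"
  obtains D where "\<And>z. (f has_derivative D z) (at z)" "\<And>h. C_on k UNIV (\<lambda>z. D z h)"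
  using C_on_SucE[OF assms] by (metis UNIV_I)

lemma integral_pd_eq_0:
  fixes f :: "R3 \<Rightarrow> 'b::euclidean_space"
  assumes "C_on (Suc k) UNIV f" "bsupp f"
  shows "bsupp (pd i f)" "(LINT x|lborel. pd i f x) = 0"
proof -
  obtain D where D: "\<And>z. (f has_derivative D z) (at z)" "\<And>h. C_on k UNIV (\<lambda>z. D z h)"
    using C_on_1_derivative[OF assms(1)] by metis
  have eq: "pd i f = (\<lambda>z. D z (axis i 1))" using pd_eq[OF D(1)] by auto
  note * = integral_derivative_eq_0[OF D(1) C_on_continuous[OF D(2)] assms(2), of "axis i 1"]
  show "bsupp (pd i f)" "(LINT x|lborel. pd i f x) = 0" unfolding eq using * by auto
qed

lemma pd_bilinear:
  fixes f :: "R3 \<Rightarrow> 'a::real_normed_vector" and g :: "R3 \<Rightarrow> 'b::real_normed_vector"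
  assumes B: "bounded_bilinear pr" and "C_on (Suc k) UNIV f" "C_on (Suc l) UNIV g"
  shows "pd i (\<lambda>x. pr (f x) (g x)) x = pr (f x) (pd i g x) + pr (pd i f x) (g x)"
proof -
  obtain D E where "(f has_derivative D) (at x)" "(g has_derivative E) (at x)"
    using assms(2,3) C_on_1_derivative by metis
  with bounded_bilinear.FDERIV[OF B this] show ?thesis by (simp add: pd_eq)
qed

lemma bsupp_bilinear:
  assumes B: "bounded_bilinear pr" and "bsupp f \<or> bsupp g"
  shows "bsupp (\<lambda>x. pr (f x) (g x))"
  using assms bounded_bilinear.zero_left[OF B] bounded_bilinear.zero_right[OF B]
  unfolding bsupp_def by metis

text \<open>The derivative of the product integrates to zero because one factor has bounded support.
  The product is an arbitrary bounded bilinear map, so scalar multiples, inner products and single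
  components are covered together.\<close>

lemma integral_by_parts:
  fixes f :: "R3 \<Rightarrow> 'a::euclidean_space" and g :: "R3 \<Rightarrow> 'b::euclidean_space"
    and pr :: "'a \<Rightarrow> 'b \<Rightarrow> 'c::euclidean_space"
  assumes B: "bounded_bilinear pr" and f: "C_on (Suc k) UNIV f" and g: "C_on (Suc l) UNIV g"
    and supp: "bsupp f \<or> bsupp g"
  shows "(LINT x|lborel. pr (f x) (pd i g x)) = - (LINT x|lborel. pr (pd i f x) (g x))"
proof -
  have c: "C_on 1 UNIV f" "C_on 1 UNIV g" using C_on_mono[OF f, of 1] C_on_mono[OF g, of 1] by (simp_all del: C_on.simps)
  have c0: "continuous_on UNIV f" "continuous_on UNIV g" "continuous_on UNIV (pd i f)" "continuous_on UNIV (pd i g)"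
    using C_on_continuous C_on_pd[OF f] C_on_pd[OF g] f g by blast+
  have b: "bsupp f \<or> bsupp (pd i g)" "bsupp (pd i f) \<or> bsupp g"
    using supp integral_pd_eq_0(1)[OF f] integral_pd_eq_0(1)[OF g] by blast+
  have int: "integrable lborel (\<lambda>x. pr (f x) (pd i g x))" "integrable lborel (\<lambda>x. pr (pd i f x) (g x))"
    by (intro integrable_bsupp bounded_bilinear.continuous_on[OF B] c0 bsupp_bilinear[OF B] b)+
  have "0 = (LINT x|lborel. pd i (\<lambda>x. pr (f x) (g x)) x)"
    using integral_pd_eq_0(2)[of 0 "\<lambda>x. pr (f x) (g x)" i] C_on_bilinear[OF B c] bsupp_bilinear[OF B supp] by simp
  also have "\<dots> = (LINT x|lborel. pr (f x) (pd i g x)) + (LINT x|lborel. pr (pd i f x) (g x))"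
    using int by (simp add: pd_bilinear[OF B f g])
  finally show ?thesis by (simp add: eq_neg_iff_add_eq_0)
qed

lemma Cc_inf_smooth: "f \<in> Cc_inf UNIV \<Longrightarrow> C_on k UNIV f"
  by (simp add: Cc_inf_def smooth_on_def)

lemma Cc_inf_bsupp: "(f :: 'a::euclidean_space \<Rightarrow> 'b::real_normed_vector) \<in> Cc_inf UNIV \<Longrightarrow> bsupp f"
  by (simp add: Cc_inf_UNIV_iff)

lemma Cc_infI: "(\<And>k. C_on k UNIV f) \<Longrightarrow> bsupp f \<Longrightarrow> f \<in> Cc_inf UNIV"
  for f :: "'a::euclidean_space \<Rightarrow> 'b::real_normed_vector"
  by (simp add: Cc_inf_UNIV_iff smooth_on_def)

lemma Cc_inf_pd:
  fixes f :: "R3 \<Rightarrow> 'b::euclidean_space"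
  assumes f: "f \<in> Cc_inf UNIV"
  shows "pd i f \<in> Cc_inf UNIV"
  by (rule Cc_infI[OF C_on_pd[OF Cc_inf_smooth[OF f]] integral_pd_eq_0(1)[OF Cc_inf_smooth[OF f, of "Suc 0"] Cc_inf_bsupp[OF f]]])

lemma Cc_inf_bilinear:
  fixes f :: "'a::euclidean_space \<Rightarrow> 'b::real_normed_vector"
  assumes B: "bounded_bilinear pr" and "f \<in> Cc_inf UNIV" "smooth_on UNIV g"
  shows "(\<lambda>x. pr (f x) (g x)) \<in> Cc_inf UNIV"
proof (rule Cc_infI)
  show "C_on k UNIV (\<lambda>x. pr (f x) (g x))" for k
    by (rule C_on_bilinear[OF B Cc_inf_smooth[OF assms(2)] smooth_onD[OF assms(3)]])
  show "bsupp (\<lambda>x. pr (f x) (g x))"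
    using bsupp_bilinear[OF B] Cc_inf_bsupp[OF assms(2)] by blast
qed

lemma Cc_inf_bounded_linear:
  fixes f :: "'a::euclidean_space \<Rightarrow> 'b::real_normed_vector"
  assumes L: "bounded_linear L" and f: "f \<in> Cc_inf UNIV"
  shows "(\<lambda>x. L (f x)) \<in> Cc_inf UNIV"
proof (rule Cc_infI[OF C_on_bounded_linear[OF L Cc_inf_smooth[OF f]]])
  show "bsupp (\<lambda>x. L (f x))"
    using Cc_inf_bsupp[OF f] linear_0[OF bounded_linear.linear[OF L]] unfolding bsupp_def by metis
qed

lemma Cc_inf_measurable [measurable_dest]:
  fixes f :: "'a::euclidean_space \<Rightarrow> 'b::euclidean_space"
  assumes "f \<in> Cc_inf UNIV"
  shows "f \<in> borel_measurable borel"
  using C_on_continuous[OF Cc_inf_smooth[OF assms, of 0]] by (rule borel_measurable_continuous_onI)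

lemma lebesgue_borel_measurable: "f \<in> borel_measurable borel \<Longrightarrow> f \<in> borel_measurable lebesgue"
  by (simp add: measurable_completion)

lemma lebesgue_eq_lborel:
  fixes f :: "'a::euclidean_space \<Rightarrow> 'b::{banach, second_countable_topology}"
  assumes "f \<in> borel_measurable borel"
  shows "(LINT x|lebesgue. f x) = (LINT x|lborel. f x)" "integrable lebesgue f \<longleftrightarrow> integrable lborel f"
  using assms by (auto simp: integral_completion integrable_completion)

subsection \<open>The fundamental lemma of the calculus of variations\<close>

text \<open>Boxes generate the Borel sets and are stable under intersection, and the sets over which
  f integrates to 0 are closed under complements and countable disjoint unions. The whole space is
  reached by an increasing sequence of boxes.\<close>

lemma integral_borel_eq_0:
  fixes f :: "'a::euclidean_space \<Rightarrow> 'b::euclidean_space"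
  assumes f: "integrable lborel f"
    and box: "\<And>a b. set_lebesgue_integral lborel (box a b) f = 0"
    and A: "A \<in> sets borel"
  shows "set_lebesgue_integral lborel A f = 0"
proof -
  let ?E = "range (\<lambda>(a, b). box a b::'a set)"
  have si: "set_integrable lborel B f" if "B \<in> sets borel" for B
    using f that by (simp add: set_integrable_def integrable_mult_indicator)
  have univ: "set_lebesgue_integral lborel UNIV f = 0"
  proof -
    let ?A = "\<lambda>n::nat. box (- (real n *\<^sub>R One)) (real n *\<^sub>R One) :: 'a set"
    have "(\<lambda>n. set_lebesgue_integral lborel (?A n) f) \<longlonglongrightarrow> set_lebesgue_integral lborel (\<Union>n. ?A n) f"
    proof (rule set_integral_cont_up)
      show "incseq ?A"
      proof (intro incseq_SucI subset_box_imp ballI)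
        show "(- (real (Suc n) *\<^sub>R One)) \<bullet> i \<le> (- (real n *\<^sub>R One)) \<bullet> i \<and> (real n *\<^sub>R One) \<bullet> i \<le> (real (Suc n) *\<^sub>R One) \<bullet> i"
          if "i \<in> Basis" for n and i :: 'a using that by simp
      qed
    qed (auto intro: si)
    then show ?thesis using box UN_box_eq_UNIV[where 'a = 'a] by (simp add: LIMSEQ_const_iff)
  qed
  have stable: "Int_stable ?E" by (auto simp: Int_stable_def box_Int_box)
  have "A \<in> sigma_sets UNIV ?E" using A by (simp add: borel_eq_box)
  have pow: "?E \<subseteq> Pow UNIV" by simp
  from stable pow \<open>A \<in> sigma_sets UNIV ?E\<close> show ?thesis
  proof (induction rule: sigma_sets_induct_disjoint)
    case (basic A)
    then show ?case using box by auto
  next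
    case empty
    then show ?case by (simp add: set_lebesgue_integral_def)
  next
    case (compl A)
    then have [measurable]: "A \<in> sets borel" by (simp add: borel_eq_box)
    have "set_lebesgue_integral lborel (A \<union> (UNIV - A)) f =
        set_lebesgue_integral lborel A f + set_lebesgue_integral lborel (UNIV - A) f"
      by (rule set_integral_Un) (auto intro: si)
    then show ?case using compl univ by (simp add: Un_absorb2)
  next
    case (union A)
    have m: "A i \<in> sets borel" for i using union(2) by (auto simp: borel_eq_box)
    have "set_lebesgue_integral lborel (\<Union>i. A i) f = (\<Sum>i. set_lebesgue_integral lborel (A i) f)"
    proof (rule lebesgue_integral_countable_add)
      show "A i \<inter> A j = {}" if "i \<noteq> j" for i j
        using union(1) that by (auto simp: disjoint_family_on_def)
      show "set_integrable lborel (\<Union>i. A i) f" by (rule si) (use m in auto)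
    qed (use m in auto)
    then show ?case using union(3) by simp
  qed
qed

lemma L1_loc_measurable:
  fixes u :: "'a::euclidean_space \<Rightarrow> 'b::euclidean_space"
  assumes "u \<in> L1_loc UNIV"
  shows "u \<in> borel_measurable lebesgue"
proof (rule borel_measurable_LIMSEQ_metric)
  show "(\<lambda>x. indicator (cball 0 (real n)) x *\<^sub>R u x) \<in> borel_measurable lebesgue" for n
    using assms by (auto simp: L1_loc_def integrable_restrict_space dest!: spec[of _ "cball 0 (real n)"])
  show "(\<lambda>n. indicator (cball 0 (real n)) x *\<^sub>R u x) \<longlonglongrightarrow> u x" for x
  proof (rule tendsto_eventually)
    obtain N where "norm x \<le> real N" using real_arch_simple by blast
    then show "\<forall>\<^sub>F n in sequentially. indicator (cball 0 (real n)) x *\<^sub>R u x = u x"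
      by (intro eventually_sequentiallyI[of N]) (auto simp: indicator_def)
  qed
qed

lemma L1_loc_integrable:
  fixes u :: "'a::euclidean_space \<Rightarrow> 'b::euclidean_space"
  assumes "u \<in> L1_loc UNIV" "compact K"
  shows "integrable lebesgue (\<lambda>x. indicator K x *\<^sub>R u x)"
  using assms by (auto simp: L1_loc_def integrable_restrict_space compact_imp_closed)

lemma L1_loc_test:
  fixes u :: "'a::euclidean_space \<Rightarrow> 'b::euclidean_space" and \<phi> :: "'a \<Rightarrow> real"
  assumes u: "u \<in> L1_loc UNIV" and \<phi>: "continuous_on UNIV \<phi>" "bsupp \<phi>"
  shows "integrable lebesgue (\<lambda>x. \<phi> x *\<^sub>R u x)"
proof -
  obtain M where M: "M > 0" "\<And>x. norm (\<phi> x) \<le> M" using bsupp_bounded[OF \<phi>] by blast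
  obtain R where R: "\<And>x. R < norm x \<Longrightarrow> \<phi> x = 0" using bsuppE[OF \<phi>(2)] by blast
  have [measurable]: "\<phi> \<in> borel_measurable lebesgue"
    using \<phi>(1) by (intro lebesgue_borel_measurable borel_measurable_continuous_onI)
  have [measurable]: "u \<in> borel_measurable lebesgue" using L1_loc_measurable[OF u] .
  show ?thesis
  proof (rule Bochner_Integration.integrable_bound)
    show "integrable lebesgue (\<lambda>x. M *\<^sub>R (indicator (cball 0 R) x *\<^sub>R u x))"
      by (intro integrable_scaleR_right L1_loc_integrable[OF u]) auto
    show "AE x in lebesgue. norm (\<phi> x *\<^sub>R u x) \<le> norm (M *\<^sub>R indicator (cball 0 R) x *\<^sub>R u x)"
    proof (rule AE_I2)
      fix x show "norm (\<phi> x *\<^sub>R u x) \<le> norm (M *\<^sub>R indicator (cball 0 R) x *\<^sub>R u x)"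
        using M(1) M(2)[of x] R[of x] by (cases "norm x \<le> R") (auto intro!: mult_right_mono)
    qed
  qed measurable
qed

lemma C_on_prod:
  fixes f :: "'i \<Rightarrow> 'a::real_normed_vector \<Rightarrow> real"
  shows "(\<And>i. i \<in> I \<Longrightarrow> C_on k A (f i)) \<Longrightarrow> C_on k A (\<lambda>z. \<Prod>i\<in>I. f i z)"
  by (induction I rule: infinite_finite_induct) (auto intro: C_on_const C_on_mult)

lemma flat_0_less: "flat k u > 0 \<longleftrightarrow> u > 0"
  by (simp add: flat_def)

lemma flat_0_tendsto:
  assumes "u > 0"
  shows "(\<lambda>n. flat 0 (real n * u)) \<longlonglongrightarrow> 1"
proof -
  have "(\<lambda>n. exp (- (1 / u) * inverse (real n))) \<longlonglongrightarrow> exp (- (1 / u) * 0)"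
    by (intro tendsto_intros lim_inverse_n)
  then have "(\<lambda>n. exp (- (1 / u) * inverse (real n))) \<longlonglongrightarrow> 1" by simp
  moreover have "\<forall>\<^sub>F n in sequentially. exp (- (1 / u) * inverse (real n)) = flat 0 (real n * u)"
    using eventually_gt_at_top[of 0] by eventually_elim (use assms in \<open>simp add: flat_def field_simps\<close>)
  ultimately show ?thesis by (rule Lim_transform_eventually)
qed

text \<open>The indicator function of a box is the limit of the test functions
  \<open>\<Prod>\<^sub>b flat 0 (n (x - a)\<^sub>b) flat 0 (n (c - x)\<^sub>b)\<close>.\<close>

lemma fundamental_lemma:
  fixes u :: "'a::euclidean_space \<Rightarrow> 'b::euclidean_space"
  assumes u: "u \<in> L1_loc UNIV"
    and 0: "\<And>\<phi>. \<phi> \<in> Cc_inf UNIV \<Longrightarrow> (LINT x|lebesgue. \<phi> x *\<^sub>R u x) = 0"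
  shows "AE x in lebesgue. u x = 0"
proof -
  have [measurable]: "u \<in> borel_measurable lebesgue" using L1_loc_measurable[OF u] .
  have box: "(LINT x|lebesgue. indicator (box a c) x *\<^sub>R u x) = 0" for a c :: 'a
  proof -
    define \<phi> where "\<phi> n x = (\<Prod>b\<in>Basis. flat 0 (real n * ((x - a) \<bullet> b)) * flat 0 (real n * ((c - x) \<bullet> b)))"
      for n x
    have in01: "0 \<le> \<phi> n x" "\<phi> n x \<le> 1" for n x
      unfolding \<phi>_def using flat_le[of 0]
      by (auto intro!: prod_nonneg prod_le_1 mult_nonneg_nonneg flat_nonneg mult_le_one)
    have supp: "\<phi> n x = 0" if x: "x \<notin> box a c" for n x
    proof -
      obtain b where b: "b \<in> Basis" "(x - a) \<bullet> b \<le> 0 \<or> (c - x) \<bullet> b \<le> 0"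
        using x by (auto simp: mem_box inner_diff_left not_less)
      then have "flat 0 (real n * ((x - a) \<bullet> b)) * flat 0 (real n * ((c - x) \<bullet> b)) = 0"
        using mult_nonneg_nonpos[of "real n" "(x - a) \<bullet> b"] mult_nonneg_nonpos[of "real n" "(c - x) \<bullet> b"]
        by (auto simp: flat_def not_less)
      then show ?thesis unfolding \<phi>_def using b(1) by (intro prod_zero) auto
    qed
    have test: "\<phi> n \<in> Cc_inf UNIV" for n
    proof (rule Cc_infI)
      show "C_on k UNIV (\<phi> n)" for k
        unfolding \<phi>_def
        by (intro C_on_prod C_on_mult C_on_compose[OF C_on_flat] C_on_inner C_on_diff C_on_id C_on_const) auto
      obtain R where "box a c \<subseteq> ball 0 R" using bounded_box bounded_subset_ballD by blast
      then show "bsupp (\<phi> n)" by (intro bsuppI[of R] supp) auto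
    qed
    have lim: "(\<lambda>n. \<phi> n x) \<longlonglongrightarrow> indicator (box a c) x" for x
    proof (cases "x \<in> box a c")
      case True
      have "(\<lambda>n. \<phi> n x) \<longlonglongrightarrow> (\<Prod>b\<in>(Basis::'a set). 1 * 1 :: real)"
        unfolding \<phi>_def using True
        by (intro tendsto_prod tendsto_mult flat_0_tendsto) (auto simp: mem_box inner_diff_left)
      then show ?thesis using True by simp
    qed (use supp in simp)
    have "(\<lambda>n. LINT x|lebesgue. \<phi> n x *\<^sub>R u x) \<longlonglongrightarrow> (LINT x|lebesgue. indicator (box a c) x *\<^sub>R u x)"
    proof (rule integral_dominated_convergence[where w = "\<lambda>x. norm (indicator (cbox a c) x *\<^sub>R u x)"])
      show "integrable lebesgue (\<lambda>x. norm (indicator (cbox a c) x *\<^sub>R u x))"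
        by (intro integrable_norm L1_loc_integrable[OF u]) auto
      show "AE x in lebesgue. (\<lambda>n. \<phi> n x *\<^sub>R u x) \<longlonglongrightarrow> indicator (box a c) x *\<^sub>R u x"
        by (intro AE_I2 tendsto_scaleR lim tendsto_const)
      show "AE x in lebesgue. norm (\<phi> n x *\<^sub>R u x) \<le> norm (indicator (cbox a c) x *\<^sub>R u x)" for n
      proof (rule AE_I2)
        fix x show "norm (\<phi> n x *\<^sub>R u x) \<le> norm (indicator (cbox a c) x *\<^sub>R u x)"
          using in01[of n x] supp[of x n] subsetD[OF box_subset_cbox, of x a c]
          by (cases "x \<in> box a c") (auto intro!: mult_left_le_one_le)
      qed
      show "(\<lambda>x. \<phi> n x *\<^sub>R u x) \<in> borel_measurable lebesgue" for n
        using lebesgue_borel_measurable[OF Cc_inf_measurable[OF test[of n]]] by measurable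
    qed (auto intro!: borel_measurable_scaleR borel_measurable_indicator L1_loc_measurable[OF u])
    then show ?thesis using 0[OF test] by (simp add: LIMSEQ_const_iff)
  qed
  \<comment> \<open>The density argument runs on \<open>lborel\<close>, so u is exchanged for a
    Borel version; cutting to the boxes \<open>?A n\<close> makes it integrable.\<close>
  obtain v where [measurable]: "v \<in> borel_measurable borel" and v: "AE x in lborel. u x = v x"
    using completion_borel_version[of u lborel] by auto
  then have v': "AE x in lebesgue. u x = v x" using AE_completion by blast
  have um: "u \<in> borel_measurable lebesgue" and vm: "v \<in> borel_measurable lebesgue"
    using L1_loc_measurable[OF u] lebesgue_borel_measurable[of v] by auto
  let ?A = "\<lambda>n. box (- (real n *\<^sub>R One)) (real n *\<^sub>R One) :: 'a set"
  have boxv: "integrable lborel (\<lambda>x. indicator (box a c) x *\<^sub>R v x)"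
    "(LINT x|lborel. indicator (box a c) x *\<^sub>R v x) = 0" for a c
  proof -
    have "integrable lebesgue (\<lambda>x. indicator (box a c) x *\<^sub>R (indicator (cbox a c) x *\<^sub>R u x))"
      by (intro integrable_mult_indicator L1_loc_integrable[OF u]) auto
    also have "(\<lambda>x. indicator (box a c) x *\<^sub>R (indicator (cbox a c) x *\<^sub>R u x)) = (\<lambda>x. indicator (box a c) x *\<^sub>R u x)"
      using box_subset_cbox[of a c] by (auto simp: indicator_def fun_eq_iff)
    finally have "integrable lebesgue (\<lambda>x. indicator (box a c) x *\<^sub>R u x)" .
    then have "integrable lebesgue (\<lambda>x. indicator (box a c) x *\<^sub>R v x)"
      by (rule integrable_cong_AE_imp) (use v' in \<open>auto elim!: eventually_mono intro!: borel_measurable_scaleR borel_measurable_indicator um vm\<close>)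
    then show "integrable lborel (\<lambda>x. indicator (box a c) x *\<^sub>R v x)"
      by (subst (asm) lebesgue_eq_lborel) auto
    have "(LINT x|lebesgue. indicator (box a c) x *\<^sub>R v x) = (LINT x|lebesgue. indicator (box a c) x *\<^sub>R u x)"
      by (rule integral_cong_AE) (use v' in \<open>auto elim!: eventually_mono intro!: borel_measurable_scaleR borel_measurable_indicator um vm\<close>)
    then show "(LINT x|lborel. indicator (box a c) x *\<^sub>R v x) = 0"
      by (subst (asm) lebesgue_eq_lborel) (auto simp: box)
  qed
  have "AE x in lborel. indicator (?A n) x *\<^sub>R v x = 0" for n
  proof (rule sigma_finite_measure.density_zero[OF sigma_finite_lborel])
    show "set_lebesgue_integral lborel A (\<lambda>x. indicator (?A n) x *\<^sub>R v x) = 0" if "A \<in> sets lborel" for A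
    proof (rule integral_borel_eq_0)
      show "set_lebesgue_integral lborel (box a c) (\<lambda>x. indicator (?A n) x *\<^sub>R v x) = 0" for a c
        using boxv(2) unfolding set_lebesgue_integral_def
        by (simp add: box_Int_box indicator_inter_arith[symmetric])
    qed (use that boxv in auto)
  qed (rule boxv)
  then have "AE x in lborel. \<forall>n. indicator (?A n) x *\<^sub>R v x = 0"
    by (subst AE_all_countable) blast
  then have "AE x in lborel. u x = 0"
    using v
  proof eventually_elim
    case (elim x)
    obtain n where "x \<in> ?A n" using UN_box_eq_UNIV[where 'a = 'a] by blast
    then show ?case using elim(1)[rule_format, of n] elim(2) by auto
  qed
  then show ?thesis by (rule AE_completion)
qed

lemma L1_loc_continuous:
  fixes g :: "'a::euclidean_space \<Rightarrow> 'b::euclidean_space"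
  assumes "continuous_on UNIV g"
  shows "g \<in> L1_loc UNIV"
  unfolding L1_loc_def
proof (intro CollectI allI impI)
  fix K :: "'a set" assume K: "compact K"
  have *: "integrable lborel (\<lambda>x. indicator K x *\<^sub>R g x)"
    by (intro borel_integrable_compact K continuous_on_subset[OF assms]) auto
  then have "integrable lebesgue (\<lambda>x. indicator K x *\<^sub>R g x)"
    using lebesgue_eq_lborel(2)[of "\<lambda>x. indicator K x *\<^sub>R g x"] borel_measurable_integrable[OF *] by simp
  then show "integrable (lebesgue_on K) g"
    by (subst integrable_restrict_space) (use K in \<open>auto simp: compact_imp_closed\<close>)
qed

lemma L1_loc_lin:
  fixes g h :: "'a::euclidean_space \<Rightarrow> 'b::euclidean_space"
  assumes "g \<in> L1_loc U" "h \<in> L1_loc U"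
  shows "(\<lambda>x. a *\<^sub>R g x + b *\<^sub>R h x) \<in> L1_loc U"
  using assms by (auto simp: L1_loc_def)

lemma weak_deriv_lin:
  fixes g h :: "R3 \<Rightarrow> 'b::euclidean_space"
  assumes "weak_deriv \<alpha> g g'" "weak_deriv \<alpha> h h'"
    and "\<And>\<phi> :: R3 \<Rightarrow> real. \<phi> \<in> Cc_inf UNIV \<Longrightarrow> pds \<alpha> \<phi> \<in> Cc_inf UNIV"
  shows "weak_deriv \<alpha> (\<lambda>x. a *\<^sub>R g x + b *\<^sub>R h x) (\<lambda>x. a *\<^sub>R g' x + b *\<^sub>R h' x)"
proof -
  have l: "g \<in> L1_loc UNIV" "h \<in> L1_loc UNIV" "g' \<in> L1_loc UNIV" "h' \<in> L1_loc UNIV"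
    using assms(1,2) by (auto simp: weak_deriv_def)
  have i: "integrable lebesgue (\<lambda>x. \<psi> x *\<^sub>R u x)" if "\<psi> \<in> Cc_inf UNIV" "u \<in> L1_loc UNIV"
    for \<psi> :: "R3 \<Rightarrow> real" and u :: "R3 \<Rightarrow> 'b"
    by (intro L1_loc_test that(2) C_on_continuous[OF Cc_inf_smooth[OF that(1), of 0]] Cc_inf_bsupp[OF that(1)])
  have lin: "(LINT x|lebesgue. \<psi> x *\<^sub>R (a *\<^sub>R u x + b *\<^sub>R v x)) =
      a *\<^sub>R (LINT x|lebesgue. \<psi> x *\<^sub>R u x) + b *\<^sub>R (LINT x|lebesgue. \<psi> x *\<^sub>R v x)"
    if \<psi>: "\<psi> \<in> Cc_inf UNIV" and u: "u \<in> L1_loc UNIV" "v \<in> L1_loc UNIV"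
    for \<psi> :: "R3 \<Rightarrow> real" and u v :: "R3 \<Rightarrow> 'b"
  proof -
    have "(\<lambda>x. \<psi> x *\<^sub>R (a *\<^sub>R u x + b *\<^sub>R v x)) = (\<lambda>x. a *\<^sub>R (\<psi> x *\<^sub>R u x) + b *\<^sub>R (\<psi> x *\<^sub>R v x))"
      by (simp add: scaleR_add_right mult.commute)
    then show ?thesis using i[OF \<psi> u(1)] i[OF \<psi> u(2)] by (simp del: scaleR_scaleR)
  qed
  show ?thesis
    unfolding weak_deriv_def
  proof (intro conjI L1_loc_lin l ballI)
    fix \<phi> :: "R3 \<Rightarrow> real" assume \<phi>: "\<phi> \<in> Cc_inf UNIV"
    have "(LINT x|lebesgue. pds \<alpha> \<phi> x *\<^sub>R g x) = (- 1) ^ length \<alpha> *\<^sub>R (LINT x|lebesgue. \<phi> x *\<^sub>R g' x)"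
      "(LINT x|lebesgue. pds \<alpha> \<phi> x *\<^sub>R h x) = (- 1) ^ length \<alpha> *\<^sub>R (LINT x|lebesgue. \<phi> x *\<^sub>R h' x)"
      using assms(1,2) \<phi> by (auto simp: weak_deriv_def)
    then show "(LINT x|lebesgue. pds \<alpha> \<phi> x *\<^sub>R (a *\<^sub>R g x + b *\<^sub>R h x)) =
        (- 1) ^ length \<alpha> *\<^sub>R (LINT x|lebesgue. \<phi> x *\<^sub>R (a *\<^sub>R g' x + b *\<^sub>R h' x))"
      unfolding lin[OF assms(3)[OF \<phi>] l(1,2)] lin[OF \<phi> l(3,4)] by (simp add: algebra_simps)
  qed
qed

lemma pds_simps [simp]: "pds [] g = g" "pds (i # \<alpha>) g = pd i (pds \<alpha> g)"
  by (simp_all add: pds_def)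

text \<open>The fundamental lemma applied to h - h'. It makes the choice inside \<open>wgrad\<close>
  harmless: whatever was chosen agrees almost everywhere with any known weak derivative.\<close>

lemma weak_deriv_unique:
  assumes "weak_deriv \<alpha> g h" "weak_deriv \<alpha> g h'"
  shows "AE x in lebesgue. h x = h' x"
proof -
  have l: "h \<in> L1_loc UNIV" "h' \<in> L1_loc UNIV" using assms by (auto simp: weak_deriv_def)
  have "AE x in lebesgue. 1 *\<^sub>R h x + (- 1) *\<^sub>R h' x = 0"
  proof (rule fundamental_lemma)
    show "(\<lambda>x. 1 *\<^sub>R h x + (- 1) *\<^sub>R h' x) \<in> L1_loc UNIV" by (intro L1_loc_lin l)
    fix \<phi> :: "R3 \<Rightarrow> real" assume \<phi>: "\<phi> \<in> Cc_inf UNIV"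
    have "(- 1) ^ length \<alpha> *\<^sub>R (LINT x|lebesgue. \<phi> x *\<^sub>R h x) = (- 1) ^ length \<alpha> *\<^sub>R (LINT x|lebesgue. \<phi> x *\<^sub>R h' x)"
      using assms \<phi> by (auto simp: weak_deriv_def)
    then have "(LINT x|lebesgue. \<phi> x *\<^sub>R h x) = (LINT x|lebesgue. \<phi> x *\<^sub>R h' x)" by simp
    moreover have "integrable lebesgue (\<lambda>x. \<phi> x *\<^sub>R h x)" "integrable lebesgue (\<lambda>x. \<phi> x *\<^sub>R h' x)"
      by (intro L1_loc_test l C_on_continuous[OF Cc_inf_smooth[OF \<phi>, of 0]] Cc_inf_bsupp[OF \<phi>])+
    ultimately show "(LINT x|lebesgue. \<phi> x *\<^sub>R (1 *\<^sub>R h x + (- 1) *\<^sub>R h' x)) = 0"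
      by (simp add: scaleR_diff_right)
  qed
  then show ?thesis by simp
qed

lemma weak_deriv_Nil:
  assumes "weak_deriv [] g h" shows "AE x in lebesgue. g x = h x"
  using assms by (intro weak_deriv_unique[of "[]" g]) (auto simp: weak_deriv_def)

lemma weak_deriv_pd:
  fixes g :: "R3 \<Rightarrow> 'b::euclidean_space"
  assumes "C_on (Suc k) UNIV g"
  shows "weak_deriv [i] g (pd i g)"
  unfolding weak_deriv_def
proof (intro conjI ballI L1_loc_continuous)
  have c: "continuous_on UNIV g" "continuous_on UNIV (pd i g)"
    using C_on_continuous[OF assms] C_on_continuous[OF C_on_pd[OF assms]] .
  then show "continuous_on UNIV g" "continuous_on UNIV (pd i g)" .
  fix \<phi> :: "R3 \<Rightarrow> real" assume \<phi>: "\<phi> \<in> Cc_inf UNIV"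
  note m = Cc_inf_measurable[OF \<phi>] Cc_inf_measurable[OF Cc_inf_pd[OF \<phi>]]
    borel_measurable_continuous_onI[OF c(1)] borel_measurable_continuous_onI[OF c(2)]
  show "(LINT x|lebesgue. pds [i] \<phi> x *\<^sub>R g x) = (- 1) ^ length [i] *\<^sub>R (LINT x|lebesgue. \<phi> x *\<^sub>R pd i g x)"
    using integral_by_parts[OF bounded_bilinear_scaleR Cc_inf_smooth[OF \<phi>, of "Suc 0"] assms, of i] m
    by (simp add: lebesgue_eq_lborel(1) Cc_inf_bsupp[OF \<phi>])
qed

lemma wgrad_weak_deriv:
  assumes "weak_deriv [j] g h"
  shows "weak_deriv [j] g (\<lambda>x. wgrad g x $ j)" "AE x in lebesgue. wgrad g x $ j = h x"
proof -
  have "weak_deriv [j] g (SOME h. weak_deriv [j] g h)" using someI[of "weak_deriv [j] g"] assms by blast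
  then show *: "weak_deriv [j] g (\<lambda>x. wgrad g x $ j)" by (simp add: wgrad_def)
  show "AE x in lebesgue. wgrad g x $ j = h x" by (rule weak_deriv_unique[OF * assms])
qed

lemma wgrad_eq_AE:
  assumes "\<And>j. weak_deriv [j] g (h j)"
  shows "AE x in lebesgue. wgrad g x = (\<chi> j. h j x)"
proof -
  have "AE x in lebesgue. \<forall>j\<in>UNIV. wgrad g x $ j = h j x"
    using wgrad_weak_deriv(2)[OF assms] by (subst AE_finite_all) auto
  then show ?thesis by eventually_elim (simp add: vec_eq_iff)
qed

subsection \<open>Square integrable fields\<close>

lemma enn_powr_ennreal: "x \<ge> 0 \<Longrightarrow> enn_powr (ennreal x) a = ennreal (x powr a)"
  by (simp add: enn_powr_def)

lemma enn_powr_less_top: "enn_powr x a < \<infinity> \<longleftrightarrow> x < \<infinity>"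
  by (auto simp: enn_powr_def less_top)

lemma enn_powr_mono: "x \<le> y \<Longrightarrow> a \<ge> 0 \<Longrightarrow> enn_powr x a \<le> enn_powr y a"
proof (cases "y = top")
  case False
  assume *: "x \<le> y" "a \<ge> 0"
  with False have "x \<noteq> top" by (auto simp: top_unique)
  with False * show ?thesis
    by (auto simp: enn_powr_def enn2real_mono less_top intro!: powr_mono2 ennreal_leI)
qed (simp add: enn_powr_def)

lemma Lp_norm_real:
  assumes "p > 0"
  shows "Lp_norm (ennreal p) u = enn_powr (\<integral>\<^sup>+ x. ennreal (norm (u x) powr p) \<partial>lebesgue) (1 / p)"
  using assms by (simp add: Lp_norm_def Lp_gauge_def enn_powr_ennreal)

lemma Lp_norm_2: "Lp_norm 2 u = enn_powr (\<integral>\<^sup>+ x. ennreal ((norm (u x))\<^sup>2) \<partial>lebesgue) (1 / 2)"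
  using Lp_norm_real[of 2 u] by simp

text \<open>A Bochner integral, hence 0 for measurable fields that are not square integrable;
  estimates for it therefore usually carry membership in \<open>Lp 2\<close>.\<close>

abbreviation sqint :: "(R3 \<Rightarrow> 'b::real_normed_vector) \<Rightarrow> real" where
  "sqint u \<equiv> (LINT x|lebesgue. (norm (u x))\<^sup>2)"

lemma Lp2_iff:
  fixes u :: "R3 \<Rightarrow> 'b::euclidean_space"
  shows "u \<in> Lp 2 \<longleftrightarrow> u \<in> borel_measurable lebesgue \<and> integrable lebesgue (\<lambda>x. (norm (u x))\<^sup>2)"
proof (cases "u \<in> borel_measurable lebesgue")
  case True
  then have "integrable lebesgue (\<lambda>x. (norm (u x))\<^sup>2) \<longleftrightarrow> (\<integral>\<^sup>+ x. ennreal ((norm (u x))\<^sup>2) \<partial>lebesgue) < \<infinity>"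
    by (simp add: integrable_iff_bounded)
  with True show ?thesis unfolding Lp_def Lp_norm_2 by (simp only: mem_Collect_eq enn_powr_less_top)
qed (simp add: Lp_def)

lemma Lp2_norm:
  fixes u :: "R3 \<Rightarrow> 'b::euclidean_space"
  assumes "u \<in> Lp 2"
  shows "Lp_norm 2 u = ennreal (sqrt (sqint u))" "(L2_norm u)\<^sup>2 = sqint u"
proof -
  have "(\<integral>\<^sup>+ x. ennreal ((norm (u x))\<^sup>2) \<partial>lebesgue) = ennreal (sqint u)"
    using assms by (intro nn_integral_eq_integral) (auto simp: Lp2_iff)
  then show *: "Lp_norm 2 u = ennreal (sqrt (sqint u))"
    unfolding Lp_norm_2 by (simp add: enn_powr_ennreal powr_half_sqrt)
  show "(L2_norm u)\<^sup>2 = sqint u" unfolding * by simp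
qed

lemma Lp2_cong_AE:
  fixes u v :: "R3 \<Rightarrow> 'b::euclidean_space"
  assumes "u \<in> Lp 2" "v \<in> borel_measurable lebesgue" "AE x in lebesgue. u x = v x"
  shows "v \<in> Lp 2" "sqint v = sqint u"
proof -
  have m: "u \<in> borel_measurable lebesgue" using assms(1) by (simp add: Lp2_iff)
  have "integrable lebesgue (\<lambda>x. (norm (v x))\<^sup>2)"
    by (rule integrable_cong_AE_imp[where g = "\<lambda>x. (norm (u x))\<^sup>2"])
      (use assms in \<open>auto simp: Lp2_iff elim!: eventually_mono\<close>)
  with assms(2) show "v \<in> Lp 2" by (simp add: Lp2_iff)
  show "sqint v = sqint u"
    by (rule integral_cong_AE) (use assms m in \<open>auto elim!: eventually_mono\<close>)
qed

lemma Lp2_bound: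
  fixes u :: "R3 \<Rightarrow> 'b::euclidean_space"
  assumes "u \<in> borel_measurable lebesgue" "integrable lebesgue w" "\<And>x. (norm (u x))\<^sup>2 \<le> w x"
  shows "u \<in> Lp 2"
proof -
  have "integrable lebesgue (\<lambda>x. (norm (u x))\<^sup>2)"
    by (rule Bochner_Integration.integrable_bound[OF assms(2)])
      (use assms(1,3) in \<open>auto intro!: AE_I2 intro: order_trans[OF _ abs_ge_self]\<close>)
  with assms(1) show ?thesis by (simp add: Lp2_iff)
qed

lemma Lp2_lin:
  fixes u v :: "R3 \<Rightarrow> 'b::euclidean_space"
  assumes "u \<in> Lp 2" "v \<in> Lp 2"
  shows "(\<lambda>x. a *\<^sub>R u x + b *\<^sub>R v x) \<in> Lp 2"
proof (rule Lp2_bound)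
  show "(\<lambda>x. a *\<^sub>R u x + b *\<^sub>R v x) \<in> borel_measurable lebesgue"
    using assms by (auto simp: Lp2_iff)
  show "integrable lebesgue (\<lambda>x. 2 * a\<^sup>2 * (norm (u x))\<^sup>2 + 2 * b\<^sup>2 * (norm (v x))\<^sup>2)"
    using assms by (auto simp: Lp2_iff)
  fix x
  have "(norm (a *\<^sub>R u x + b *\<^sub>R v x))\<^sup>2 \<le> (norm (a *\<^sub>R u x) + norm (b *\<^sub>R v x))\<^sup>2"
    by (intro power_mono norm_triangle_ineq) auto
  also have "\<dots> \<le> 2 * (norm (a *\<^sub>R u x))\<^sup>2 + 2 * (norm (b *\<^sub>R v x))\<^sup>2"
    using sum_squares_bound[of "norm (a *\<^sub>R u x)" "norm (b *\<^sub>R v x)"] by (simp add: power2_sum)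
  finally show "(norm (a *\<^sub>R u x + b *\<^sub>R v x))\<^sup>2 \<le> 2 * a\<^sup>2 * (norm (u x))\<^sup>2 + 2 * b\<^sup>2 * (norm (v x))\<^sup>2"
    by (simp add: power_mult_distrib)
qed

lemma Lp2_diff:
  fixes u v :: "R3 \<Rightarrow> 'b::euclidean_space"
  assumes "u \<in> Lp 2" "v \<in> Lp 2"
  shows "(\<lambda>x. u x - v x) \<in> Lp 2"
  using Lp2_lin[OF assms, of 1 "-1"] by simp

text \<open>Cauchy-Schwarz from the discriminant of the quadratic polynomial t ->
  \<open>sqint\<close> of u - t v, which is nonnegative.\<close>

lemma Lp2_inner:
  fixes u v :: "R3 \<Rightarrow> 'b::euclidean_space"
  assumes "u \<in> Lp 2" "v \<in> Lp 2"
  shows "integrable lebesgue (\<lambda>x. u x \<bullet> v x)"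
    and "\<bar>LINT x|lebesgue. u x \<bullet> v x\<bar> \<le> sqrt (sqint u) * sqrt (sqint v)"
proof -
  have m [measurable]: "u \<in> borel_measurable lebesgue" "v \<in> borel_measurable lebesgue"
    and i: "integrable lebesgue (\<lambda>x. (norm (u x))\<^sup>2)" "integrable lebesgue (\<lambda>x. (norm (v x))\<^sup>2)"
    using assms by (auto simp: Lp2_iff)
  show int: "integrable lebesgue (\<lambda>x. u x \<bullet> v x)"
  proof (rule Bochner_Integration.integrable_bound)
    show "integrable lebesgue (\<lambda>x. (norm (u x))\<^sup>2 + (norm (v x))\<^sup>2)" using i by simp
    show "AE x in lebesgue. norm (u x \<bullet> v x) \<le> norm ((norm (u x))\<^sup>2 + (norm (v x))\<^sup>2)"
    proof (rule AE_I2)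
      fix x
      have "0 \<le> norm (u x) * norm (v x)" by simp
      then show "norm (u x \<bullet> v x) \<le> norm ((norm (u x))\<^sup>2 + (norm (v x))\<^sup>2)"
        using Cauchy_Schwarz_ineq2[of "u x" "v x"] sum_squares_bound[of "norm (u x)" "norm (v x)"] by auto
    qed
  qed measurable
  define a where "a = sqint u"
  define b where "b = sqint v"
  define c where "c = (LINT x|lebesgue. u x \<bullet> v x)"
  have ab: "0 \<le> a" "0 \<le> b" unfolding a_def b_def by (auto intro!: integral_nonneg_AE)
  have q: "0 \<le> a - 2 * t * c + t\<^sup>2 * b" for t
  proof -
    have "0 \<le> (LINT x|lebesgue. (norm (u x - t *\<^sub>R v x))\<^sup>2)" by (intro integral_nonneg_AE) auto
    also have "(\<lambda>x. (norm (u x - t *\<^sub>R v x))\<^sup>2) = (\<lambda>x. (norm (u x))\<^sup>2 - 2 * t * (u x \<bullet> v x) + t\<^sup>2 * (norm (v x))\<^sup>2)"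
      by (rule ext) (simp add: power2_norm_eq_inner inner_diff inner_commute algebra_simps power2_eq_square[of t])
    finally show ?thesis using i int by (simp add: a_def b_def c_def)
  qed
  have "c\<^sup>2 \<le> a * b"
  proof (cases "b = 0")
    case True
    have "c = 0"
    proof (rule ccontr)
      assume "c \<noteq> 0"
      \<comment> \<open>For b = 0 the polynomial is affine in t, and this t gives the value a - (a +
        1) < 0.\<close>
      then show False using q[of "(a + 1) / (2 * c)"] True by (simp add: field_simps)
    qed
    with ab show ?thesis by simp
  next
    case False
    with ab have b: "b > 0" by simp
    have "(c / b)\<^sup>2 * b = c\<^sup>2 / b" using b by (simp add: power2_eq_square field_simps)
    then have "0 \<le> a - c\<^sup>2 / b" using q[of "c / b"] b by (simp add: power2_eq_square field_simps)
    then show ?thesis using b by (simp add: field_simps)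
  qed
  then have "sqrt (c\<^sup>2) \<le> sqrt (a * b)" by (rule real_sqrt_le_mono)
  then show "\<bar>LINT x|lebesgue. u x \<bullet> v x\<bar> \<le> sqrt (sqint u) * sqrt (sqint v)"
    by (simp add: real_sqrt_mult a_def b_def c_def)
qed

lemma Lp2_continuous_bsupp:
  fixes u :: "R3 \<Rightarrow> 'b::euclidean_space"
  assumes "continuous_on UNIV u" "bsupp u"
  shows "u \<in> Lp 2"
proof -
  have "integrable lebesgue (\<lambda>x. (norm (u x))\<^sup>2)"
    using assms by (intro integrable_bsupp) (auto intro!: continuous_intros simp: bsupp_def)
  with borel_measurable_continuous_onI[OF assms(1)] show ?thesis
    by (simp add: Lp2_iff lebesgue_borel_measurable)
qed

subsection \<open>Mollification\<close>

lemma Cc_inf_derivative: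
  fixes \<rho> :: "'a::euclidean_space \<Rightarrow> 'b::euclidean_space"
  assumes \<rho>: "\<rho> \<in> Cc_inf UNIV"
  obtains D where "\<And>z. (\<rho> has_derivative D z) (at z)" "\<And>h. (\<lambda>z. D z h) \<in> Cc_inf UNIV"
proof -
  define D where "D z = frechet_derivative \<rho> (at z)" for z
  have D: "(\<rho> has_derivative D z) (at z)" "C_on k UNIV (\<lambda>z. D z h)" for z k h
    using Cc_inf_smooth[OF \<rho>, of "Suc k"] unfolding C_on_Suc_open[OF open_UNIV] D_def
    by (auto simp: frechet_derivative_works)
  have "(\<lambda>z. D z h) \<in> Cc_inf UNIV" for h
    by (rule Cc_infI[OF D(2) integral_derivative_eq_0(1)[OF D(1) C_on_continuous[OF D(2)[of 0]] Cc_inf_bsupp[OF \<rho>]]])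
  with D(1) show ?thesis by (rule that)
qed

lemma Cc_inf_lipschitz:
  fixes \<rho> :: "'a::euclidean_space \<Rightarrow> 'b::euclidean_space"
  assumes \<rho>: "\<rho> \<in> Cc_inf UNIV"
  obtains L where "L \<ge> 0" "\<And>x y. norm (\<rho> x - \<rho> y) \<le> L * norm (x - y)"
proof -
  obtain D where D: "\<And>z. (\<rho> has_derivative D z) (at z)" "\<And>h. (\<lambda>z. D z h) \<in> Cc_inf UNIV"
    using Cc_inf_derivative[OF \<rho>] by blast
  have "\<exists>M. \<forall>z. norm (D z b) \<le> M" for b
    using bsupp_bounded[OF C_on_continuous[OF Cc_inf_smooth[OF D(2)[of b], of 0]] Cc_inf_bsupp[OF D(2)[of b]]] by blast
  then obtain M where M: "\<And>b z. norm (D z b) \<le> M b" by metis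
  have M0: "M b \<ge> 0" for b using M[of undefined b] norm_ge_zero order_trans by blast
  have "onorm (D z) \<le> (\<Sum>b\<in>Basis. M b)" for z
  proof (rule onorm_le)
    fix h
    have lin: "linear (D z)" using D(1) has_derivative_linear by blast
    have eq: "D z h = (\<Sum>b\<in>Basis. (h \<bullet> b) *\<^sub>R D z b)"
      using linear_sum[OF lin, of "\<lambda>b. (h \<bullet> b) *\<^sub>R b" Basis]
      by (simp add: linear_cmul[OF lin] euclidean_representation)
    have "norm (D z h) \<le> (\<Sum>b\<in>Basis. norm h * M b)"
      unfolding eq
      by (rule order_trans[OF norm_sum sum_mono]) (auto intro!: mult_mono M Basis_le_norm)
    then show "norm (D z h) \<le> (\<Sum>b\<in>Basis. M b) * norm h"
      by (simp add: sum_distrib_left mult.commute)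
  qed
  then have "norm (\<rho> x - \<rho> y) \<le> (\<Sum>b\<in>Basis. M b) * norm (x - y)" for x y
    using D(1) by (intro differentiable_bound[of UNIV \<rho> D]) auto
  then show ?thesis using M0 by (intro that[of "\<Sum>b\<in>Basis. M b"]) (auto intro: sum_nonneg)
qed

text \<open>The derivative is Lipschitz with one constant for all base points, because its values on
  basis vectors are test functions. The uniform quadratic remainder lets a convolution be
  differentiated by a direct estimate.\<close>

lemma Cc_inf_taylor:
  fixes \<rho> :: "'a::euclidean_space \<Rightarrow> 'b::euclidean_space"
  assumes \<rho>: "\<rho> \<in> Cc_inf UNIV" and D: "\<And>z. (\<rho> has_derivative D z) (at z)"
  obtains C where "C \<ge> 0" "\<And>z k. norm (\<rho> (z + k) - \<rho> z - D z k) \<le> C * (norm k)\<^sup>2"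
proof -
  obtain D' where D': "\<And>z. (\<rho> has_derivative D' z) (at z)" "\<And>h. (\<lambda>z. D' z h) \<in> Cc_inf UNIV"
    using Cc_inf_derivative[OF \<rho>] by blast
  have "D = D'" using D D'(1) has_derivative_unique by blast
  then have "\<exists>L\<ge>0. \<forall>x y. norm (D x b - D y b) \<le> L * norm (x - y)" for b
    using Cc_inf_lipschitz[OF D'(2)[of b]] by metis
  then obtain L where L0: "\<And>b. L b \<ge> 0" and L: "\<And>b x y. norm (D x b - D y b) \<le> L b * norm (x - y)" by metis
  define C where "C = (\<Sum>b\<in>Basis. L b)"
  have on: "onorm (\<lambda>h. D x h - D z h) \<le> C * norm (x - z)" for x z
  proof (rule onorm_le)
    fix h
    have lin: "linear (\<lambda>h. D x h - D z h)"
      using D has_derivative_linear by (intro linear_compose_sub) blast+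
    have eq: "D x h - D z h = (\<Sum>b\<in>Basis. (h \<bullet> b) *\<^sub>R (D x b - D z b))"
      using linear_sum[OF lin, of "\<lambda>b. (h \<bullet> b) *\<^sub>R b" Basis]
      by (simp add: linear_cmul[OF lin] euclidean_representation)
    have "norm (D x h - D z h) \<le> (\<Sum>b\<in>Basis. norm h * (L b * norm (x - z)))"
      unfolding eq by (rule order_trans[OF norm_sum sum_mono]) (auto intro!: mult_mono L Basis_le_norm)
    then show "norm (D x h - D z h) \<le> C * norm (x - z) * norm h"
      by (simp add: C_def sum_distrib_left sum_distrib_right mult.commute mult.left_commute)
  qed
  have "norm (\<rho> (z + k) - \<rho> z - D z k) \<le> C * (norm k)\<^sup>2" for z k
  proof -
    let ?S = "closed_segment z (z + k)"
    \<comment> \<open>After subtracting the linear map \<open>D z\<close>, the derivative on the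
      segment has norm at most C |k|; the mean value inequality supplies the second factor
      |k|.\<close>
    have "norm ((\<lambda>x. \<rho> x - D z x) (z + k) - (\<lambda>x. \<rho> x - D z x) z) \<le> C * norm k * norm (z + k - z)"
    proof (rule differentiable_bound[of ?S _ "\<lambda>x h. D x h - D z h"])
      have lz: "bounded_linear (D z)" using D has_derivative_bounded_linear by blast
      show "((\<lambda>x. \<rho> x - D z x) has_derivative (\<lambda>h. D x h - D z h)) (at x within ?S)" for x
        by (intro has_derivative_diff has_derivative_at_withinI[OF D] bounded_linear_imp_has_derivative lz)
      fix x assume "x \<in> ?S"
      then have "norm (x - z) \<le> norm k"
        using segment_bound1[of x z "z + k"] by (simp add: norm_minus_commute)
      then show "onorm (\<lambda>h. D x h - D z h) \<le> C * norm k"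
        using on[of x z] L0 by (intro order_trans[OF on] mult_left_mono) (auto simp: C_def sum_nonneg)
    qed auto
    moreover have "D z (z + k) = D z z + D z k"
      using has_derivative_linear[OF D[of z]] by (simp add: linear_add)
    ultimately show ?thesis by (simp add: algebra_simps power2_eq_square)
  qed
  then show ?thesis using L0 by (intro that[of C]) (auto simp: C_def sum_nonneg)
qed

definition conv :: "(R3 \<Rightarrow> real) \<Rightarrow> (R3 \<Rightarrow> 'b::euclidean_space) \<Rightarrow> R3 \<Rightarrow> 'b" where
  "conv \<rho> u x = (LINT y|lebesgue. \<rho> (x - y) *\<^sub>R u y)"

lemma Cc_inf_reflect:
  fixes \<rho> :: "R3 \<Rightarrow> real"
  assumes "\<rho> \<in> Cc_inf UNIV"
  shows "(\<lambda>y. \<rho> (x - y)) \<in> Cc_inf UNIV"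
proof (rule Cc_infI)
  show "C_on k UNIV (\<lambda>y. \<rho> (x - y))" for k
    by (rule C_on_compose[OF Cc_inf_smooth[OF assms] C_on_diff[OF C_on_const C_on_id]]) simp
  obtain R where R: "\<And>z. R < norm z \<Longrightarrow> \<rho> z = 0" using bsuppE[OF Cc_inf_bsupp[OF assms]] by blast
  show "bsupp (\<lambda>y. \<rho> (x - y))"
  proof (rule bsuppI)
    fix y :: R3 assume "R + norm x < norm y"
    then have "R < norm (x - y)" using norm_triangle_ineq2[of y x] by (simp add: norm_minus_commute)
    then show "\<rho> (x - y) = 0" by (rule R)
  qed
qed

lemma conv_integrable:
  fixes \<rho> :: "R3 \<Rightarrow> real"
  assumes "\<rho> \<in> Cc_inf UNIV" "u \<in> L1_loc UNIV"
  shows "integrable lebesgue (\<lambda>y. \<rho> (x - y) *\<^sub>R u y)"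
  using Cc_inf_reflect[OF assms(1), of x]
  by (intro L1_loc_test assms(2) C_on_continuous[OF Cc_inf_smooth[of _ 0]] Cc_inf_bsupp)

text \<open>The Taylor remainder of the kernel is at most C |k|^2 and, for |k| \<le> 1, vanishes
  outside one ball about x, over which u is integrable.\<close>

lemma conv_has_derivative:
  fixes \<rho> :: "R3 \<Rightarrow> real"
  assumes \<rho>: "\<rho> \<in> Cc_inf UNIV" and u: "u \<in> L1_loc UNIV"
    and D: "\<And>z. (\<rho> has_derivative D z) (at z)" "\<And>h. (\<lambda>z. D z h) \<in> Cc_inf UNIV"
  shows "(conv \<rho> u has_derivative (\<lambda>h. conv (\<lambda>z. D z h) u x)) (at x)"
proof -
  obtain C where C: "C \<ge> 0" "\<And>z k. norm (\<rho> (z + k) - \<rho> z - D z k) \<le> C * (norm k)\<^sup>2"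
    using Cc_inf_taylor[OF \<rho> D(1)] by blast
  obtain R where R: "R > 0" "\<And>z. R < norm z \<Longrightarrow> \<rho> z = 0" using bsuppE[OF Cc_inf_bsupp[OF \<rho>]] by blast
  let ?B = "cball x (R + 1)"
  define A where "A = (LINT y|lebesgue. norm (indicator ?B y *\<^sub>R u y))"
  have A0: "A \<ge> 0" unfolding A_def by (intro integral_nonneg_AE) auto
  have Bi: "integrable lebesgue (\<lambda>y. indicator ?B y *\<^sub>R u y)"
    by (rule L1_loc_integrable[OF u]) simp
  have i: "integrable lebesgue (\<lambda>y. D (x - y) h *\<^sub>R u y)" for h
    using conv_integrable[OF D(2) u] .
  have lin: "linear (D z)" for z using D(1) has_derivative_linear by blast
  have D0: "D z h = 0" if "R < norm z" for z h
  proof -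
    have "open {z::R3. R < norm z}" by (intro open_Collect_less continuous_intros)
    then have "((\<lambda>_. 0) has_derivative D z) (at z)"
      by (rule has_derivative_transform_within_open[OF D(1)]) (use R(2) that in auto)
    then have "D z = (\<lambda>_. 0)" by (rule has_derivative_unique) simp
    then show ?thesis by simp
  qed
  have bl: "bounded_linear (\<lambda>h. conv (\<lambda>z. D z h) u x)"
  proof (rule linear_conv_bounded_linear[THEN iffD1], rule linearI)
    fix a b :: R3 and c :: real
    show "conv (\<lambda>z. D z (a + b)) u x = conv (\<lambda>z. D z a) u x + conv (\<lambda>z. D z b) u x"
      unfolding conv_def using i[of a] i[of b] by (simp add: linear_add[OF lin] scaleR_add_left)
    show "conv (\<lambda>z. D z (c *\<^sub>R a)) u x = c *\<^sub>R conv (\<lambda>z. D z a) u x"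
      unfolding conv_def using i[of a] by (simp add: linear_cmul[OF lin] flip: scaleR_scaleR)
  qed
  have est: "norm (conv \<rho> u (x + k) - conv \<rho> u x - conv (\<lambda>z. D z k) u x) \<le> C * A * (norm k)\<^sup>2"
    if k: "norm k \<le> 1" for k
  proof -
    let ?I = "\<lambda>y. (\<rho> (x - y + k) - \<rho> (x - y) - D (x - y) k) *\<^sub>R u y"
    have eq: "conv \<rho> u (x + k) - conv \<rho> u x - conv (\<lambda>z. D z k) u x
        = (LINT y|lebesgue. (\<rho> (x - y + k) - \<rho> (x - y) - D (x - y) k) *\<^sub>R u y)"
      unfolding conv_def using conv_integrable[OF \<rho> u, of "x + k"] conv_integrable[OF \<rho> u, of x] i[of k]
      by (simp add: scaleR_diff_left algebra_simps)
    have "norm (conv \<rho> u (x + k) - conv \<rho> u x - conv (\<lambda>z. D z k) u x) = norm (integral\<^sup>L lebesgue ?I)"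
      by (simp only: eq)
    also have "\<dots> \<le> (LINT y|lebesgue. norm (?I y))"
      by (rule integral_norm_bound)
    also have "\<dots> \<le> (LINT y|lebesgue. C * (norm k)\<^sup>2 * norm (indicator ?B y *\<^sub>R u y))"
    proof (rule integral_mono)
      have "integrable lebesgue (\<lambda>y. (\<rho> (x - y + k) - \<rho> (x - y) - D (x - y) k) *\<^sub>R u y)"
        using conv_integrable[OF \<rho> u, of "x + k"] conv_integrable[OF \<rho> u, of x] i[of k]
        by (simp add: scaleR_diff_left algebra_simps)
      then show "integrable lebesgue (\<lambda>y. norm ((\<rho> (x - y + k) - \<rho> (x - y) - D (x - y) k) *\<^sub>R u y))"
        by (rule integrable_norm)
      show "integrable lebesgue (\<lambda>y. C * (norm k)\<^sup>2 * norm (indicator ?B y *\<^sub>R u y))"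
        by (intro integrable_mult_right integrable_norm Bi)
      fix y
      show "norm ((\<rho> (x - y + k) - \<rho> (x - y) - D (x - y) k) *\<^sub>R u y) \<le> C * (norm k)\<^sup>2 * norm (indicator ?B y *\<^sub>R u y)"
      proof (cases "y \<in> ?B")
        case True
        then show ?thesis using C(2)[of "x - y" k] by (simp add: mult_right_mono)
      next
        case False
        then have n: "R + 1 < norm (x - y)" by (simp add: dist_norm)
        then have "R < norm (x - y + k)"
          using k norm_triangle_ineq2[of "x - y" "- k"] by simp
        then show ?thesis using n R(2) D0 False by simp
      qed
    qed
    also have "\<dots> = C * A * (norm k)\<^sup>2" by (simp add: A_def)
    finally show ?thesis .
  qed
  show ?thesis
    unfolding has_derivative_at
  proof (rule conjI[OF bl], rule Lim_null_comparison)
    show "((\<lambda>k. C * A * norm k) \<longlongrightarrow> 0) (at 0)"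
      by (auto intro!: tendsto_eq_intros)
    have "\<forall>\<^sub>F k::R3 in at 0. norm k \<le> 1"
      unfolding eventually_at by (intro exI[of _ 1]) (auto simp: dist_norm)
    then show "\<forall>\<^sub>F k in at 0. norm (norm (conv \<rho> u (x + k) - conv \<rho> u x - conv (\<lambda>z. D z k) u x) / norm k) \<le> C * A * norm k"
    proof eventually_elim
      case (elim k)
      then show ?case using est[OF elim] C A0
        by (cases "k = 0") (simp_all add: divide_le_eq power2_eq_square mult.assoc)
    qed
  qed
qed

lemma C_on_conv:
  assumes u: "u \<in> L1_loc UNIV"
  shows "\<rho> \<in> Cc_inf UNIV \<Longrightarrow> C_on k UNIV (conv \<rho> u)"
proof (induction k arbitrary: \<rho>)
  case 0
  obtain D where D: "\<And>z. (\<rho> has_derivative D z) (at z)" "\<And>h. (\<lambda>z. D z h) \<in> Cc_inf UNIV"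
    using Cc_inf_derivative[OF 0] by blast
  have "continuous_on UNIV (conv \<rho> u)"
    by (rule has_derivative_continuous_on[OF has_derivative_at_withinI[OF conv_has_derivative[OF 0 u D]]])
  then show ?case by simp
next
  case (Suc k)
  obtain D where D: "\<And>z. (\<rho> has_derivative D z) (at z)" "\<And>h. (\<lambda>z. D z h) \<in> Cc_inf UNIV"
    using Cc_inf_derivative[OF Suc.prems] by blast
  show ?case
    by (rule C_on_SucI[OF has_derivative_at_withinI[OF conv_has_derivative[OF Suc.prems u D]] Suc.IH[OF D(2)]])
qed

lemma pd_conv:
  assumes \<rho>: "\<rho> \<in> Cc_inf UNIV" and u: "u \<in> L1_loc UNIV"
  shows "pd i (conv \<rho> u) = conv (pd i \<rho>) u"
proof
  fix x
  obtain D where D: "\<And>z. (\<rho> has_derivative D z) (at z)" "\<And>h. (\<lambda>z. D z h) \<in> Cc_inf UNIV"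
    using Cc_inf_derivative[OF \<rho>] by blast
  have "pd i \<rho> = (\<lambda>z. D z (axis i 1))" using pd_eq[OF D(1)] by auto
  then show "pd i (conv \<rho> u) x = conv (pd i \<rho>) u x"
    using pd_eq[OF conv_has_derivative[OF \<rho> u D]] by simp
qed

text \<open>The weak derivative is tested with y -> \<open>\<rho> (x - y)\<close>; the sign from
  reflecting the kernel cancels the sign in the definition of a weak derivative.\<close>

lemma conv_weak_deriv:
  assumes \<rho>: "\<rho> \<in> Cc_inf UNIV" and w: "weak_deriv [i] u h"
  shows "conv (pd i \<rho>) u = conv \<rho> h"
proof
  fix x
  obtain D where D: "\<And>z. (\<rho> has_derivative D z) (at z)" "\<And>h. (\<lambda>z. D z h) \<in> Cc_inf UNIV"
    using Cc_inf_derivative[OF \<rho>] by blast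
  note D = D(1)
  have "pd i (\<lambda>y. \<rho> (x - y)) y = - pd i \<rho> (x - y)" for y
  proof -
    have "((\<lambda>y. x - y) has_derivative (\<lambda>h. - h)) (at y)" by (auto intro!: derivative_eq_intros)
    from has_derivative_compose[OF this D] have "pd i (\<lambda>y. \<rho> (x - y)) y = D (x - y) (- axis i 1)"
      by (rule pd_eq)
    also have "\<dots> = - D (x - y) (axis i 1)"
      using has_derivative_linear[OF D[of "x - y"]] by (simp add: linear_neg)
    finally show ?thesis using pd_eq[OF D] by simp
  qed
  moreover have "(LINT y|lebesgue. pd i (\<lambda>y. \<rho> (x - y)) y *\<^sub>R u y) = - (LINT y|lebesgue. \<rho> (x - y) *\<^sub>R h y)"
    using w Cc_inf_reflect[OF \<rho>, of x] by (simp add: weak_deriv_def)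
  ultimately show "conv (pd i \<rho>) u x = conv \<rho> h x" by (simp add: conv_def)
qed

lemma Lp2_L1_loc:
  fixes u :: "R3 \<Rightarrow> 'b::euclidean_space"
  assumes "u \<in> Lp 2"
  shows "u \<in> L1_loc UNIV"
  unfolding L1_loc_def
proof (intro CollectI allI impI)
  fix K :: "R3 set" assume K: "compact K"
  have m: "u \<in> borel_measurable lebesgue" and i: "integrable lebesgue (\<lambda>x. (norm (u x))\<^sup>2)"
    using assms by (auto simp: Lp2_iff)
  have Kf: "emeasure lborel K < \<infinity>" using K emeasure_lborel_cbox_finite emeasure_bounded_finite compact_imp_bounded by blast
  have Ki: "integrable lebesgue (indicator K :: R3 \<Rightarrow> real)"
    using Kf K by (intro integrable_real_indicator) (auto simp: compact_imp_closed)
  have "integrable lebesgue (\<lambda>x. indicator K x *\<^sub>R u x)"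
  proof (rule Bochner_Integration.integrable_bound)
    show "integrable lebesgue (\<lambda>x. indicator K x + (norm (u x))\<^sup>2)" using Ki i by simp
    show "(\<lambda>x. indicator K x *\<^sub>R u x) \<in> borel_measurable lebesgue"
      by (intro borel_measurable_scaleR borel_measurable_indicator m) (use K in \<open>auto simp: compact_imp_closed\<close>)
    show "AE x in lebesgue. norm (indicator K x *\<^sub>R u x) \<le> norm (indicator K x + (norm (u x))\<^sup>2)"
    proof (rule AE_I2)
      fix x
      have "norm (u x) \<le> 1 + (norm (u x))\<^sup>2"
      proof -
        have "2 * norm (u x) \<le> 1 + (norm (u x))\<^sup>2" using sum_squares_bound[of 1 "norm (u x)"] by simp
        then show ?thesis using norm_ge_zero[of "u x"] by linarith
      qed
      then show "norm (indicator K x *\<^sub>R u x) \<le> norm (indicator K x + (norm (u x))\<^sup>2)"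
        by (auto simp: indicator_def)
    qed
  qed
  then show "integrable (lebesgue_on K) u"
    by (subst integrable_restrict_space) (use K in \<open>auto simp: compact_imp_closed\<close>)
qed

lemma sqint_nonneg: "sqint u \<ge> 0"
  by (intro integral_nonneg_AE) auto

lemma sqint_add_le:
  fixes u v :: "R3 \<Rightarrow> 'b::euclidean_space"
  assumes "u \<in> Lp 2" "v \<in> Lp 2"
  shows "sqint (\<lambda>x. u x + v x) \<le> 2 * sqint u + 2 * sqint v"
proof -
  have i: "integrable lebesgue (\<lambda>x. (norm (u x))\<^sup>2)" "integrable lebesgue (\<lambda>x. (norm (v x))\<^sup>2)"
    "integrable lebesgue (\<lambda>x. (norm (u x + v x))\<^sup>2)"
    using assms Lp2_lin[OF assms, of 1 1] by (auto simp: Lp2_iff)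
  have le: "(norm (u x + v x))\<^sup>2 \<le> 2 * (norm (u x))\<^sup>2 + 2 * (norm (v x))\<^sup>2" for x
  proof -
    have "(norm (u x + v x))\<^sup>2 \<le> (norm (u x) + norm (v x))\<^sup>2"
      by (intro power_mono norm_triangle_ineq) auto
    then show ?thesis using sum_squares_bound[of "norm (u x)" "norm (v x)"] by (simp add: power2_sum)
  qed
  have "sqint (\<lambda>x. u x + v x) \<le> (LINT x|lebesgue. 2 * (norm (u x))\<^sup>2 + 2 * (norm (v x))\<^sup>2)"
    by (rule integral_mono) (use i le in auto)
  then show ?thesis using i by simp
qed

lemma sqint_dominated:
  fixes h :: "nat \<Rightarrow> R3 \<Rightarrow> 'b::euclidean_space"
  assumes "\<And>n. h n \<in> borel_measurable lebesgue" "integrable lebesgue w"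
    and "\<And>n x. (norm (h n x))\<^sup>2 \<le> w x" "AE x in lebesgue. (\<lambda>n. h n x) \<longlonglongrightarrow> 0"
  shows "(\<lambda>n. sqint (h n)) \<longlonglongrightarrow> 0"
proof -
  have "(\<lambda>n. sqint (h n)) \<longlonglongrightarrow> (LINT x::R3|lebesgue. 0)"
  proof (rule integral_dominated_convergence[where w = w])
    show "AE x in lebesgue. (\<lambda>n. (norm (h n x))\<^sup>2) \<longlonglongrightarrow> 0"
      using assms(4) by eventually_elim (auto intro!: tendsto_eq_intros)
  qed (use assms in auto)
  then show ?thesis by simp
qed

text \<open>u is first cut in space and in size, which gives the bounded function
  \<open>U k\<close>. Continuous functions converging to \<open>U k\<close> almost everywhere exist
  but are uncontrolled, so they are clamped as well before dominated convergence is applied.\<close>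

lemma Lp2_approx_continuous:
  fixes u :: "R3 \<Rightarrow> 'b::euclidean_space"
  assumes u: "u \<in> Lp 2" and e: "e > 0"
  obtains g where "continuous_on UNIV g" "bsupp g" "sqint (\<lambda>x. g x - u x) < e"
proof -
  have m: "u \<in> borel_measurable lebesgue" and i: "integrable lebesgue (\<lambda>x. (norm (u x))\<^sup>2)"
    using u by (auto simp: Lp2_iff)
  define A where "A k = {x. norm x \<le> real (Suc k)} \<inter> {x. norm (u x) \<le> real (Suc k)}" for k
  define U where "U k x = indicator (A k) x *\<^sub>R u x" for k x
  have A: "A k \<in> sets lebesgue" for k
  proof -
    have "{x::R3. norm x \<le> real (Suc k)} = cball 0 (real (Suc k))" by auto
    then have "{x::R3. norm x \<le> real (Suc k)} \<in> sets lebesgue" by (simp del: of_nat_Suc)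
    moreover have "{x \<in> space lebesgue. norm (u x) \<le> real (Suc k)} \<in> sets lebesgue"
      using m by (intro borel_measurable_le) auto
    ultimately have "{x::R3. norm x \<le> real (Suc k)} \<inter> {x \<in> space lebesgue. norm (u x) \<le> real (Suc k)} \<in> sets lebesgue"
      by (rule sets.Int)
    then show ?thesis unfolding A_def by simp
  qed
  have Um: "U k \<in> borel_measurable lebesgue" for k
    unfolding U_def by (intro borel_measurable_scaleR borel_measurable_indicator A m)
  have U2: "U k \<in> Lp 2" for k
    by (rule Lp2_bound[OF Um i]) (auto simp: U_def indicator_def)
  have "(\<lambda>k. sqint (\<lambda>x. U k x - u x)) \<longlonglongrightarrow> 0"
  proof (rule sqint_dominated[OF _ i])
    show "(\<lambda>x. U n x - u x) \<in> borel_measurable lebesgue" for n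
      using Um m by (intro borel_measurable_diff)
    show "(norm (U n x - u x))\<^sup>2 \<le> (norm (u x))\<^sup>2" for n x by (auto simp: U_def indicator_def)
    show "AE x in lebesgue. (\<lambda>n. U n x - u x) \<longlonglongrightarrow> 0"
    proof (rule AE_I2, rule tendsto_eventually)
      fix x
      obtain N where N: "max (norm x) (norm (u x)) \<le> real N" using real_arch_simple by blast
      show "\<forall>\<^sub>F n in sequentially. U n x - u x = 0"
        using eventually_ge_at_top[of N] by eventually_elim (use N in \<open>auto simp: U_def A_def indicator_def\<close>)
    qed
  qed
  \<comment> \<open>A quarter, because \<open>sqint_add_le\<close> doubles each of the two
    errors.\<close>
  then have "\<forall>\<^sub>F k in sequentially. sqint (\<lambda>x. U k x - u x) < e / 4"
    by (rule order_tendstoD) (use e in simp)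
  then obtain k where k: "sqint (\<lambda>x. U k x - u x) < e / 4"
    by (auto simp: eventually_sequentially)
  define r where "r = real (Suc k)"
  have r: "r > 0" by (simp add: r_def)
  have Ub: "norm (U k x) \<le> r" "r < norm x \<Longrightarrow> U k x = 0" for x
    by (auto simp: U_def A_def indicator_def r_def)
  have "U k measurable_on UNIV" by (rule lebesgue_measurable_imp_measurable_on[OF Um]) simp
  then obtain N g where Ng: "negligible N" "\<forall>n. continuous_on UNIV (g n)"
    "\<forall>x. x \<notin> N \<longrightarrow> (\<lambda>n. g n x) \<longlonglongrightarrow> (if x \<in> UNIV then U k x else 0)"
    unfolding measurable_on_def by (elim exE conjE) (rule that)
  have N: "negligible N" and g: "\<And>n. continuous_on UNIV (g n)"
    "\<And>x. x \<notin> N \<Longrightarrow> (\<lambda>n. g n x) \<longlonglongrightarrow> U k x"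
    using Ng by simp_all
  \<comment> \<open>\<open>cl\<close> retracts onto the ball of radius r and \<open>ct\<close> is a
    piecewise linear cut-off in space; neither changes \<open>U k\<close>.\<close>
  define cl where "cl w = (r / max r (norm w)) *\<^sub>R w" for w :: 'b
  define ct where "ct x = max 0 (min 1 (r + 1 - norm x))" for x :: R3
  define G where "G n x = ct x *\<^sub>R cl (g n x)" for n x
  have clb: "norm (cl w) \<le> r" for w
    using r by (auto simp: cl_def max_def field_simps abs_mult)
  have cl_id: "cl w = w" if "norm w \<le> r" for w
    using r that by (simp add: cl_def max_def)
  have clc: "continuous_on UNIV cl"
    unfolding cl_def using r by (intro continuous_intros) (auto simp: max_def)
  have ct: "0 \<le> ct x" "ct x \<le> 1" "norm x \<le> r \<Longrightarrow> ct x = 1" "r + 1 < norm x \<Longrightarrow> ct x = 0" for x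
    by (auto simp: ct_def)
  have Gc: "continuous_on UNIV (G n)" for n
    unfolding G_def ct_def
    by (intro continuous_intros continuous_on_compose2[OF clc g(1)]) auto
  have Gs: "bsupp (G n)" for n
    by (rule bsuppI[of "r + 1"]) (simp add: G_def ct)
  have Gm: "G n \<in> borel_measurable lebesgue" for n
    by (rule lebesgue_borel_measurable[OF borel_measurable_continuous_onI[OF Gc]])
  have "(\<lambda>n. sqint (\<lambda>x. G n x - U k x)) \<longlonglongrightarrow> 0"
  proof (rule sqint_dominated)
    show "(\<lambda>x. G n x - U k x) \<in> borel_measurable lebesgue" for n
      using Gm Um by (intro borel_measurable_diff)
    show "integrable lebesgue (\<lambda>x::R3. (2 * r)\<^sup>2 * indicator (cball 0 (r + 1)) x)"
      using emeasure_lborel_cball_finite[of "0::R3" "r + 1"]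
      by (intro integrable_mult_right integrable_real_indicator) auto
    show "(norm (G n x - U k x))\<^sup>2 \<le> (2 * r)\<^sup>2 * indicator (cball 0 (r + 1)) x" for n x
    proof (cases "norm x \<le> r + 1")
      case True
      have "norm (G n x) \<le> 1 * r" unfolding G_def norm_scaleR
        using ct[of x] clb r by (intro mult_mono) auto
      then have "norm (G n x - U k x) \<le> 2 * r" using Ub(1)[of x] norm_triangle_ineq4[of "G n x" "U k x"] by simp
      then have "(norm (G n x - U k x))\<^sup>2 \<le> (2 * r)\<^sup>2" by (rule power_mono) simp
      then show ?thesis using True by simp
    next
      case False
      then show ?thesis using Ub(2)[of x] ct(4)[of x] by (simp add: G_def)
    qed
    have lim: "(\<lambda>n. G n x - U k x) \<longlonglongrightarrow> 0" if "x \<notin> N" for x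
    proof -
      have "isCont cl (U k x)" using clc by (simp add: continuous_on_eq_continuous_at)
      from isCont_tendsto_compose[OF this g(2)[OF that]]
      have "(\<lambda>n. G n x) \<longlonglongrightarrow> ct x *\<^sub>R cl (U k x)" unfolding G_def by (intro tendsto_intros)
      also have "ct x *\<^sub>R cl (U k x) = U k x"
        using cl_id[OF Ub(1)[of x]] ct(3)[of x] Ub(2)[of x] by (cases "norm x \<le> r") auto
      finally show ?thesis by (simp add: LIM_zero)
    qed
    have "AE x in lebesgue. x \<notin> N" using N by (intro AE_not_in) (simp add: negligible_iff_null_sets)
    then show "AE x in lebesgue. (\<lambda>n. G n x - U k x) \<longlonglongrightarrow> 0" by eventually_elim (rule lim)
  qed
  then have "\<forall>\<^sub>F n in sequentially. sqint (\<lambda>x. G n x - U k x) < e / 4"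
    by (rule order_tendstoD) (use e in simp)
  then obtain n where n: "sqint (\<lambda>x. G n x - U k x) < e / 4"
    by (auto simp: eventually_sequentially)
  have "sqint (\<lambda>x. (G n x - U k x) + (U k x - u x)) \<le> 2 * sqint (\<lambda>x. G n x - U k x) + 2 * sqint (\<lambda>x. U k x - u x)"
    by (intro sqint_add_le Lp2_diff Lp2_continuous_bsupp Gc Gs U2 u)
  also have "\<dots> < e" using n k by simp
  finally show ?thesis by (intro that[OF Gc Gs, of n]) simp
qed

text \<open>Evenness turns \<open>\<rho> (x - y)\<close> into \<open>\<rho> (- x + y)\<close>, to
  which translation invariance of \<open>lborel\<close> in y applies directly.\<close>

locale mollifier_kernel =
  fixes \<rho> :: "R3 \<Rightarrow> real"
  assumes test: "\<rho> \<in> Cc_inf UNIV" and nonneg: "\<rho> x \<ge> 0" and even: "\<rho> (- x) = \<rho> x"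
    and mass: "(LINT x|lborel. \<rho> x) = 1"
begin

lemma \<rho>_measurable [measurable]: "\<rho> \<in> borel_measurable borel"
  by (rule Cc_inf_measurable[OF test])

lemma \<rho>_integrable: "integrable lborel \<rho>"
  by (rule integrable_bsupp(1)[OF C_on_continuous[OF Cc_inf_smooth[OF test, of 0]] Cc_inf_bsupp[OF test]])

lemma reflect: "\<rho> (x - y) = \<rho> (- x + y)"
  using even[of "x - y"] by simp

lemma mass_x: "(LINT y|lborel. \<rho> (x - y)) = 1"
  using lborel_integral_translate[of \<rho> "- x"] mass by (simp only: reflect \<rho>_measurable)

lemma nn_mass: "(\<integral>\<^sup>+ y. ennreal (\<rho> y) \<partial>lborel) = 1"
  using nn_integral_eq_integral[OF \<rho>_integrable] mass nonneg by simp

lemma nn_mass_y: "(\<integral>\<^sup>+ y. ennreal (\<rho> (x - y)) \<partial>lborel) = 1"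
  using lborel_nn_integral_translate[of "\<lambda>z. ennreal (\<rho> z)" "- x"] nn_mass by (simp only: reflect) simp

lemma nn_mass_x: "(\<integral>\<^sup>+ x. ennreal (\<rho> (x - y)) \<partial>lborel) = 1"
  using lborel_nn_integral_translate[of "\<lambda>z. ennreal (\<rho> z)" "- y"] nn_mass by simp

lemma conv_measurable: "u \<in> L1_loc UNIV \<Longrightarrow> conv \<rho> u \<in> borel_measurable borel"
  by (rule borel_measurable_continuous_onI[OF C_on_continuous[OF C_on_conv[OF _ test, of _ 0]]])

text \<open>Young's inequality for a kernel of mass one: Cauchy-Schwarz, with \<rho> split into two
  square roots, gives the pointwise bound \<open>ptw\<close>, and Tonelli integrates it.\<close>

lemma conv_contraction:
  fixes u :: "R3 \<Rightarrow> 'b::euclidean_space"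
  assumes u: "u \<in> Lp 2"
  shows "conv \<rho> u \<in> Lp 2" "sqint (conv \<rho> u) \<le> sqint u"
proof -
  have m: "u \<in> borel_measurable lebesgue" and i: "integrable lebesgue (\<lambda>x. (norm (u x))\<^sup>2)"
    using u by (auto simp: Lp2_iff)
  obtain v where v [measurable]: "v \<in> borel_measurable borel" and uv: "AE x in lborel. u x = v x"
    using completion_borel_version[of u lborel] m by auto
  have uv': "AE x in lebesgue. u x = v x" using uv by (rule AE_completion)
  have ptw: "ennreal ((norm (conv \<rho> u x))\<^sup>2) \<le> (\<integral>\<^sup>+ y. ennreal (\<rho> (x - y)) * ennreal ((norm (v y))\<^sup>2) \<partial>lborel)" for x
  proof -
    have ci: "integrable lebesgue (\<lambda>y. \<rho> (x - y) *\<^sub>R u y)" by (rule conv_integrable[OF test Lp2_L1_loc[OF u]])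
    have "norm (conv \<rho> u x) \<le> (LINT y|lebesgue. norm (\<rho> (x - y) *\<^sub>R u y))"
      unfolding conv_def by (rule integral_norm_bound)
    then have "ennreal (norm (conv \<rho> u x)) \<le> ennreal (LINT y|lebesgue. norm (\<rho> (x - y) *\<^sub>R u y))"
      by (rule ennreal_leI)
    also have "\<dots> = (\<integral>\<^sup>+ y. ennreal (norm (\<rho> (x - y) *\<^sub>R u y)) \<partial>lebesgue)"
      by (rule nn_integral_eq_integral[symmetric, OF integrable_norm[OF ci]]) auto
    also have "\<dots> = (\<integral>\<^sup>+ y. ennreal (norm (\<rho> (x - y) *\<^sub>R v y)) \<partial>lebesgue)"
      by (rule nn_integral_cong_AE) (use uv' in \<open>auto elim!: eventually_mono\<close>)
    also have "\<dots> = (\<integral>\<^sup>+ y. ennreal (sqrt (\<rho> (x - y))) * ennreal (sqrt (\<rho> (x - y)) * norm (v y)) \<partial>lborel)"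
      unfolding nn_integral_completion
      by (rule nn_integral_cong) (simp add: nonneg flip: ennreal_mult mult.assoc)
    finally have "ennreal (norm (conv \<rho> u x)) ^ 2 \<le>
        (\<integral>\<^sup>+ y. ennreal (sqrt (\<rho> (x - y))) * ennreal (sqrt (\<rho> (x - y)) * norm (v y)) \<partial>lborel) ^ 2"
      by (rule power_mono) simp
    also have "\<dots> \<le> (\<integral>\<^sup>+ y. ennreal (sqrt (\<rho> (x - y))) ^ 2 \<partial>lborel) * (\<integral>\<^sup>+ y. ennreal (sqrt (\<rho> (x - y)) * norm (v y)) ^ 2 \<partial>lborel)"
      by (rule Cauchy_Schwarz_nn_integral) measurable
    also have "(\<integral>\<^sup>+ y. ennreal (sqrt (\<rho> (x - y))) ^ 2 \<partial>lborel) = 1"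
      using nn_mass_y[of x] nonneg by (simp add: ennreal_power)
    also have "(\<integral>\<^sup>+ y. ennreal (sqrt (\<rho> (x - y)) * norm (v y)) ^ 2 \<partial>lborel) = (\<integral>\<^sup>+ y. ennreal (\<rho> (x - y)) * ennreal ((norm (v y))\<^sup>2) \<partial>lborel)"
      by (rule nn_integral_cong) (simp add: nonneg ennreal_power power_mult_distrib ennreal_mult)
    finally show ?thesis by (simp add: ennreal_power)
  qed
  have "(\<integral>\<^sup>+ x. ennreal ((norm (conv \<rho> u x))\<^sup>2) \<partial>lborel)
      \<le> (\<integral>\<^sup>+ x. \<integral>\<^sup>+ y. ennreal (\<rho> (x - y)) * ennreal ((norm (v y))\<^sup>2) \<partial>lborel \<partial>lborel)"
    by (rule nn_integral_mono) (rule ptw)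
  also have "\<dots> = (\<integral>\<^sup>+ y. \<integral>\<^sup>+ x. ennreal (\<rho> (x - y)) * ennreal ((norm (v y))\<^sup>2) \<partial>lborel \<partial>lborel)"
    by (rule lborel_pair.Fubini'[symmetric]) measurable
  also have "\<dots> = (\<integral>\<^sup>+ y. ennreal ((norm (v y))\<^sup>2) \<partial>lborel)"
    by (rule nn_integral_cong) (simp add: nn_integral_multc nn_mass_x)
  also have "\<dots> = (\<integral>\<^sup>+ y. ennreal ((norm (u y))\<^sup>2) \<partial>lebesgue)"
    unfolding nn_integral_completion by (rule nn_integral_cong_AE) (use uv in \<open>auto elim!: eventually_mono\<close>)
  also have "\<dots> = ennreal (sqint u)"
    by (rule nn_integral_eq_integral[OF i]) auto
  finally have *: "(\<integral>\<^sup>+ x. ennreal ((norm (conv \<rho> u x))\<^sup>2) \<partial>lebesgue) \<le> ennreal (sqint u)"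
    unfolding nn_integral_completion .
  have cm: "conv \<rho> u \<in> borel_measurable lebesgue"
    by (rule lebesgue_borel_measurable[OF conv_measurable[OF Lp2_L1_loc[OF u]]])
  have ci: "integrable lebesgue (\<lambda>x. (norm (conv \<rho> u x))\<^sup>2)"
  proof (rule integrableI_bounded)
    show "(\<integral>\<^sup>+ x. ennreal (norm ((norm (conv \<rho> u x))\<^sup>2)) \<partial>lebesgue) < \<infinity>"
      using * by (simp add: order_le_less_trans)
  qed (use cm in simp)
  with cm show "conv \<rho> u \<in> Lp 2" by (simp add: Lp2_iff)
  have "ennreal (sqint (conv \<rho> u)) \<le> ennreal (sqint u)"
    using * by (subst (asm) nn_integral_eq_integral[OF ci]) auto
  then show "sqint (conv \<rho> u) \<le> sqint u" using sqint_nonneg by (simp add: ennreal_le_iff)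
qed

text \<open>With mass one the convolution is an average of the values of g near x. The case e = 0
  shows where it vanishes.\<close>

lemma conv_diff_le:
  fixes g :: "R3 \<Rightarrow> 'b::euclidean_space"
  assumes g: "g \<in> L1_loc UNIV" and e: "e \<ge> 0" "\<And>y. \<rho> (x - y) \<noteq> 0 \<Longrightarrow> norm (g y - w) \<le> e"
  shows "norm (conv \<rho> g x - w) \<le> e"
proof -
  have i: "integrable lebesgue (\<lambda>y. \<rho> (x - y) *\<^sub>R g y)" by (rule conv_integrable[OF test g])
  note r = Cc_inf_reflect[OF test, of x]
  have ri: "integrable lborel (\<lambda>y. \<rho> (x - y))"
    by (rule integrable_bsupp(1)[OF C_on_continuous[OF Cc_inf_smooth[OF r, of 0]] Cc_inf_bsupp[OF r]])
  have rl: "integrable lebesgue (\<lambda>y. \<rho> (x - y))" "(LINT y|lebesgue. \<rho> (x - y)) = 1"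
    using ri mass_x lebesgue_eq_lborel[of "\<lambda>y. \<rho> (x - y)"] by auto
  have eq: "conv \<rho> g x - w = (LINT y|lebesgue. \<rho> (x - y) *\<^sub>R (g y - w))"
    unfolding conv_def using i rl by (simp add: scaleR_diff_right)
  have "norm (conv \<rho> g x - w) \<le> (LINT y|lebesgue. norm (\<rho> (x - y) *\<^sub>R (g y - w)))"
    unfolding eq by (rule integral_norm_bound)
  also have "\<dots> \<le> (LINT y|lebesgue. e * \<rho> (x - y))"
  proof (rule integral_mono)
    have "integrable lebesgue (\<lambda>y. \<rho> (x - y) *\<^sub>R (g y - w))" using i rl by (simp add: scaleR_diff_right)
    then show "integrable lebesgue (\<lambda>y. norm (\<rho> (x - y) *\<^sub>R (g y - w)))" by (rule integrable_norm)
    show "norm (\<rho> (x - y) *\<^sub>R (g y - w)) \<le> e * \<rho> (x - y)" for y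
      using e(2)[of y] nonneg[of "x - y"] by (cases "\<rho> (x - y) = 0") (auto simp: mult.commute mult_left_mono)
  qed (use rl in simp)
  also have "\<dots> = e" using rl by simp
  finally show ?thesis .
qed

end

lemma C_on_flat_radial: "C_on k UNIV (\<lambda>x::'a::euclidean_space. flat m (a - b * (x \<bullet> x)))"
  by (rule C_on_compose[OF C_on_flat C_on_diff[OF C_on_const C_on_mult[OF C_on_const C_on_inner[OF C_on_id C_on_id]]]]) simp

definition moll_ker :: "nat \<Rightarrow> R3 \<Rightarrow> real" where
  "moll_ker n x = flat 0 ((1 / real (Suc n))\<^sup>2 - x \<bullet> x)"

definition moll :: "nat \<Rightarrow> R3 \<Rightarrow> real" where
  "moll n x = moll_ker n x / (LINT y|lborel. moll_ker n y)"

lemma moll_ker_test: "moll_ker n \<in> Cc_inf UNIV"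
proof (rule Cc_infI)
  show "C_on k UNIV (moll_ker n)" for k
    using C_on_flat_radial[of k 0 "(1 / real (Suc n))\<^sup>2" 1] unfolding moll_ker_def by simp
  show "bsupp (moll_ker n)"
  proof (rule bsuppI)
    fix x :: R3 assume "1 / real (Suc n) < norm x"
    then have "(1 / real (Suc n))\<^sup>2 < (norm x)\<^sup>2" by (intro power_strict_mono) auto
    then show "moll_ker n x = 0" by (simp add: moll_ker_def flat_def power2_norm_eq_inner)
  qed
qed

lemma moll_ker_pos: "norm x < 1 / real (Suc n) \<longleftrightarrow> moll_ker n x > 0"
proof -
  have "norm x < 1 / real (Suc n) \<longleftrightarrow> (norm x)\<^sup>2 < (1 / real (Suc n))\<^sup>2"
    by (auto intro: power_strict_mono power2_less_imp_less)
  then show ?thesis by (simp add: moll_ker_def flat_0_less power2_norm_eq_inner)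
qed

lemma moll_ker_mass: "(LINT y|lborel. moll_ker n y) > 0"
proof -
  let ?k = "moll_ker n"
  have i: "integrable lborel ?k"
    by (rule integrable_bsupp(1)[OF C_on_continuous[OF Cc_inf_smooth[OF moll_ker_test, of 0]] Cc_inf_bsupp[OF moll_ker_test]])
  have nn: "?k x \<ge> 0" for x by (simp add: moll_ker_def flat_nonneg)
  have "(LINT y|lborel. ?k y) \<noteq> 0"
  proof
    assume "(LINT y|lborel. ?k y) = 0"
    then have "AE y in lborel. ?k y = 0"
      using integral_nonneg_eq_0_iff_AE[OF i] nn by simp
    then have "AE y in lborel. y \<notin> ball (0::R3) (1 / real (Suc n))"
      by eventually_elim (use moll_ker_pos in force)
    then have "emeasure lborel (ball (0::R3) (1 / real (Suc n))) = 0"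
      by (subst (asm) AE_iff_measurable[where N = "ball 0 (1 / real (Suc n))"]) auto
    then have "measure lborel (ball (0::R3) (1 / real (Suc n))) = 0" by (simp only: measure_def enn2real_0)
    moreover have "measure lborel (ball (0::R3) (1 / real (Suc n))) > 0" by (rule content_ball_pos) simp
    ultimately show False by simp
  qed
  moreover have "(LINT y|lborel. ?k y) \<ge> 0" by (rule integral_nonneg_AE) (simp add: nn)
  ultimately show ?thesis by simp
qed

lemma moll_kernel: "mollifier_kernel (moll n)"
proof
  have "moll n = (\<lambda>x. (1 / (LINT y|lborel. moll_ker n y)) * moll_ker n x)" by (auto simp: moll_def)
  moreover have "bounded_linear (\<lambda>z. (1 / (LINT y|lborel. moll_ker n y)) * z)"
    by (rule bounded_linear_mult_right)
  ultimately show "moll n \<in> Cc_inf UNIV"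
    using Cc_inf_bounded_linear[OF _ moll_ker_test[of n]] by simp
  show "moll n x \<ge> 0" "moll n (- x) = moll n x" for x
    using moll_ker_mass[of n] by (auto simp: moll_def moll_ker_def flat_nonneg)
  show "(LINT x|lborel. moll n x) = 1"
    using moll_ker_mass[of n] by (simp add: moll_def)
qed

lemmas moll_test = mollifier_kernel.test[OF moll_kernel]

lemma moll_supp: "moll n x \<noteq> 0 \<Longrightarrow> norm x < 1 / real (Suc n)"
  using moll_ker_pos[of x n] flat_nonneg[of 0] by (auto simp: moll_def moll_ker_def order_less_le)

text \<open>Pointwise convergence comes from continuity and domination from
  \<open>conv_diff_le\<close>: the kernels have radius at most 1, so all mollifications vanish
  outside the ball of radius R + 1.\<close>

lemma moll_continuous:
  fixes g :: "R3 \<Rightarrow> 'b::euclidean_space"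
  assumes c: "continuous_on UNIV g" and s: "bsupp g"
  shows "(\<lambda>n. sqint (\<lambda>x. conv (moll n) g x - g x)) \<longlonglongrightarrow> 0"
proof -
  obtain M where M: "M > 0" "\<And>x. norm (g x) \<le> M" using bsupp_bounded[OF c s] by blast
  obtain R where R: "R > 0" "\<And>x. R < norm x \<Longrightarrow> g x = 0" using bsuppE[OF s] by blast
  have l: "g \<in> L1_loc UNIV" by (rule L1_loc_continuous[OF c])
  note le = mollifier_kernel.conv_diff_le[OF moll_kernel l]
  show ?thesis
  proof (rule sqint_dominated)
    show "(\<lambda>x. conv (moll n) g x - g x) \<in> borel_measurable lebesgue" for n
      by (intro lebesgue_borel_measurable borel_measurable_diff mollifier_kernel.conv_measurable[OF moll_kernel l]
          borel_measurable_continuous_onI[OF c])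
    show "integrable lebesgue (\<lambda>x::R3. (2 * M)\<^sup>2 * indicator (cball 0 (R + 1)) x)"
      using emeasure_lborel_cball_finite[of "0::R3" "R + 1"]
      by (intro integrable_mult_right integrable_real_indicator) auto
    show "(norm (conv (moll n) g x - g x))\<^sup>2 \<le> (2 * M)\<^sup>2 * indicator (cball 0 (R + 1)) x" for n x
    proof (cases "norm x \<le> R + 1")
      case True
      have "norm (conv (moll n) g x - g x) \<le> 2 * M"
      proof (rule le)
        show "norm (g y - g x) \<le> 2 * M" for y
          using norm_triangle_ineq4[of "g y" "g x"] M(2)[of x] M(2)[of y] by simp
      qed (use M in simp)
      then have "(norm (conv (moll n) g x - g x))\<^sup>2 \<le> (2 * M)\<^sup>2" by (rule power_mono) simp
      then show ?thesis using True by simp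
    next
      case False
      have "norm (conv (moll n) g x - g x) \<le> 0"
      proof (rule le)
        fix y assume "moll n (x - y) \<noteq> 0"
        then have "norm (x - y) < 1 / real (Suc n)" by (rule moll_supp)
        also have "\<dots> \<le> 1" by simp
        finally have "R < norm y" using False norm_triangle_ineq2[of x y] by linarith
        then show "norm (g y - g x) \<le> 0" using False R by simp
      qed simp
      then show ?thesis by simp
    qed
    show "AE x in lebesgue. (\<lambda>n. conv (moll n) g x - g x) \<longlonglongrightarrow> 0"
    proof (rule AE_I2, rule LIMSEQ_I)
      fix x :: R3 and e :: real assume e: "e > 0"
      have "isCont g x" using c by (simp add: continuous_on_eq_continuous_at)
      then obtain d where d: "d > 0" "\<And>y. norm (y - x) < d \<Longrightarrow> norm (g y - g x) < e / 2"
        using e unfolding continuous_at_eps_delta dist_norm by (metis half_gt_zero)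
      obtain N where N: "1 / real (Suc N) < d" using d(1) nat_approx_posE by blast
      have "norm (conv (moll n) g x - g x - 0) < e" if "n \<ge> N" for n
      proof -
        have "norm (conv (moll n) g x - g x) \<le> e / 2"
        proof (rule le)
          fix y assume "moll n (x - y) \<noteq> 0"
          then have "norm (x - y) < 1 / real (Suc n)" by (rule moll_supp)
          also have "\<dots> \<le> 1 / real (Suc N)" using that by (simp add: field_simps)
          finally have "norm (y - x) < d" using N by (simp add: norm_minus_commute)
          then show "norm (g y - g x) \<le> e / 2" using d(2) by (simp add: less_imp_le)
        qed (use e in simp)
        then show ?thesis using e by simp
      qed
      then show "\<exists>N. \<forall>n\<ge>N. norm (conv (moll n) g x - g x - 0) < e" by blast
    qed
  qed
qed

text \<open>Density and contraction: for continuous g of bounded support the convergence is known,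
  and mollification does not increase the error u - g.\<close>

lemma moll_L2:
  fixes u :: "R3 \<Rightarrow> 'b::euclidean_space"
  assumes u: "u \<in> Lp 2"
  shows "(\<lambda>n. sqint (\<lambda>x. conv (moll n) u x - u x)) \<longlonglongrightarrow> 0"
proof (rule LIMSEQ_I)
  fix e :: real assume e: "e > 0"
  \<comment> \<open>With the doublings of \<open>sqint_add_le\<close> the errors add up to (2/12 +
    4/8 + 4/12) e = e.\<close>
  obtain g where g: "continuous_on UNIV g" "bsupp g" "sqint (\<lambda>x. g x - u x) < e / 12"
    using Lp2_approx_continuous[OF u, of "e / 12"] e by auto
  have g2: "g \<in> Lp 2" by (rule Lp2_continuous_bsupp[OF g(1,2)])
  have "\<forall>\<^sub>F n in sequentially. sqint (\<lambda>x. conv (moll n) g x - g x) < e / 8"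
    by (rule order_tendstoD[OF moll_continuous[OF g(1,2)]]) (use e in simp)
  then obtain N where N: "\<And>n. n \<ge> N \<Longrightarrow> sqint (\<lambda>x. conv (moll n) g x - g x) < e / 8"
    by (auto simp: eventually_sequentially)
  have "norm (sqint (\<lambda>x. conv (moll n) u x - u x) - 0) < e" if n: "n \<ge> N" for n
  proof -
    interpret mollifier_kernel "moll n" by (rule moll_kernel)
    have ug: "(\<lambda>x. u x - g x) \<in> Lp 2" by (rule Lp2_diff[OF u g2])
    have lin: "conv (moll n) (\<lambda>x. u x - g x) x = conv (moll n) u x - conv (moll n) g x" for x
      unfolding conv_def using conv_integrable[OF test Lp2_L1_loc[OF u], of x] conv_integrable[OF test Lp2_L1_loc[OF g2], of x]
      by (simp add: scaleR_diff_right)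
    have c1: "conv (moll n) (\<lambda>x. u x - g x) \<in> Lp 2" by (rule conv_contraction[OF ug])
    have c2: "(\<lambda>x. conv (moll n) g x - g x) \<in> Lp 2" by (rule Lp2_diff[OF conv_contraction(1)[OF g2] g2])
    have c3: "(\<lambda>x. g x - u x) \<in> Lp 2" by (rule Lp2_diff[OF g2 u])
    have c23: "(\<lambda>x. (conv (moll n) g x - g x) + (g x - u x)) \<in> Lp 2" using Lp2_lin[OF c2 c3, of 1 1] by simp
    have "sqint (\<lambda>x. conv (moll n) (\<lambda>x. u x - g x) x + ((conv (moll n) g x - g x) + (g x - u x)))
        \<le> 2 * sqint (conv (moll n) (\<lambda>x. u x - g x)) + 2 * sqint (\<lambda>x. (conv (moll n) g x - g x) + (g x - u x))"
      by (rule sqint_add_le[OF c1 c23])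
    moreover have "sqint (\<lambda>x. (conv (moll n) g x - g x) + (g x - u x))
        \<le> 2 * sqint (\<lambda>x. conv (moll n) g x - g x) + 2 * sqint (\<lambda>x. g x - u x)"
      by (rule sqint_add_le[OF c2 c3])
    moreover have "sqint (conv (moll n) (\<lambda>x. u x - g x)) \<le> sqint (\<lambda>x. g x - u x)"
      using conv_contraction(2)[OF ug] by (simp add: norm_minus_commute)
    ultimately have "sqint (\<lambda>x. conv (moll n) u x - u x) < e"
      using g(3) N[OF n] unfolding lin by simp
    then show ?thesis using sqint_nonneg[of "\<lambda>x. conv (moll n) u x - u x"] by simp
  qed
  then show "\<exists>N. \<forall>n\<ge>N. norm (sqint (\<lambda>x. conv (moll n) u x - u x) - 0) < e" by blast
qed

subsection \<open>The swirl\<close>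

lemma flat_comp_deriv:
  assumes "(q has_derivative q') (at x)"
  shows "((\<lambda>x. flat m (q x)) has_derivative (\<lambda>h. (flat (m + 2) (q x) - m * flat (Suc m) (q x)) * q' h)) (at x)"
  using has_derivative_compose[OF assms flat_has_deriv[of m "q x", unfolded has_field_derivative_def]] .

lemma radial_deriv:
  fixes x :: "'a::euclidean_space"
  shows "((\<lambda>x. flat m (a - b * (x \<bullet> x))) has_derivative
    (\<lambda>h. (flat (m + 2) (a - b * (x \<bullet> x)) - m * flat (Suc m) (a - b * (x \<bullet> x))) * (- (b * (2 * (x \<bullet> h)))))) (at x)"
proof (rule flat_comp_deriv)
  show "((\<lambda>x. a - b * (x \<bullet> x)) has_derivative (\<lambda>h. - (b * (2 * (x \<bullet> h))))) (at x)"
    by (auto intro!: derivative_eq_intros simp: inner_commute)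
qed

lemma pd_radial:
  "pd i (\<lambda>x. flat m (a - b * (x \<bullet> x))) x =
    (flat (m + 2) (a - b * (x \<bullet> x)) - m * flat (Suc m) (a - b * (x \<bullet> x))) * (- (2 * b * x $ i))"
  by (subst pd_eq[OF radial_deriv]) (simp add: inner_axis)

lemma pd_linear: "bounded_linear L \<Longrightarrow> pd i L x = L (axis i 1)"
  by (rule pd_eq) (rule bounded_linear_imp_has_derivative)

lemma pd_cong_fun: "(\<And>x. f x = g x) \<Longrightarrow> pd i f x = pd i g x"
  by (simp add: pd_def)

lemma pd_affine:
  fixes W :: "R3 \<Rightarrow> 'b::real_normed_vector"
  assumes "C_on (Suc k) UNIV W"
  shows "pd i (\<lambda>y. W (N *\<^sub>R (y - c))) y = N *\<^sub>R pd i W (N *\<^sub>R (y - c))"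
proof -
  obtain D where D: "\<And>z. (W has_derivative D z) (at z)"
    using C_on_1_derivative[OF assms] by metis
  have "((\<lambda>y. N *\<^sub>R (y - c)) has_derivative (\<lambda>h. N *\<^sub>R h)) (at y)"
    by (auto intro!: derivative_eq_intros)
  from pd_eq[OF has_derivative_compose[OF this D]] show ?thesis
    using has_derivative_linear[OF D] by (simp add: linear_cmul pd_eq[OF D])
qed

lemma pd_scaleR:
  fixes W :: "R3 \<Rightarrow> 'b::real_normed_vector"
  assumes "C_on (Suc k) UNIV W"
  shows "pd i (\<lambda>y. a *\<^sub>R W y) y = a *\<^sub>R pd i W y"
proof -
  obtain D where D: "\<And>z. (W has_derivative D z) (at z)"
    using C_on_1_derivative[OF assms] by metis
  show ?thesis
    using pd_eq[OF has_derivative_scaleR_right[OF D]] pd_eq[OF D] by metis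
qed

lemma C_on_affine:
  fixes W :: "R3 \<Rightarrow> 'b::real_normed_vector"
  assumes "C_on k UNIV W"
  shows "C_on k UNIV (\<lambda>y. W (N *\<^sub>R (y - c)))"
  by (rule C_on_compose[OF assms C_on_scaleR[OF C_on_const C_on_diff[OF C_on_id C_on_const]]]) simp

definition rot :: "R3 \<Rightarrow> R3" where
  "rot x = (- (x $ 2)) *\<^sub>R axis 1 1 + (x $ 1) *\<^sub>R axis 2 1"

lemma bounded_linear_rot: "bounded_linear rot"
  unfolding linear_conv_bounded_linear[symmetric]
  by (rule linearI) (auto simp: rot_def algebra_simps)

lemma rot_nth: "rot x $ 1 = - x $ 2" "rot x $ 2 = x $ 1" "rot x $ 3 = 0"
  by (auto simp: rot_def axis_def)

definition swirl :: "R3 \<Rightarrow> R3" where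
  "swirl y = flat 0 (1 - 1 * (y \<bullet> y)) *\<^sub>R rot y"

lemma swirl_smooth: "C_on k UNIV swirl"
  unfolding swirl_def
  by (rule C_on_scaleR[OF C_on_flat_radial C_on_linear[OF bounded_linear_rot]])

lemma swirl_supp: "norm y \<ge> 1 \<Longrightarrow> swirl y = 0"
proof -
  assume "norm y \<ge> 1"
  then have "1 \<le> (norm y)\<^sup>2" by simp
  then show ?thesis by (simp add: swirl_def flat_def power2_norm_eq_inner)
qed

lemma swirl_bsupp: "bsupp swirl"
  by (rule bsuppI[of 1]) (simp add: swirl_supp)

lemma pd_swirl:
  "pd i swirl y = (- 2 * flat 2 (1 - 1 * (y \<bullet> y)) * y $ i) *\<^sub>R rot y + flat 0 (1 - 1 * (y \<bullet> y)) *\<^sub>R rot (axis i 1)"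
proof -
  have "pd i swirl y = flat 0 (1 - 1 * (y \<bullet> y)) *\<^sub>R pd i rot y + pd i (\<lambda>x. flat 0 (1 - 1 * (x \<bullet> x))) y *\<^sub>R rot y"
    unfolding swirl_def[abs_def]
    by (rule pd_bilinear[OF bounded_bilinear_scaleR C_on_flat_radial[of "Suc 0"] C_on_linear[OF bounded_linear_rot, of "Suc 0"]])
  then show ?thesis
    by (simp add: pd_linear[OF bounded_linear_rot] pd_radial[where b = 1, simplified] numeral_2_eq_2)
qed

text \<open>The gradient of the radial factor is parallel to y, hence orthogonal to
  \<open>rot y\<close>, and \<open>rot\<close> itself has trace zero.\<close>

lemma divg_swirl: "divg swirl y = 0"
  unfolding divg_def pd_swirl by (simp add: sum_3 rot_nth axis_def)

text \<open>Provides points with nonzero Laplacian for the lower bound in the blow-up. On the sphere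
  y \<bullet> y = 1/2 the derivative of \<open>flat 2\<close> vanishes, since \<open>flat 4\<close>
  is twice \<open>flat 3\<close> there; the remaining coefficients are -16 and three times
  -8.\<close>

lemma lap_swirl:
  assumes "y \<bullet> y = 1 / 2"
  shows "lap swirl y = (- 40 * exp (- 2)) *\<^sub>R rot y"
proof -
  let ?f = "\<lambda>m x. flat m (1 - 1 * (x \<bullet> x :: real))"
  have f: "flat 4 (1 / 2) = 16 * exp (- 2)" "flat 3 (1 / 2) = 8 * exp (- 2)"
    "flat 2 (1 / 2) = 4 * exp (- 2)" "flat (Suc (Suc 0)) (1 / 2) = 4 * exp (- 2)" "1 - y \<bullet> y = 1 / 2"
    using assms by (simp_all add: flat_def power_divide)
  have lin: "bounded_linear (\<lambda>y::R3. y $ i)" for i by (rule bounded_linear_vec_nth)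
  have pd2: "pd i (pd i swirl) y = (- 16 * exp (- 2) * (y $ i)) *\<^sub>R rot (axis i 1) - (8 * exp (- 2)) *\<^sub>R rot y" for i
  proof -
    have c1: "C_on (Suc 0) UNIV (\<lambda>y::R3. - 2 * ?f 2 y * y $ i)"
      by (intro C_on_mult C_on_const C_on_flat_radial C_on_linear[OF lin])
    have c2: "C_on (Suc 0) UNIV (\<lambda>y::R3. - 2 * ?f 2 y)"
      by (intro C_on_mult C_on_const C_on_flat_radial)
    have c3: "C_on (Suc 0) UNIV (\<lambda>y. (- 2 * ?f 2 y * y $ i) *\<^sub>R rot y)"
      by (rule C_on_scaleR[OF c1 C_on_linear[OF bounded_linear_rot]])
    have c4: "C_on (Suc 0) UNIV (\<lambda>y::R3. ?f 0 y *\<^sub>R rot (axis i 1))"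
      by (rule C_on_scaleR[OF C_on_flat_radial C_on_const])
    obtain D where D: "\<And>z. ((\<lambda>y. (- 2 * ?f 2 y * y $ i) *\<^sub>R rot y) has_derivative D z) (at z)"
      "\<And>h. C_on 0 UNIV (\<lambda>z. D z h)"
      by (rule C_on_1_derivative[OF c3]) blast
    obtain E where E: "\<And>z. ((\<lambda>y::R3. ?f 0 y *\<^sub>R rot (axis i 1)) has_derivative E z) (at z)"
      "\<And>h. C_on 0 UNIV (\<lambda>z. E z h)"
      by (rule C_on_1_derivative[OF c4]) blast
    note DE = D(1)[of y] E(1)[of y]
    have "pd i (pd i swirl) y = pd i (\<lambda>y. (- 2 * ?f 2 y * y $ i) *\<^sub>R rot y + ?f 0 y *\<^sub>R rot (axis i 1)) y"
      by (rule pd_cong_fun) (rule pd_swirl)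
    also have "\<dots> = pd i (\<lambda>y. (- 2 * ?f 2 y * y $ i) *\<^sub>R rot y) y + pd i (\<lambda>y. ?f 0 y *\<^sub>R rot (axis i 1)) y"
      using pd_eq[OF has_derivative_add[OF DE]] pd_eq[OF DE(1)] pd_eq[OF DE(2)] by metis
    also have "pd i (\<lambda>y. ?f 0 y *\<^sub>R rot (axis i 1)) y = ?f 0 y *\<^sub>R pd i (\<lambda>_. rot (axis i 1)) y + pd i (?f 0) y *\<^sub>R rot (axis i 1)"
      by (rule pd_bilinear[OF bounded_bilinear_scaleR C_on_flat_radial[of "Suc 0"] C_on_const[of "Suc 0"]])
    also have "pd i (\<lambda>y. (- 2 * ?f 2 y * y $ i) *\<^sub>R rot y) y
        = (- 2 * ?f 2 y * y $ i) *\<^sub>R pd i rot y + pd i (\<lambda>y. - 2 * ?f 2 y * y $ i) y *\<^sub>R rot y"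
      by (rule pd_bilinear[OF bounded_bilinear_scaleR c1 C_on_linear[OF bounded_linear_rot, of "Suc 0"]])
    also have "pd i (\<lambda>y. - 2 * ?f 2 y * y $ i) y = (- 2 * ?f 2 y) * pd i (\<lambda>y. y $ i) y + pd i (\<lambda>y. - 2 * ?f 2 y) y * y $ i"
      by (rule pd_bilinear[OF bounded_bilinear_mult c2 C_on_linear[OF lin, of "Suc 0"]])
    also have "pd i (\<lambda>y. - 2 * ?f 2 y) y = - 2 * pd i (?f 2) y"
      using pd_scaleR[OF C_on_flat_radial[of "Suc 0" 2 1 1], of i "- 2" y] by simp
    also have "pd i (\<lambda>_. rot (axis i 1)) y = 0"
      by (rule pd_eq[of _ "\<lambda>_. 0"]) simp
    finally show ?thesis
      unfolding vec_eq_iff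
      by (auto simp: pd_linear[OF lin] pd_linear[OF bounded_linear_rot] pd_radial pd_radial[where b = 1, simplified] f)
  qed
  have "(\<Sum>i\<in>UNIV. (y $ i) *\<^sub>R rot (axis i 1)) = rot y"
    by (simp add: vec_eq_iff sum_3 forall_3 rot_nth axis_def)
  then have s: "(\<Sum>i\<in>UNIV. (c * (y $ i)) *\<^sub>R rot (axis i 1)) = c *\<^sub>R rot y" for c
    using scaleR_sum_right[of c "\<lambda>i. (y $ i) *\<^sub>R rot (axis i 1)" UNIV] by simp
  show ?thesis
    unfolding lap_def pd2 sum_subtractf s by (simp add: vec_eq_iff sum_3)
qed

lemma Lp2_vec:
  fixes h :: "R3 \<Rightarrow> 'b::euclidean_space^3"
  assumes "\<And>j. (\<lambda>x. h x $ j) \<in> Lp 2"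
  shows "h \<in> Lp 2" "sqint h = (\<Sum>j\<in>UNIV. sqint (\<lambda>x. h x $ j))"
proof -
  have bl: "bounded_linear (axis j :: 'b \<Rightarrow> 'b^3)" for j
    unfolding linear_conv_bounded_linear[symmetric]
    by (rule linearI) (auto simp: axis_def vec_eq_iff)
  have n: "(norm w)\<^sup>2 = (\<Sum>j\<in>UNIV. (norm (w $ j))\<^sup>2)" for w :: "'b^3"
    by (simp add: norm_vec_def L2_set_def sum_nonneg)
  have eq: "h x = (\<Sum>j\<in>UNIV. axis j (h x $ j))" for x
    by (simp add: vec_eq_iff axis_def sum.delta)
  have "(\<lambda>x. axis j (h x $ j)) \<in> borel_measurable lebesgue" for j
    using measurable_compose[OF _ borel_measurable_continuous_onI[OF linear_continuous_on[OF bl]]] assms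
    by (auto simp: Lp2_iff)
  then have "(\<lambda>x. \<Sum>j\<in>UNIV. axis j (h x $ j)) \<in> borel_measurable lebesgue"
    by (intro borel_measurable_sum)
  then have m: "h \<in> borel_measurable lebesgue" using eq by simp
  have i: "integrable lebesgue (\<lambda>x. (norm (h x $ j))\<^sup>2)" for j using assms by (auto simp: Lp2_iff)
  show "h \<in> Lp 2" unfolding Lp2_iff n using m i by auto
  show "sqint h = (\<Sum>j\<in>UNIV. sqint (\<lambda>x. h x $ j))" unfolding n using i by simp
qed

text \<open>\<open>Sobolev\<close> asserts only that some weak derivatives in \<open>Lp 2\<close>
  exist, for the empty multi-index too; almost everywhere uniqueness carries this over to g itself
  and to the chosen \<open>wgrad\<close>.\<close>

lemma H1_D:
  fixes g :: "R3 \<Rightarrow> 'b::euclidean_space"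
  assumes g: "g \<in> Sobolev 1 2"
  shows "g \<in> Lp 2" "weak_deriv [j] g (\<lambda>x. wgrad g x $ j)" "(\<lambda>x. wgrad g x $ j) \<in> Lp 2"
    "wgrad g \<in> Lp 2"
proof -
  have "\<exists>h\<in>Lp 2. weak_deriv [] g h" using g unfolding Sobolev_def by force
  then obtain h where h: "h \<in> Lp 2" "weak_deriv [] g h" by blast
  have "AE x in lebesgue. h x = g x" using weak_deriv_Nil[OF h(2)] by eventually_elim simp
  moreover have "g \<in> borel_measurable lebesgue"
    using h(2) L1_loc_measurable by (auto simp: weak_deriv_def)
  ultimately show "g \<in> Lp 2" using Lp2_cong_AE(1)[OF h(1)] by blast
  have *: "weak_deriv [j] g (\<lambda>x. wgrad g x $ j) \<and> (\<lambda>x. wgrad g x $ j) \<in> Lp 2" for j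
  proof -
    have "length [j] \<le> 1" by simp
    then have "\<exists>h\<in>Lp 2. weak_deriv [j] g h" using g unfolding Sobolev_def by blast
    then obtain h where h: "h \<in> Lp 2" "weak_deriv [j] g h" by blast
    have w: "weak_deriv [j] g (\<lambda>x. wgrad g x $ j)" by (rule wgrad_weak_deriv(1)[OF h(2)])
    have "AE x in lebesgue. h x = wgrad g x $ j" using wgrad_weak_deriv(2)[OF h(2)] by eventually_elim simp
    moreover have "(\<lambda>x. wgrad g x $ j) \<in> borel_measurable lebesgue"
      using w L1_loc_measurable by (auto simp: weak_deriv_def)
    ultimately show ?thesis using w Lp2_cong_AE(1)[OF h(1)] by blast
  qed
  then show "weak_deriv [j] g (\<lambda>x. wgrad g x $ j)" "(\<lambda>x. wgrad g x $ j) \<in> Lp 2" by auto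
  show "wgrad g \<in> Lp 2" by (rule Lp2_vec(1)) (use * in blast)
qed

lemma H1_I:
  fixes g :: "R3 \<Rightarrow> 'b::euclidean_space"
  assumes g: "g \<in> Lp 2" and w: "\<And>j. weak_deriv [j] g (h j)" and h: "\<And>j. h j \<in> Lp 2"
  shows "g \<in> Sobolev 1 2" "sqint (wgrad g) = (\<Sum>j\<in>UNIV. sqint (h j))"
proof -
  have "\<exists>h\<in>Lp 2. weak_deriv \<alpha> g h" if "length \<alpha> \<le> 1" for \<alpha>
  proof (cases \<alpha>)
    case Nil
    have "weak_deriv [] g g" using w by (simp add: weak_deriv_def)
    then show ?thesis using g Nil by blast
  next
    case (Cons j \<beta>)
    with that have "\<alpha> = [j]" by simp
    then show ?thesis using w h by blast
  qed
  then show s: "g \<in> Sobolev 1 2" by (simp add: Sobolev_def)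
  have "sqint (\<lambda>x. wgrad g x $ j) = sqint (h j)" for j
  proof (rule Lp2_cong_AE(2)[OF h])
    show "(\<lambda>x. wgrad g x $ j) \<in> borel_measurable lebesgue" using H1_D(3)[OF s] by (simp add: Lp2_iff)
    show "AE x in lebesgue. h j x = wgrad g x $ j"
      using wgrad_weak_deriv(2)[OF w[of j]] by eventually_elim simp
  qed
  then show "sqint (wgrad g) = (\<Sum>j\<in>UNIV. sqint (h j))"
    using Lp2_vec(2)[OF H1_D(3)[OF s]] by simp
qed

lemma H1_norm_eq:
  assumes "g \<in> H1"
  shows "H1_norm g = ennreal (sqrt (sqint g + sqint (wgrad g)))"
proof -
  have "(Lp_norm 2 g)\<^sup>2 + (Lp_norm 2 (wgrad g))\<^sup>2 = ennreal (sqint g + sqint (wgrad g))"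
    using Lp2_norm(1)[OF H1_D(1)[OF assms]] Lp2_norm(1)[OF H1_D(4)[OF assms]] sqint_nonneg[of g] sqint_nonneg[of "wgrad g"]
    by (simp add: ennreal_power)
  then show ?thesis
    unfolding H1_norm_def using sqint_nonneg[of g] sqint_nonneg[of "wgrad g"]
    by (simp add: enn_powr_ennreal powr_half_sqrt del: ennreal_plus)
qed

lemma Cc_inf_H1:
  fixes \<psi> :: "R3 \<Rightarrow> 'b::euclidean_space"
  assumes "\<psi> \<in> Cc_inf UNIV"
  shows "\<psi> \<in> Lp 2" "\<psi> \<in> Sobolev 1 2"
proof -
  have l: "\<phi> \<in> Lp 2" if "\<phi> \<in> Cc_inf UNIV" for \<phi> :: "R3 \<Rightarrow> 'b"
    by (rule Lp2_continuous_bsupp[OF C_on_continuous[OF Cc_inf_smooth[OF that, of 0]] Cc_inf_bsupp[OF that]])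
  show "\<psi> \<in> Lp 2" by (rule l[OF assms])
  show "\<psi> \<in> Sobolev 1 2"
    by (rule H1_I(1)[OF l[OF assms] weak_deriv_pd[OF Cc_inf_smooth[OF assms, of "Suc 0"]] l[OF Cc_inf_pd[OF assms]]])
qed

text \<open>The factor \<open>exp 1\<close> normalises the value at the origin to 1, so that the
  cut-offs tend to 1 everywhere.\<close>

definition cut :: "nat \<Rightarrow> R3 \<Rightarrow> real" where
  "cut n x = exp 1 * flat 0 (1 - (1 / real (Suc n))\<^sup>2 * (x \<bullet> x))"

lemma cut_test: "cut n \<in> Cc_inf UNIV"
proof (rule Cc_infI)
  show "C_on k UNIV (cut n)" for k
    unfolding cut_def by (rule C_on_mult[OF C_on_const C_on_flat_radial])
  show "bsupp (cut n)"
  proof (rule bsuppI)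
    fix x :: R3 assume "real (Suc n) < norm x"
    then have "1 < (1 / real (Suc n)) * norm x" by (simp add: field_simps)
    then have "1 < ((1 / real (Suc n)) * norm x)\<^sup>2" by (simp only: one_less_power pos2)
    then have "\<not> 0 < 1 - (1 / real (Suc n))\<^sup>2 * (x \<bullet> x)"
      by (simp only: power_mult_distrib power2_norm_eq_inner)
    then show "cut n x = 0" by (simp only: cut_def flat_def if_False mult_zero_right)
  qed
qed

lemma cut_bounds: "0 \<le> cut n x" "cut n x \<le> 1"
proof -
  let ?u = "1 - (1 / real (Suc n))\<^sup>2 * (x \<bullet> x)"
  show "0 \<le> cut n x" by (simp add: cut_def flat_nonneg)
  have u: "?u \<le> 1" by simp
  have "flat 0 ?u \<le> exp (- 1)"
  proof (cases "?u > 0")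
    case True
    then have "- 1 / ?u \<le> - 1" using u by (simp only: divide_le_eq) simp
    then show ?thesis using True by (simp add: flat_def)
  next
    case False
    then show ?thesis unfolding flat_def by simp
  qed
  then have "cut n x \<le> exp 1 * exp (- 1)" unfolding cut_def by (intro mult_left_mono) auto
  then show "cut n x \<le> 1" by (simp flip: exp_add)
qed

lemma cut_tendsto: "(\<lambda>n. cut n x) \<longlonglongrightarrow> 1"
proof -
  have "(\<lambda>n. 1 - (inverse (real (Suc n)))\<^sup>2 * (x \<bullet> x)) \<longlonglongrightarrow> 1 - 0\<^sup>2 * (x \<bullet> x)"
    by (intro tendsto_intros LIMSEQ_inverse_real_of_nat)
  then have "(\<lambda>n. 1 - (1 / real (Suc n))\<^sup>2 * (x \<bullet> x)) \<longlonglongrightarrow> 1" by (simp add: divide_inverse)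
  moreover have "isCont (flat 0) 1" using flat_has_deriv DERIV_isCont by blast
  ultimately have "(\<lambda>n. flat 0 (1 - (1 / real (Suc n))\<^sup>2 * (x \<bullet> x))) \<longlonglongrightarrow> flat 0 1"
    by (rule isCont_tendsto_compose[rotated])
  then have "(\<lambda>n. cut n x) \<longlonglongrightarrow> exp 1 * flat 0 1" unfolding cut_def by (intro tendsto_intros)
  then show ?thesis by (simp add: flat_def flip: exp_add)
qed

text \<open>\<open>flat 2\<close> is at most 2! and the inner derivative at most 2/(n+1) on the ball
  of radius n+1. The decay in n removes the extra product-rule term in
  \<open>H1_dense\<close>.\<close>

lemma pd_cut: "\<bar>pd i (cut n) x\<bar> \<le> 4 * exp 1 / real (Suc n)"
proof -
  let ?c = "(1 / real (Suc n))\<^sup>2"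
  let ?u = "1 - ?c * (x \<bullet> x)"
  have "pd i (cut n) x = exp 1 * pd i (\<lambda>x. flat 0 (1 - ?c * (x \<bullet> x))) x"
    using pd_scaleR[OF C_on_flat_radial[of "Suc 0" 0 1 ?c], of i "exp 1" x] by (simp add: cut_def[abs_def])
  also have "\<dots> = exp 1 * (flat 2 ?u * (- (2 * ?c * x $ i)))"
    by (subst pd_radial) (simp only: of_nat_0 mult_zero_left diff_zero add_0)
  finally have eq: "pd i (cut n) x = exp 1 * (flat 2 ?u * (- (2 * ?c * x $ i)))" .
  show ?thesis
  proof (cases "norm x \<le> real (Suc n)")
    case True
    have "\<bar>flat 2 ?u\<bar> \<le> 2" using flat_le[of 2 ?u] flat_nonneg[of 2 ?u] by (simp add: fact_2)
    moreover have "\<bar>2 * ?c * x $ i\<bar> \<le> 2 / real (Suc n)"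
    proof -
      have "\<bar>x $ i\<bar> \<le> real (Suc n)" using component_le_norm_cart[of x i] True by linarith
      then have "2 * ?c * \<bar>x $ i\<bar> \<le> 2 * ?c * real (Suc n)" by (intro mult_left_mono) auto
      also have "\<dots> = 2 / real (Suc n)" by (simp add: power2_eq_square field_simps del: of_nat_Suc)
      finally show ?thesis by (simp add: abs_mult)
    qed
    ultimately have "\<bar>flat 2 ?u\<bar> * \<bar>2 * ?c * x $ i\<bar> \<le> 2 * (2 / real (Suc n))" by (intro mult_mono) auto
    then have "exp 1 * (\<bar>flat 2 ?u\<bar> * \<bar>2 * ?c * x $ i\<bar>) \<le> exp 1 * (2 * (2 / real (Suc n)))"
      by (rule mult_left_mono) simp
    moreover have "exp 1 * (2 * (2 / real (Suc n))) = 4 * exp 1 / real (Suc n)" by simp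
    moreover have "\<bar>pd i (cut n) x\<bar> = exp 1 * (\<bar>flat 2 ?u\<bar> * \<bar>2 * ?c * x $ i\<bar>)"
      unfolding eq by (simp only: abs_mult abs_minus abs_exp_cancel)
    ultimately show ?thesis by linarith
  next
    case False
    then have "1 < (1 / real (Suc n)) * norm x" by (simp add: field_simps)
    then have "1 < ((1 / real (Suc n)) * norm x)\<^sup>2" by (simp only: one_less_power pos2)
    then have "?u \<le> 0" by (simp only: power_mult_distrib power2_norm_eq_inner)
    then have "flat 2 ?u = 0" by (simp only: flat_def if_not_P not_less)
    then show ?thesis unfolding eq by simp
  qed
qed

subsection \<open>Density of test functions\<close>

lemma cut_conv:
  fixes u :: "R3 \<Rightarrow> 'b::euclidean_space"
  assumes u: "u \<in> Lp 2"
  shows "(\<lambda>x. cut n x *\<^sub>R conv (moll n) u x) \<in> Lp 2"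
    "(\<lambda>n. sqint (\<lambda>x. cut n x *\<^sub>R conv (moll n) u x - u x)) \<longlonglongrightarrow> 0"
proof -
  have cm: "cut n \<in> borel_measurable lebesgue" for n
    by (rule lebesgue_borel_measurable[OF Cc_inf_measurable[OF cut_test]])
  have mult: "(\<lambda>x. cut n x *\<^sub>R w x) \<in> Lp 2" "sqint (\<lambda>x. cut n x *\<^sub>R w x) \<le> sqint w"
    if w: "w \<in> Lp 2" for n and w :: "R3 \<Rightarrow> 'b"
  proof -
    have wm: "w \<in> borel_measurable lebesgue" and wi: "integrable lebesgue (\<lambda>x. (norm (w x))\<^sup>2)"
      using w by (auto simp: Lp2_iff)
    have le: "(norm (cut n x *\<^sub>R w x))\<^sup>2 \<le> (norm (w x))\<^sup>2" for x
      using cut_bounds[of n x] by (intro power_mono) (auto intro: mult_left_le_one_le)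
    show l: "(\<lambda>x. cut n x *\<^sub>R w x) \<in> Lp 2"
      by (rule Lp2_bound[OF borel_measurable_scaleR[OF cm wm] wi le])
    show "sqint (\<lambda>x. cut n x *\<^sub>R w x) \<le> sqint w"
      by (rule integral_mono[OF _ wi le]) (use l in \<open>simp add: Lp2_iff\<close>)
  qed
  have c: "conv (moll n) u \<in> Lp 2" for n by (rule mollifier_kernel.conv_contraction(1)[OF moll_kernel u])
  show "(\<lambda>x. cut n x *\<^sub>R conv (moll n) u x) \<in> Lp 2" by (rule mult(1)[OF c])
  have um: "u \<in> borel_measurable lebesgue" and ui: "integrable lebesgue (\<lambda>x. (norm (u x))\<^sup>2)"
    using u by (auto simp: Lp2_iff)
  have l1: "(\<lambda>n. sqint (\<lambda>x. (cut n x - 1) *\<^sub>R u x)) \<longlonglongrightarrow> 0"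
  proof (rule sqint_dominated[OF _ ui])
    show "(\<lambda>x. (cut n x - 1) *\<^sub>R u x) \<in> borel_measurable lebesgue" for n
      by (intro borel_measurable_scaleR borel_measurable_diff cm um borel_measurable_const)
    show "(norm ((cut n x - 1) *\<^sub>R u x))\<^sup>2 \<le> (norm (u x))\<^sup>2" for n x
      using cut_bounds[of n x] by (intro power_mono) (auto intro: mult_left_le_one_le)
    show "AE x in lebesgue. (\<lambda>n. (cut n x - 1) *\<^sub>R u x) \<longlonglongrightarrow> 0"
    proof (rule AE_I2)
      fix x
      have "(\<lambda>n. (cut n x - 1) *\<^sub>R u x) \<longlonglongrightarrow> (1 - 1) *\<^sub>R u x"
        by (intro tendsto_intros cut_tendsto)
      then show "(\<lambda>n. (cut n x - 1) *\<^sub>R u x) \<longlonglongrightarrow> 0" by simp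
    qed
  qed
  have le: "sqint (\<lambda>x. cut n x *\<^sub>R conv (moll n) u x - u x)
      \<le> 2 * sqint (\<lambda>x. conv (moll n) u x - u x) + 2 * sqint (\<lambda>x. (cut n x - 1) *\<^sub>R u x)" for n
  proof -
    have d: "(\<lambda>x. conv (moll n) u x - u x) \<in> Lp 2" by (rule Lp2_diff[OF c u])
    have e: "(\<lambda>x. (cut n x - 1) *\<^sub>R u x) \<in> Lp 2"
      using Lp2_diff[OF mult(1)[OF u] u] by (simp add: scaleR_diff_left)
    have pw: "cut n x *\<^sub>R conv (moll n) u x - u x
        = cut n x *\<^sub>R (conv (moll n) u x - u x) + (cut n x - 1) *\<^sub>R u x" for x
      by (simp add: scaleR_diff_left scaleR_diff_right)
    have "sqint (\<lambda>x. cut n x *\<^sub>R conv (moll n) u x - u x)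
        = sqint (\<lambda>x. cut n x *\<^sub>R (conv (moll n) u x - u x) + (cut n x - 1) *\<^sub>R u x)" by (simp only: pw)
    then show ?thesis using sqint_add_le[OF mult(1)[OF d, of n] e] mult(2)[OF d, of n] by linarith
  qed
  show "(\<lambda>n. sqint (\<lambda>x. cut n x *\<^sub>R conv (moll n) u x - u x)) \<longlonglongrightarrow> 0"
  proof (rule tendsto_sandwich)
    show "\<forall>\<^sub>F n in sequentially. 0 \<le> sqint (\<lambda>x. cut n x *\<^sub>R conv (moll n) u x - u x)"
      by (simp add: sqint_nonneg)
    show "\<forall>\<^sub>F n in sequentially. sqint (\<lambda>x. cut n x *\<^sub>R conv (moll n) u x - u x)
        \<le> 2 * sqint (\<lambda>x. conv (moll n) u x - u x) + 2 * sqint (\<lambda>x. (cut n x - 1) *\<^sub>R u x)"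
      using le by simp
    have "(\<lambda>n. 2 * sqint (\<lambda>x. conv (moll n) u x - u x) + 2 * sqint (\<lambda>x. (cut n x - 1) *\<^sub>R u x)) \<longlonglongrightarrow> 2 * 0 + 2 * 0"
      by (intro tendsto_intros moll_L2[OF u] l1)
    then show "(\<lambda>n. 2 * sqint (\<lambda>x. conv (moll n) u x - u x) + 2 * sqint (\<lambda>x. (cut n x - 1) *\<^sub>R u x)) \<longlonglongrightarrow> 0" by simp
  qed simp
qed

text \<open>Mollify and cut off with the same index: the derivative is the cut-off mollified weak
  gradient plus a term with \<open>pd j (cut n)\<close>, which is of order 1/n in L^2.\<close>

lemma H1_dense:
  fixes g :: "R3 \<Rightarrow> 'b::euclidean_space"
  assumes g: "g \<in> Sobolev 1 2"
  obtains \<psi> :: "nat \<Rightarrow> R3 \<Rightarrow> 'b" where "\<And>n. \<psi> n \<in> Cc_inf UNIV"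
    "(\<lambda>n. sqint (\<lambda>x. \<psi> n x - g x)) \<longlonglongrightarrow> 0"
    "\<And>j. (\<lambda>n. sqint (\<lambda>x. pd j (\<psi> n) x - wgrad g x $ j)) \<longlonglongrightarrow> 0"
proof -
  note G = H1_D[OF g]
  have gl: "g \<in> L1_loc UNIV" by (rule Lp2_L1_loc[OF G(1)])
  define \<psi> where "\<psi> n x = cut n x *\<^sub>R conv (moll n) g x" for n x
  have sm: "smooth_on UNIV (conv (moll n) g)" for n
    by (rule smooth_onI) (rule C_on_conv[OF gl moll_test])
  have t: "\<psi> n \<in> Cc_inf UNIV" for n
    unfolding \<psi>_def by (rule Cc_inf_bilinear[OF bounded_bilinear_scaleR cut_test sm])
  have p: "pd j (\<psi> n) x = cut n x *\<^sub>R conv (moll n) (\<lambda>x. wgrad g x $ j) x + pd j (cut n) x *\<^sub>R conv (moll n) g x" for j n x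
    unfolding \<psi>_def
    by (subst pd_bilinear[OF bounded_bilinear_scaleR Cc_inf_smooth[OF cut_test, of "Suc 0"] C_on_conv[OF gl moll_test, of "Suc 0"]])
      (simp add: pd_conv[OF moll_test gl] conv_weak_deriv[OF moll_test G(2)])
  have lim: "(\<lambda>n. sqint (\<lambda>x. pd j (\<psi> n) x - wgrad g x $ j)) \<longlonglongrightarrow> 0" for j
  proof (rule tendsto_sandwich)
    let ?a = "\<lambda>n x. cut n x *\<^sub>R conv (moll n) (\<lambda>x. wgrad g x $ j) x - wgrad g x $ j"
    let ?b = "\<lambda>n x. pd j (cut n) x *\<^sub>R conv (moll n) g x"
    let ?B = "\<lambda>n. 2 * sqint (?a n) + 2 * ((4 * exp 1 / real (Suc n))\<^sup>2 * sqint g)"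
    show "\<forall>\<^sub>F n in sequentially. 0 \<le> sqint (\<lambda>x. pd j (\<psi> n) x - wgrad g x $ j)"
      by (simp add: sqint_nonneg)
    have "sqint (\<lambda>x. pd j (\<psi> n) x - wgrad g x $ j) \<le> ?B n" for n
    proof -
      have cg: "conv (moll n) g \<in> Lp 2" "sqint (conv (moll n) g) \<le> sqint g"
        by (rule mollifier_kernel.conv_contraction[OF moll_kernel G(1)])+
      have cgm: "conv (moll n) g \<in> borel_measurable lebesgue" and cgi: "integrable lebesgue (\<lambda>x. (norm (conv (moll n) g x))\<^sup>2)"
        using cg(1) by (auto simp: Lp2_iff)
      have ble: "(norm (?b n x))\<^sup>2 \<le> (4 * exp 1 / real (Suc n))\<^sup>2 * (norm (conv (moll n) g x))\<^sup>2" for x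
        unfolding power_mult_distrib[symmetric] norm_scaleR real_norm_def
        by (intro power_mono mult_right_mono pd_cut) auto
      have bi: "integrable lebesgue (\<lambda>x. (4 * exp 1 / real (Suc n))\<^sup>2 * (norm (conv (moll n) g x))\<^sup>2)"
        by (intro integrable_mult_right cgi)
      have bm: "?b n \<in> borel_measurable lebesgue"
        by (intro borel_measurable_scaleR cgm lebesgue_borel_measurable[OF Cc_inf_measurable[OF Cc_inf_pd[OF cut_test]]])
      have b: "?b n \<in> Lp 2" by (rule Lp2_bound[OF bm bi ble])
      have "sqint (?b n) \<le> (LINT x|lebesgue. (4 * exp 1 / real (Suc n))\<^sup>2 * (norm (conv (moll n) g x))\<^sup>2)"
        by (rule integral_mono[OF _ bi ble]) (use b in \<open>simp add: Lp2_iff\<close>)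
      also have "\<dots> = (4 * exp 1 / real (Suc n))\<^sup>2 * sqint (conv (moll n) g)" by simp
      also have "\<dots> \<le> (4 * exp 1 / real (Suc n))\<^sup>2 * sqint g" using cg(2) by (intro mult_left_mono) auto
      finally have sb: "sqint (?b n) \<le> (4 * exp 1 / real (Suc n))\<^sup>2 * sqint g" .
      have a: "?a n \<in> Lp 2" by (rule Lp2_diff[OF cut_conv(1)[OF G(3)] G(3)])
      have pw: "pd j (\<psi> n) x - wgrad g x $ j = ?a n x + ?b n x" for x
        by (simp add: p)
      have "sqint (\<lambda>x. pd j (\<psi> n) x - wgrad g x $ j) = sqint (\<lambda>x. ?a n x + ?b n x)" by (simp only: pw)
      then show ?thesis using sqint_add_le[OF a b] sb by linarith
    qed
    then show "\<forall>\<^sub>F n in sequentially. sqint (\<lambda>x. pd j (\<psi> n) x - wgrad g x $ j) \<le> ?B n" by simp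
    have "(\<lambda>n. 2 * sqint (?a n) + 2 * ((4 * exp 1 * inverse (real (Suc n)))\<^sup>2 * sqint g)) \<longlonglongrightarrow> 2 * 0 + 2 * ((4 * exp 1 * 0)\<^sup>2 * sqint g)"
      by (intro tendsto_intros cut_conv(2)[OF G(3)] LIMSEQ_inverse_real_of_nat)
    then show "?B \<longlonglongrightarrow> 0" by (simp add: divide_inverse)
  qed simp
  have "(\<lambda>n. sqint (\<lambda>x. \<psi> n x - g x)) \<longlonglongrightarrow> 0"
    unfolding \<psi>_def by (rule cut_conv(2)[OF G(1)])
  with t lim show ?thesis by (intro that)
qed

text \<open>Both functionals are continuous for the H^1 norm, and test fields are dense. As
  \<open>pairing h\<close> is merely some functional representing h, this is what gives it a
  definite value on \<open>H1\<close>.\<close>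

lemma H1_functional_unique:
  assumes l: "H1_functional l" "H1_functional l'" and eq: "\<And>\<phi>. \<phi> \<in> Cc_inf UNIV \<Longrightarrow> l \<phi> = l' \<phi>"
    and g: "g \<in> H1"
  shows "l g = l' g"
proof -
  obtain \<psi> :: "nat \<Rightarrow> R3 \<Rightarrow> R3" where \<psi>: "\<And>n. \<psi> n \<in> Cc_inf UNIV"
    "(\<lambda>n. sqint (\<lambda>x. \<psi> n x - g x)) \<longlonglongrightarrow> 0"
    "\<And>j. (\<lambda>n. sqint (\<lambda>x. pd j (\<psi> n) x - wgrad g x $ j)) \<longlonglongrightarrow> 0"
    by (rule H1_dense[OF g]) blast
  note G = H1_D[OF g]
  define e where "e n = sqint (\<lambda>x. \<psi> n x - g x) + (\<Sum>j\<in>UNIV. sqint (\<lambda>x. pd j (\<psi> n) x - wgrad g x $ j))" for n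
  have "e \<longlonglongrightarrow> 0 + (\<Sum>j\<in>(UNIV::3 set). 0)"
    unfolding e_def by (intro tendsto_add tendsto_sum \<psi>)
  then have e: "(\<lambda>n. sqrt (e n)) \<longlonglongrightarrow> 0" using tendsto_real_sqrt[of e 0] by simp
  have e0: "e n \<ge> 0" for n unfolding e_def by (intro add_nonneg_nonneg sum_nonneg sqint_nonneg)
  have lim: "(\<lambda>n. k (\<psi> n)) \<longlonglongrightarrow> k g" if k: "H1_functional k" for k
  proof -
    obtain C where C: "\<And>\<phi>. \<phi> \<in> H1 \<Longrightarrow> \<bar>k \<phi>\<bar> \<le> C * enn2real (H1_norm \<phi>)"
      using conjunct2[OF k[unfolded H1_functional_def]] by blast
    have "\<bar>k (\<psi> n) - k g\<bar> \<le> C * sqrt (e n)" for n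
    proof -
      let ?d = "\<lambda>x. 1 *\<^sub>R \<psi> n x + (- 1) *\<^sub>R g x"
      have P: "\<psi> n \<in> Lp 2" "\<psi> n \<in> H1" "pd j (\<psi> n) \<in> Lp 2" for j
        using Cc_inf_H1[OF \<psi>(1)] Cc_inf_H1(1)[OF Cc_inf_pd[OF \<psi>(1)]] by simp_all
      have lin: "k ?d = k (\<psi> n) - k g"
      proof -
        have "k ?d = 1 * k (\<psi> n) + (- 1) * k g"
          using conjunct1[OF k[unfolded H1_functional_def], rule_format, OF P(2) g, of 1 "- 1"] .
        then show ?thesis by simp
      qed
      have w: "weak_deriv [j] ?d (\<lambda>x. 1 *\<^sub>R pd j (\<psi> n) x + (- 1) *\<^sub>R wgrad g x $ j)" for j
        by (rule weak_deriv_lin[OF weak_deriv_pd[OF Cc_inf_smooth[OF \<psi>(1), of "Suc 0"]] G(2)]) (simp add: Cc_inf_pd)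
      have d: "?d \<in> H1" "sqint (wgrad ?d) = (\<Sum>j\<in>UNIV. sqint (\<lambda>x. 1 *\<^sub>R pd j (\<psi> n) x + (- 1) *\<^sub>R wgrad g x $ j))"
        using H1_I[OF Lp2_lin[OF P(1) G(1)] w Lp2_lin[OF P(3) G(3)]] by auto
      have "sqint ?d + sqint (wgrad ?d) = e n" unfolding d(2) e_def by simp
      then have "H1_norm ?d = ennreal (sqrt (e n))" using H1_norm_eq[OF d(1)] by simp
      then have "\<bar>k ?d\<bar> \<le> C * sqrt (e n)" using C[OF d(1)] e0[of n] by simp
      then show ?thesis unfolding lin .
    qed
    then have "(\<lambda>n. k (\<psi> n) - k g) \<longlonglongrightarrow> 0"
      by (intro Lim_null_comparison[OF _ tendsto_mult_right_zero[OF e, of C]]) simp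
    then show ?thesis by (rule LIM_zero_cancel)
  qed
  have "(\<lambda>n. l (\<psi> n)) = (\<lambda>n. l' (\<psi> n))" using eq[OF \<psi>(1)] by simp
  then show ?thesis using lim[OF l(1)] lim[OF l(2)] LIMSEQ_unique by metis
qed

section \<open>The duality pairing for square integrable forces\<close>

lemma represents_Lp2:
  assumes h: "h \<in> Lp 2"
  shows "represents h (\<lambda>\<phi>. LINT x|lebesgue. h x \<bullet> \<phi> x)"
  unfolding represents_def
proof (intro conjI ballI refl Lp2_L1_loc h)
  show "H1_functional (\<lambda>\<phi>. LINT x|lebesgue. h x \<bullet> \<phi> x)"
    unfolding H1_functional_def
  proof (intro conjI ballI allI exI[of _ "sqrt (sqint h)"])
    fix \<phi> \<psi> a b assume "\<phi> \<in> H1" "\<psi> \<in> H1"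
    then have "integrable lebesgue (\<lambda>x. h x \<bullet> \<phi> x)" "integrable lebesgue (\<lambda>x. h x \<bullet> \<psi> x)"
      using Lp2_inner(1)[OF h H1_D(1)] by auto
    then show "(LINT x|lebesgue. h x \<bullet> (a *\<^sub>R \<phi> x + b *\<^sub>R \<psi> x)) =
        a * (LINT x|lebesgue. h x \<bullet> \<phi> x) + b * (LINT x|lebesgue. h x \<bullet> \<psi> x)"
      by (simp add: inner_add_right)
  next
    fix \<phi> :: "R3 \<Rightarrow> R3" assume \<phi>: "\<phi> \<in> H1"
    have "\<bar>LINT x|lebesgue. h x \<bullet> \<phi> x\<bar> \<le> sqrt (sqint h) * sqrt (sqint \<phi>)"
      by (rule Lp2_inner(2)[OF h H1_D(1)[OF \<phi>]])
    also have "\<dots> \<le> sqrt (sqint h) * sqrt (sqint \<phi> + sqint (wgrad \<phi>))"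
      using sqint_nonneg[of "wgrad \<phi>"] sqint_nonneg[of h] by (intro mult_left_mono) auto
    also have "\<dots> = sqrt (sqint h) * enn2real (H1_norm \<phi>)"
      using sqint_nonneg[of "wgrad \<phi>"] sqint_nonneg[of \<phi>] by (simp add: H1_norm_eq[OF \<phi>])
    finally show "\<bar>LINT x|lebesgue. h x \<bullet> \<phi> x\<bar> \<le> sqrt (sqint h) * enn2real (H1_norm \<phi>)" .
  qed
qed

text \<open>The force constructed below lies in L^2 at every time, so this turns its pairings into
  integrals.\<close>

lemma pairing_Lp2:
  assumes h: "h \<in> Lp 2" and \<phi>: "\<phi> \<in> H1"
  shows "pairing h \<phi> = (LINT x|lebesgue. h x \<bullet> \<phi> x)"
proof -
  have r: "represents h (pairing h)"
    unfolding pairing_def using someI[of "represents h", OF represents_Lp2[OF h]] .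
  note r' = represents_Lp2[OF h]
  show ?thesis
    by (rule H1_functional_unique[OF _ _ _ \<phi>, of "pairing h" "\<lambda>\<phi>. LINT x|lebesgue. h x \<bullet> \<phi> x"])
      (use r r' in \<open>auto simp: represents_def\<close>)
qed

section \<open>Integrals over space-time\<close>

lemma nn_integral_cball_translate:
  "(\<integral>\<^sup>+ x. indicator (cball (c::'a) r) x \<partial>lborel) = emeasure lborel (cball (0::'a::euclidean_space) r)"
proof -
  have "(\<integral>\<^sup>+ x. indicator (cball c r) x \<partial>lborel) = (\<integral>\<^sup>+ x. indicator (cball c r) (c + x) \<partial>lborel)"
    by (rule lborel_nn_integral_translate[symmetric]) (intro borel_measurable_indicator borel_closed closed_cball)
  also have "\<dots> = (\<integral>\<^sup>+ x. indicator (cball (0::'a) r) x \<partial>lborel)"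
    by (rule nn_integral_cong) (simp add: indicator_def dist_norm)
  finally show ?thesis by simp
qed

text \<open>Tonelli, with unit balls of equal volume as slices. The centre is only measurable in
  time, because the support will jump from bubble to bubble.\<close>

lemma integrable_moving_ball:
  fixes g :: "R3 \<times> real \<Rightarrow> 'b::euclidean_space"
  assumes g [measurable]: "g \<in> borel_measurable (lborel \<Otimes>\<^sub>M lborel)"
    and c [measurable]: "c \<in> borel_measurable borel" and G [measurable]: "G \<in> borel_measurable borel"
    and le: "\<And>x t. norm (g (x, t)) \<le> G t * indicator (cball (c t) 1) x"
    and fin: "(\<integral>\<^sup>+ t. ennreal (G t) \<partial>lborel) < \<infinity>"
  shows "integrable (lborel \<Otimes>\<^sub>M lborel) g"
proof (rule integrableI_bounded)
  have "(\<integral>\<^sup>+ z. ennreal (norm (g z)) \<partial>(lborel \<Otimes>\<^sub>M lborel)) = (\<integral>\<^sup>+ t. \<integral>\<^sup>+ x. ennreal (norm (g (x, t))) \<partial>lborel \<partial>lborel)"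
    by (rule lborel_pair.nn_integral_snd[symmetric]) simp
  also have "\<dots> \<le> (\<integral>\<^sup>+ t. \<integral>\<^sup>+ x. ennreal (G t) * indicator (cball (c t) 1) x \<partial>lborel \<partial>lborel)"
  proof (intro nn_integral_mono)
    fix t x
    have "ennreal (norm (g (x, t))) \<le> ennreal (G t * indicator (cball (c t) 1) x)"
      by (rule ennreal_leI[OF le])
    also have "\<dots> = ennreal (G t) * indicator (cball (c t) 1) x"
      by (auto simp: indicator_def)
    finally show "ennreal (norm (g (x, t))) \<le> ennreal (G t) * indicator (cball (c t) 1) x" .
  qed
  also have "\<dots> = (\<integral>\<^sup>+ t. ennreal (G t) * emeasure lborel (cball (0::R3) 1) \<partial>lborel)"
  proof (rule nn_integral_cong)
    fix t
    have "(\<integral>\<^sup>+ x. ennreal (G t) * indicator (cball (c t) 1) x \<partial>lborel) = ennreal (G t) * (\<integral>\<^sup>+ x. indicator (cball (c t) 1) x \<partial>lborel)"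
      by (rule nn_integral_cmult, rule borel_measurable_indicator) simp
    then show "(\<integral>\<^sup>+ x. ennreal (G t) * indicator (cball (c t) 1) x \<partial>lborel) = ennreal (G t) * emeasure lborel (cball (0::R3) 1)"
      by (simp only: nn_integral_cball_translate)
  qed
  also have "\<dots> = (\<integral>\<^sup>+ t. ennreal (G t) \<partial>lborel) * emeasure lborel (cball (0::R3) 1)"
    by (rule nn_integral_multc) simp
  also have "\<dots> < \<infinity>"
    using fin emeasure_lborel_cball_finite[of "0::R3" 1] by (simp add: ennreal_mult_less_top)
  finally show "(\<integral>\<^sup>+ z. ennreal (norm (g z)) \<partial>(lborel \<Otimes>\<^sub>M lborel)) < \<infinity>" .
qed simp

lemma lebesgue_on_integral:
  fixes h :: "real \<Rightarrow> 'b::euclidean_space"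
  assumes h: "h \<in> borel_measurable borel"
  shows "(LINT t|lebesgue_on {0<..<S}. h t) = (LINT t|lborel. indicator {0<..<S} t *\<^sub>R h t)"
    and "integrable (lebesgue_on {0<..<S}) h \<longleftrightarrow> integrable lborel (\<lambda>t. indicator {0<..<S} t *\<^sub>R h t)"
proof -
  have m: "(\<lambda>t. indicator {0<..<S} t *\<^sub>R h t) \<in> borel_measurable borel" using h by simp
  show "(LINT t|lebesgue_on {0<..<S}. h t) = (LINT t|lborel. indicator {0<..<S} t *\<^sub>R h t)"
    using lebesgue_eq_lborel(1)[OF m] by (subst integral_restrict_space) auto
  show "integrable (lebesgue_on {0<..<S}) h \<longleftrightarrow> integrable lborel (\<lambda>t. indicator {0<..<S} t *\<^sub>R h t)"
    using lebesgue_eq_lborel(2)[OF m] by (subst integrable_restrict_space) auto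
qed

text \<open>A inherits measurability from B by completeness of Lebesgue measure. This is how
  integrands containing \<open>pairing\<close> or \<open>wgrad\<close>, whose dependence on time is
  unknown a priori, become integrable.\<close>

lemma lebesgue_on_AE_cong:
  fixes A B :: "real \<Rightarrow> 'b::euclidean_space"
  assumes B: "integrable (lebesgue_on {0<..<S}) B" and AE: "AE t in lebesgue_on {0<..<S}. A t = B t"
  shows "integrable (lebesgue_on {0<..<S}) A" "(LINT t|lebesgue_on {0<..<S}. A t) = (LINT t|lebesgue_on {0<..<S}. B t)"
proof -
  let ?i = "\<lambda>f t. indicator {0<..<S} t *\<^sub>R f t"
  have "AE t in lebesgue. t \<in> {0<..<S} \<longrightarrow> A t = B t"
    using AE by (subst (asm) AE_restrict_space_iff) auto
  then have e: "AE t in lebesgue. ?i B t = ?i A t" by eventually_elim (auto simp: indicator_def)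
  have Bi: "integrable lebesgue (?i B)" using B by (subst (asm) integrable_restrict_space) auto
  then have Bm: "?i B \<in> borel_measurable lebesgue" by simp
  have Am: "?i A \<in> borel_measurable lebesgue" by (rule borel_measurable_AE[OF Bm e])
  have "integrable lebesgue (?i A)" by (rule integrable_cong_AE_imp[OF Bi Am]) (use e in \<open>auto elim!: eventually_mono\<close>)
  then show "integrable (lebesgue_on {0<..<S}) A" by (subst integrable_restrict_space) auto
  have "(LINT t|lebesgue. ?i A t) = (LINT t|lebesgue. ?i B t)"
    by (rule integral_cong_AE[OF Am Bm]) (use e in \<open>auto elim!: eventually_mono\<close>)
  then show "(LINT t|lebesgue_on {0<..<S}. A t) = (LINT t|lebesgue_on {0<..<S}. B t)"
    by (subst (1 2) integral_restrict_space) auto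
qed

lemma AE_lebesgue_on_countable:
  fixes S :: real
  assumes "countable Z" "\<And>t. 0 < t \<Longrightarrow> t < S \<Longrightarrow> t \<notin> Z \<Longrightarrow> P t"
  shows "AE t in lebesgue_on {0<..<S}. P t"
proof -
  have "AE t in lborel. t \<notin> Z" by (rule AE_not_in) (rule countable_imp_null_set_lborel[OF assms(1)])
  then have "AE t in lebesgue. t \<notin> Z" by (rule AE_completion)
  then have "AE t in lebesgue. t \<in> {0<..<S} \<longrightarrow> P t"
    by eventually_elim (use assms(2) in auto)
  moreover have "{0<..<S} \<inter> space lebesgue \<in> sets lebesgue" by simp
  ultimately show ?thesis using AE_restrict_space_iff by blast
qed

text \<open>The definitions integrate iteratively over Lebesgue measure in x and t, while Fubini's
  theorem lives on the product of \<open>lborel\<close> with itself; Borel measurability of g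
  bridges the two.\<close>

lemma iterated_integral:
  fixes g :: "R3 \<times> real \<Rightarrow> 'b::euclidean_space"
  assumes g [measurable]: "g \<in> borel_measurable (lborel \<Otimes>\<^sub>M lborel)"
    and i: "integrable (lborel \<Otimes>\<^sub>M lborel) (\<lambda>z. indicator {0<..<S} (snd z) *\<^sub>R g z)"
  shows "(LINT t|lebesgue_on {0<..<S}. LINT x|lebesgue. g (x, t)) = (LINT z|(lborel \<Otimes>\<^sub>M lborel). indicator {0<..<S} (snd z) *\<^sub>R g z)"
    and "integrable (lebesgue_on {0<..<S}) (\<lambda>t. LINT x|lebesgue. g (x, t))"
    and "(\<lambda>t. LINT x|lborel. g (x, t)) \<in> borel_measurable borel"
proof -
  have gx: "(\<lambda>x. g (x, t)) \<in> borel_measurable borel" for t by measurable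
  have in_eq: "(LINT x|lebesgue. g (x, t)) = (LINT x|lborel. g (x, t))" for t
    by (rule lebesgue_eq_lborel(1)[OF gx])
  have m: "(\<lambda>t. LINT x|lborel. g (x, t)) \<in> borel_measurable borel"
  proof -
    have "(\<lambda>t. LINT x|lborel. g (x, t)) \<in> borel_measurable lborel"
      by (rule lborel.borel_measurable_lebesgue_integral) measurable
    then show ?thesis by simp
  qed
  then show "(\<lambda>t. LINT x|lborel. g (x, t)) \<in> borel_measurable borel" .
  have i': "integrable lborel (\<lambda>t. LINT x|lborel. indicator {0<..<S} t *\<^sub>R g (x, t))"
    using lborel_pair.integrable_snd[of "\<lambda>x t. indicator {0<..<S} t *\<^sub>R g (x, t)"] i by (simp add: case_prod_unfold)
  then have i'': "integrable lborel (\<lambda>t. indicator {0<..<S} t *\<^sub>R (LINT x|lborel. g (x, t)))" by simp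
  show "integrable (lebesgue_on {0<..<S}) (\<lambda>t. LINT x|lebesgue. g (x, t))"
    unfolding in_eq lebesgue_on_integral(2)[OF m] by (rule i'')
  have "(LINT t|lborel. LINT x|lborel. indicator {0<..<S} t *\<^sub>R g (x, t)) = (LINT z|(lborel \<Otimes>\<^sub>M lborel). indicator {0<..<S} (snd z) *\<^sub>R g z)"
    using lborel_pair.integral_snd[of "\<lambda>x t. indicator {0<..<S} t *\<^sub>R g (x, t)"] i by (simp add: case_prod_unfold)
  then show "(LINT t|lebesgue_on {0<..<S}. LINT x|lebesgue. g (x, t)) = (LINT z|(lborel \<Otimes>\<^sub>M lborel). indicator {0<..<S} (snd z) *\<^sub>R g z)"
    unfolding in_eq lebesgue_on_integral(1)[OF m] by simp
qed

lemma inner_vec3: "(v::real^'n^3) \<bullet> w = (\<Sum>j\<in>UNIV. v $ j \<bullet> w $ j)"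
  by (simp add: inner_vec_def)

text \<open>\<open>weak_deriv\<close> tests with scalar functions; applying it to the components of
  \<phi> and summing covers vector test fields.\<close>

lemma weak_deriv_inner:
  fixes g h :: "R3 \<Rightarrow> R3"
  assumes w: "weak_deriv [j] g h" and \<phi>: "\<phi> \<in> Cc_inf UNIV"
  shows "(LINT x|lebesgue. h x \<bullet> \<phi> x) = - (LINT x|lebesgue. g x \<bullet> pd j \<phi> x)"
proof -
  have gl: "g \<in> L1_loc UNIV" "h \<in> L1_loc UNIV" using w by (auto simp: weak_deriv_def)
  have bl: "bounded_linear (\<lambda>v::R3. v $ i)" for i by (rule bounded_linear_vec_nth)
  have ci: "(\<lambda>x. \<phi> x $ i) \<in> Cc_inf UNIV" for i by (rule Cc_inf_bounded_linear[OF bl \<phi>])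
  have pi: "pd j (\<lambda>x. \<phi> x $ i) x = pd j \<phi> x $ i" for i x
  proof -
    obtain D where D: "\<And>z. (\<phi> has_derivative D z) (at z)" "\<And>h. (\<lambda>z. D z h) \<in> Cc_inf UNIV"
      using Cc_inf_derivative[OF \<phi>] by metis
    show ?thesis using pd_eq[OF bounded_linear.has_derivative[OF bl D(1)]] pd_eq[OF D(1)] by metis
  qed
  have t: "integrable lebesgue (\<lambda>x. \<psi> x *\<^sub>R u x)" if "\<psi> \<in> Cc_inf UNIV" "u \<in> L1_loc UNIV" for \<psi> and u :: "R3 \<Rightarrow> R3"
    by (rule L1_loc_test[OF that(2) C_on_continuous[OF Cc_inf_smooth[OF that(1), of 0]] Cc_inf_bsupp[OF that(1)]])
  have split: "(LINT x|lebesgue. u x \<bullet> \<psi> x) = (\<Sum>i\<in>UNIV. (LINT x|lebesgue. (\<psi> x $ i) *\<^sub>R u x) $ i)"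
    if "\<psi> \<in> Cc_inf UNIV" "u \<in> L1_loc UNIV" for \<psi> u :: "R3 \<Rightarrow> R3"
  proof -
    have i: "integrable lebesgue (\<lambda>x. (\<psi> x $ i) *\<^sub>R u x)" for i
      by (rule t[OF Cc_inf_bounded_linear[OF bl that(1)] that(2)])
    have e: "(LINT x|lebesgue. (\<psi> x $ i) *\<^sub>R u x) $ i = (LINT x|lebesgue. ((\<psi> x $ i) *\<^sub>R u x) $ i)" for i
      by (rule integral_bounded_linear[OF bl i, symmetric])
    have ii: "integrable lebesgue (\<lambda>x. ((\<psi> x $ i) *\<^sub>R u x) $ i)" for i
      by (rule integrable_bounded_linear[OF bl i])
    show ?thesis unfolding e using ii by (simp add: inner_vec_def mult.commute)
  qed
  have "(LINT x|lebesgue. pd j (\<lambda>x. \<phi> x $ i) x *\<^sub>R g x) = - (LINT x|lebesgue. (\<phi> x $ i) *\<^sub>R h x)" for i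
    using w ci[of i] by (simp add: weak_deriv_def)
  then show ?thesis
    unfolding split[OF \<phi> gl(2)] split[OF Cc_inf_pd[OF \<phi>] gl(1)] pi by (simp add: sum_negf)
qed

lemma Cc_inf_lap:
  fixes \<phi> :: "R3 \<Rightarrow> 'b::euclidean_space"
  assumes "\<phi> \<in> Cc_inf UNIV" shows "lap \<phi> \<in> Cc_inf UNIV"
proof (rule Cc_infI)
  note P = Cc_inf_pd[OF Cc_inf_pd[OF assms]]
  show "C_on k UNIV (lap \<phi>)" for k
    unfolding lap_def[abs_def] by (rule C_on_sum) (rule Cc_inf_smooth[OF P])
  obtain R where R: "\<And>x. R < norm x \<Longrightarrow> \<phi> x = 0" using bsuppE[OF Cc_inf_bsupp[OF assms]] by blast
  have z: "pd i \<psi> x = 0" if "\<And>x. R < norm x \<Longrightarrow> \<psi> x = 0" "R < norm x" for i x and \<psi> :: "R3 \<Rightarrow> 'b"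
  proof (rule pd_eq[of \<psi> "\<lambda>_. 0" x i])
    have "open {z::R3. R < norm z}" by (intro open_Collect_less continuous_intros)
    then show "(\<psi> has_derivative (\<lambda>_. 0)) (at x)"
      by (rule has_derivative_transform_within_open[OF has_derivative_const[of 0]]) (use that in auto)
  qed
  show "bsupp (lap \<phi>)"
    by (rule bsuppI[of R]) (simp add: lap_def z R)
qed

text \<open>All derivatives end up on the test field, so W may be a competitor with just one weak
  derivative.\<close>

lemma H1_lap:
  assumes W: "W \<in> H1" and \<phi>: "\<phi> \<in> Cc_inf UNIV"
  shows "(LINT x|lebesgue. wgrad W x \<bullet> grad \<phi> x) = - (LINT x|lebesgue. W x \<bullet> lap \<phi> x)"
    and "integrable lebesgue (\<lambda>x. wgrad W x \<bullet> grad \<phi> x)"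
proof -
  note H = H1_D[OF W]
  have pl: "pd j \<phi> \<in> Lp 2" "pd j (pd j \<phi>) \<in> Lp 2" for j
    using Cc_inf_H1(1)[OF Cc_inf_pd[OF \<phi>]] Cc_inf_H1(1)[OF Cc_inf_pd[OF Cc_inf_pd[OF \<phi>]]] by auto
  have i: "integrable lebesgue (\<lambda>x. wgrad W x $ j \<bullet> pd j \<phi> x)" for j
    by (rule Lp2_inner(1)[OF H(3) pl(1)])
  have i2: "integrable lebesgue (\<lambda>x. W x \<bullet> pd j (pd j \<phi>) x)" for j
    by (rule Lp2_inner(1)[OF H(1) pl(2)])
  have eq: "wgrad W x \<bullet> grad \<phi> x = (\<Sum>j\<in>UNIV. wgrad W x $ j \<bullet> pd j \<phi> x)" for x
    by (simp add: inner_vec3 grad_def)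
  show "integrable lebesgue (\<lambda>x. wgrad W x \<bullet> grad \<phi> x)" unfolding eq using i by simp
  have "(LINT x|lebesgue. wgrad W x \<bullet> grad \<phi> x) = (\<Sum>j\<in>UNIV. LINT x|lebesgue. wgrad W x $ j \<bullet> pd j \<phi> x)"
    unfolding eq using i by simp
  also have "\<dots> = (\<Sum>j\<in>UNIV. - (LINT x|lebesgue. W x \<bullet> pd j (pd j \<phi>) x))"
    by (rule sum.cong[OF refl]) (rule weak_deriv_inner[OF H(2) Cc_inf_pd[OF \<phi>]])
  also have "\<dots> = - (LINT x|lebesgue. W x \<bullet> lap \<phi> x)"
    unfolding lap_def inner_sum_right using i2 by (simp add: sum_negf)
  finally show "(LINT x|lebesgue. wgrad W x \<bullet> grad \<phi> x) = - (LINT x|lebesgue. W x \<bullet> lap \<phi> x)" .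
qed

subsection \<open>Compactly supported flows\<close>

text \<open>First derivatives are bounded by C; only the Laplacian may be unbounded, controlled by
  an F integrable on bounded time intervals, and second derivatives are guaranteed off the closed
  countable set Z of times. \<open>early\<close> provides zero initial data and removes boundary
  terms at t = 0. \<open>supp_dt\<close> is a separate requirement because the centre c may jump in
  time. The locale serves the solution and, with Z empty, its smooth approximations.\<close>

locale flow =
  fixes V :: "real \<Rightarrow> R3 \<Rightarrow> R3" and Z :: "real set" and c :: "real \<Rightarrow> R3"
    and F :: "real \<Rightarrow> real" and C t0 :: real
  assumes V_C1: "C_on 1 UNIV (spacetime V)"
    and Z: "closed Z" "countable Z"
    and V_smooth: "C_on k (UNIV \<times> (- Z)) (spacetime V)"
    and early: "t < t0 \<Longrightarrow> V t x = 0" and t0: "t0 > 0"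
    and supp: "1 < norm (x - c t) \<Longrightarrow> V t x = 0" and supp_dt: "1 < norm (x - c t) \<Longrightarrow> time_deriv V t x = 0"
    and c_meas [measurable]: "c \<in> borel_measurable borel"
    and V_le: "norm (V t x) \<le> C" and pd_le: "norm (pd i (V t) x) \<le> C" and dt_le: "norm (time_deriv V t x) \<le> C"
    and lap_le: "norm (lap (V t) x) \<le> F t"
    and F_meas [measurable]: "F \<in> borel_measurable borel" and F_nonneg: "F t \<ge> 0"
    and F_int: "(\<integral>\<^sup>+ t. ennreal (F t) * indicator {0<..<S} t \<partial>lborel) < \<infinity>"
    and divfree: "divg (V t) x = 0"
begin

definition force :: "real \<Rightarrow> R3 \<Rightarrow> R3" where
  "force t x = time_deriv V t x - lap (V t) x + (\<Sum>j\<in>UNIV. (V t x $ j) *\<^sub>R pd j (V t) x)"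

lemma C_nonneg: "C \<ge> 0" using V_le[of 0 0] norm_ge_zero order_trans by blast

lemma V_C1': "C_on (Suc 0) (UNIV \<times> UNIV) (spacetime V)"
  using V_C1 by simp

lemma V_slice: "C_on (Suc 0) UNIV (V t)"
  by (rule C_on_slice[OF V_C1']) simp

lemma V_slice_smooth: "t \<notin> Z \<Longrightarrow> C_on k UNIV (V t)"
  by (rule C_on_slice[OF V_smooth]) simp

lemma V_bsupp: "bsupp (V t)"
proof (rule bsuppI)
  fix x :: R3 assume "1 + norm (c t) < norm x"
  then have "1 < norm (x - c t)" using norm_triangle_ineq2[of x "c t"] by linarith
  then show "V t x = 0" by (rule supp)
qed

lemma V_test: "t \<notin> Z \<Longrightarrow> V t \<in> Cc_inf UNIV"
  by (rule Cc_infI[OF V_slice_smooth V_bsupp])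

lemma local_zero:
  fixes g :: "R3 \<Rightarrow> 'b::real_normed_vector"
  assumes "\<And>x. 1 < norm (x - a) \<Longrightarrow> g x = 0" "1 < norm (x - a)"
  shows "pd i g x = 0"
proof (rule pd_eq[of g "\<lambda>_. 0" x i])
  have "open {z::R3. 1 < norm (z - a)}" by (intro open_Collect_less continuous_intros)
  then show "(g has_derivative (\<lambda>_. 0)) (at x)"
    by (rule has_derivative_transform_within_open[OF has_derivative_const[of 0]]) (use assms in auto)
qed

lemma pd_supp: "1 < norm (x - c t) \<Longrightarrow> pd i (V t) x = 0"
  by (rule local_zero[OF supp])

lemma lap_supp: "1 < norm (x - c t) \<Longrightarrow> lap (V t) x = 0"
  by (simp add: lap_def local_zero[of "c t", OF pd_supp])

lemma V_cont: "continuous_on UNIV (spacetime V)"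
  by (rule C_on_continuous[OF V_C1])

lemma pd_cont: "continuous_on UNIV (spacetime (\<lambda>t. pd i (V t)))"
  using C_on_continuous[OF C_on_pd_spacetime[OF V_C1', of i]] by simp

lemma dt: "continuous_on UNIV (spacetime (time_deriv V))"
  "((\<lambda>s. V s x) has_vector_derivative time_deriv V t x) (at t)"
proof -
  obtain d where d: "C_on 0 (UNIV \<times> UNIV) (spacetime d)"
    "\<And>t x. t \<in> UNIV \<Longrightarrow> ((\<lambda>s. V s x) has_vector_derivative d t x) (at t within UNIV)"
    "\<And>t x. t \<in> interior UNIV \<Longrightarrow> time_deriv V t x = d t x"
    by (rule C_on_time_deriv[OF V_C1']) blast
  have "time_deriv V = d" using d(3) by (simp add: fun_eq_iff)
  with d(1,2) show "continuous_on UNIV (spacetime (time_deriv V))"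
    "((\<lambda>s. V s x) has_vector_derivative time_deriv V t x) (at t)" by auto
qed

lemma slice_cont: "continuous_on UNIV (spacetime u) \<Longrightarrow> continuous_on UNIV (u t)"
  for u :: "real \<Rightarrow> R3 \<Rightarrow> 'b::real_normed_vector"
proof -
  assume u: "continuous_on UNIV (spacetime u)"
  have "continuous_on UNIV (\<lambda>x. spacetime u (x, t))"
    by (rule continuous_on_compose2[OF u]) (auto intro: continuous_intros)
  then show ?thesis by simp
qed

lemma cont_measurable: "continuous_on UNIV (spacetime u) \<Longrightarrow> spacetime u \<in> borel_measurable (lborel \<Otimes>\<^sub>M lborel)"
  for u :: "real \<Rightarrow> R3 \<Rightarrow> 'b::euclidean_space"
  using borel_measurable_continuous_onI[of "spacetime u"] by (simp add: lborel_prod)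

lemma V_meas [measurable]: "spacetime V \<in> borel_measurable (lborel \<Otimes>\<^sub>M lborel)"
  and pd_meas [measurable]: "spacetime (\<lambda>t. pd i (V t)) \<in> borel_measurable (lborel \<Otimes>\<^sub>M lborel)"
  and dt_meas [measurable]: "spacetime (time_deriv V) \<in> borel_measurable (lborel \<Otimes>\<^sub>M lborel)"
  by (intro cont_measurable V_cont pd_cont dt)+

lemma Z_open: "open (UNIV \<times> (- Z) :: (R3 \<times> real) set)"
  by (intro open_Times) (use Z in \<open>auto simp: open_Compl\<close>)

text \<open>At times in Z second derivatives may fail to exist and \<open>lap\<close> has no
  reliable value; putting 0 there makes the field Borel and changes nothing for almost every
  t.\<close>

definition lapB :: "real \<Rightarrow> R3 \<Rightarrow> R3" where "lapB t x = (if t \<in> Z then 0 else lap (V t) x)"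

definition forceB :: "real \<Rightarrow> R3 \<Rightarrow> R3" where
  "forceB t x = time_deriv V t x - lapB t x + (\<Sum>j\<in>UNIV. (V t x $ j) *\<^sub>R pd j (V t) x)"

lemma forceB: "t \<notin> Z \<Longrightarrow> forceB t x = force t x"
  by (simp add: forceB_def force_def lapB_def)

lemma lap_cont: "continuous_on (UNIV \<times> (- Z)) (spacetime (\<lambda>t. lap (V t)))"
proof -
  have "C_on 0 (UNIV \<times> (- Z)) (spacetime (\<lambda>t. pd i (pd i (V t))))" for i
    by (rule C_on_pd_spacetime[OF C_on_pd_spacetime[OF V_smooth]])
  then have "continuous_on (UNIV \<times> (- Z)) (\<lambda>z. \<Sum>i\<in>UNIV. spacetime (\<lambda>t. pd i (pd i (V t))) z)"
    by (intro continuous_on_sum) simp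
  then show ?thesis by (simp add: lap_def case_prod_unfold)
qed

lemma lapB_meas [measurable]: "spacetime lapB \<in> borel_measurable (lborel \<Otimes>\<^sub>M lborel)"
proof -
  have "(\<lambda>z. indicator (UNIV \<times> (- Z)) z *\<^sub>R spacetime (\<lambda>t. lap (V t)) z) \<in> borel_measurable borel"
    by (rule borel_measurable_continuous_on_indicator[OF borel_open[OF Z_open] lap_cont])
  also have "(\<lambda>z. indicator (UNIV \<times> (- Z)) z *\<^sub>R spacetime (\<lambda>t. lap (V t)) z) = spacetime lapB"
    by (auto simp: fun_eq_iff lapB_def indicator_def)
  finally show ?thesis by (simp add: lborel_prod)
qed

lemma conv_meas: "(\<lambda>z. \<Sum>j\<in>UNIV. (spacetime V z $ j) *\<^sub>R spacetime (\<lambda>t. pd j (V t)) z) \<in> borel_measurable (lborel \<Otimes>\<^sub>M lborel)"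
  by (intro borel_measurable_sum borel_measurable_scaleR pd_meas measurable_compose[OF V_meas]
      borel_measurable_continuous_onI linear_continuous_on bounded_linear_vec_nth)

lemma forceB_meas [measurable]: "spacetime forceB \<in> borel_measurable (lborel \<Otimes>\<^sub>M lborel)"
proof -
  have "(\<lambda>z. spacetime (time_deriv V) z - spacetime lapB z + (\<Sum>j\<in>UNIV. (spacetime V z $ j) *\<^sub>R spacetime (\<lambda>t. pd j (V t)) z))
      \<in> borel_measurable (lborel \<Otimes>\<^sub>M lborel)"
    by (intro borel_measurable_add borel_measurable_diff dt_meas lapB_meas conv_meas)
  also have "(\<lambda>z. spacetime (time_deriv V) z - spacetime lapB z + (\<Sum>j\<in>UNIV. (spacetime V z $ j) *\<^sub>R spacetime (\<lambda>t. pd j (V t)) z))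
      = spacetime forceB" by (auto simp: forceB_def)
  finally show ?thesis .
qed

text \<open>Majorant for the force: C for the time derivative, F for the Laplacian, and three
  summands of size C^2 for the convective term.\<close>

definition G :: "real \<Rightarrow> real" where "G t = C + F t + 3 * C\<^sup>2"

lemma G_meas [measurable]: "G \<in> borel_measurable borel"
  unfolding G_def by measurable

lemma G_nonneg: "G t \<ge> 0" using C_nonneg F_nonneg[of t] by (simp add: G_def)

lemma conv_le: "norm (\<Sum>j\<in>UNIV. (V t x $ j) *\<^sub>R pd j (V t) x) \<le> 3 * C\<^sup>2"
proof -
  have "norm (\<Sum>j\<in>UNIV. (V t x $ j) *\<^sub>R pd j (V t) x) \<le> (\<Sum>j\<in>(UNIV::3 set). C * C)"
  proof (rule order_trans[OF norm_sum sum_mono])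
    fix j
    have "\<bar>V t x $ j\<bar> \<le> C" using component_le_norm_cart[of "V t x" j] V_le[of t x] by linarith
    then show "norm ((V t x $ j) *\<^sub>R pd j (V t) x) \<le> C * C"
      unfolding norm_scaleR real_norm_def using pd_le C_nonneg by (intro mult_mono) auto
  qed
  then show ?thesis by (simp add: power2_eq_square)
qed

lemma forceB_le: "norm (forceB t x) \<le> G t * indicator (cball (c t) 1) x"
proof (cases "x \<in> cball (c t) 1")
  case True
  have "norm (lapB t x) \<le> F t" using lap_le F_nonneg by (simp add: lapB_def)
  then have "norm (forceB t x) \<le> C + F t + 3 * C\<^sup>2"
    unfolding forceB_def using dt_le[of t x] conv_le[of t x]
    by (intro order_trans[OF norm_triangle_ineq add_mono] order_trans[OF norm_triangle_ineq4 add_mono]) auto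
  then show ?thesis using True by (simp add: G_def)
next
  case False
  then have "1 < norm (x - c t)" by (simp add: dist_norm norm_minus_commute)
  then show ?thesis by (simp add: forceB_def lapB_def supp supp_dt pd_supp lap_supp G_nonneg)
qed

lemma G_int:
  assumes "M \<ge> 0"
  shows "(\<integral>\<^sup>+ t. ennreal (indicator {0<..<S} t * (G t * M)) \<partial>lborel) < \<infinity>"
proof -
  have "(\<integral>\<^sup>+ t. ennreal (indicator {0<..<S} t * (G t * M)) \<partial>lborel)
      = (\<integral>\<^sup>+ t. ennreal ((C + 3 * C\<^sup>2) * M) * indicator {0<..<S} t + ennreal M * (ennreal (F t) * indicator {0<..<S} t) \<partial>lborel)"
    using assms C_nonneg F_nonneg
    by (intro nn_integral_cong) (auto simp: indicator_def G_def algebra_simps simp flip: ennreal_mult ennreal_plus)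
  also have "\<dots> = ennreal ((C + 3 * C\<^sup>2) * M) * emeasure lborel {0<..<S} + ennreal M * (\<integral>\<^sup>+ t. ennreal (F t) * indicator {0<..<S} t \<partial>lborel)"
    by (subst nn_integral_add, measurable) (simp add: nn_integral_cmult nn_integral_cmult_indicator)
  also have "\<dots> < \<infinity>"
  proof -
    have "emeasure lborel {0<..<S} < \<infinity>" by (cases "S \<ge> 0") auto
    then show ?thesis using F_int[of S] by (simp add: ennreal_mult_less_top ennreal_add_less_top)
  qed
  finally show ?thesis .
qed

lemma V_H1: "V t \<in> Lp 2" "V t \<in> H1" "sqint (wgrad (V t)) = (\<Sum>j\<in>UNIV. sqint (pd j (V t)))"
proof -
  have p: "pd j (V t) \<in> Lp 2" for j
    by (rule Lp2_continuous_bsupp[OF slice_cont[OF pd_cont] integral_pd_eq_0(1)[OF V_slice V_bsupp]])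
  show l: "V t \<in> Lp 2" by (rule Lp2_continuous_bsupp[OF slice_cont[OF V_cont] V_bsupp])
  show "V t \<in> H1" "sqint (wgrad (V t)) = (\<Sum>j\<in>UNIV. sqint (pd j (V t)))"
    by (rule H1_I[OF l weak_deriv_pd[OF V_slice] p])+
qed

lemma convect_V: "AE x in lebesgue. convect (V t) x = (\<Sum>j\<in>UNIV. (V t x $ j) *\<^sub>R pd j (V t) x)"
  using wgrad_eq_AE[OF weak_deriv_pd[OF V_slice[of t]]] by eventually_elim (simp add: convect_def)

lemma conv_cont: "continuous_on UNIV (\<lambda>x. \<Sum>j\<in>UNIV. (V t x $ j) *\<^sub>R pd j (V t) x)"
  by (intro continuous_on_sum continuous_on_scaleR continuous_on_component slice_cont[OF V_cont] slice_cont[OF pd_cont])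

lemma bsupp_c: "(\<And>x. 1 < norm (x - c t) \<Longrightarrow> g x = 0) \<Longrightarrow> bsupp g" for g :: "R3 \<Rightarrow> 'b::zero"
proof (rule bsuppI)
  fix x :: R3 assume g: "\<And>x. 1 < norm (x - c t) \<Longrightarrow> g x = 0" and "1 + norm (c t) < norm x"
  then have "1 < norm (x - c t)" using norm_triangle_ineq2[of x "c t"] by linarith
  then show "g x = 0" by (rule g)
qed

lemma dt_Lp2: "time_deriv V t \<in> Lp 2"
  by (rule Lp2_continuous_bsupp[OF slice_cont[OF dt(1)] bsupp_c[of t, OF supp_dt]])

lemma conv_Lp2: "(\<lambda>x. \<Sum>j\<in>UNIV. (V t x $ j) *\<^sub>R pd j (V t) x) \<in> Lp 2"
  by (rule Lp2_continuous_bsupp[OF conv_cont bsupp_c[of t]]) (simp add: supp)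

lemma lap_Lp2: "t \<notin> Z \<Longrightarrow> lap (V t) \<in> Lp 2"
  by (rule Cc_inf_H1(1)[OF Cc_inf_lap[OF V_test]])

lemma force_Lp2: "t \<notin> Z \<Longrightarrow> force t \<in> Lp 2"
  using Lp2_lin[OF Lp2_diff[OF dt_Lp2 lap_Lp2] conv_Lp2, of t 1 t 1] by (simp add: force_def[abs_def])

lemma force_inner:
  assumes t: "t \<notin> Z" and u: "u \<in> Lp 2"
  shows "(LINT x|lebesgue. force t x \<bullet> u x) = (LINT x|lebesgue. time_deriv V t x \<bullet> u x)
    - (LINT x|lebesgue. lap (V t) x \<bullet> u x) + (LINT x|lebesgue. (\<Sum>j\<in>UNIV. (V t x $ j) *\<^sub>R pd j (V t) x) \<bullet> u x)"
  unfolding force_def inner_add_left inner_diff_left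
  using Lp2_inner(1)[OF dt_Lp2 u] Lp2_inner(1)[OF lap_Lp2[OF t] u] Lp2_inner(1)[OF conv_Lp2 u] by simp

end

lemma time_deriv_local_zero:
  assumes "open U" "t \<in> U" "\<And>s. s \<in> U \<Longrightarrow> u s x = 0"
  shows "time_deriv u t x = 0"
proof -
  have "((\<lambda>_. 0) has_vector_derivative 0) (at t)" by simp
  then have "((\<lambda>s. u s x) has_vector_derivative 0) (at t)"
    by (rule has_vector_derivative_transform_within_open[OF _ assms(1,2)]) (use assms(3) in simp)
  then show ?thesis unfolding time_deriv_def by (rule vector_derivative_at)
qed

context flow
begin

lemma forceB_Lp2: "forceB t \<in> Lp 2"
proof (cases "t \<in> Z")
  case True
  then show ?thesis using Lp2_lin[OF dt_Lp2 conv_Lp2, of 1 t 1 t] by (simp add: forceB_def[abs_def] lapB_def)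
next
  case False
  then have "forceB t = force t" by (auto simp: forceB)
  with force_Lp2[OF False] show ?thesis by simp
qed

lemma V_sigma: "V t \<in> L2_sigma"
  unfolding L2_sigma_def
proof (intro CollectI conjI V_H1 ballI)
  fix \<phi> :: "R3 \<Rightarrow> real" assume \<phi>: "\<phi> \<in> Cc_inf UNIV"
  have bb: "bounded_bilinear (\<lambda>(v::R3) (a::real). (v $ i) * a)" for i
    using bounded_bilinear.comp1[OF bounded_bilinear_mult bounded_linear_vec_nth] .
  have vi: "continuous_on UNIV (\<lambda>x. V t x $ i)" "continuous_on UNIV (\<lambda>x. pd i (V t) x $ i)" for i
    by (intro continuous_on_component slice_cont[OF V_cont] slice_cont[OF pd_cont])+
  have pc: "continuous_on UNIV \<phi>" "continuous_on UNIV (pd i \<phi>)" for i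
    using C_on_continuous[OF Cc_inf_smooth[OF \<phi>, of 0]] C_on_continuous[OF Cc_inf_smooth[OF Cc_inf_pd[OF \<phi>], of 0]] by auto
  have s: "bsupp (\<lambda>x. V t x $ i * pd i \<phi> x)" "bsupp (\<lambda>x. pd i (V t) x $ i * \<phi> x)" for i
    by (rule bsupp_c[of t], simp add: supp pd_supp)+
  have i: "integrable lborel (\<lambda>x. V t x $ i * pd i \<phi> x)" "integrable lborel (\<lambda>x. pd i (V t) x $ i * \<phi> x)" for i
    by (intro integrable_bsupp(1) continuous_on_mult vi pc s)+
  have "(\<Sum>i\<in>UNIV. LINT x|lborel. V t x $ i * pd i \<phi> x) = (\<Sum>i\<in>UNIV. - (LINT x|lborel. pd i (V t) x $ i * \<phi> x))"
    by (rule sum.cong[OF refl]) (rule integral_by_parts[OF bb V_slice Cc_inf_smooth[OF \<phi>, of "Suc 0"]], simp add: V_bsupp)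
  also have "\<dots> = - (LINT x|lborel. (\<Sum>i\<in>UNIV. pd i (V t) x $ i * \<phi> x))"
    using i(2) by (simp add: sum_negf)
  also have "\<dots> = - (LINT x|lborel. divg (V t) x * \<phi> x)"
    by (simp add: divg_def sum_distrib_right)
  finally have "(\<Sum>i\<in>UNIV. LINT x|lborel. V t x $ i * pd i \<phi> x) = 0" by (simp add: divfree)
  then have "(LINT x|lborel. V t x \<bullet> grad \<phi> x) = 0"
    using i(1) by (simp add: inner_vec_def grad_def)
  moreover have "(\<lambda>x. V t x \<bullet> grad \<phi> x) \<in> borel_measurable borel"
    unfolding inner_vec_def grad_def
    by (rule borel_measurable_continuous_onI) (simp, intro continuous_on_sum continuous_on_mult vi pc)
  ultimately show "(LINT x|lebesgue. V t x \<bullet> grad \<phi> x) = 0" by (simp add: lebesgue_eq_lborel)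
qed

text \<open>The force makes the equation hold pointwise off Z. After testing with \<phi> the two
  sides therefore differ only by the time derivative of V \<bullet> \<phi>, which integrates to
  zero. The set \<open>I\<close> is variable so that the half-open interval of
  \<open>test_fields\<close> and the open one of \<open>associated_pressure\<close> are treated
  together.\<close>

lemma momentum:
  fixes \<phi> :: "real \<Rightarrow> R3 \<Rightarrow> R3"
  assumes \<phi>: "spacetime \<phi> \<in> Cc_inf (UNIV \<times> I)" and I: "{0<..<S} \<subseteq> I" "I \<subseteq> {0..<S}"
  shows "\<And>t. 0 < t \<Longrightarrow> t < S \<Longrightarrow> \<phi> t \<in> Cc_inf UNIV"
    and "\<And>t. 0 < t \<Longrightarrow> t < S \<Longrightarrow> time_deriv \<phi> t \<in> Lp 2"
    and "(LINT t|lebesgue_on {0<..<S}. LINT x|lebesgue.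
        - (V t x \<bullet> time_deriv \<phi> t x) - V t x \<bullet> lap (\<phi> t) x + convect (V t) x \<bullet> \<phi> t x)
      = (LINT t|lebesgue_on {0<..<S}. pairing (forceB t) (\<phi> t))"
proof -
  from \<phi> obtain K where sm: "smooth_on (UNIV \<times> I) (spacetime \<phi>)" and K: "compact K" "K \<subseteq> UNIV \<times> I"
    "\<And>z. z \<notin> K \<Longrightarrow> spacetime \<phi> z = 0" unfolding Cc_inf_def by blast
  have smk: "C_on k (UNIV \<times> I) (spacetime \<phi>)" for k by (rule smooth_onD[OF sm])
  have Ko: "open (- K)" using K(1) by (simp add: compact_imp_closed open_Compl)
  have "bounded K" by (rule compact_imp_bounded[OF K(1)])
  then obtain R where R: "\<And>z. z \<in> K \<Longrightarrow> norm z \<le> R" unfolding bounded_iff by blast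
  have far: "\<phi> t x = 0" if "R < norm x" for t x
  proof -
    have "norm x \<le> norm (x, t)" by (rule norm_fst_le)
    then have "(x, t) \<notin> K" using R[of "(x, t)"] that by linarith
    then show ?thesis using K(3)[of "(x, t)"] by simp
  qed
  have test: "\<phi> t \<in> Cc_inf UNIV" if t: "0 < t" "t < S" for t
  proof (rule Cc_infI)
    show "C_on k UNIV (\<phi> t)" for k by (rule C_on_slice[OF smk]) (use I t in auto)
    show "bsupp (\<phi> t)" by (rule bsuppI[of R]) (rule far)
  qed
  then show "\<And>t. 0 < t \<Longrightarrow> t < S \<Longrightarrow> \<phi> t \<in> Cc_inf UNIV" .
  obtain d where d: "C_on 0 (UNIV \<times> I) (spacetime d)"
    "\<And>t x. t \<in> I \<Longrightarrow> ((\<lambda>s. \<phi> s x) has_vector_derivative d t x) (at t within I)"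
    "\<And>t x. t \<in> interior I \<Longrightarrow> time_deriv \<phi> t x = d t x"
    by (rule C_on_time_deriv[OF smk[of "Suc 0"]]) blast
  have int: "t \<in> interior I" if "0 < t" "t < S" for t
  proof -
    have "{0<..<S} \<subseteq> interior I" by (rule interior_maximal[OF I(1)]) simp
    with that show ?thesis by auto
  qed
  have tI: "t \<in> I" if "0 < t" "t < S" for t using that I by auto
  have \<phi>d: "((\<lambda>s. \<phi> s x) has_vector_derivative time_deriv \<phi> t x) (at t)" if t: "0 < t" "t < S" for t x
    using d(2)[OF tI[OF t], of x] unfolding at_within_interior[OF int[OF t]] d(3)[OF int[OF t]] .
  have dt_far: "time_deriv \<phi> t x = 0" if "R < norm x" for t x
    by (rule time_deriv_local_zero[of UNIV]) (use far that in auto)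
  have \<phi>dc: "continuous_on UNIV (time_deriv \<phi> t)" if t: "0 < t" "t < S" for t
  proof -
    have "C_on 0 UNIV (d t)" by (rule C_on_slice[OF d(1) tI[OF t]])
    moreover have "time_deriv \<phi> t = d t" using d(3)[OF int[OF t]] by auto
    ultimately show ?thesis by simp
  qed
  have \<phi>d2: "time_deriv \<phi> t \<in> Lp 2" if t: "0 < t" "t < S" for t
    by (rule Lp2_continuous_bsupp[OF \<phi>dc[OF t] bsuppI[of R, OF dt_far]])
  then show "\<And>t. 0 < t \<Longrightarrow> t < S \<Longrightarrow> time_deriv \<phi> t \<in> Lp 2" .
  \<comment> \<open>A C^1 function of bounded support on all of space-time: the support of \<phi>
    stays away from t = S, and V vanishes near t = 0 although \<phi> need not.\<close>
  define \<Phi> where "\<Phi> t x = V t x \<bullet> \<phi> t x" for t x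
  have \<Phi>0: "\<Phi> t x = 0" if "(x, t) \<notin> K \<or> t < t0" for t x
    using that K(3)[of "(x, t)"] early[of t x] by (auto simp: \<Phi>_def)
  have \<Phi>C: "C_on (Suc 0) UNIV (spacetime \<Phi>)"
  proof (rule C_on_local[OF _ open_UNIV])
    fix z :: "R3 \<times> real"
    show "\<exists>U. open U \<and> z \<in> U \<and> C_on (Suc 0) U (spacetime \<Phi>)"
    proof (cases "z \<in> K \<and> t0 \<le> snd z")
      case True
      then have z: "z \<in> UNIV \<times> {0<..<S}" using K(2) I(2) t0 by (cases z) auto
      have "C_on (Suc 0) (UNIV \<times> {0<..<S}) (\<lambda>z. spacetime V z \<bullet> spacetime \<phi> z)"
        by (rule C_on_inner[OF C_on_subset[OF V_C1'] C_on_subset[OF smk]]) (use I in auto)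
      then have "C_on (Suc 0) (UNIV \<times> {0<..<S}) (spacetime \<Phi>)" by (simp add: \<Phi>_def case_prod_unfold del: C_on.simps)
      moreover have "open (UNIV \<times> {0<..<S} :: (R3 \<times> real) set)" by (intro open_Times) auto
      ultimately show ?thesis using z by blast
    next
      case False
      let ?U = "- K \<union> {w. snd w < t0}"
      have "open ?U" by (intro open_Un Ko open_Collect_less continuous_intros)
      moreover have "z \<in> ?U" using False by auto
      moreover have "C_on (Suc 0) ?U (spacetime \<Phi>)"
        by (rule C_on_cong[OF C_on_const[of _ _ 0]]) (use \<Phi>0 in fastforce)
      ultimately show ?thesis by blast
    qed
  qed
  have \<Phi>s: "bsupp (spacetime \<Phi>)"
  proof (rule bsuppI)
    fix z :: "R3 \<times> real" assume "R < norm z"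
    then have "z \<notin> K" using R[of z] by linarith
    then show "spacetime \<Phi> z = 0" using \<Phi>0 by (cases z) auto
  qed
  obtain D where D: "\<And>z. (spacetime \<Phi> has_derivative D z) (at z)" "\<And>h. C_on 0 UNIV (\<lambda>z. D z h)"
    by (rule C_on_1_derivative[OF \<Phi>C]) blast
  define H where "H z = D z (0, 1)" for z
  have Hc: "continuous_on UNIV H" unfolding H_def by (rule C_on_continuous[OF D(2)])
  \<comment> \<open>Integration by parts in time: the derivative in direction (0, 1) has zero
    integral over space-time.\<close>
  note D0 = integral_derivative_eq_0[OF D(1) Hc[unfolded H_def] \<Phi>s, folded H_def]
  have HP: "H (x, t) = time_deriv \<Phi> t x" for x t
  proof -
    have "((\<lambda>s. \<Phi> s x) has_vector_derivative D (x, t) (0, 1)) (at t within UNIV)"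
      by (rule has_derivative_slice(2)) (use D(1) in auto)
    then show ?thesis unfolding H_def time_deriv_def by (simp add: vector_derivative_at)
  qed
  have H1: "H (x, t) = V t x \<bullet> time_deriv \<phi> t x + time_deriv V t x \<bullet> \<phi> t x" if t: "0 < t" "t < S" for x t
    unfolding HP time_deriv_def[of \<Phi>] \<Phi>_def
    by (rule vector_derivative_at[OF bounded_bilinear.has_vector_derivative[OF bounded_bilinear_inner dt(2) \<phi>d[OF t]]])
  have H0: "H (x, t) = 0" if t: "\<not> (0 < t \<and> t < S)" for x t
    unfolding HP
  proof (cases "t \<le> 0")
    case True
    show "time_deriv \<Phi> t x = 0"
      by (rule time_deriv_local_zero[of "{..<t0}"]) (use True t0 \<Phi>0 in auto)
  next
    case False
    then have "(x, t) \<notin> K" using t K(2) I(2) by auto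
    moreover have "open ((\<lambda>s. (x, s)) -` (- K))" by (intro open_vimage Ko continuous_intros)
    ultimately show "time_deriv \<Phi> t x = 0"
      by (intro time_deriv_local_zero[of "(\<lambda>s. (x, s)) -` (- K)"]) (use \<Phi>0 in auto)
  qed
  have Hm [measurable]: "H \<in> borel_measurable (lborel \<Otimes>\<^sub>M lborel)"
    using borel_measurable_continuous_onI[OF Hc] by (simp add: lborel_prod)
  have Hi: "integrable (lborel \<Otimes>\<^sub>M lborel) H"
    using integrable_bsupp(1)[OF Hc D0(1)] by (simp add: lborel_prod)
  have Hind: "(\<lambda>z. indicator {0<..<S} (snd z) *\<^sub>R H z) = H"
  proof
    fix z :: "R3 \<times> real"
    show "indicator {0<..<S} (snd z) *\<^sub>R H z = H z"
      using H0[of "snd z" "fst z"] by (cases "0 < snd z \<and> snd z < S") auto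
  qed
  note it = iterated_integral[OF Hm, of S, unfolded Hind, OF Hi]
  have HI: "(LINT t|lebesgue_on {0<..<S}. LINT x|lebesgue. H (x, t)) = 0"
    using it(1) D0(2) by (simp add: lborel_prod)
  obtain M where M: "M \<ge> 0" "\<And>t x. 0 < t \<Longrightarrow> t < S \<Longrightarrow> norm (\<phi> t x) \<le> M"
  proof -
    have "bounded (spacetime \<phi> ` K)"
      by (intro compact_imp_bounded compact_continuous_image K(1) continuous_on_subset[OF C_on_continuous[OF smk[of 0]] K(2)])
    then obtain M where M: "M > 0" "\<forall>y\<in>spacetime \<phi> ` K. norm y \<le> M" unfolding bounded_pos by blast
    have "norm (\<phi> t x) \<le> M" for t x
    proof (cases "(x, t) \<in> K")
      case True
      then show ?thesis using bspec[OF M(2) imageI[OF True]] by simp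
    next
      case False
      then show ?thesis using M(1) K(3)[OF False] by simp
    qed
    with M(1) show ?thesis by (intro that[of M]) auto
  qed
  \<comment> \<open>\<phi> is known to be continuous only relative to its strip; restriction to the
    open strip gives a Borel function on space-time, as Fubini requires.\<close>
  define \<psi> where "\<psi> z = indicator (UNIV \<times> {0<..<S}) z *\<^sub>R spacetime \<phi> z" for z
  have \<psi>m [measurable]: "\<psi> \<in> borel_measurable (lborel \<Otimes>\<^sub>M lborel)"
  proof -
    have "open (UNIV \<times> {0<..<S} :: (R3 \<times> real) set)" by (intro open_Times) auto
    then have "\<psi> \<in> borel_measurable borel"
      unfolding \<psi>_def by (intro borel_measurable_continuous_on_indicator borel_open
          continuous_on_subset[OF C_on_continuous[OF smk[of 0]]]) (use I in auto)
    then show ?thesis by (simp add: lborel_prod)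
  qed
  define g where "g z = spacetime forceB z \<bullet> \<psi> z" for z
  have gm [measurable]: "g \<in> borel_measurable (lborel \<Otimes>\<^sub>M lborel)" unfolding g_def by measurable
  have gi: "integrable (lborel \<Otimes>\<^sub>M lborel) (\<lambda>z. indicator {0<..<S} (snd z) *\<^sub>R g z)"
  proof (rule integrable_moving_ball[OF _ c_meas _ _ G_int[OF M(1)]])
    fix x t
    show "norm (indicator {0<..<S} (snd (x, t)) *\<^sub>R g (x, t)) \<le> indicator {0<..<S} t * (G t * M) * indicator (cball (c t) 1) x"
    proof (cases "0 < t \<and> t < S")
      case True
      have "norm (g (x, t)) \<le> norm (forceB t x) * norm (\<phi> t x)"
        using True Cauchy_Schwarz_ineq2[of "forceB t x" "\<phi> t x"] by (simp add: g_def \<psi>_def)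
      also have "\<dots> \<le> (G t * indicator (cball (c t) 1) x) * M"
        using True M G_nonneg[of t] by (intro mult_mono forceB_le) auto
      finally show ?thesis using True by (simp add: mult.commute mult.left_commute)
    qed auto
  qed measurable
  note itg = iterated_integral[OF gm gi]
  have pair: "pairing (forceB t) (\<phi> t) = (LINT x|lebesgue. g (x, t))" if t: "0 < t" "t < S" for t
    using pairing_Lp2[OF forceB_Lp2 Cc_inf_H1(2)[OF test[OF t]]] t by (simp add: g_def \<psi>_def)
  have "AE t in lebesgue_on {0<..<S}. pairing (forceB t) (\<phi> t) = (LINT x|lebesgue. g (x, t))"
    by (rule AE_lebesgue_on_countable[OF Z(2)]) (rule pair)
  note P = lebesgue_on_AE_cong[OF itg(2) this]
  have "AE t in lebesgue_on {0<..<S}.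
      (LINT x|lebesgue. - (V t x \<bullet> time_deriv \<phi> t x) - V t x \<bullet> lap (\<phi> t) x + convect (V t) x \<bullet> \<phi> t x)
      = (LINT x|lebesgue. g (x, t)) - (LINT x|lebesgue. H (x, t))"
  proof (rule AE_lebesgue_on_countable[OF Z(2)])
    fix t assume t: "0 < t" "t < S" and tZ: "t \<notin> Z"
    note \<phi>t = test[OF t]
    have \<phi>2: "\<phi> t \<in> Lp 2" "lap (\<phi> t) \<in> Lp 2"
      using Cc_inf_H1(1)[OF \<phi>t] Cc_inf_H1(1)[OF Cc_inf_lap[OF \<phi>t]] by auto
    let ?c = "\<lambda>x. \<Sum>j\<in>UNIV. (V t x $ j) *\<^sub>R pd j (V t) x"
    have i: "integrable lebesgue (\<lambda>x. V t x \<bullet> time_deriv \<phi> t x)" "integrable lebesgue (\<lambda>x. V t x \<bullet> lap (\<phi> t) x)"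
      "integrable lebesgue (\<lambda>x. ?c x \<bullet> \<phi> t x)" "integrable lebesgue (\<lambda>x. time_deriv V t x \<bullet> \<phi> t x)"
      by (rule Lp2_inner(1)[OF V_H1(1) \<phi>d2[OF t]] Lp2_inner(1)[OF V_H1(1) \<phi>2(2)]
          Lp2_inner(1)[OF conv_Lp2 \<phi>2(1)] Lp2_inner(1)[OF dt_Lp2 \<phi>2(1)])+
    have w: "convect (V t) \<in> borel_measurable lebesgue"
    proof (rule borel_measurable_AE[of ?c])
      show "?c \<in> borel_measurable lebesgue" using conv_Lp2[of t] by (simp add: Lp2_iff)
      show "AE x in lebesgue. ?c x = convect (V t) x" using convect_V[of t] by eventually_elim simp
    qed
    have "(LINT x|lebesgue. - (V t x \<bullet> time_deriv \<phi> t x) - V t x \<bullet> lap (\<phi> t) x + convect (V t) x \<bullet> \<phi> t x)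
        = (LINT x|lebesgue. - (V t x \<bullet> time_deriv \<phi> t x) - V t x \<bullet> lap (\<phi> t) x + ?c x \<bullet> \<phi> t x)"
    proof (rule integral_cong_AE)
      have m: "V t \<in> borel_measurable lebesgue" "\<phi> t \<in> borel_measurable lebesgue"
        "time_deriv \<phi> t \<in> borel_measurable lebesgue" "lap (\<phi> t) \<in> borel_measurable lebesgue" "?c \<in> borel_measurable lebesgue"
        using V_H1(1)[of t] \<phi>2 \<phi>d2[OF t] conv_Lp2[of t] by (simp_all add: Lp2_iff)
      show "(\<lambda>x. - (V t x \<bullet> time_deriv \<phi> t x) - V t x \<bullet> lap (\<phi> t) x + convect (V t) x \<bullet> \<phi> t x) \<in> borel_measurable lebesgue"
        "(\<lambda>x. - (V t x \<bullet> time_deriv \<phi> t x) - V t x \<bullet> lap (\<phi> t) x + ?c x \<bullet> \<phi> t x) \<in> borel_measurable lebesgue"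
        by (intro borel_measurable_add borel_measurable_diff borel_measurable_uminus borel_measurable_inner m w)+
      show "AE x in lebesgue. - (V t x \<bullet> time_deriv \<phi> t x) - V t x \<bullet> lap (\<phi> t) x + convect (V t) x \<bullet> \<phi> t x
          = - (V t x \<bullet> time_deriv \<phi> t x) - V t x \<bullet> lap (\<phi> t) x + ?c x \<bullet> \<phi> t x"
        using convect_V[of t] by eventually_elim simp
    qed
    also have "\<dots> = - (LINT x|lebesgue. V t x \<bullet> time_deriv \<phi> t x) - (LINT x|lebesgue. V t x \<bullet> lap (\<phi> t) x) + (LINT x|lebesgue. ?c x \<bullet> \<phi> t x)"
      using i by simp
    \<comment> \<open>Symmetry of the Laplacian through the product of the gradients:
      \<open>H1_lap\<close> is used twice with exchanged roles, which is possible because off Z the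
      slice \<open>V t\<close> is itself a test field.\<close>
    also have "(LINT x|lebesgue. V t x \<bullet> lap (\<phi> t) x) = (LINT x|lebesgue. lap (V t) x \<bullet> \<phi> t x)"
    proof -
      have "(LINT x|lebesgue. wgrad (\<phi> t) x \<bullet> grad (V t) x) = (LINT x|lebesgue. wgrad (V t) x \<bullet> grad (\<phi> t) x)"
      proof (rule integral_cong_AE)
        have a: "AE x in lebesgue. wgrad (\<phi> t) x = grad (\<phi> t) x" "AE x in lebesgue. wgrad (V t) x = grad (V t) x"
          using wgrad_eq_AE[OF weak_deriv_pd[OF Cc_inf_smooth[OF \<phi>t, of "Suc 0"]]] wgrad_eq_AE[OF weak_deriv_pd[OF V_slice[of t]]]
          by (simp_all add: grad_def)
        then show "AE x in lebesgue. wgrad (\<phi> t) x \<bullet> grad (V t) x = wgrad (V t) x \<bullet> grad (\<phi> t) x"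
          by eventually_elim (simp add: inner_commute)
        show "(\<lambda>x. wgrad (\<phi> t) x \<bullet> grad (V t) x) \<in> borel_measurable lebesgue"
          using H1_lap(2)[OF Cc_inf_H1(2)[OF \<phi>t] V_test[OF tZ]] by (rule borel_measurable_integrable)
        show "(\<lambda>x. wgrad (V t) x \<bullet> grad (\<phi> t) x) \<in> borel_measurable lebesgue"
          using H1_lap(2)[OF V_H1(2) \<phi>t] by (rule borel_measurable_integrable)
      qed
      then have "(LINT x|lebesgue. \<phi> t x \<bullet> lap (V t) x) = (LINT x|lebesgue. V t x \<bullet> lap (\<phi> t) x)"
        unfolding H1_lap(1)[OF Cc_inf_H1(2)[OF \<phi>t] V_test[OF tZ]] H1_lap(1)[OF V_H1(2) \<phi>t] by simp
      then show ?thesis by (simp add: inner_commute)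
    qed
    finally have A: "(LINT x|lebesgue. - (V t x \<bullet> time_deriv \<phi> t x) - V t x \<bullet> lap (\<phi> t) x + convect (V t) x \<bullet> \<phi> t x)
      = - (LINT x|lebesgue. V t x \<bullet> time_deriv \<phi> t x) - (LINT x|lebesgue. lap (V t) x \<bullet> \<phi> t x) + (LINT x|lebesgue. ?c x \<bullet> \<phi> t x)" .
    have "(LINT x|lebesgue. g (x, t)) = (LINT x|lebesgue. force t x \<bullet> \<phi> t x)"
      using t by (simp add: g_def \<psi>_def forceB[OF tZ])
    moreover have "(LINT x|lebesgue. H (x, t)) = (LINT x|lebesgue. V t x \<bullet> time_deriv \<phi> t x) + (LINT x|lebesgue. time_deriv V t x \<bullet> \<phi> t x)"
      unfolding H1[OF t] using i by simp
    ultimately show "(LINT x|lebesgue. - (V t x \<bullet> time_deriv \<phi> t x) - V t x \<bullet> lap (\<phi> t) x + convect (V t) x \<bullet> \<phi> t x)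
      = (LINT x|lebesgue. g (x, t)) - (LINT x|lebesgue. H (x, t))"
      unfolding A force_inner[OF tZ \<phi>2(1)] by simp
  qed
  from lebesgue_on_AE_cong(2)[OF Bochner_Integration.integrable_diff[OF itg(2) it(2)] this]
  show "(LINT t|lebesgue_on {0<..<S}. LINT x|lebesgue.
        - (V t x \<bullet> time_deriv \<phi> t x) - V t x \<bullet> lap (\<phi> t) x + convect (V t) x \<bullet> \<phi> t x)
      = (LINT t|lebesgue_on {0<..<S}. pairing (forceB t) (\<phi> t))"
    unfolding P(2) using HI itg(2) it(2) by simp
qed

end

section \<open>Norms of fields supported in unit balls\<close>

definition vol1 :: real where "vol1 = measure lborel (cball (0::R3) 1)"

lemma emeasure_unit_ball: "emeasure lborel (cball (a::R3) 1) = ennreal vol1"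
proof -
  have "emeasure lborel (cball a 1) = (\<integral>\<^sup>+ x. indicator (cball a 1) x \<partial>lborel)" by simp
  also have "\<dots> = emeasure lborel (cball (0::R3) 1)" by (rule nn_integral_cball_translate)
  also have "\<dots> = ennreal vol1"
    unfolding vol1_def using emeasure_lborel_cball_finite[of "0::R3" 1] by (intro emeasure_eq_ennreal_measure) auto
  finally show ?thesis .
qed

lemma vol1_nonneg: "vol1 \<ge> 0" by (simp add: vol1_def)

lemma indicator_ball_integral:
  "integrable lebesgue (\<lambda>x::R3. k * indicator (cball a 1) x :: real)"
  "(LINT x|lebesgue. k * indicator (cball (a::R3) 1) x :: real) = k * vol1"
proof -
  have i: "integrable lebesgue (indicator (cball a 1) :: R3 \<Rightarrow> real)"
    using emeasure_lborel_cball_finite[of a 1] by (intro integrable_real_indicator) auto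
  then show "integrable lebesgue (\<lambda>x::R3. k * indicator (cball a 1) x :: real)" by (rule integrable_mult_right)
  have "measure lebesgue (cball a 1) = vol1"
    using emeasure_unit_ball[of a] vol1_nonneg by (simp add: measure_def)
  then show "(LINT x|lebesgue. k * indicator (cball (a::R3) 1) x :: real) = k * vol1" by simp
qed

lemma sqint_le_ball:
  fixes u :: "R3 \<Rightarrow> 'b::euclidean_space"
  assumes u: "u \<in> Lp 2" and le: "\<And>x. norm (u x) \<le> H * indicator (cball a 1) x"
  shows "sqint u \<le> H\<^sup>2 * vol1"
proof -
  have "(norm (u x))\<^sup>2 \<le> H\<^sup>2 * indicator (cball a 1) x" for x
  proof -
    have "(norm (u x))\<^sup>2 \<le> (H * indicator (cball a 1) x)\<^sup>2" by (rule power_mono[OF le]) simp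
    then show ?thesis by (cases "x \<in> cball a 1") simp_all
  qed
  then have "sqint u \<le> (LINT x|lebesgue. H\<^sup>2 * indicator (cball a 1) x)"
    using u by (intro integral_mono indicator_ball_integral) (auto simp: Lp2_iff)
  then show ?thesis by (simp only: indicator_ball_integral)
qed

lemma Lp_norm_ball:
  fixes u :: "R3 \<Rightarrow> 'b::euclidean_space"
  assumes le: "\<And>x. norm (u x) \<le> H * indicator (cball a 1) x" and H: "H \<ge> 0" and p: "p > 0"
  shows "Lp_norm (ennreal p) u \<le> ennreal (H * vol1 powr (1 / p))"
proof -
  have "(\<integral>\<^sup>+ x. ennreal (norm (u x) powr p) \<partial>lebesgue) \<le> (\<integral>\<^sup>+ x. ennreal (H powr p) * indicator (cball a 1) x \<partial>lebesgue)"
  proof (rule nn_integral_mono)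
    fix x
    show "ennreal (norm (u x) powr p) \<le> ennreal (H powr p) * indicator (cball a 1) x"
      using le[of x] p by (cases "x \<in> cball a 1") (auto intro!: ennreal_leI powr_mono2)
  qed
  also have "\<dots> = ennreal (H powr p) * emeasure lborel (cball a 1)"
    by (simp add: nn_integral_cmult_indicator)
  also have "\<dots> = ennreal (H powr p * vol1)"
    unfolding emeasure_unit_ball by (simp add: vol1_nonneg ennreal_mult)
  finally have "Lp_norm (ennreal p) u \<le> enn_powr (ennreal (H powr p * vol1)) (1 / p)"
    unfolding Lp_norm_real[OF p] using p by (intro enn_powr_mono) auto
  also have "\<dots> = ennreal ((H powr p * vol1) powr (1 / p))"
    by (rule enn_powr_ennreal) (simp add: vol1_nonneg)
  also have "(H powr p * vol1) powr (1 / p) = H * vol1 powr (1 / p)"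
    using H p vol1_nonneg by (simp add: powr_mult powr_powr)
  finally show ?thesis .
qed

lemma spacetime_lebesgue_on:
  fixes u :: "real \<Rightarrow> R3 \<Rightarrow> 'b::euclidean_space"
  assumes "spacetime u \<in> borel_measurable (lborel \<Otimes>\<^sub>M lborel)"
  shows "spacetime u \<in> borel_measurable (lebesgue_on (UNIV \<times> {0<..<S}))"
proof -
  have "spacetime u \<in> borel_measurable borel" using assms by (simp add: lborel_prod)
  then show ?thesis by (intro measurable_restrict_space1 lebesgue_borel_measurable)
qed

lemma slice_measurable:
  fixes u :: "real \<Rightarrow> R3 \<Rightarrow> 'b::euclidean_space"
  assumes [measurable]: "spacetime u \<in> borel_measurable (lborel \<Otimes>\<^sub>M lborel)"
  shows "u t \<in> borel_measurable borel"
proof -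
  have "(\<lambda>x. spacetime u (x, t)) \<in> borel_measurable lborel" by measurable
  then show ?thesis by simp
qed

lemma gauge_finite:
  fixes S :: real
  assumes r: "r > 0" and le: "\<And>t. N t \<le> ennreal (K t)" "\<And>t. K t \<ge> 0"
    and fin: "(\<integral>\<^sup>+ t. ennreal (K t powr r) * indicator {0<..<S} t \<partial>lborel) < \<infinity>"
  shows "Lp_gauge (ennreal r) (lebesgue_on {0<..<S}) N < \<infinity>"
proof -
  have "(\<integral>\<^sup>+ t. enn_powr (N t) r \<partial>lebesgue_on {0<..<S}) \<le> (\<integral>\<^sup>+ t. ennreal (K t powr r) \<partial>lebesgue_on {0<..<S})"
    by (intro nn_integral_mono) (use enn_powr_mono[OF le(1), of r] r le(2) in \<open>simp add: enn_powr_ennreal\<close>)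
  also have "\<dots> = (\<integral>\<^sup>+ t. ennreal (K t powr r) * indicator {0<..<S} t \<partial>lborel)"
    by (subst nn_integral_restrict_space) (auto simp: nn_integral_completion)
  finally have "(\<integral>\<^sup>+ t. enn_powr (N t) r \<partial>lebesgue_on {0<..<S}) < \<infinity>" using fin by (rule order_le_less_trans)
  then have "enn_powr (\<integral>\<^sup>+ t. enn_powr (N t) r \<partial>lebesgue_on {0<..<S}) (1 / r) < \<infinity>"
    by (simp only: enn_powr_less_top)
  then show ?thesis using r by (simp add: Lp_gauge_def)
qed

text \<open>Unit balls have one finite volume, so the L^q norm of each slice is at most a constant
  times its supremum, for every q; what remains is integrability in time of the bound H.\<close>

lemma LrLq_I:
  fixes u :: "real \<Rightarrow> R3 \<Rightarrow> 'b::euclidean_space"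
  assumes m: "spacetime u \<in> borel_measurable (lborel \<Otimes>\<^sub>M lborel)"
    and le: "\<And>t x. norm (u t x) \<le> H t * indicator (cball (c t) 1) x" and H: "\<And>t. H t \<ge> 0" "H \<in> borel_measurable borel"
    and rq: "r > 0" "q > 0" and fin: "(\<integral>\<^sup>+ t. ennreal (H t powr r) * indicator {0<..<S} t \<partial>lborel) < \<infinity>"
  shows "u \<in> LrLq (ennreal r) (ennreal q) S"
  unfolding Bochner_def
proof (intro CollectI conjI)
  have n: "Lp_norm (ennreal q) (u t) \<le> ennreal (H t * vol1 powr (1 / q))" for t
    by (rule Lp_norm_ball[OF le H(1) rq(2)])
  show "spacetime u \<in> borel_measurable (lebesgue_on (UNIV \<times> {0<..<S}))" by (rule spacetime_lebesgue_on[OF m])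
  have "Lp_norm (ennreal q) (u t) < \<infinity>" for t using n[of t] by (simp add: order_le_less_trans)
  then show "AE t in lebesgue_on {0<..<S}. u t \<in> Lp (ennreal q)"
    using lebesgue_borel_measurable[OF slice_measurable[OF m]] by (simp add: Lp_def)
  show "Lp_gauge (ennreal r) (lebesgue_on {0<..<S}) (\<lambda>t. Lp_norm (ennreal q) (u t)) < \<infinity>"
  proof (rule gauge_finite[OF rq(1) n])
    have [measurable]: "H \<in> borel_measurable borel" by (rule H(2))
    show "0 \<le> H t * vol1 powr (1 / q)" for t using H(1) by simp
    have "(\<integral>\<^sup>+ t. ennreal ((H t * vol1 powr (1 / q)) powr r) * indicator {0<..<S} t \<partial>lborel)
        = (\<integral>\<^sup>+ t. ennreal ((vol1 powr (1 / q)) powr r) * (ennreal (H t powr r) * indicator {0<..<S} t) \<partial>lborel)"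
      using H(1) by (intro nn_integral_cong) (simp add: powr_mult ennreal_mult mult.commute mult.left_commute)
    also have "\<dots> = ennreal ((vol1 powr (1 / q)) powr r) * (\<integral>\<^sup>+ t. ennreal (H t powr r) * indicator {0<..<S} t \<partial>lborel)"
      by (rule nn_integral_cmult) measurable
    also have "\<dots> < \<infinity>" using fin by (simp add: ennreal_mult_less_top)
    finally show "(\<integral>\<^sup>+ t. ennreal ((H t * vol1 powr (1 / q)) powr r) * indicator {0<..<S} t \<partial>lborel) < \<infinity>" .
  qed
qed

lemma const_powr_int: fixes S :: real shows "(\<integral>\<^sup>+ t. ennreal (K powr r) * indicator {0<..<S} t \<partial>lborel) < \<infinity>"
proof -
  have "emeasure lborel {0<..<S} < \<infinity>" by (cases "S \<ge> 0") auto
  then show ?thesis by (simp add: nn_integral_cmult_indicator ennreal_mult_less_top)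
qed

lemma integral_measurable:
  fixes g :: "R3 \<times> real \<Rightarrow> real"
  assumes [measurable]: "g \<in> borel_measurable (lborel \<Otimes>\<^sub>M lborel)"
  shows "(\<lambda>t. LINT x|lborel. g (x, t)) \<in> borel_measurable borel"
proof -
  have "(\<lambda>t. LINT x|lborel. g (x, t)) \<in> borel_measurable lborel"
    by (rule lborel.borel_measurable_lebesgue_integral) measurable
  then show ?thesis by simp
qed

lemma zero_Lp2: "(\<lambda>x. 0) \<in> (Lp 2 :: (R3 \<Rightarrow> R3) set)"
  by (rule Lp2_continuous_bsupp) (auto intro: bsuppI)

lemma zero_Hm1: "(\<lambda>t x. 0) \<in> Bochner 2 S Hm1 Hm1_norm"
  unfolding Bochner_def
proof (intro CollectI conjI)
  have "(\<lambda>x. 0) \<in> Hm1" unfolding Hm1_def using represents_Lp2[OF zero_Lp2] by blast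
  then show "AE t in lebesgue_on {0<..<S}. (\<lambda>x. 0) \<in> Hm1" by simp
  have "Hm1_norm (\<lambda>x. 0) \<le> 0"
    unfolding Hm1_norm_def by (rule SUP_least) (simp add: pairing_Lp2[OF zero_Lp2])
  then have "Lp_gauge (ennreal 2) (lebesgue_on {0<..<S}) (\<lambda>t. Hm1_norm (\<lambda>x. 0)) < \<infinity>"
    by (intro gauge_finite[of 2 _ "\<lambda>_. 0"]) auto
  then show "Lp_gauge 2 (lebesgue_on {0<..<S}) (\<lambda>t. Hm1_norm (\<lambda>x. 0)) < \<infinity>" by simp
qed simp

context flow
begin

lemma ball_le:
  fixes u :: "R3 \<Rightarrow> 'b::real_normed_vector"
  assumes "norm (u x) \<le> K" "1 < norm (x - c t) \<Longrightarrow> u x = 0"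
  shows "norm (u x) \<le> K * indicator (cball (c t) 1) x"
  using assms by (cases "x \<in> cball (c t) 1") (auto simp: dist_norm norm_minus_commute)

lemma V_ball: "norm (V t x) \<le> C * indicator (cball (c t) 1) x"
  by (rule ball_le[of "V t" x C t, OF V_le supp])

lemma pd_ball: "norm (pd i (V t) x) \<le> C * indicator (cball (c t) 1) x"
  by (rule ball_le[of "pd i (V t)" x C t, OF pd_le pd_supp])

lemma dt_ball: "norm (time_deriv V t x) \<le> C * indicator (cball (c t) 1) x"
  by (rule ball_le[of "time_deriv V t" x C t, OF dt_le supp_dt])

lemma V_LrLq: "r > 0 \<Longrightarrow> q > 0 \<Longrightarrow> V \<in> LrLq (ennreal r) (ennreal q) S"
  by (rule LrLq_I[OF V_meas V_ball C_nonneg _ _ _ const_powr_int]) auto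

lemma V_H1_norm: "H1_norm (V t) \<le> ennreal (sqrt (4 * (C\<^sup>2 * vol1)))"
proof -
  have p: "sqint (pd j (V t)) \<le> C\<^sup>2 * vol1" for j
    by (rule sqint_le_ball[OF Lp2_continuous_bsupp[OF slice_cont[OF pd_cont] integral_pd_eq_0(1)[OF V_slice V_bsupp]] pd_ball])
  have "sqint (V t) + sqint (wgrad (V t)) \<le> C\<^sup>2 * vol1 + (\<Sum>j\<in>(UNIV::3 set). C\<^sup>2 * vol1)"
    unfolding V_H1(3) by (intro add_mono sum_mono p sqint_le_ball[OF V_H1(1) V_ball])
  also have "\<dots> = 4 * (C\<^sup>2 * vol1)" by simp
  finally show ?thesis unfolding H1_norm_eq[OF V_H1(2)] by (intro ennreal_leI real_sqrt_le_mono)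
qed

lemma sqint_V_meas: "(\<lambda>t. sqint (V t)) \<in> borel_measurable borel"
proof -
  have "(\<lambda>z. (norm (spacetime V z))\<^sup>2) \<in> borel_measurable (lborel \<Otimes>\<^sub>M lborel)" by measurable
  from integral_measurable[OF this] have "(\<lambda>t. LINT x|lborel. (norm (V t x))\<^sup>2) \<in> borel_measurable borel" by simp
  moreover have "(\<lambda>x. (norm (V t x))\<^sup>2) \<in> borel_measurable borel" for t
    using slice_measurable[OF V_meas, of t] by simp
  ultimately show ?thesis by (simp add: lebesgue_eq_lborel)
qed

lemma V_Linf: "V \<in> Bochner \<infinity> S L2_sigma (Lp_norm 2)"
  unfolding Bochner_def
proof (intro CollectI conjI)
  show "spacetime V \<in> borel_measurable (lebesgue_on (UNIV \<times> {0<..<S}))" by (rule spacetime_lebesgue_on[OF V_meas])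
  show "AE t in lebesgue_on {0<..<S}. V t \<in> L2_sigma" by (simp add: V_sigma)
  \<comment> \<open>\<open>esssup\<close> has the value top for functions that are not measurable,
    so measurability in time has to come first.\<close>
  have m: "(\<lambda>t. Lp_norm 2 (V t)) \<in> borel_measurable (lebesgue_on {0<..<S})"
    unfolding Lp2_norm(1)[OF V_H1(1)]
    by (intro measurable_restrict_space1 lebesgue_borel_measurable measurable_compose[OF _ measurable_ennreal] borel_measurable_sqrt sqint_V_meas measurable_completion)
      (use sqint_V_meas in auto)
  have "Lp_norm 2 (V t) \<le> ennreal (C * vol1 powr (1 / 2))" for t
    using Lp_norm_ball[OF V_ball C_nonneg, of 2 t] by simp
  then have "esssup (lebesgue_on {0<..<S}) (\<lambda>t. Lp_norm 2 (V t)) \<le> ennreal (C * vol1 powr (1 / 2))"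
    unfolding esssup_eq_AE[OF m] by (intro Inf_lower) simp
  then show "Lp_gauge \<infinity> (lebesgue_on {0<..<S}) (\<lambda>t. Lp_norm 2 (V t)) < \<infinity>"
    by (simp add: Lp_gauge_def order_le_less_trans)
qed

lemma V_L2H1: "V \<in> Bochner 2 S H1 H1_norm"
  unfolding Bochner_def
proof (intro CollectI conjI)
  show "spacetime V \<in> borel_measurable (lebesgue_on (UNIV \<times> {0<..<S}))" by (rule spacetime_lebesgue_on[OF V_meas])
  show "AE t in lebesgue_on {0<..<S}. V t \<in> H1" using V_H1(2) by (intro AE_I2)
  have "Lp_gauge (ennreal 2) (lebesgue_on {0<..<S}) (\<lambda>t. H1_norm (V t)) < \<infinity>"
    by (rule gauge_finite[OF _ V_H1_norm _ const_powr_int]) (auto simp: vol1_nonneg)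
  then show "Lp_gauge 2 (lebesgue_on {0<..<S}) (\<lambda>t. H1_norm (V t)) < \<infinity>" by simp
qed

text \<open>The whole force goes into the L^1(0,S;L^2) summand; the other one is zero.\<close>

lemma forceB_forces: "forceB \<in> forces S"
proof -
  have "forceB \<in> LrLq (ennreal 1) (ennreal 2) S"
  proof (rule LrLq_I[OF forceB_meas forceB_le G_nonneg G_meas])
    show "(\<integral>\<^sup>+ t. ennreal (G t powr 1) * indicator {0<..<S} t \<partial>lborel) < \<infinity>"
    proof -
      have "(\<integral>\<^sup>+ t. ennreal (G t powr 1) * indicator {0<..<S} t \<partial>lborel) = (\<integral>\<^sup>+ t. ennreal (indicator {0<..<S} t * (G t * 1)) \<partial>lborel)"
        using G_nonneg by (intro nn_integral_cong) (auto simp: indicator_def)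
      then show ?thesis using G_int[of 1 S] by simp
    qed
  qed auto
  then have "forceB \<in> LrLq 1 2 S" by simp
  then show ?thesis unfolding forces_def
    by (intro CollectI bexI[of _ "\<lambda>t x. 0"] bexI[of _ forceB] zero_Hm1) simp
qed

text \<open>\<open>momentum\<close> on the half-open interval, with the Laplacian of the test field
  traded for gradients; no initial term appears because V starts from zero.\<close>

lemma weak_form:
  assumes \<phi>: "\<phi> \<in> test_fields S"
  shows "(LINT t|lebesgue_on {0<..<S}. LINT x|lebesgue.
           wgrad (V t) x \<bullet> grad (\<phi> t) x + convect (V t) x \<bullet> \<phi> t x - V t x \<bullet> time_deriv \<phi> t x)
        = (LINT t|lebesgue_on {0<..<S}. pairing (forceB t) (\<phi> t))"
proof -
  have \<phi>c: "spacetime \<phi> \<in> Cc_inf (UNIV \<times> {0..<S})" using \<phi> by (simp add: test_fields_def)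
  have "{0<..<S} \<subseteq> {0..<S}" by auto
  note m = momentum[OF \<phi>c this order_refl]
  have "(LINT t|lebesgue_on {0<..<S}. LINT x|lebesgue.
           wgrad (V t) x \<bullet> grad (\<phi> t) x + convect (V t) x \<bullet> \<phi> t x - V t x \<bullet> time_deriv \<phi> t x)
      = (LINT t|lebesgue_on {0<..<S}. LINT x|lebesgue.
        - (V t x \<bullet> time_deriv \<phi> t x) - V t x \<bullet> lap (\<phi> t) x + convect (V t) x \<bullet> \<phi> t x)"
  proof (rule Bochner_Integration.integral_cong[OF refl])
    fix t assume "t \<in> space (lebesgue_on {0<..<S})"
    then have t: "0 < t" "t < S" by auto
    have c2: "convect (V t) \<in> Lp 2"
    proof (rule Lp2_cong_AE(1)[OF conv_Lp2])
      have a: "AE x in lebesgue. (\<Sum>j\<in>UNIV. (V t x $ j) *\<^sub>R pd j (V t) x) = convect (V t) x"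
        using convect_V[of t] by eventually_elim simp
      then show "AE x in lebesgue. (\<Sum>j\<in>UNIV. (V t x $ j) *\<^sub>R pd j (V t) x) = convect (V t) x" .
      show "convect (V t) \<in> borel_measurable lebesgue"
        by (rule borel_measurable_AE[OF _ a]) (use conv_Lp2 in \<open>simp add: Lp2_iff\<close>)
    qed
    note \<phi>t = m(1)[OF t]
    have i: "integrable lebesgue (\<lambda>x. V t x \<bullet> time_deriv \<phi> t x)" "integrable lebesgue (\<lambda>x. V t x \<bullet> lap (\<phi> t) x)"
      "integrable lebesgue (\<lambda>x. convect (V t) x \<bullet> \<phi> t x)"
      by (rule Lp2_inner(1)[OF V_H1(1) m(2)[OF t]] Lp2_inner(1)[OF V_H1(1) Cc_inf_H1(1)[OF Cc_inf_lap[OF \<phi>t]]]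
          Lp2_inner(1)[OF c2 Cc_inf_H1(1)[OF \<phi>t]])+
    show "(LINT x|lebesgue. wgrad (V t) x \<bullet> grad (\<phi> t) x + convect (V t) x \<bullet> \<phi> t x - V t x \<bullet> time_deriv \<phi> t x)
      = (LINT x|lebesgue. - (V t x \<bullet> time_deriv \<phi> t x) - V t x \<bullet> lap (\<phi> t) x + convect (V t) x \<bullet> \<phi> t x)"
      using i H1_lap[OF V_H1(2) \<phi>t, of t] by simp
  qed
  then show ?thesis using m(3) by simp
qed

lemma V_pressure: "associated_pressure forceB V (\<lambda>t x. 0)"
  unfolding associated_pressure_def
proof (intro allI impI conjI)
  fix S :: real assume "S > 0"
  show "spacetime (\<lambda>t x. 0) \<in> (L1_loc (UNIV \<times> {0<..<S}) :: (R3 \<times> real \<Rightarrow> real) set)"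
    by (simp add: L1_loc_def case_prod_unfold)
  fix \<phi> :: "real \<Rightarrow> R3 \<Rightarrow> R3" assume \<phi>: "spacetime \<phi> \<in> Cc_inf (UNIV \<times> {0<..<S})"
  have s: "{0<..<S} \<subseteq> {0..<S}" by auto
  show "(LINT t|lebesgue_on {0<..<S}. LINT x|lebesgue.
           - (V t x \<bullet> time_deriv \<phi> t x) - V t x \<bullet> lap (\<phi> t) x
             + convect (V t) x \<bullet> \<phi> t x - 0 * divg (\<phi> t) x)
        = (LINT t|lebesgue_on {0<..<S}. pairing (forceB t) (\<phi> t))"
    using momentum(3)[OF \<phi> order_refl s] by simp
qed

end

section \<open>Energy equality and continuity in time\<close>

context flow
begin

lemma lap_energy: "t \<notin> Z \<Longrightarrow> (LINT x|lebesgue. lap (V t) x \<bullet> V t x) = - sqint (wgrad (V t))"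
proof -
  assume t: "t \<notin> Z"
  have "(LINT x|lebesgue. wgrad (V t) x \<bullet> grad (V t) x) = sqint (wgrad (V t))"
  proof (rule integral_cong_AE)
    show "(\<lambda>x. wgrad (V t) x \<bullet> grad (V t) x) \<in> borel_measurable lebesgue"
      using H1_lap(2)[OF V_H1(2) V_test[OF t]] by (rule borel_measurable_integrable)
    show "(\<lambda>x. (norm (wgrad (V t) x))\<^sup>2) \<in> borel_measurable lebesgue"
      using H1_D(4)[OF V_H1(2)] by (auto simp: Lp2_iff)
    show "AE x in lebesgue. wgrad (V t) x \<bullet> grad (V t) x = (norm (wgrad (V t) x))\<^sup>2"
      using wgrad_eq_AE[OF weak_deriv_pd[OF V_slice[of t]]]
      by eventually_elim (simp add: grad_def power2_norm_eq_inner)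
  qed
  then show ?thesis using H1_lap(1)[OF V_H1(2) V_test[OF t], of t] by (simp add: inner_commute)
qed

lemma grad_norm_sq: "t \<notin> Z \<Longrightarrow> grad (\<lambda>x. (V t x \<bullet> V t x) / 2) x = (\<chi> i. V t x \<bullet> pd i (V t) x)"
  and norm_sq_test: "t \<notin> Z \<Longrightarrow> (\<lambda>x. (V t x \<bullet> V t x) / 2) \<in> Cc_inf UNIV"
proof -
  assume t: "t \<notin> Z"
  have T: "(\<lambda>x. V t x \<bullet> V t x) \<in> Cc_inf UNIV"
    by (rule Cc_inf_bilinear[OF bounded_bilinear_inner V_test[OF t] smooth_onI[OF V_slice_smooth[OF t]]])
  have "bounded_linear (\<lambda>a::real. a / 2)" by (rule bounded_linear_divide)
  from Cc_inf_bounded_linear[OF this T] show "(\<lambda>x. (V t x \<bullet> V t x) / 2) \<in> Cc_inf UNIV" .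
  have "pd i (\<lambda>x. (V t x \<bullet> V t x) / 2) x = V t x \<bullet> pd i (V t) x" for i
  proof -
    have "pd i (\<lambda>x. (1 / 2) *\<^sub>R (V t x \<bullet> V t x)) x = (1 / 2) *\<^sub>R pd i (\<lambda>x. V t x \<bullet> V t x) x"
      by (rule pd_scaleR[OF Cc_inf_smooth[OF T, of "Suc 0"]])
    also have "pd i (\<lambda>x. V t x \<bullet> V t x) x = V t x \<bullet> pd i (V t) x + pd i (V t) x \<bullet> V t x"
      by (rule pd_bilinear[OF bounded_bilinear_inner V_slice V_slice])
    finally show ?thesis by (simp add: inner_commute)
  qed
  then show "grad (\<lambda>x. (V t x \<bullet> V t x) / 2) x = (\<chi> i. V t x \<bullet> pd i (V t) x)" by (simp add: grad_def)
qed

text \<open>\<open>(u \<cdot> \<nabla>)V \<cdot> V = u \<cdot> \<nabla>(|V|\<^sup>2/2)\<close> integrates to zero for solenoidal \<open>u\<close>.\<close>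

lemma transport_zero:
  assumes t: "t \<notin> Z" and u: "u \<in> L2_sigma"
  shows "(LINT x|lebesgue. (\<Sum>j\<in>UNIV. (u x $ j) *\<^sub>R pd j (V t) x) \<bullet> V t x) = 0"
proof -
  have "(LINT x|lebesgue. u x \<bullet> grad (\<lambda>x. (V t x \<bullet> V t x) / 2) x) = 0"
    using u norm_sq_test[OF t] unfolding L2_sigma_def by blast
  moreover have "u x \<bullet> grad (\<lambda>x. (V t x \<bullet> V t x) / 2) x = (\<Sum>j\<in>UNIV. (u x $ j) *\<^sub>R pd j (V t) x) \<bullet> V t x" for x
    unfolding grad_norm_sq[OF t] by (simp add: inner_vec_def[of "u x"] inner_sum_left) (simp add: inner_commute)
  ultimately show ?thesis by simp
qed

definition kin :: "R3 \<times> real \<Rightarrow> real" where "kin z = spacetime (time_deriv V) z \<bullet> spacetime V z"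

lemma kin_meas [measurable]: "kin \<in> borel_measurable (lborel \<Otimes>\<^sub>M lborel)"
  unfolding kin_def by measurable

lemma kin_int: "integrable (lborel \<Otimes>\<^sub>M lborel) (\<lambda>z. indicator {0<..<S} (snd z) *\<^sub>R kin z)"
proof (rule integrable_moving_ball[OF _ c_meas _ _ G_int[OF C_nonneg]])
  fix x t
  have "norm (kin (x, t)) \<le> norm (time_deriv V t x) * norm (V t x)"
    using Cauchy_Schwarz_ineq2 by (simp add: kin_def)
  also have "\<dots> \<le> C * (C * indicator (cball (c t) 1) x)"
    using C_nonneg by (intro mult_mono dt_le V_ball) auto
  also have "\<dots> \<le> G t * (C * indicator (cball (c t) 1) x)"
    using C_nonneg F_nonneg[of t] by (intro mult_right_mono) (auto simp: G_def)
  finally show "norm (indicator {0<..<S} (snd (x, t)) *\<^sub>R kin (x, t)) \<le> indicator {0<..<S} t * (G t * C) * indicator (cball (c t) 1) x"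
    by (cases "t \<in> {0<..<S}") (auto simp: mult.assoc)
qed measurable

text \<open>For fixed x the fundamental theorem of calculus applies to |V|^2 / 2, which is zero at
  time 0; Fubini then exchanges the integrals in s and x.\<close>

lemma sqint_V:
  assumes t: "t > 0"
  shows "sqint (V t) = 2 * (LINT s|lebesgue_on {0<..<t}. LINT x|lebesgue. kin (x, s))"
proof -
  have ptw: "(LINT s|lborel. indicator {0<..<t} s *\<^sub>R kin (x, s)) = (norm (V t x))\<^sup>2 / 2" for x
  proof -
    have d: "((\<lambda>s. (V s x \<bullet> V s x) / 2) has_vector_derivative kin (x, s)) (at s within {0..t})" for s
    proof -
      have "((\<lambda>s. V s x \<bullet> V s x) has_vector_derivative V s x \<bullet> time_deriv V s x + time_deriv V s x \<bullet> V s x) (at s)"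
        by (rule bounded_bilinear.has_vector_derivative[OF bounded_bilinear_inner dt(2) dt(2)])
      then have "((\<lambda>s. (V s x \<bullet> V s x) / 2) has_vector_derivative (V s x \<bullet> time_deriv V s x + time_deriv V s x \<bullet> V s x) / 2) (at s)"
        by (rule bounded_linear.has_vector_derivative[OF bounded_linear_divide])
      then have "((\<lambda>s. (V s x \<bullet> V s x) / 2) has_vector_derivative kin (x, s)) (at s)"
        by (simp add: kin_def inner_commute)
      then show ?thesis by (rule has_vector_derivative_at_within)
    qed
    have kc: "continuous_on {0..t} (\<lambda>s. kin (x, s))"
    proof -
      have "continuous_on UNIV kin" unfolding kin_def by (intro continuous_on_inner V_cont dt(1))
      then show ?thesis by (rule continuous_on_compose2) (auto intro: continuous_intros)
    qed
    have "(LINT s|lborel. indicator {0..t} s *\<^sub>R kin (x, s)) = (V t x \<bullet> V t x) / 2 - (V 0 x \<bullet> V 0 x) / 2"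
      by (rule integral_FTC_Icc[OF _ d kc]) (use t in auto)
    moreover have "(LINT s|lborel. indicator {0<..<t} s *\<^sub>R kin (x, s)) = (LINT s|lborel. indicator {0..t} s *\<^sub>R kin (x, s))"
    proof (rule integral_cong_AE)
      have km: "(\<lambda>s. kin (x, s)) \<in> borel_measurable lborel" by measurable
      then show "(\<lambda>s. indicator {0<..<t} s *\<^sub>R kin (x, s)) \<in> borel_measurable lborel"
        "(\<lambda>s. indicator {0..t} s *\<^sub>R kin (x, s)) \<in> borel_measurable lborel" by simp_all
      have "AE s in lborel. s \<notin> {0, t}" by (intro AE_not_in countable_imp_null_set_lborel) auto
      then show "AE s in lborel. indicator {0<..<t} s *\<^sub>R kin (x, s) = indicator {0..t} s *\<^sub>R kin (x, s)"
        by eventually_elim (auto simp: indicator_def)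
    qed
    ultimately show ?thesis using early[of 0 x] t0 by (simp add: power2_norm_eq_inner)
  qed
  note i = kin_int[of t]
  have "(LINT s|lebesgue_on {0<..<t}. LINT x|lebesgue. kin (x, s)) = (LINT z|(lborel \<Otimes>\<^sub>M lborel). indicator {0<..<t} (snd z) *\<^sub>R kin z)"
    by (rule iterated_integral(1)[OF kin_meas i])
  also have "\<dots> = (LINT x|lborel. LINT s|lborel. indicator {0<..<t} s *\<^sub>R kin (x, s))"
    using lborel_pair.integral_fst[of "\<lambda>x s. indicator {0<..<t} s *\<^sub>R kin (x, s)"] i by (simp add: case_prod_unfold)
  also have "\<dots> = (LINT x|lborel. (norm (V t x))\<^sup>2 / 2)" unfolding ptw ..
  also have "\<dots> = sqint (V t) / 2"
    using lebesgue_eq_lborel(1)[of "\<lambda>x. (norm (V t x))\<^sup>2"] slice_measurable[OF V_meas, of t] by simp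
  finally show ?thesis by simp
qed

lemma pairing_V: "pairing (forceB t) (V t) = (LINT x|lebesgue. forceB t x \<bullet> V t x)"
  by (rule pairing_Lp2[OF forceB_Lp2 V_H1(2)])

text \<open>In the product of the force with V the Laplacian yields the dissipation, and the
  convective term drops out by \<open>transport_zero\<close> with u = V.\<close>

lemma power_balance: "t \<notin> Z \<Longrightarrow> pairing (forceB t) (V t) = (LINT x|lebesgue. kin (x, t)) + sqint (wgrad (V t))"
  unfolding pairing_V using force_inner[OF _ V_H1(1), of t] lap_energy[of t] transport_zero[OF _ V_sigma, of t]
  by (simp add: forceB kin_def)

lemma sqint_wgrad_int: "integrable (lebesgue_on {0<..<S}) (\<lambda>t. sqint (wgrad (V t)))"
proof -
  define g where "g z = (\<Sum>j\<in>UNIV. (norm (spacetime (\<lambda>t. pd j (V t)) z))\<^sup>2)" for z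
  have gm [measurable]: "g \<in> borel_measurable (lborel \<Otimes>\<^sub>M lborel)" unfolding g_def by measurable
  have m1: "(\<lambda>z. indicator {0<..<S} (snd z) *\<^sub>R g z) \<in> borel_measurable (lborel \<Otimes>\<^sub>M lborel)" by measurable
  have m2: "(\<lambda>t. indicator {0<..<S} t * (G t * 1)) \<in> borel_measurable borel" by measurable
  have gi: "integrable (lborel \<Otimes>\<^sub>M lborel) (\<lambda>z. indicator {0<..<S} (snd z) *\<^sub>R g z)"
  proof (rule integrable_moving_ball[OF m1 c_meas m2 _ G_int[of 1]])
    fix x t
    have "norm (g (x, t)) \<le> (\<Sum>j\<in>(UNIV::3 set). C\<^sup>2 * indicator (cball (c t) 1) x)"
      unfolding g_def real_norm_def
    proof (subst abs_of_nonneg, simp add: sum_nonneg, rule sum_mono)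
      fix j :: 3
      have "(norm (pd j (V t) x))\<^sup>2 \<le> (C * indicator (cball (c t) 1) x)\<^sup>2" by (rule power_mono[OF pd_ball]) simp
      then show "(norm (spacetime (\<lambda>t. pd j (V t)) (x, t)))\<^sup>2 \<le> C\<^sup>2 * indicator (cball (c t) 1) x"
        by (cases "x \<in> cball (c t) 1") simp_all
    qed
    also have "\<dots> \<le> G t * indicator (cball (c t) 1) x"
      using C_nonneg F_nonneg[of t] by (cases "x \<in> cball (c t) 1") (simp_all add: G_def)
    finally show "norm (indicator {0<..<S} (snd (x, t)) *\<^sub>R g (x, t)) \<le> indicator {0<..<S} t * (G t * 1) * indicator (cball (c t) 1) x"
      by (cases "t \<in> {0<..<S}") auto
  qed simp
  have "(LINT x|lebesgue. g (x, t)) = sqint (wgrad (V t))" for t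
  proof -
    have "integrable lebesgue (\<lambda>x. (norm (pd j (V t) x))\<^sup>2)" for j
      using Lp2_continuous_bsupp[OF slice_cont[OF pd_cont] integral_pd_eq_0(1)[OF V_slice V_bsupp]] by (simp add: Lp2_iff)
    then show ?thesis unfolding V_H1(3) g_def by simp
  qed
  then show ?thesis using iterated_integral(2)[OF gm gi] by simp
qed

lemma energy_equality:
  assumes t: "t > 0"
  shows "energy_lhs V t = energy_rhs (\<lambda>x. 0) forceB V t"
proof -
  have "AE s in lebesgue_on {0<..<t}. pairing (forceB s) (V s) = (LINT x|lebesgue. kin (x, s)) + sqint (wgrad (V s))"
    by (rule AE_lebesgue_on_countable[OF Z(2)]) (rule power_balance)
  from lebesgue_on_AE_cong(2)[OF Bochner_Integration.integrable_add[OF iterated_integral(2)[OF kin_meas kin_int] sqint_wgrad_int] this]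
  have P: "(LINT s|lebesgue_on {0<..<t}. pairing (forceB s) (V s))
      = (LINT s|lebesgue_on {0<..<t}. LINT x|lebesgue. kin (x, s)) + (LINT s|lebesgue_on {0<..<t}. sqint (wgrad (V s)))"
    using iterated_integral(2)[OF kin_meas kin_int, of t] sqint_wgrad_int[of t] by simp
  have "(L2_norm (wgrad (V s)))\<^sup>2 = sqint (wgrad (V s))" for s by (rule Lp2_norm(2)[OF H1_D(4)[OF V_H1(2)]])
  then show ?thesis
    unfolding energy_lhs_def energy_rhs_def Lp2_norm(2)[OF V_H1(1)] Lp2_norm(2)[OF zero_Lp2] P sqint_V[OF t] by simp
qed

lemma zero_sigma: "(\<lambda>x. 0) \<in> L2_sigma"
  by (simp add: L2_sigma_def zero_Lp2)

lemma V_Leray_Hopf: "Leray_Hopf S (\<lambda>x. 0) forceB V"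
  unfolding Leray_Hopf_def
proof (intro conjI ballI)
  show "(\<lambda>x. 0) \<in> L2_sigma" by (rule zero_sigma)
  show "forceB \<in> forces S" by (rule forceB_forces)
  show "V \<in> Bochner \<infinity> S L2_sigma (Lp_norm 2)" by (rule V_Linf)
  show "V \<in> Bochner 2 S H1 H1_norm" by (rule V_L2H1)
  show "(LINT t|lebesgue_on {0<..<S}. LINT x|lebesgue.
           wgrad (V t) x \<bullet> grad (\<phi> t) x + convect (V t) x \<bullet> \<phi> t x - V t x \<bullet> time_deriv \<phi> t x)
        = (LINT t|lebesgue_on {0<..<S}. pairing (forceB t) (\<phi> t)) + (LINT x|lebesgue. 0 \<bullet> \<phi> 0 x)"
    if "\<phi> \<in> test_fields S" for \<phi>
    unfolding weak_form[OF that] by simp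
  show "V t \<in> Lp 2" for t by (rule V_H1(1))
  show "energy_lhs V t \<le> energy_rhs (\<lambda>x. 0) forceB V t" if "t \<in> {0<..S}" for t
    using energy_equality[of t] that by simp
qed

text \<open>V is Lipschitz in time with constant C, uniformly in x, and the difference of two slices
  lives in two unit balls.\<close>

lemma V_C0: "V \<in> C0_L2"
  unfolding C0_L2_def
proof (intro CollectI conjI allI impI V_H1(1))
  fix t :: real
  have lip: "norm (V s x - V t x) \<le> C * \<bar>s - t\<bar>" for s x
  proof -
    have "norm (V s x - V t x) \<le> C * norm (s - t)"
    proof (rule differentiable_bound[of UNIV "\<lambda>s. V s x" "\<lambda>s r. r *\<^sub>R time_deriv V s x"])
      show "onorm (\<lambda>r. r *\<^sub>R time_deriv V s x) \<le> C" for s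
        using dt_le[of s x] by (intro onorm_le) (simp add: mult.commute[of C] mult_left_mono)
    qed (use dt(2) in \<open>auto simp: has_vector_derivative_def\<close>)
    then show ?thesis by simp
  qed
  have le: "Lp_norm 2 (\<lambda>x. V s x - V t x) \<le> ennreal (sqrt (2 * vol1) * C * \<bar>s - t\<bar>)" for s
  proof -
    have d: "(\<lambda>x. V s x - V t x) \<in> Lp 2" by (rule Lp2_diff[OF V_H1(1) V_H1(1)])
    have "(norm (V s x - V t x))\<^sup>2 \<le> (C * \<bar>s - t\<bar>)\<^sup>2 * indicator (cball (c s) 1) x + (C * \<bar>s - t\<bar>)\<^sup>2 * indicator (cball (c t) 1) x" for x
    proof (cases "x \<in> cball (c s) 1 \<or> x \<in> cball (c t) 1")
      case True
      define k where "k = (C * \<bar>s - t\<bar>)\<^sup>2"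
      have "(norm (V s x - V t x))\<^sup>2 \<le> k" unfolding k_def by (rule power_mono[OF lip]) simp
      moreover have "0 \<le> k" by (simp add: k_def)
      ultimately show ?thesis using True unfolding k_def[symmetric] by (auto simp: indicator_def)
    next
      case False
      then have "V s x = 0" "V t x = 0" by (auto intro!: supp simp: dist_norm norm_minus_commute)
      then show ?thesis by simp
    qed
    then have "sqint (\<lambda>x. V s x - V t x) \<le> (LINT x|lebesgue. (C * \<bar>s - t\<bar>)\<^sup>2 * indicator (cball (c s) 1) x + (C * \<bar>s - t\<bar>)\<^sup>2 * indicator (cball (c t) 1) x)"
      using d by (intro integral_mono Bochner_Integration.integrable_add indicator_ball_integral) (auto simp: Lp2_iff)
    also have "\<dots> = (C * \<bar>s - t\<bar>)\<^sup>2 * vol1 + (C * \<bar>s - t\<bar>)\<^sup>2 * vol1"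
      by (subst Bochner_Integration.integral_add[OF indicator_ball_integral(1) indicator_ball_integral(1)]) (simp only: indicator_ball_integral(2))
    finally have "sqrt (sqint (\<lambda>x. V s x - V t x)) \<le> sqrt (2 * vol1 * (C * \<bar>s - t\<bar>)\<^sup>2)" by (intro real_sqrt_le_mono) simp
    also have "\<dots> = sqrt (2 * vol1) * C * \<bar>s - t\<bar>" using C_nonneg by (simp add: real_sqrt_mult)
    finally show ?thesis unfolding Lp2_norm(1)[OF d] by (rule ennreal_leI)
  qed
  have "((\<lambda>s. ennreal (sqrt (2 * vol1) * C * \<bar>s - t\<bar>)) \<longlongrightarrow> ennreal (sqrt (2 * vol1) * C * \<bar>t - t\<bar>)) (at t within {0..})"
    by (intro tendsto_ennrealI tendsto_intros)
  then have "((\<lambda>s. ennreal (sqrt (2 * vol1) * C * \<bar>s - t\<bar>)) \<longlongrightarrow> 0) (at t within {0..})" by simp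
  then show "((\<lambda>s. Lp_norm 2 (\<lambda>x. V s x - V t x)) \<longlongrightarrow> 0) (at t within {0..})"
    by (rule tendsto_sandwich[OF _ _ tendsto_const, rotated 2]) (auto simp: le)
qed

end

subsection \<open>The bubble\<close>

text \<open>Quadratic at s = 0 to outweigh the dilation, and zero for |s| \<ge> 1, so that a bubble
  is active on a bounded time interval only.\<close>

definition amp :: "real \<Rightarrow> real" where "amp s = s\<^sup>2 * flat 0 (1 - s\<^sup>2)"

text \<open>This is |s|^(-\<gamma>) off 0; writing it through the square makes smoothness for both
  signs of s immediate. At s = 0, where \<open>powr\<close> gives 0, the factor \<open>amp\<close>
  vanishes.\<close>

definition dil :: "real \<Rightarrow> real \<Rightarrow> real" where "dil \<gamma> s = (s\<^sup>2) powr (- \<gamma> / 2)"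

definition bubble :: "real \<Rightarrow> real \<Rightarrow> R3 \<Rightarrow> R3" where
  "bubble \<gamma> s y = amp s *\<^sub>R swirl (dil \<gamma> s *\<^sub>R y)"

lemma C_on_amp: "C_on k UNIV amp"
proof -
  have "C_on k UNIV (\<lambda>s::real. (s \<bullet> s) * flat 0 (1 - 1 * (s \<bullet> s)))" for k
    by (rule C_on_mult[OF C_on_inner[OF C_on_id C_on_id] C_on_flat_radial])
  then show ?thesis by (simp add: amp_def[abs_def] power2_eq_square)
qed

lemma amp_bounds: "0 \<le> amp s" "amp s \<le> s\<^sup>2" "\<bar>s\<bar> \<ge> 1 \<Longrightarrow> amp s = 0" "amp 0 = 0"
proof -
  show "0 \<le> amp s" by (simp add: amp_def flat_nonneg)
  have "flat 0 (1 - s\<^sup>2) \<le> 1" using flat_le[of 0] by simp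
  then show "amp s \<le> s\<^sup>2" using mult_left_mono[of "flat 0 (1 - s\<^sup>2)" 1 "s\<^sup>2"] by (simp add: amp_def)
  show "amp s = 0" if "\<bar>s\<bar> \<ge> 1"
  proof -
    have "1 \<le> s\<^sup>2" using that abs_le_square_iff[of 1 s] by simp
    then show ?thesis by (simp add: amp_def flat_def)
  qed
  show "amp 0 = 0" by (simp add: amp_def)
qed

lemma amp_deriv: "(amp has_real_derivative (2 * s * flat 0 (1 - s\<^sup>2) - 2 * s ^ 3 * flat 2 (1 - s\<^sup>2))) (at s)"
proof -
  have "((\<lambda>s. 1 - s\<^sup>2) has_real_derivative (- 2 * s)) (at s)"
    by (auto intro!: derivative_eq_intros)
  from DERIV_chain2[OF flat_has_deriv[of 0] this]
  have "((\<lambda>s. flat 0 (1 - s\<^sup>2)) has_real_derivative flat 2 (1 - s\<^sup>2) * (- 2 * s)) (at s)"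
    by (simp add: numeral_2_eq_2)
  moreover have "((\<lambda>s. s\<^sup>2) has_real_derivative 2 * s) (at s)"
    by (auto intro!: derivative_eq_intros)
  ultimately have "((\<lambda>s. s\<^sup>2 * flat 0 (1 - s\<^sup>2)) has_real_derivative
      2 * s * flat 0 (1 - s\<^sup>2) + (flat 2 (1 - s\<^sup>2) * (- 2 * s)) * s\<^sup>2) (at s)"
    by (intro DERIV_mult)
  moreover have "2 * s * flat 0 (1 - s\<^sup>2) + (flat 2 (1 - s\<^sup>2) * (- 2 * s)) * s\<^sup>2
      = 2 * s * flat 0 (1 - s\<^sup>2) - 2 * s ^ 3 * flat 2 (1 - s\<^sup>2)"
    by (simp add: power2_eq_square power3_eq_cube)
  ultimately show ?thesis unfolding amp_def[abs_def] by (simp only:)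
qed

lemma amp_deriv_bound:
  "\<bar>2 * s * flat 0 (1 - s\<^sup>2) - 2 * s ^ 3 * flat 2 (1 - s\<^sup>2)\<bar> \<le> 6 * \<bar>s\<bar>"
proof (cases "\<bar>s\<bar> < 1")
  case True
  have f: "0 \<le> flat 0 (1 - s\<^sup>2)" "flat 0 (1 - s\<^sup>2) \<le> 1" "0 \<le> flat 2 (1 - s\<^sup>2)" "flat 2 (1 - s\<^sup>2) \<le> 2"
    using flat_le[of 0] flat_le[of 2 "1 - s\<^sup>2"] flat_nonneg by (auto simp: fact_2)
  have "\<bar>s\<bar> ^ 3 \<le> \<bar>s\<bar>" using True power_decreasing[of 1 3 "\<bar>s\<bar>"] by simp
  then have "\<bar>s ^ 3 * flat 2 (1 - s\<^sup>2)\<bar> \<le> \<bar>s\<bar> * 2"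
    unfolding abs_mult power_abs using f by (intro mult_mono) auto
  moreover have "\<bar>s * flat 0 (1 - s\<^sup>2)\<bar> \<le> \<bar>s\<bar> * 1"
    unfolding abs_mult using f by (intro mult_mono) auto
  ultimately show ?thesis by linarith
next
  case False
  then have "1 \<le> s\<^sup>2" using abs_le_square_iff[of 1 s] by simp
  then show ?thesis by (simp add: flat_def)
qed

lemma dil_eq: "s \<noteq> 0 \<Longrightarrow> dil \<gamma> s = \<bar>s\<bar> powr (- \<gamma>)"
proof -
  assume "s \<noteq> 0"
  then have "s\<^sup>2 = \<bar>s\<bar> powr 2" by (simp add: powr_numeral)
  then have "dil \<gamma> s = (\<bar>s\<bar> powr 2) powr (- \<gamma> / 2)" by (simp only: dil_def)
  also have "\<dots> = \<bar>s\<bar> powr (- \<gamma>)" unfolding powr_powr by simp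
  finally show ?thesis .
qed

lemma C_on_dil: "C_on k (- {0}) (dil \<gamma>)"
proof -
  have "C_on k (- {0}) (\<lambda>s::real. s \<bullet> s)" by (rule C_on_inner[OF C_on_id C_on_id])
  then have "C_on k (- {0}) (\<lambda>s::real. (s \<bullet> s) powr (- \<gamma> / 2))"
    by (intro C_on_compose[OF C_on_powr]) (auto simp: zero_less_mult_iff)
  then show ?thesis by (simp add: dil_def[abs_def] power2_eq_square)
qed

lemma dil_deriv:
  assumes "s \<noteq> 0"
  shows "(dil \<gamma> has_real_derivative (- \<gamma> / s * dil \<gamma> s)) (at s)"
proof -
  have "((\<lambda>s. s\<^sup>2) has_real_derivative 2 * s) (at s)"
    by (auto intro!: derivative_eq_intros)
  from DERIV_fun_powr[OF this, of "- \<gamma> / 2"]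
  have "(dil \<gamma> has_real_derivative (- \<gamma> / 2) * (s\<^sup>2) powr (- \<gamma> / 2 - 1) * (2 * s)) (at s)"
    using assms unfolding dil_def[abs_def] by simp
  moreover have "(s\<^sup>2) powr (- \<gamma> / 2 - 1) = dil \<gamma> s / s\<^sup>2"
    using assms by (simp add: dil_def powr_diff)
  moreover have "(- \<gamma> / 2) * (dil \<gamma> s / s\<^sup>2) * (2 * s) = - \<gamma> / s * dil \<gamma> s"
    using assms by (simp add: power2_eq_square)
  ultimately show ?thesis by (simp only:)
qed

lemma bubble_zero: "s = 0 \<or> \<bar>s\<bar> \<ge> 1 \<Longrightarrow> bubble \<gamma> s y = 0"
  by (auto simp: bubble_def amp_bounds)

lemma dil_ge_1: "s \<noteq> 0 \<Longrightarrow> \<bar>s\<bar> \<le> 1 \<Longrightarrow> \<gamma> \<ge> 0 \<Longrightarrow> dil \<gamma> s \<ge> 1"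
proof -
  assume *: "s \<noteq> 0" "\<bar>s\<bar> \<le> 1" "\<gamma> \<ge> 0"
  then have "1 powr (- \<gamma>) \<le> \<bar>s\<bar> powr (- \<gamma>)" by (intro powr_mono2') auto
  then show ?thesis using * by (simp add: dil_eq)
qed

lemma bubble_supp:
  assumes "norm y \<ge> 1" "\<gamma> \<ge> 0"
  shows "bubble \<gamma> s y = 0"
proof (cases "s = 0 \<or> \<bar>s\<bar> \<ge> 1")
  case False
  then have "1 \<le> dil \<gamma> s * norm y"
    using mult_mono[of 1 "dil \<gamma> s" 1 "norm y"] dil_ge_1[of s \<gamma>] assms by simp
  then have "swirl (dil \<gamma> s *\<^sub>R y) = 0"
    by (intro swirl_supp) (simp add: dil_def)
  then show ?thesis by (simp add: bubble_def)
qed (rule bubble_zero)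

lemma C_on_fst: "C_on k A fst" and C_on_snd: "C_on k A snd"
  by (auto intro: C_on_linear bounded_linear_fst bounded_linear_snd)

lemma C_on_bubble_off: "C_on k (UNIV \<times> (- {0})) (spacetime (bubble \<gamma>))"
proof -
  have sn: "C_on k (UNIV \<times> (- {0})) (\<lambda>z::R3 \<times> real. dil \<gamma> (snd z))"
    by (rule C_on_compose[OF C_on_dil C_on_snd]) auto
  have "C_on k (UNIV \<times> (- {0})) (\<lambda>z::R3 \<times> real. amp (snd z) *\<^sub>R swirl (dil \<gamma> (snd z) *\<^sub>R fst z))"
    by (intro C_on_scaleR C_on_compose[OF C_on_amp C_on_snd] C_on_compose[OF swirl_smooth C_on_scaleR[OF sn C_on_fst]]) auto
  then show ?thesis by (simp add: bubble_def case_prod_unfold)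
qed

text \<open>Near a point \<open>(y, 0)\<close> with \<open>y \<noteq> 0\<close> the dilation factor exceeds \<open>1 / norm y\<close>, so the bubble vanishes.\<close>

lemma C_on_bubble:
  assumes \<gamma>: "\<gamma> \<ge> 1"
  shows "C_on k (- {(0, 0)}) (spacetime (bubble \<gamma>))"
proof (rule C_on_local)
  fix z :: "R3 \<times> real" assume z: "z \<in> - {(0, 0)}"
  show "\<exists>U. open U \<and> z \<in> U \<and> C_on k U (spacetime (bubble \<gamma>))"
  proof (cases "snd z = 0")
    case False
    then have "z \<in> UNIV \<times> (- {0})" by (cases z) auto
    moreover have "open (UNIV \<times> (- {0}) :: (R3 \<times> real) set)" by (intro open_Times) auto
    ultimately show ?thesis using C_on_bubble_off by blast
  next
    case True
    \<comment> \<open>The neighbourhood uses the same d in space and in time, so that |s| < d < norm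
      y; hence the dilated point has norm above 1 as \<gamma> \<ge> 1.\<close>
    define d where "d = min 1 (norm (fst z) / 2)"
    have d: "d > 0" "d \<le> 1" using z True by (auto simp: d_def prod_eq_iff)
    let ?U = "{w::R3 \<times> real. d < norm (fst w)} \<inter> {w. \<bar>snd w\<bar> < d}"
    have "open ?U" by (intro open_Int open_Collect_less continuous_intros)
    moreover have "z \<in> ?U" using d True z by (auto simp: d_def prod_eq_iff min_def)
    moreover have "C_on k ?U (spacetime (bubble \<gamma>))"
    proof (rule C_on_cong[OF C_on_const[of _ _ 0]])
      fix w :: "R3 \<times> real" assume w: "w \<in> ?U"
      show "0 = spacetime (bubble \<gamma>) w"
      proof (cases "snd w = 0")
        case False
        let ?s = "snd w"
        have s1: "\<bar>?s\<bar> \<le> 1" using w d by auto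
        have "\<bar>?s\<bar> powr (- 1) \<le> \<bar>?s\<bar> powr (- \<gamma>)" using False s1 \<gamma> by (intro powr_mono') auto
        then have "1 / \<bar>?s\<bar> \<le> dil \<gamma> ?s" using False by (simp add: dil_eq powr_minus_divide)
        then have "1 / \<bar>?s\<bar> * d \<le> dil \<gamma> ?s * norm (fst w)" using w d by (intro mult_mono) (auto simp: dil_def)
        moreover have "1 \<le> 1 / \<bar>?s\<bar> * d" using w False by (simp add: field_simps)
        ultimately have "1 \<le> norm (dil \<gamma> ?s *\<^sub>R fst w)" by (simp add: dil_def)
        then show ?thesis by (simp add: case_prod_unfold bubble_def swirl_supp)
      qed (simp add: case_prod_unfold bubble_zero)
    qed
    ultimately show ?thesis by blast
  qed
qed (simp add: open_Compl)

lemma pd_bubble: "pd i (bubble \<gamma> s) y = (amp s * dil \<gamma> s) *\<^sub>R pd i swirl (dil \<gamma> s *\<^sub>R y)"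
proof -
  have "pd i (\<lambda>y. amp s *\<^sub>R swirl (dil \<gamma> s *\<^sub>R (y - 0))) y = amp s *\<^sub>R pd i (\<lambda>y. swirl (dil \<gamma> s *\<^sub>R (y - 0))) y"
    by (rule pd_scaleR[OF C_on_affine[OF swirl_smooth[of "Suc 0"]]])
  also have "\<dots> = amp s *\<^sub>R (dil \<gamma> s *\<^sub>R pd i swirl (dil \<gamma> s *\<^sub>R (y - 0)))"
    by (subst pd_affine[OF swirl_smooth[of "Suc 0"]]) simp
  finally show ?thesis by (simp add: bubble_def[abs_def])
qed

lemma lap_bubble: "lap (bubble \<gamma> s) y = (amp s * (dil \<gamma> s)\<^sup>2) *\<^sub>R lap swirl (dil \<gamma> s *\<^sub>R y)"
proof -
  have "pd i (pd i (bubble \<gamma> s)) y = (amp s * (dil \<gamma> s)\<^sup>2) *\<^sub>R pd i (pd i swirl) (dil \<gamma> s *\<^sub>R y)" for i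
  proof -
    have c: "C_on (Suc 0) UNIV (pd i swirl)" by (rule C_on_pd[OF swirl_smooth])
    have "pd i (pd i (bubble \<gamma> s)) y = pd i (\<lambda>y. (amp s * dil \<gamma> s) *\<^sub>R pd i swirl (dil \<gamma> s *\<^sub>R (y - 0))) y"
      by (rule pd_cong_fun) (simp add: pd_bubble)
    also have "\<dots> = (amp s * dil \<gamma> s) *\<^sub>R pd i (\<lambda>y. pd i swirl (dil \<gamma> s *\<^sub>R (y - 0))) y"
      by (rule pd_scaleR[OF C_on_affine[OF c]])
    also have "\<dots> = (amp s * dil \<gamma> s) *\<^sub>R (dil \<gamma> s *\<^sub>R pd i (pd i swirl) (dil \<gamma> s *\<^sub>R (y - 0)))"
      by (subst pd_affine[OF c]) simp
    finally show ?thesis by (simp add: power2_eq_square mult.assoc)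
  qed
  then show ?thesis by (simp add: lap_def scaleR_sum_right)
qed

lemma divg_bubble: "divg (bubble \<gamma> s) y = 0"
proof -
  have "divg (bubble \<gamma> s) y = (amp s * dil \<gamma> s) * divg swirl (dil \<gamma> s *\<^sub>R y)"
    by (simp add: divg_def pd_bubble sum_distrib_left)
  then show ?thesis by (simp add: divg_swirl)
qed

text \<open>The time derivative of the bubble, as \<open>bubble_deriv\<close> confirms. The
  derivative of the dilation is grouped into the field z -> (z \<bullet> grad) swirl, evaluated at
  \<open>dil \<gamma> s *\<^sub>R y\<close>; in this form it is bounded although \<open>dil\<close>
  is not.\<close>

definition bubble_t :: "real \<Rightarrow> real \<Rightarrow> R3 \<Rightarrow> R3" where
  "bubble_t \<gamma> s y = (if s = 0 then 0 else
    (2 * s * flat 0 (1 - s\<^sup>2) - 2 * s ^ 3 * flat 2 (1 - s\<^sup>2)) *\<^sub>R swirl (dil \<gamma> s *\<^sub>R y)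
    - (amp s * \<gamma> / s) *\<^sub>R (\<Sum>i\<in>UNIV. (dil \<gamma> s * y $ i) *\<^sub>R pd i swirl (dil \<gamma> s *\<^sub>R y)))"

text \<open>All the fields are continuous with bounded support, the last one even with its growing
  factor z; this keeps the time derivative of the bubble under control.\<close>

lemma swirl_bounds:
  obtains M where "M > 0" "\<And>z. norm (swirl z) \<le> M" "\<And>i z. norm (pd i swirl z) \<le> M"
    "\<And>z. norm (lap swirl z) \<le> M" "\<And>z. norm (\<Sum>i\<in>UNIV. (z $ i) *\<^sub>R pd i swirl z) \<le> M"
proof -
  have T: "swirl \<in> Cc_inf UNIV" by (rule Cc_infI[OF swirl_smooth swirl_bsupp])
  have b: "\<exists>M>0. \<forall>z. norm (f z) \<le> M" if f: "f \<in> Cc_inf UNIV" for f :: "R3 \<Rightarrow> R3"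
    using bsupp_bounded[OF C_on_continuous[OF Cc_inf_smooth[OF f, of 0]] Cc_inf_bsupp[OF f]] by metis
  have P: "pd i swirl \<in> Cc_inf UNIV" for i by (rule Cc_inf_pd[OF T])
  have sum: "(\<lambda>z. \<Sum>i\<in>UNIV. f i z) \<in> Cc_inf UNIV" if f: "\<And>i. f i \<in> Cc_inf UNIV" for f :: "3 \<Rightarrow> R3 \<Rightarrow> R3"
  proof (rule Cc_infI)
    show "C_on k UNIV (\<lambda>z. \<Sum>i\<in>UNIV. f i z)" for k by (rule C_on_sum) (rule Cc_inf_smooth[OF f])
    obtain R where R: "\<And>i x. R i < norm x \<Longrightarrow> f i x = 0"
      using Cc_inf_bsupp[OF f] unfolding bsupp_def by metis
    show "bsupp (\<lambda>z. \<Sum>i\<in>UNIV. f i z)"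
    proof (rule bsuppI)
      fix x :: R3 assume x: "(\<Sum>i\<in>UNIV. \<bar>R i\<bar>) < norm x"
      have "f i x = 0" for i
      proof (rule R)
        have "\<bar>R i\<bar> \<le> (\<Sum>i\<in>UNIV. \<bar>R i\<bar>)" by (rule member_le_sum) auto
        with x show "R i < norm x" by linarith
      qed
      then show "(\<Sum>i\<in>UNIV. f i x) = 0" by simp
    qed
  qed
  have L: "lap swirl \<in> Cc_inf UNIV"
    using sum[of "\<lambda>i. pd i (pd i swirl)", OF Cc_inf_pd[OF P]] by (simp add: lap_def[abs_def])
  have X: "(\<lambda>z. \<Sum>i\<in>UNIV. (z $ i) *\<^sub>R pd i swirl z) \<in> Cc_inf UNIV"
  proof (rule sum)
    fix i :: 3
    have bb: "bounded_bilinear (\<lambda>(v::R3) (a::real). a *\<^sub>R v)"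
      by (rule bounded_bilinear.flip[OF bounded_bilinear_scaleR])
    have "smooth_on UNIV (\<lambda>z::R3. z $ i)"
      by (rule smooth_onI) (rule C_on_linear[OF bounded_linear_vec_nth])
    from Cc_inf_bilinear[OF bb P this] show "(\<lambda>z. (z $ i) *\<^sub>R pd i swirl z) \<in> Cc_inf UNIV" .
  qed
  obtain M0 where M0: "M0 > 0" "\<And>z. norm (swirl z) \<le> M0" using b[OF T] by blast
  obtain M1 where M1: "\<And>i. M1 i > 0" "\<And>i z. norm (pd i swirl z) \<le> M1 i" using b[OF P] by metis
  obtain M2 where M2: "M2 > 0" "\<And>z. norm (lap swirl z) \<le> M2" using b[OF L] by blast
  obtain M3 where M3: "M3 > 0" "\<And>z. norm (\<Sum>i\<in>UNIV. (z $ i) *\<^sub>R pd i swirl z) \<le> M3" using b[OF X] by blast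
  define M where "M = M0 + (\<Sum>i\<in>UNIV. M1 i) + M2 + M3"
  have S: "M1 i \<le> (\<Sum>i\<in>UNIV. M1 i)" for i
    by (rule member_le_sum) (use M1(1) in \<open>auto intro: less_imp_le\<close>)
  have S0: "0 < (\<Sum>i\<in>UNIV. M1 i)" using S[of 1] M1(1)[of 1] by linarith
  show ?thesis
  proof
    show "M > 0" using M0 M2 M3 S0 by (simp add: M_def)
    fix z i
    show "norm (swirl z) \<le> M" using M0(2)[of z] M0(1) M2(1) M3(1) S0 by (simp add: M_def)
    show "norm (pd i swirl z) \<le> M" using M1(2)[of i z] S[of i] M0(1) M2(1) M3(1) by (simp add: M_def)
    show "norm (lap swirl z) \<le> M" using M2(2)[of z] M0(1) M2(1) M3(1) S0 by (simp add: M_def)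
    show "norm (\<Sum>i\<in>UNIV. (z $ i) *\<^sub>R pd i swirl z) \<le> M" using M3(2)[of z] M0(1) M2(1) S0 unfolding M_def by linarith
  qed
qed

definition bubble_D :: "real \<Rightarrow> R3 \<times> real \<Rightarrow> R3 \<times> real \<Rightarrow> R3" where
  "bubble_D \<gamma> z h = (\<Sum>i\<in>UNIV. (fst h $ i) *\<^sub>R pd i (bubble \<gamma> (snd z)) (fst z)) + snd h *\<^sub>R bubble_t \<gamma> (snd z) (fst z)"

lemma bubble_deriv_off:
  assumes s: "s \<noteq> 0"
  shows "(spacetime (bubble \<gamma>) has_derivative bubble_D \<gamma> (y, s)) (at (y, s))"
proof -
  obtain D where D: "\<And>z. (swirl has_derivative D z) (at z)" "\<And>h. C_on 0 UNIV (\<lambda>z. D z h)"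
    by (rule C_on_1_derivative[OF swirl_smooth[of "Suc 0"]]) blast
  let ?a' = "2 * s * flat 0 (1 - s\<^sup>2) - 2 * s ^ 3 * flat 2 (1 - s\<^sup>2)"
  let ?N = "dil \<gamma> s" let ?N' = "- \<gamma> / s * dil \<gamma> s"
  have sd: "((snd :: R3 \<times> real \<Rightarrow> real) has_derivative snd) (at (y, s))"
    by (rule bounded_linear_imp_has_derivative[OF bounded_linear_snd])
  have a: "((\<lambda>z::R3 \<times> real. amp (snd z)) has_derivative (\<lambda>h. ?a' * snd h)) (at (y, s))"
    using has_derivative_compose[OF sd, of amp "(*) ?a'"] amp_deriv[of s]
    by (simp add: has_field_derivative_def)
  have n: "((\<lambda>z::R3 \<times> real. dil \<gamma> (snd z)) has_derivative (\<lambda>h. ?N' * snd h)) (at (y, s))"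
    using has_derivative_compose[OF sd, of "dil \<gamma>" "(*) ?N'"] dil_deriv[OF s, of \<gamma>]
    by (simp add: has_field_derivative_def)
  have m: "((\<lambda>z::R3 \<times> real. dil \<gamma> (snd z) *\<^sub>R fst z) has_derivative (\<lambda>h. ?N *\<^sub>R fst h + (?N' * snd h) *\<^sub>R y)) (at (y, s))"
    using has_derivative_scaleR[OF n has_derivative_fst[OF has_derivative_ident]] by simp
  have w: "((\<lambda>z::R3 \<times> real. swirl (dil \<gamma> (snd z) *\<^sub>R fst z)) has_derivative
      (\<lambda>h. D (?N *\<^sub>R y) (?N *\<^sub>R fst h + (?N' * snd h) *\<^sub>R y))) (at (y, s))"
    using has_derivative_compose[OF m, of swirl "D (?N *\<^sub>R y)"] D(1) by simp
  have "((\<lambda>z::R3 \<times> real. amp (snd z) *\<^sub>R swirl (dil \<gamma> (snd z) *\<^sub>R fst z)) has_derivative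
      (\<lambda>h. amp s *\<^sub>R D (?N *\<^sub>R y) (?N *\<^sub>R fst h + (?N' * snd h) *\<^sub>R y) + (?a' * snd h) *\<^sub>R swirl (?N *\<^sub>R y))) (at (y, s))"
    using has_derivative_scaleR[OF a w] by simp
  moreover have "amp s *\<^sub>R D (?N *\<^sub>R y) (?N *\<^sub>R fst h + (?N' * snd h) *\<^sub>R y) + (?a' * snd h) *\<^sub>R swirl (?N *\<^sub>R y)
      = bubble_D \<gamma> (y, s) h" for h
  proof -
    let ?p = "\<lambda>i. pd i swirl (?N *\<^sub>R y)"
    have lin: "linear (D (?N *\<^sub>R y))" using D(1) has_derivative_linear by blast
    define S1 where "S1 = (\<Sum>i\<in>UNIV. (fst h $ i) *\<^sub>R ?p i)"
    define S2 where "S2 = (\<Sum>i\<in>UNIV. (y $ i) *\<^sub>R ?p i)"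
    have d: "D (?N *\<^sub>R y) (?N *\<^sub>R fst h + (?N' * snd h) *\<^sub>R y) = ?N *\<^sub>R S1 + (?N' * snd h) *\<^sub>R S2"
      unfolding S1_def S2_def linear_add[OF lin] linear_cmul[OF lin] has_derivative_pd[OF D(1), symmetric] by simp
    have b1: "(\<Sum>i\<in>UNIV. (fst h $ i) *\<^sub>R pd i (bubble \<gamma> s) y) = (amp s * ?N) *\<^sub>R S1"
      unfolding S1_def pd_bubble scaleR_sum_right by (simp add: mult.commute)
    have b2: "(\<Sum>i\<in>UNIV. (?N * y $ i) *\<^sub>R ?p i) = ?N *\<^sub>R S2"
      unfolding S2_def scaleR_sum_right by simp
    have "bubble_D \<gamma> (y, s) h = (amp s * ?N) *\<^sub>R S1 + snd h *\<^sub>R (?a' *\<^sub>R swirl (?N *\<^sub>R y) - (amp s * \<gamma> / s) *\<^sub>R ?N *\<^sub>R S2)"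
      using s by (simp add: bubble_D_def bubble_t_def b1 b2)
    then show ?thesis unfolding d by (simp add: scaleR_add_right scaleR_diff_right mult.commute mult.left_commute)
  qed
  ultimately have "((\<lambda>z::R3 \<times> real. amp (snd z) *\<^sub>R swirl (dil \<gamma> (snd z) *\<^sub>R fst z)) has_derivative bubble_D \<gamma> (y, s)) (at (y, s))"
    by (simp only:)
  then show ?thesis by (simp add: bubble_def case_prod_unfold)
qed

context
  fixes \<gamma> M :: real
  assumes \<gamma>: "1 \<le> \<gamma>" "\<gamma> \<le> 3 / 2"
    and M: "M > 0" "\<And>z. norm (swirl z) \<le> M" "\<And>i z. norm (pd i swirl z) \<le> M"
    "\<And>z. norm (lap swirl z) \<le> M" "\<And>z. norm (\<Sum>i\<in>UNIV. (z $ i) *\<^sub>R pd i swirl z) \<le> M"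
begin

lemma amp_dil: "amp s * dil \<gamma> s \<le> \<bar>s\<bar> powr (2 - \<gamma>)" "amp s * (dil \<gamma> s)\<^sup>2 \<le> \<bar>s\<bar> powr (2 - 2 * \<gamma>)"
proof -
  have d0: "0 \<le> dil \<gamma> s" by (simp add: dil_def)
  have "amp s * dil \<gamma> s \<le> \<bar>s\<bar> powr (2 - \<gamma>) \<and> amp s * (dil \<gamma> s)\<^sup>2 \<le> \<bar>s\<bar> powr (2 - 2 * \<gamma>)"
  proof (cases "s = 0")
    case False
    have s2: "s\<^sup>2 = \<bar>s\<bar> powr 2" using False by (simp add: powr_numeral)
    have e: "s\<^sup>2 * dil \<gamma> s = \<bar>s\<bar> powr (2 - \<gamma>)"
      unfolding s2 dil_eq[OF False] by (simp only: powr_add[symmetric]) simp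
    have e2: "s\<^sup>2 * (dil \<gamma> s)\<^sup>2 = \<bar>s\<bar> powr (2 - 2 * \<gamma>)"
      unfolding s2 dil_eq[OF False] power2_eq_square[of "_ powr _"] by (simp only: powr_add[symmetric]) simp
    show ?thesis
      using mult_right_mono[OF amp_bounds(2) d0, of s] mult_right_mono[OF amp_bounds(2) zero_le_power2, of s "dil \<gamma> s"]
      by (simp add: e e2)
  qed (simp add: amp_bounds)
  then show "amp s * dil \<gamma> s \<le> \<bar>s\<bar> powr (2 - \<gamma>)" "amp s * (dil \<gamma> s)\<^sup>2 \<le> \<bar>s\<bar> powr (2 - 2 * \<gamma>)" by auto
qed

lemma bubble_le: "norm (bubble \<gamma> s y) \<le> M * s\<^sup>2"
proof -
  have "norm (bubble \<gamma> s y) = amp s * norm (swirl (dil \<gamma> s *\<^sub>R y))"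
    using amp_bounds(1)[of s] by (simp add: bubble_def)
  also have "\<dots> \<le> s\<^sup>2 * M" using amp_bounds M by (intro mult_mono) auto
  finally show ?thesis by (simp add: mult.commute)
qed

text \<open>The exponent 2 - \<gamma> is positive, so the gradient tends to 0 as s does and the
  bubble can be C^1. One more dilation factor makes it 2 - 2 \<gamma> for the Laplacian, which is
  negative once \<gamma> > 1.\<close>

lemma pd_bubble_le: "norm (pd i (bubble \<gamma> s) y) \<le> M * \<bar>s\<bar> powr (2 - \<gamma>)"
proof -
  have "norm (pd i (bubble \<gamma> s) y) = amp s * dil \<gamma> s * norm (pd i swirl (dil \<gamma> s *\<^sub>R y))"
    using amp_bounds(1)[of s] by (simp add: pd_bubble dil_def)
  also have "\<dots> \<le> \<bar>s\<bar> powr (2 - \<gamma>) * M" using amp_dil(1) M by (intro mult_mono) auto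
  finally show ?thesis by (simp add: mult.commute)
qed

lemma lap_bubble_le: "norm (lap (bubble \<gamma> s) y) \<le> M * \<bar>s\<bar> powr (2 - 2 * \<gamma>)"
proof -
  have "norm (lap (bubble \<gamma> s) y) = amp s * (dil \<gamma> s)\<^sup>2 * norm (lap swirl (dil \<gamma> s *\<^sub>R y))"
    using amp_bounds(1)[of s] by (simp add: lap_bubble)
  also have "\<dots> \<le> \<bar>s\<bar> powr (2 - 2 * \<gamma>) * M" using amp_dil(2) M by (intro mult_mono) auto
  finally show ?thesis by (simp add: mult.commute)
qed

lemma bubble_t_le: "norm (bubble_t \<gamma> s y) \<le> 8 * M * \<bar>s\<bar>"
proof (cases "s = 0")
  case False
  let ?a' = "2 * s * flat 0 (1 - s\<^sup>2) - 2 * s ^ 3 * flat 2 (1 - s\<^sup>2)"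
  let ?z = "dil \<gamma> s *\<^sub>R y"
  let ?X = "\<Sum>i\<in>UNIV. (?z $ i) *\<^sub>R pd i swirl ?z"
  have eq: "bubble_t \<gamma> s y = ?a' *\<^sub>R swirl ?z - (amp s * \<gamma> / s) *\<^sub>R ?X"
    using False by (simp add: bubble_t_def)
  have "norm (?a' *\<^sub>R swirl ?z) \<le> 6 * \<bar>s\<bar> * M"
    unfolding norm_scaleR real_norm_def using amp_deriv_bound[of s] M by (intro mult_mono) auto
  \<comment> \<open>3/2 is the upper bound on \<gamma>; together with the 6 of
    \<open>amp_deriv_bound\<close> the total stays below 8.\<close>
  moreover have "norm ((amp s * \<gamma> / s) *\<^sub>R ?X) \<le> (3 / 2 * \<bar>s\<bar>) * M"
  proof -
    have "\<bar>amp s * \<gamma> / s\<bar> = \<gamma> * (amp s / \<bar>s\<bar>)" using amp_bounds(1)[of s] \<gamma> by (simp add: abs_mult)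
    also have "\<dots> \<le> 3 / 2 * \<bar>s\<bar>"
    proof (rule mult_mono)
      show "amp s / \<bar>s\<bar> \<le> \<bar>s\<bar>" using amp_bounds(2)[of s] False by (simp add: divide_le_eq power2_eq_square)
    qed (use \<gamma> amp_bounds(1)[of s] in auto)
    finally show ?thesis unfolding norm_scaleR real_norm_def using M(5)[of ?z] M(1) by (intro mult_mono) auto
  qed
  moreover have "norm (bubble_t \<gamma> s y) \<le> norm (?a' *\<^sub>R swirl ?z) + norm ((amp s * \<gamma> / s) *\<^sub>R ?X)"
    unfolding eq by (rule norm_triangle_ineq4)
  moreover have "0 \<le> M * \<bar>s\<bar>" using M(1) by simp
  ultimately show ?thesis by (simp add: algebra_simps)
qed (simp add: bubble_t_def)

lemma bubble_D_0: "bubble_D \<gamma> (y, 0) h = 0"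
proof -
  have "pd i (bubble \<gamma> 0) y = 0" for i y
    using pd_bubble_le[of i 0 y] \<gamma> by simp
  then show ?thesis by (simp add: bubble_D_def bubble_t_def)
qed

text \<open>Off s = 0 this is \<open>bubble_deriv_off\<close>. At s = 0 the quadratic bound M s^2
  forces the derivative to be zero, whatever the dilation does.\<close>

lemma bubble_deriv: "(spacetime (bubble \<gamma>) has_derivative bubble_D \<gamma> z) (at z)"
proof (cases "snd z = 0")
  case False
  then show ?thesis using bubble_deriv_off[of "snd z" \<gamma> "fst z"] by simp
next
  case True
  then obtain y where z: "z = (y, 0)" by (cases z) auto
  have D0: "bubble_D \<gamma> z = (\<lambda>_. 0)" using bubble_D_0 z by auto
  show ?thesis
    unfolding D0 has_derivative_at
  proof (rule conjI[OF bounded_linear_zero], rule Lim_null_comparison)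
    show "((\<lambda>h::R3 \<times> real. M * norm h) \<longlongrightarrow> 0) (at 0)" by (auto intro!: tendsto_eq_intros)
    have "norm (norm (spacetime (bubble \<gamma>) (z + h) - spacetime (bubble \<gamma>) z - 0) / norm h) \<le> M * norm h" for h :: "R3 \<times> real"
    proof -
      have "norm (bubble \<gamma> (snd h) (y + fst h)) \<le> M * (snd h)\<^sup>2" by (rule bubble_le)
      also have "\<dots> \<le> M * (norm h)\<^sup>2"
        using M(1) norm_snd_le[of "snd h" "fst h"] by (intro mult_left_mono) (auto simp: abs_le_square_iff[symmetric])
      finally have "norm (spacetime (bubble \<gamma>) (z + h) - spacetime (bubble \<gamma>) z - 0) \<le> M * (norm h)\<^sup>2"
        by (cases h) (simp add: z bubble_zero)
      then show ?thesis by (cases "h = 0") (simp_all add: divide_le_eq power2_eq_square mult.assoc)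
    qed
    then show "\<forall>\<^sub>F h in at 0. norm (norm (spacetime (bubble \<gamma>) (z + h) - spacetime (bubble \<gamma>) z - 0) / norm h) \<le> M * norm h"
      by simp
  qed
qed

text \<open>Continuity of the derivative is delicate only at s = 0; there the bounds on
  \<open>pd i\<close> and on \<open>bubble_t\<close> tend to 0.\<close>

lemma C_on_1_bubble: "C_on 1 UNIV (spacetime (bubble \<gamma>))"
proof -
  have "C_on (Suc 0) UNIV (spacetime (bubble \<gamma>))"
  proof (rule C_on_SucI[OF has_derivative_at_withinI[OF bubble_deriv]])
    fix h :: "R3 \<times> real"
    have "isCont (\<lambda>z. bubble_D \<gamma> z h) z" for z
    proof (cases "snd z = 0")
      case False
      have o: "open (UNIV \<times> (- {0}) :: (R3 \<times> real) set)" by (intro open_Times) auto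
      have "C_on 0 (UNIV \<times> (- {0})) (\<lambda>z. frechet_derivative (spacetime (bubble \<gamma>)) (at z) h)"
        using C_on_bubble_off[of "Suc 0" \<gamma>] unfolding C_on_Suc_open[OF o] by blast
      moreover have "frechet_derivative (spacetime (bubble \<gamma>)) (at z) h = bubble_D \<gamma> z h" for z
        using frechet_derivative_at[OF bubble_deriv] by metis
      ultimately have "continuous_on (UNIV \<times> (- {0})) (\<lambda>z. bubble_D \<gamma> z h)" by simp
      then show ?thesis using continuous_on_eq_continuous_at[OF o, of "\<lambda>z. bubble_D \<gamma> z h"] False
        by (cases z) auto
    next
      case True
      then obtain y where z: "z = (y, 0)" by (cases z) auto
      define c where "c = norm (fst h)"
      have bd: "norm (bubble_D \<gamma> w h) \<le> 3 * (c * (M * \<bar>snd w\<bar> powr (2 - \<gamma>))) + \<bar>snd h\<bar> * (8 * M * \<bar>snd w\<bar>)" for w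
      proof -
        have "norm (\<Sum>i\<in>UNIV. (fst h $ i) *\<^sub>R pd i (bubble \<gamma> (snd w)) (fst w)) \<le> (\<Sum>i\<in>(UNIV::3 set). c * (M * \<bar>snd w\<bar> powr (2 - \<gamma>)))"
          by (rule order_trans[OF norm_sum sum_mono])
            (auto intro!: mult_mono pd_bubble_le component_le_norm_cart simp: c_def)
        moreover have "norm (snd h *\<^sub>R bubble_t \<gamma> (snd w) (fst w)) \<le> \<bar>snd h\<bar> * (8 * M * \<bar>snd w\<bar>)"
          by (auto intro!: mult_left_mono bubble_t_le)
        ultimately show ?thesis unfolding bubble_D_def
          by (intro order_trans[OF norm_triangle_ineq add_mono]) auto
      qed
      have "((\<lambda>w::R3 \<times> real. 3 * (c * (M * \<bar>snd w\<bar> powr (2 - \<gamma>))) + \<bar>snd h\<bar> * (8 * M * \<bar>snd w\<bar>)) \<longlongrightarrow>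
          3 * (c * (M * \<bar>snd z\<bar> powr (2 - \<gamma>))) + \<bar>snd h\<bar> * (8 * M * \<bar>snd z\<bar>)) (at z)"
        using \<gamma> by (intro tendsto_intros tendsto_powr' ) auto
      then have "((\<lambda>w::R3 \<times> real. 3 * (c * (M * \<bar>snd w\<bar> powr (2 - \<gamma>))) + \<bar>snd h\<bar> * (8 * M * \<bar>snd w\<bar>)) \<longlongrightarrow> 0) (at z)"
        using z by simp
      then have "((\<lambda>w. bubble_D \<gamma> w h) \<longlongrightarrow> 0) (at z)"
        by (rule Lim_null_comparison[rotated]) (simp add: bd)
      then show ?thesis unfolding isCont_def using z bubble_D_0 by simp
    qed
    then show "C_on 0 UNIV (\<lambda>z. bubble_D \<gamma> z h)" by (simp add: continuous_at_imp_continuous_on)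
  qed
  then show ?thesis by simp
qed

end

subsection \<open>Weak-strong uniqueness\<close>

text \<open>Tonelli for the indicator of a null set, with time as the outer variable.\<close>

lemma AE_pair_swap:
  assumes "AE z in lborel \<Otimes>\<^sub>M lborel. P (z :: 'a::euclidean_space \<times> 'b::euclidean_space)"
  shows "AE t in lborel. AE x in lborel. P (x, t)"
proof -
  obtain N where N [measurable]: "N \<in> sets (lborel \<Otimes>\<^sub>M lborel)" and N0: "emeasure (lborel \<Otimes>\<^sub>M lborel) N = 0"
    and NP: "{z \<in> space (lborel \<Otimes>\<^sub>M lborel). \<not> P z} \<subseteq> N"
    using assms by (auto elim!: AE_E)
  have "0 = (\<integral>\<^sup>+ z. indicator N z \<partial>(lborel \<Otimes>\<^sub>M lborel))" by (simp only: nn_integral_indicator[OF N] N0)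
  also have "\<dots> = (\<integral>\<^sup>+ t. \<integral>\<^sup>+ x. indicator N (x, t) \<partial>lborel \<partial>lborel)"
    by (rule lborel_pair.nn_integral_snd[symmetric]) simp
  finally have "AE t in lborel. (\<integral>\<^sup>+ x. indicator N (x, t) \<partial>lborel) = 0"
    by (subst (asm) eq_commute, subst (asm) nn_integral_0_iff_AE) (auto intro!: lborel.borel_measurable_nn_integral)
  then show ?thesis
  proof eventually_elim
    case (elim t)
    have "AE x in lborel. indicator N (x, t) = (0::ennreal)"
      using elim by (subst (asm) nn_integral_0_iff_AE) measurable
    then show ?case
    proof eventually_elim
      case (elim x)
      then have "(x, t) \<notin> N" by (simp add: indicator_def split: if_splits)
      then show ?case using NP by (auto simp: space_pair_measure)
    qed
  qed
qed

lemma Lp2_inner_tendsto: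
  fixes u :: "R3 \<Rightarrow> 'b::euclidean_space"
  assumes u: "u \<in> Lp 2" and v: "\<And>n. v n \<in> Lp 2" "w \<in> Lp 2" and lim: "(\<lambda>n. sqint (\<lambda>x. v n x - w x)) \<longlonglongrightarrow> 0"
  shows "(\<lambda>n. LINT x|lebesgue. u x \<bullet> v n x) \<longlonglongrightarrow> (LINT x|lebesgue. u x \<bullet> w x)"
proof -
  have b: "norm ((LINT x|lebesgue. u x \<bullet> v n x) - (LINT x|lebesgue. u x \<bullet> w x)) \<le> sqrt (sqint u) * sqrt (sqint (\<lambda>x. v n x - w x))" for n
  proof -
    have "(LINT x|lebesgue. u x \<bullet> v n x) - (LINT x|lebesgue. u x \<bullet> w x) = (LINT x|lebesgue. u x \<bullet> (v n x - w x))"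
      using Lp2_inner(1)[OF u v(1)] Lp2_inner(1)[OF u v(2)] by (simp add: inner_diff_right)
    then show ?thesis using Lp2_inner(2)[OF u Lp2_diff[OF v(1) v(2)]] by simp
  qed
  have "(\<lambda>n. sqrt (sqint u) * sqrt (sqint (\<lambda>x. v n x - w x))) \<longlonglongrightarrow> sqrt (sqint u) * sqrt 0"
    by (intro tendsto_mult tendsto_const tendsto_real_sqrt lim)
  then have z: "(\<lambda>n. sqrt (sqint u) * sqrt (sqint (\<lambda>x. v n x - w x))) \<longlonglongrightarrow> 0" by simp
  have "(\<lambda>n. (LINT x|lebesgue. u x \<bullet> v n x) - (LINT x|lebesgue. u x \<bullet> w x)) \<longlonglongrightarrow> 0"
    by (rule Lim_null_comparison[OF _ z]) (simp add: b[unfolded real_norm_def])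
  then show ?thesis by (rule LIM_zero_cancel)
qed

lemma sqint_tendsto:
  fixes w :: "R3 \<Rightarrow> 'b::euclidean_space"
  assumes v: "\<And>n. v n \<in> Lp 2" "w \<in> Lp 2" and lim: "(\<lambda>n. sqint (\<lambda>x. v n x - w x)) \<longlonglongrightarrow> 0"
  shows "(\<lambda>n. sqint (v n)) \<longlonglongrightarrow> sqint w"
proof -
  have eq: "sqint (v n) = sqint (\<lambda>x. v n x - w x) + 2 * (LINT x|lebesgue. w x \<bullet> v n x) - sqint w" for n
  proof -
    have i: "integrable lebesgue (\<lambda>x. (norm (v n x))\<^sup>2)" "integrable lebesgue (\<lambda>x. (norm (w x))\<^sup>2)"
      "integrable lebesgue (\<lambda>x. w x \<bullet> v n x)"
      using v Lp2_inner(1)[OF v(2) v(1)] by (auto simp: Lp2_iff)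
    have "(norm (v n x - w x))\<^sup>2 = (norm (v n x))\<^sup>2 - 2 * (w x \<bullet> v n x) + (norm (w x))\<^sup>2" for x
      by (simp add: power2_norm_eq_inner inner_diff inner_commute algebra_simps)
    then show ?thesis using i by simp
  qed
  have "(\<lambda>n. sqint (\<lambda>x. v n x - w x) + 2 * (LINT x|lebesgue. w x \<bullet> v n x) - sqint w) \<longlonglongrightarrow> 0 + 2 * (LINT x|lebesgue. w x \<bullet> w x) - sqint w"
    by (intro tendsto_intros lim Lp2_inner_tendsto[OF v(2) v lim])
  then show ?thesis unfolding eq by (simp add: power2_norm_eq_inner)
qed

lemma bounded_mult_Lp2:
  fixes w :: "R3 \<Rightarrow> R3" and \<phi> :: "R3 \<Rightarrow> R3"
  assumes w: "w \<in> Lp 2" and \<phi>: "\<phi> \<in> Cc_inf UNIV"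
  shows "(\<lambda>x. (w x $ j) *\<^sub>R \<phi> x) \<in> Lp 2"
proof -
  obtain M where M: "M > 0" "\<And>x. norm (\<phi> x) \<le> M"
    using bsupp_bounded[OF C_on_continuous[OF Cc_inf_smooth[OF \<phi>, of 0]] Cc_inf_bsupp[OF \<phi>]] by blast
  have m: "w \<in> borel_measurable lebesgue" "integrable lebesgue (\<lambda>x. (norm (w x))\<^sup>2)" using w by (auto simp: Lp2_iff)
  have wj: "(\<lambda>x. w x $ j) \<in> borel_measurable lebesgue"
    by (rule measurable_compose[OF m(1) borel_measurable_continuous_onI[OF linear_continuous_on[OF bounded_linear_vec_nth]]])
  show ?thesis
  proof (rule Lp2_bound)
    show "(\<lambda>x. (w x $ j) *\<^sub>R \<phi> x) \<in> borel_measurable lebesgue"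
      by (intro borel_measurable_scaleR wj lebesgue_borel_measurable[OF Cc_inf_measurable[OF \<phi>]])
    show "integrable lebesgue (\<lambda>x. M\<^sup>2 * (norm (w x))\<^sup>2)" by (intro integrable_mult_right m)
    show "(norm ((w x $ j) *\<^sub>R \<phi> x))\<^sup>2 \<le> M\<^sup>2 * (norm (w x))\<^sup>2" for x
    proof -
      have "norm ((w x $ j) *\<^sub>R \<phi> x) \<le> norm (w x) * M"
        unfolding norm_scaleR real_norm_def using M by (intro mult_mono component_le_norm_cart) auto
      then have "(norm ((w x $ j) *\<^sub>R \<phi> x))\<^sup>2 \<le> (norm (w x) * M)\<^sup>2" by (rule power_mono) simp
      then show ?thesis by (simp add: power_mult_distrib mult.commute)
    qed
  qed
qed

text \<open>For solenoidal W the trilinear form is antisymmetric in its last two arguments. The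
  condition in \<open>L2_sigma\<close> is tested with the scalars
  \<open>\<psi> n x \<bullet> \<phi> x\<close>, where \<open>\<psi> n\<close> are test fields
  approximating W in H^1, since W itself does not give a test function.\<close>

lemma convect_by_parts:
  assumes W: "W \<in> H1" "W \<in> L2_sigma" and \<phi>: "\<phi> \<in> Cc_inf UNIV"
  shows "(LINT x|lebesgue. convect W x \<bullet> \<phi> x) = - (LINT x|lebesgue. (\<Sum>j\<in>UNIV. (W x $ j) *\<^sub>R pd j \<phi> x) \<bullet> W x)"
    and "integrable lebesgue (\<lambda>x. convect W x \<bullet> \<phi> x)"
    and "integrable lebesgue (\<lambda>x. (\<Sum>j\<in>UNIV. (W x $ j) *\<^sub>R pd j \<phi> x) \<bullet> W x)"
proof -
  note H = H1_D[OF W(1)]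
  obtain \<psi> :: "nat \<Rightarrow> R3 \<Rightarrow> R3" where \<psi>: "\<And>n. \<psi> n \<in> Cc_inf UNIV"
    "(\<lambda>n. sqint (\<lambda>x. \<psi> n x - W x)) \<longlonglongrightarrow> 0"
    "\<And>j. (\<lambda>n. sqint (\<lambda>x. pd j (\<psi> n) x - wgrad W x $ j)) \<longlonglongrightarrow> 0"
    by (rule H1_dense[OF W(1)]) blast
  let ?a = "\<lambda>j x. (W x $ j) *\<^sub>R \<phi> x" let ?b = "\<lambda>j x. (W x $ j) *\<^sub>R pd j \<phi> x"
  have a: "?a j \<in> Lp 2" for j by (rule bounded_mult_Lp2[OF H(1) \<phi>])
  have b: "?b j \<in> Lp 2" for j by (rule bounded_mult_Lp2[OF H(1) Cc_inf_pd[OF \<phi>]])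
  have p2: "\<psi> n \<in> Lp 2" "pd j (\<psi> n) \<in> Lp 2" for n j
    using Cc_inf_H1(1)[OF \<psi>(1)] Cc_inf_H1(1)[OF Cc_inf_pd[OF \<psi>(1)]] by auto
  have n: "(\<Sum>j\<in>UNIV. LINT x|lebesgue. ?a j x \<bullet> pd j (\<psi> n) x) = - (\<Sum>j\<in>UNIV. LINT x|lebesgue. ?b j x \<bullet> \<psi> n x)" for n
  proof -
    have T: "(\<lambda>x. \<psi> n x \<bullet> \<phi> x) \<in> Cc_inf UNIV"
      by (rule Cc_inf_bilinear[OF bounded_bilinear_inner \<psi>(1) smooth_onI[OF Cc_inf_smooth[OF \<phi>]]])
    have "pd j (\<lambda>x. \<psi> n x \<bullet> \<phi> x) x = \<psi> n x \<bullet> pd j \<phi> x + pd j (\<psi> n) x \<bullet> \<phi> x" for j x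
      by (rule pd_bilinear[OF bounded_bilinear_inner Cc_inf_smooth[OF \<psi>(1), of "Suc 0"] Cc_inf_smooth[OF \<phi>, of "Suc 0"]])
    then have e: "W x \<bullet> grad (\<lambda>x. \<psi> n x \<bullet> \<phi> x) x = (\<Sum>j\<in>UNIV. ?b j x \<bullet> \<psi> n x) + (\<Sum>j\<in>UNIV. ?a j x \<bullet> pd j (\<psi> n) x)" for x
      by (simp add: inner_vec_def[of "W x"] grad_def distrib_left sum.distrib inner_commute)
    have "(LINT x|lebesgue. W x \<bullet> grad (\<lambda>x. \<psi> n x \<bullet> \<phi> x) x) = 0"
      using W(2) T unfolding L2_sigma_def by blast
    then show ?thesis unfolding e using Lp2_inner(1)[OF b p2(1)] Lp2_inner(1)[OF a p2(2)] by simp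
  qed
  have "(\<lambda>n. \<Sum>j\<in>UNIV. LINT x|lebesgue. ?a j x \<bullet> pd j (\<psi> n) x) \<longlonglongrightarrow> (\<Sum>j\<in>UNIV. LINT x|lebesgue. ?a j x \<bullet> wgrad W x $ j)"
    by (intro tendsto_sum Lp2_inner_tendsto[OF a p2(2) H(3) \<psi>(3)])
  moreover have "(\<lambda>n. - (\<Sum>j\<in>UNIV. LINT x|lebesgue. ?b j x \<bullet> \<psi> n x)) \<longlonglongrightarrow> - (\<Sum>j\<in>UNIV. LINT x|lebesgue. ?b j x \<bullet> W x)"
    by (intro tendsto_minus tendsto_sum Lp2_inner_tendsto[OF b p2(1) H(1) \<psi>(2)])
  ultimately have eq: "(\<Sum>j\<in>UNIV. LINT x|lebesgue. ?a j x \<bullet> wgrad W x $ j) = - (\<Sum>j\<in>UNIV. LINT x|lebesgue. ?b j x \<bullet> W x)"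
    unfolding n by (rule LIMSEQ_unique)
  have ia: "integrable lebesgue (\<lambda>x. ?a j x \<bullet> wgrad W x $ j)" for j by (rule Lp2_inner(1)[OF a H(3)])
  have ib: "integrable lebesgue (\<lambda>x. ?b j x \<bullet> W x)" for j by (rule Lp2_inner(1)[OF b H(1)])
  have c: "convect W x \<bullet> \<phi> x = (\<Sum>j\<in>UNIV. ?a j x \<bullet> wgrad W x $ j)" for x
    unfolding convect_def inner_sum_left by (rule sum.cong) (simp_all add: inner_commute)
  show "integrable lebesgue (\<lambda>x. convect W x \<bullet> \<phi> x)" unfolding c using ia by simp
  show "integrable lebesgue (\<lambda>x. (\<Sum>j\<in>UNIV. (W x $ j) *\<^sub>R pd j \<phi> x) \<bullet> W x)"
    unfolding inner_sum_left using ib by simp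
  show "(LINT x|lebesgue. convect W x \<bullet> \<phi> x) = - (LINT x|lebesgue. (\<Sum>j\<in>UNIV. (W x $ j) *\<^sub>R pd j \<phi> x) \<bullet> W x)"
    unfolding c inner_sum_left using ia ib eq by simp
qed

lemma continuous_bounded_Icc:
  fixes k :: "real \<Rightarrow> real"
  assumes "continuous_on UNIV k" shows "\<exists>B. \<forall>t\<in>{0..S}. norm (k t) \<le> B"
  using compact_imp_bounded[OF compact_continuous_image[OF continuous_on_subset[OF assms, of "{0..S}"]]]
  by (auto simp: bounded_iff)

lemma integrable_continuous_mult:
  fixes k u :: "real \<Rightarrow> real"
  assumes k: "continuous_on UNIV k" and u: "integrable (lebesgue_on {0<..<S}) u"
  shows "integrable (lebesgue_on {0<..<S}) (\<lambda>t. k t * u t)"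
proof -
  obtain B where B: "\<forall>t\<in>{0..S}. norm (k t) \<le> B" using continuous_bounded_Icc[OF k] by blast
  have km: "k \<in> borel_measurable (lebesgue_on {0<..<S})"
    by (intro measurable_restrict_space1 lebesgue_borel_measurable borel_measurable_continuous_onI k)
  show ?thesis
  proof (rule Bochner_Integration.integrable_bound)
    show "integrable (lebesgue_on {0<..<S}) (\<lambda>t. B * u t)" using u by simp
    show "(\<lambda>t. k t * u t) \<in> borel_measurable (lebesgue_on {0<..<S})" using km u by simp
    show "AE t in lebesgue_on {0<..<S}. norm (k t * u t) \<le> norm (B * u t)"
    proof (rule AE_I2)
      fix t assume "t \<in> space (lebesgue_on {0<..<S})"
      then have "norm (k t) \<le> B" using B by auto
      then show "norm (k t * u t) \<le> norm (B * u t)" by (simp add: abs_mult mult_right_mono)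
    qed
  qed
qed

text \<open>Multiplying the energy inequality by \<open>-\<theta>'\<close> and integrating avoids Lebesgue points and Gronwall's lemma.\<close>

lemma weighted_energy:
  fixes a q \<theta> \<theta>' :: "real \<Rightarrow> real"
  assumes q: "integrable (lebesgue_on {0<..<S}) q" and a: "integrable (lebesgue_on {0<..<S}) a"
    and le: "\<And>t. 0 < t \<Longrightarrow> t < S \<Longrightarrow> a t + 2 * (LINT s|lebesgue_on {0<..<t}. q s) \<le> 0"
    and d: "\<And>t. (\<theta> has_real_derivative \<theta>' t) (at t)" and c: "continuous_on UNIV \<theta>'"
    and neg: "\<And>t. \<theta>' t \<le> 0" and S: "\<theta> S = 0"
  shows "(LINT t|lebesgue_on {0<..<S}. - \<theta>' t * a t) + 2 * (LINT t|lebesgue_on {0<..<S}. \<theta> t * q t) \<le> 0"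
    and "integrable (lebesgue_on {0<..<S}) (\<lambda>t. - \<theta>' t * a t)" "integrable (lebesgue_on {0<..<S}) (\<lambda>t. \<theta> t * q t)"
proof -
  have tc: "continuous_on UNIV \<theta>" using d by (intro DERIV_continuous_on) auto
  have mc: "continuous_on UNIV (\<lambda>t. - \<theta>' t)" by (intro continuous_on_minus c)
  show ia: "integrable (lebesgue_on {0<..<S}) (\<lambda>t. - \<theta>' t * a t)" by (rule integrable_continuous_mult[OF mc a])
  show iq: "integrable (lebesgue_on {0<..<S}) (\<lambda>t. \<theta> t * q t)" by (rule integrable_continuous_mult[OF tc q])
  let ?q0 = "\<lambda>t. indicator {0<..<S} t *\<^sub>R q t"
  have q0: "integrable lebesgue ?q0" using q by (subst (asm) integrable_restrict_space) auto
  then have "?q0 \<in> borel_measurable (completion lborel)" by simp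
  then obtain qb where qb [measurable]: "qb \<in> borel_measurable lborel" and qq: "AE t in lborel. ?q0 t = qb t"
    by (rule completion_borel_version) blast
  have qq': "AE t in lebesgue. ?q0 t = qb t" by (rule AE_completion[OF qq])
  have qbi: "integrable lborel qb"
  proof -
    have "integrable lebesgue qb" by (rule integrable_cong_AE_imp[OF q0 _ qq'[THEN AE_mp]]) (auto intro: lebesgue_borel_measurable)
    then show ?thesis by (subst (asm) lebesgue_eq_lborel) auto
  qed
  have Iq: "(LINT s|lebesgue_on {0<..<t}. q s) = (LINT s|lborel. indicator {0<..<t} s * qb s)" if "0 < t" "t < S" for t
  proof -
    have "(LINT s|lebesgue_on {0<..<t}. q s) = (LINT s|lebesgue. indicator {0<..<t} s *\<^sub>R ?q0 s)"
      by (subst integral_restrict_space) (auto intro!: Bochner_Integration.integral_cong simp: indicator_def that(2) intro: less_trans[OF _ that(2)])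
    also have "\<dots> = (LINT s|lebesgue. indicator {0<..<t} s * qb s)"
    proof (rule integral_cong_AE)
      have m: "?q0 \<in> borel_measurable lebesgue" using q0 by (rule borel_measurable_integrable)
      show "(\<lambda>s. indicator {0<..<t} s *\<^sub>R ?q0 s) \<in> borel_measurable lebesgue"
        by (rule borel_measurable_scaleR[OF borel_measurable_indicator m]) simp
      show "(\<lambda>s. indicator {0<..<t} s * qb s) \<in> borel_measurable lebesgue"
        by (rule lebesgue_borel_measurable) simp
      show "AE s in lebesgue. indicator {0<..<t} s *\<^sub>R ?q0 s = indicator {0<..<t} s * qb s"
        using qq' by eventually_elim simp
    qed
    also have "\<dots> = (LINT s|lborel. indicator {0<..<t} s * qb s)" by (rule lebesgue_eq_lborel(1)) simp
    finally show ?thesis .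
  qed
  have [measurable]: "\<theta>' \<in> borel_measurable borel" "\<theta> \<in> borel_measurable borel"
    using c tc by (auto intro: borel_measurable_continuous_onI)
  \<comment> \<open>A kernel on the triangle 0 < s < t < S. Integration over s first gives the time
    integral of q weighted by -\<theta>'; integration over t first gives \<theta> q, because
    \<theta> vanishes at S.\<close>
  define k where "k z = indicator {0<..<S} (fst z) * (- \<theta>' (fst z)) * (indicator {0<..<fst z} (snd z) * qb (snd z))" for z :: "real \<times> real"
  have kmeas [measurable]: "k \<in> borel_measurable (lborel \<Otimes>\<^sub>M lborel)"
  proof -
    have "k = (\<lambda>z. indicator {0<..<S} (fst z) * (- \<theta>' (fst z)) * (indicator {w. 0 < snd w \<and> snd w < fst w} z * qb (snd z)))"
      by (auto simp: k_def fun_eq_iff indicator_def)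
    also have "\<dots> \<in> borel_measurable (lborel \<Otimes>\<^sub>M lborel)" by measurable
    finally show ?thesis .
  qed
  obtain B where B: "\<forall>t\<in>{0..S}. norm (\<theta>' t) \<le> B" using continuous_bounded_Icc[OF c] by blast
  have ki: "integrable (lborel \<Otimes>\<^sub>M lborel) k"
  proof (rule Bochner_Integration.integrable_bound)
    show "integrable (lborel \<Otimes>\<^sub>M lborel) (\<lambda>z. (indicator {0<..<S} (fst z) * B) * qb (snd z))"
    proof (rule lborel_pair.Fubini_integrable)
      have "integrable lborel (\<lambda>t. (indicator {0<..<S} t * \<bar>B\<bar>) * (LINT s|lborel. \<bar>qb s\<bar>))"
        by (cases "S \<ge> 0") (auto intro!: integrable_mult_left integrable_real_indicator)
      then show "integrable lborel (\<lambda>t. LINT s|lborel. norm ((indicator {0<..<S} (fst (t, s)) * B) * qb (snd (t, s))))"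
        by (simp add: abs_mult)
    qed (use qbi in \<open>auto intro!: AE_I2\<close>)
    show "AE z in lborel \<Otimes>\<^sub>M lborel. norm (k z) \<le> norm ((indicator {0<..<S} (fst z) * B) * qb (snd z))"
    proof (rule AE_I2)
      fix z :: "real \<times> real"
      have "norm (\<theta>' (fst z)) \<le> B" if "fst z \<in> {0<..<S}" using B that by auto
      then show "norm (k z) \<le> norm ((indicator {0<..<S} (fst z) * B) * qb (snd z))"
        by (auto simp: k_def indicator_def abs_mult intro!: mult_right_mono)
    qed
  qed measurable
  have i1: "(LINT t|lborel. LINT s|lborel. k (t, s)) = (LINT z|(lborel \<Otimes>\<^sub>M lborel). k z)"
    using lborel_pair.integral_fst[of "\<lambda>t s. k (t, s)"] ki by simp
  have i2: "(LINT s|lborel. LINT t|lborel. k (t, s)) = (LINT z|(lborel \<Otimes>\<^sub>M lborel). k z)"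
    using lborel_pair.integral_snd[of "\<lambda>t s. k (t, s)"] ki by simp
  have inner2: "(LINT t|lborel. k (t, s)) = indicator {0<..<S} s * (\<theta> s * qb s)" for s
  proof (cases "0 < s \<and> s < S")
    case True
    have "k (t, s) = qb s * (indicator {s<..<S} t *\<^sub>R (- \<theta>' t))" for t
      using True by (auto simp: k_def indicator_def)
    then have "(LINT t|lborel. k (t, s)) = qb s * (LINT t|lborel. indicator {s<..<S} t *\<^sub>R (- \<theta>' t))" by simp
    also have "(LINT t|lborel. indicator {s<..<S} t *\<^sub>R (- \<theta>' t)) = (LINT t|lborel. indicator {s..S} t *\<^sub>R (- \<theta>' t))"
    proof (rule integral_cong_AE)
      have "AE t in lborel. t \<notin> {s, S}" by (intro AE_not_in countable_imp_null_set_lborel) auto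
      then show "AE t in lborel. indicator {s<..<S} t *\<^sub>R (- \<theta>' t) = indicator {s..S} t *\<^sub>R (- \<theta>' t)"
        by eventually_elim (auto simp: indicator_def)
    qed measurable
    also have "\<dots> = (- \<theta> S) - (- \<theta> s)"
    proof (rule integral_FTC_Icc)
      show "((\<lambda>t. - \<theta> t) has_vector_derivative - \<theta>' t) (at t within {s..S})" for t
        using d[of t] by (intro has_vector_derivative_at_within[OF has_vector_derivative_minus])
          (simp add: has_real_derivative_iff_has_vector_derivative)
    qed (use True in \<open>auto intro: continuous_on_subset[OF mc]\<close>)
    finally show ?thesis using True S by simp
  next
    case False
    then have "k (t, s) = 0" for t by (auto simp: k_def indicator_def)
    then show ?thesis using False by auto
  qed
  have Tq: "(LINT t|lebesgue_on {0<..<S}. \<theta> t * q t) = (LINT z|(lborel \<Otimes>\<^sub>M lborel). k z)"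
  proof -
    have "(LINT t|lebesgue_on {0<..<S}. \<theta> t * q t) = (LINT t|lebesgue. indicator {0<..<S} t *\<^sub>R (\<theta> t * q t))"
      by (rule integral_restrict_space) auto
    also have "\<dots> = (LINT t|lebesgue. indicator {0<..<S} t * (\<theta> t * qb t))"
    proof (rule integral_cong_AE)
      show "(\<lambda>t. indicator {0<..<S} t *\<^sub>R (\<theta> t * q t)) \<in> borel_measurable lebesgue"
        using iq by (subst (asm) integrable_restrict_space) auto
      show "(\<lambda>t. indicator {0<..<S} t * (\<theta> t * qb t)) \<in> borel_measurable lebesgue"
        by (rule lebesgue_borel_measurable) simp
      show "AE t in lebesgue. indicator {0<..<S} t *\<^sub>R (\<theta> t * q t) = indicator {0<..<S} t * (\<theta> t * qb t)"
        using qq' by eventually_elim (auto simp: indicator_def)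
    qed
    also have "\<dots> = (LINT t|lborel. indicator {0<..<S} t * (\<theta> t * qb t))" by (rule lebesgue_eq_lborel(1)) simp
    also have "\<dots> = (LINT s|lborel. LINT t|lborel. k (t, s))" unfolding inner2 ..
    finally show ?thesis using i2 by simp
  qed
  have inner1: "(LINT s|lborel. k (t, s)) = - \<theta>' t * (LINT s|lebesgue_on {0<..<t}. q s)" if "0 < t" "t < S" for t
    unfolding Iq[OF that] k_def using that by (simp add: mult.assoc)
  have m1: "(\<lambda>t. LINT s|lborel. k (t, s)) \<in> borel_measurable borel"
  proof -
    have "(\<lambda>t. LINT s|lborel. k (t, s)) \<in> borel_measurable lborel"
      by (rule lborel.borel_measurable_lebesgue_integral) measurable
    then show ?thesis by simp
  qed
  have k0: "indicator {0<..<S} t *\<^sub>R (LINT s|lborel. k (t, s)) = (LINT s|lborel. k (t, s))" for t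
    by (cases "t \<in> {0<..<S}") (auto simp: k_def)
  have ik: "integrable (lebesgue_on {0<..<S}) (\<lambda>t. LINT s|lborel. k (t, s))"
    unfolding lebesgue_on_integral(2)[OF m1] k0
    using lborel_pair.integrable_fst[of "\<lambda>t s. k (t, s)"] ki by simp
  have "(LINT t|lebesgue_on {0<..<S}. LINT s|lborel. k (t, s)) = (LINT z|(lborel \<Otimes>\<^sub>M lborel). k z)"
    unfolding lebesgue_on_integral(1)[OF m1] k0 using i1 by simp
  then have "(LINT t|lebesgue_on {0<..<S}. - \<theta>' t * a t) + 2 * (LINT t|lebesgue_on {0<..<S}. \<theta> t * q t)
      = (LINT t|lebesgue_on {0<..<S}. - \<theta>' t * a t + 2 * (LINT s|lborel. k (t, s)))"
    unfolding Tq using ia ik by simp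
  also have "\<dots> \<le> (LINT t|lebesgue_on {0<..<S}. 0)"
  proof (rule integral_mono)
    fix t assume "t \<in> space (lebesgue_on {0<..<S})"
    then have t: "0 < t" "t < S" by auto
    have "- \<theta>' t * (a t + 2 * (LINT s|lebesgue_on {0<..<t}. q s)) \<le> 0"
      using le[OF t] neg[of t] by (simp add: mult_nonpos_nonpos)
    then show "- \<theta>' t * a t + 2 * (LINT s|lborel. k (t, s)) \<le> 0"
      unfolding inner1[OF t] by (simp add: algebra_simps)
  qed (use ia ik in simp_all)
  finally show "(LINT t|lebesgue_on {0<..<S}. - \<theta>' t * a t) + 2 * (LINT t|lebesgue_on {0<..<S}. \<theta> t * q t) \<le> 0" by simp
qed

section \<open>Measurability in time for competitors\<close>

text \<open>Lebesgue measurability on the product does not pass to every slice, so integrals of a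
  competitor over space are computed from a Borel version, which agrees with it on almost every
  slice.\<close>

lemma borel_version_spacetime:
  fixes W :: "real \<Rightarrow> R3 \<Rightarrow> 'b::euclidean_space"
  assumes "spacetime W \<in> borel_measurable (lebesgue_on (UNIV \<times> {0<..<S}))"
  obtains Wb where "Wb \<in> borel_measurable (lborel \<Otimes>\<^sub>M lborel)"
    "AE t in lebesgue_on {0<..<S}. AE x in lebesgue. W t x = Wb (x, t)"
proof -
  have o: "open (UNIV \<times> {0<..<S} :: (R3 \<times> real) set)" by (intro open_Times) auto
  have O: "(UNIV \<times> {0<..<S} :: (R3 \<times> real) set) \<inter> space lebesgue \<in> sets lebesgue"
    using borel_open[OF o] by simp
  have "(\<lambda>z. indicator (UNIV \<times> {0<..<S}) z *\<^sub>R spacetime W z) \<in> borel_measurable (completion lborel)"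
    using assms unfolding borel_measurable_restrict_space_iff[OF O] .
  then obtain Wb where Wb: "Wb \<in> borel_measurable (lborel :: (R3 \<times> real) measure)"
    and eq: "AE z in lborel. indicator (UNIV \<times> {0<..<S}) z *\<^sub>R spacetime W z = Wb z"
    by (rule completion_borel_version) blast
  have "AE z in lborel \<Otimes>\<^sub>M lborel. indicator (UNIV \<times> {0<..<S}) z *\<^sub>R spacetime W z = Wb z"
    using eq unfolding lborel_prod .
  from AE_completion[OF AE_pair_swap[OF this]]
  have "AE t in lebesgue. AE x in lborel. indicator (UNIV \<times> {0<..<S}) (x, t) *\<^sub>R spacetime W (x, t) = Wb (x, t)" .
  then have "AE t in lebesgue. t \<in> {0<..<S} \<longrightarrow> (AE x in lebesgue. W t x = Wb (x, t))"
  proof eventually_elim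
    case (elim t)
    show ?case
    proof
      assume "t \<in> {0<..<S}"
      then have "AE x in lborel. W t x = Wb (x, t)" using elim by (simp add: indicator_def)
      then show "AE x in lebesgue. W t x = Wb (x, t)" by (rule AE_completion)
    qed
  qed
  then have "AE t in lebesgue_on {0<..<S}. AE x in lebesgue. W t x = Wb (x, t)"
    by (subst AE_restrict_space_iff) auto
  moreover have "Wb \<in> borel_measurable (lborel \<Otimes>\<^sub>M lborel)" using Wb unfolding lborel_prod .
  ultimately show ?thesis using that by blast
qed

text \<open>The integrand takes the value \<open>W t x\<close> as an argument, so that W can be
  exchanged for its Borel version inside k; Fubini then gives measurability in t, and D gives
  integrability.\<close>

lemma slice_integral_integrable:
  fixes W :: "real \<Rightarrow> R3 \<Rightarrow> R3" and k :: "R3 \<times> real \<Rightarrow> R3 \<Rightarrow> real"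
  assumes Wb [measurable]: "Wb \<in> borel_measurable (lborel \<Otimes>\<^sub>M lborel)"
    and W: "AE t in lebesgue_on {0<..<S}. W t \<in> borel_measurable lebesgue \<and> (AE x in lebesgue. W t x = Wb (x, t))"
    and k: "(\<lambda>p. k (fst p) (snd p)) \<in> borel_measurable ((lborel \<Otimes>\<^sub>M lborel) \<Otimes>\<^sub>M borel)"
    and D: "integrable (lebesgue_on {0<..<S}) D"
    and le: "AE t in lebesgue_on {0<..<S}. \<bar>LINT x|lebesgue. k (x, t) (W t x)\<bar> \<le> D t"
  shows "integrable (lebesgue_on {0<..<S}) (\<lambda>t. LINT x|lebesgue. k (x, t) (W t x))"
proof -
  have kb: "(\<lambda>z. k z (Wb z)) \<in> borel_measurable (lborel \<Otimes>\<^sub>M lborel)"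
    using measurable_compose[OF measurable_Pair[OF measurable_ident Wb] k] by simp
  have B: "(\<lambda>t. LINT x|lborel. k (x, t) (Wb (x, t))) \<in> borel_measurable borel"
    by (rule integral_measurable[OF kb])
  have eq: "AE t in lebesgue_on {0<..<S}. (LINT x|lebesgue. k (x, t) (W t x)) = (LINT x|lborel. k (x, t) (Wb (x, t)))"
    using W
  proof eventually_elim
    case (elim t)
    have t1: "(\<lambda>x. (x, t)) \<in> measurable lborel (lborel \<Otimes>\<^sub>M lborel)" by measurable
    have kt: "(\<lambda>x. k (x, t) (Wb (x, t))) \<in> borel_measurable borel"
      using measurable_compose[OF t1 kb] by simp
    have t2: "(\<lambda>x. (x, t)) \<in> measurable lebesgue (lborel \<Otimes>\<^sub>M lborel)" by (rule measurable_completion[OF t1])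
    have "(LINT x|lebesgue. k (x, t) (W t x)) = (LINT x|lebesgue. k (x, t) (Wb (x, t)))"
    proof (rule integral_cong_AE)
      show "(\<lambda>x. k (x, t) (W t x)) \<in> borel_measurable lebesgue"
        using measurable_compose[OF measurable_Pair[OF t2 conjunct1[OF elim]] k] by simp
      show "(\<lambda>x. k (x, t) (Wb (x, t))) \<in> borel_measurable lebesgue" by (rule lebesgue_borel_measurable[OF kt])
      show "AE x in lebesgue. k (x, t) (W t x) = k (x, t) (Wb (x, t))"
        using conjunct2[OF elim] by eventually_elim simp
    qed
    then show ?case using lebesgue_eq_lborel(1)[OF kt] by simp
  qed
  have "integrable (lebesgue_on {0<..<S}) (\<lambda>t. LINT x|lborel. k (x, t) (Wb (x, t)))"
  proof (rule Bochner_Integration.integrable_bound[OF D])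
    show "(\<lambda>t. LINT x|lborel. k (x, t) (Wb (x, t))) \<in> borel_measurable (lebesgue_on {0<..<S})"
      by (intro measurable_restrict_space1 lebesgue_borel_measurable B)
    show "AE t in lebesgue_on {0<..<S}. norm (LINT x|lborel. k (x, t) (Wb (x, t))) \<le> norm (D t)"
      using eq le by eventually_elim simp
  qed
  from lebesgue_on_AE_cong(1)[OF this eq] show ?thesis .
qed

lemma vec_nth_borel [measurable]: "(\<lambda>w::R3. w $ j) \<in> borel_measurable borel"
  by (intro borel_measurable_continuous_onI linear_continuous_on bounded_linear_vec_nth)

text \<open>The derivatives of the mollifications converge to the weak gradient, which makes
  its norm measurable in time.\<close>

lemma sqint_wgrad_integrable:
  fixes W :: "real \<Rightarrow> R3 \<Rightarrow> R3"
  assumes Wb [measurable]: "Wb \<in> borel_measurable (lborel \<Otimes>\<^sub>M lborel)"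
    and W: "AE t in lebesgue_on {0<..<S}. AE x in lebesgue. W t x = Wb (x, t)"
    and H: "AE t in lebesgue_on {0<..<S}. W t \<in> H1"
    and fin: "(\<integral>\<^sup>+ t. ennreal (sqint (wgrad (W t))) \<partial>lebesgue_on {0<..<S}) < \<infinity>"
  shows "integrable (lebesgue_on {0<..<S}) (\<lambda>t. sqint (wgrad (W t)))"
proof -
  \<comment> \<open>Derivatives of the mollifications, computed from the Borel version and hence
    jointly measurable in x and t; the kernel carries the derivative.\<close>
  define cw where "cw n j z = (LINT y|lborel. pd j (moll n) (fst z - y) *\<^sub>R Wb (y, snd z))" for n j and z :: "R3 \<times> real"
  have pm [measurable]: "pd j (moll n) \<in> borel_measurable borel" for n j
    by (rule Cc_inf_measurable[OF Cc_inf_pd[OF moll_test]])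
  have cwm [measurable]: "cw n j \<in> borel_measurable (lborel \<Otimes>\<^sub>M lborel)" for n j
    unfolding cw_def by (rule lborel.borel_measurable_lebesgue_integral) measurable
  define g where "g n j t = (LINT x|lborel. (norm (cw n j (x, t)))\<^sup>2)" for n j t
  have gm [measurable]: "g n j \<in> borel_measurable borel" for n j
    unfolding g_def by (rule integral_measurable[of "\<lambda>z. (norm (cw n j z))\<^sup>2"]) measurable
  \<comment> \<open>For almost every t the limits exist and sum to the squared norm of the weak
    gradient; at the other times \<open>lim\<close> has an unspecified value, yet L is
    measurable.\<close>
  define L where "L t = (\<Sum>j\<in>UNIV. lim (\<lambda>n. g n j t))" for t
  have Lm: "L \<in> borel_measurable borel"
    unfolding L_def by (intro borel_measurable_sum borel_measurable_lim_metric gm)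
  have eq: "AE t in lebesgue_on {0<..<S}. sqint (wgrad (W t)) = L t"
    using W H
  proof eventually_elim
    case (elim t)
    note h = H1_D[OF elim(2)]
    have c: "conv \<rho> (W t) x = (LINT y|lborel. \<rho> (x - y) *\<^sub>R Wb (y, t))" if \<rho>: "\<rho> \<in> Cc_inf UNIV" for \<rho> :: "R3 \<Rightarrow> real" and x
    proof -
      have r: "(\<lambda>y. \<rho> (x - y)) \<in> borel_measurable borel"
        by (rule Cc_inf_measurable[OF Cc_inf_reflect[OF \<rho>]])
      have b: "(\<lambda>y. \<rho> (x - y) *\<^sub>R Wb (y, t)) \<in> borel_measurable borel"
      proof -
        have "(\<lambda>y. Wb (y, t)) \<in> borel_measurable lborel" by measurable
        then show ?thesis using r by simp
      qed
      have "conv \<rho> (W t) x = (LINT y|lebesgue. \<rho> (x - y) *\<^sub>R Wb (y, t))"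
        unfolding conv_def
      proof (rule integral_cong_AE)
        show "(\<lambda>y. \<rho> (x - y) *\<^sub>R W t y) \<in> borel_measurable lebesgue"
          using h(1) by (intro borel_measurable_scaleR lebesgue_borel_measurable[OF r]) (simp add: Lp2_iff)
        show "(\<lambda>y. \<rho> (x - y) *\<^sub>R Wb (y, t)) \<in> borel_measurable lebesgue" by (rule lebesgue_borel_measurable[OF b])
        show "AE y in lebesgue. \<rho> (x - y) *\<^sub>R W t y = \<rho> (x - y) *\<^sub>R Wb (y, t)"
          using elim(1) by eventually_elim simp
      qed
      then show ?thesis using lebesgue_eq_lborel(1)[OF b] by simp
    qed
    have "(\<lambda>n. g n j t) \<longlonglongrightarrow> sqint (\<lambda>x. wgrad (W t) x $ j)" for j
    proof -
      have cj: "conv (moll n) (\<lambda>x. wgrad (W t) x $ j) \<in> Lp 2" for n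
        by (rule mollifier_kernel.conv_contraction(1)[OF moll_kernel h(3)])
      have e: "g n j t = sqint (conv (moll n) (\<lambda>x. wgrad (W t) x $ j))" for n
      proof -
        have ce: "cw n j (x, t) = conv (moll n) (\<lambda>x. wgrad (W t) x $ j) x" for x
          unfolding conv_weak_deriv[OF moll_test h(2), symmetric] c[OF Cc_inf_pd[OF moll_test]] cw_def by simp
        have "(\<lambda>x. cw n j (x, t)) \<in> borel_measurable lborel" by measurable
        then have "(\<lambda>x. (norm (conv (moll n) (\<lambda>x. wgrad (W t) x $ j) x))\<^sup>2) \<in> borel_measurable borel"
          unfolding ce by simp
        from lebesgue_eq_lborel(1)[OF this] show ?thesis unfolding g_def ce by simp
      qed
      show ?thesis unfolding e by (rule sqint_tendsto[OF cj h(3) moll_L2[OF h(3)]])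
    qed
    then have "lim (\<lambda>n. g n j t) = sqint (\<lambda>x. wgrad (W t) x $ j)" for j by (rule limI)
    then show ?case unfolding L_def using Lp2_vec(2)[of "wgrad (W t)", OF h(3)] by simp
  qed
  have "integrable (lebesgue_on {0<..<S}) L"
  proof (rule integrableI_bounded)
    show "L \<in> borel_measurable (lebesgue_on {0<..<S})"
      by (intro measurable_restrict_space1 lebesgue_borel_measurable Lm)
    have "(\<integral>\<^sup>+ t. ennreal (norm (L t)) \<partial>lebesgue_on {0<..<S}) = (\<integral>\<^sup>+ t. ennreal (sqint (wgrad (W t))) \<partial>lebesgue_on {0<..<S})"
    proof (rule nn_integral_cong_AE)
      show "AE t in lebesgue_on {0<..<S}. ennreal (norm (L t)) = ennreal (sqint (wgrad (W t)))"
        using eq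
      proof eventually_elim
        case (elim t)
        show ?case unfolding elim[symmetric] using sqint_nonneg[of "wgrad (W t)"] by (metis abs_of_nonneg real_norm_def)
      qed
    qed
    then show "(\<integral>\<^sup>+ t. ennreal (norm (L t)) \<partial>lebesgue_on {0<..<S}) < \<infinity>" using fin by simp
  qed
  from lebesgue_on_AE_cong(1)[OF this eq] show ?thesis .
qed

lemma sqint_diff:
  fixes u v :: "R3 \<Rightarrow> 'b::euclidean_space"
  assumes u: "u \<in> Lp 2" and v: "v \<in> Lp 2"
  shows "sqint (\<lambda>x. u x - v x) = sqint u + sqint v - 2 * (LINT x|lebesgue. u x \<bullet> v x)"
proof -
  have i: "integrable lebesgue (\<lambda>x. (norm (u x))\<^sup>2)" "integrable lebesgue (\<lambda>x. (norm (v x))\<^sup>2)"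
    "integrable lebesgue (\<lambda>x. u x \<bullet> v x)"
    using u v Lp2_inner(1)[OF u v] by (auto simp: Lp2_iff)
  have "(norm (u x - v x))\<^sup>2 = (norm (u x))\<^sup>2 + (norm (v x))\<^sup>2 - 2 * (u x \<bullet> v x)" for x
    by (simp add: power2_norm_eq_inner inner_diff inner_commute algebra_simps)
  then show ?thesis using i by simp
qed

lemma transport_bound:
  fixes u :: "R3 \<Rightarrow> R3" and a :: "3 \<Rightarrow> R3 \<Rightarrow> R3"
  assumes u: "u \<in> Lp 2" and a: "\<And>j. a j \<in> borel_measurable borel" "\<And>j x. norm (a j x) \<le> C"
  shows "(\<lambda>x. \<Sum>j\<in>UNIV. (u x $ j) *\<^sub>R a j x) \<in> Lp 2"
    and "norm ((\<Sum>j\<in>UNIV. (u x $ j) *\<^sub>R a j x) \<bullet> u x) \<le> 3 * C * (norm (u x))\<^sup>2"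
    and "\<bar>LINT x|lebesgue. (\<Sum>j\<in>UNIV. (u x $ j) *\<^sub>R a j x) \<bullet> u x\<bar> \<le> 3 * C * sqint u"
proof -
  have C: "C \<ge> 0" using a(2) norm_ge_zero order_trans by blast
  have m: "u \<in> borel_measurable lebesgue" "integrable lebesgue (\<lambda>x. (norm (u x))\<^sup>2)" using u by (auto simp: Lp2_iff)
  have b: "norm (\<Sum>j\<in>UNIV. (u x $ j) *\<^sub>R a j x) \<le> 3 * C * norm (u x)" for x
  proof -
    have "norm (\<Sum>j\<in>UNIV. (u x $ j) *\<^sub>R a j x) \<le> (\<Sum>j\<in>(UNIV::3 set). norm (u x) * C)"
    proof (rule sum_norm_le)
      show "norm ((u x $ j) *\<^sub>R a j x) \<le> norm (u x) * C" for j
        unfolding norm_scaleR real_norm_def by (intro mult_mono component_le_norm_cart a(2)) auto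
    qed
    then show ?thesis by (simp add: mult_ac)
  qed
  show L: "(\<lambda>x. \<Sum>j\<in>UNIV. (u x $ j) *\<^sub>R a j x) \<in> Lp 2"
  proof (rule Lp2_bound)
    show "(\<lambda>x. \<Sum>j\<in>UNIV. (u x $ j) *\<^sub>R a j x) \<in> borel_measurable lebesgue"
      by (intro borel_measurable_sum borel_measurable_scaleR measurable_compose[OF m(1) vec_nth_borel] lebesgue_borel_measurable a)
    show "integrable lebesgue (\<lambda>x. (3 * C)\<^sup>2 * (norm (u x))\<^sup>2)" by (intro integrable_mult_right m)
    show "(norm (\<Sum>j\<in>UNIV. (u x $ j) *\<^sub>R a j x))\<^sup>2 \<le> (3 * C)\<^sup>2 * (norm (u x))\<^sup>2" for x
      using power_mono[OF b[of x], of 2] by (simp add: power_mult_distrib)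
  qed
  have p: "norm ((\<Sum>j\<in>UNIV. (u x $ j) *\<^sub>R a j x) \<bullet> u x) \<le> 3 * C * (norm (u x))\<^sup>2" for x
  proof -
    have "norm ((\<Sum>j\<in>UNIV. (u x $ j) *\<^sub>R a j x) \<bullet> u x) \<le> norm (\<Sum>j\<in>UNIV. (u x $ j) *\<^sub>R a j x) * norm (u x)"
      unfolding real_norm_def by (rule Cauchy_Schwarz_ineq2)
    also have "\<dots> \<le> (3 * C * norm (u x)) * norm (u x)" by (intro mult_right_mono b) simp
    finally show ?thesis by (simp add: power2_eq_square)
  qed
  then show "norm ((\<Sum>j\<in>UNIV. (u x $ j) *\<^sub>R a j x) \<bullet> u x) \<le> 3 * C * (norm (u x))\<^sup>2" .
  have "\<bar>LINT x|lebesgue. (\<Sum>j\<in>UNIV. (u x $ j) *\<^sub>R a j x) \<bullet> u x\<bar> \<le> (LINT x|lebesgue. norm ((\<Sum>j\<in>UNIV. (u x $ j) *\<^sub>R a j x) \<bullet> u x))"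
    using integral_norm_bound[of lebesgue "\<lambda>x. (\<Sum>j\<in>UNIV. (u x $ j) *\<^sub>R a j x) \<bullet> u x"] by simp
  also have "\<dots> \<le> (LINT x|lebesgue. 3 * C * (norm (u x))\<^sup>2)"
    by (intro integral_mono integrable_norm Lp2_inner(1)[OF L u] integrable_mult_right m p)
  finally show "\<bar>LINT x|lebesgue. (\<Sum>j\<in>UNIV. (u x $ j) *\<^sub>R a j x) \<bullet> u x\<bar> \<le> 3 * C * sqint u" by simp
qed

lemma L2_sigma_diff:
  assumes u: "u \<in> L2_sigma" and v: "v \<in> L2_sigma"
  shows "(\<lambda>x. u x - v x) \<in> L2_sigma"
proof -
  have L: "u \<in> Lp 2" "v \<in> Lp 2" using u v by (auto simp: L2_sigma_def)
  have "(LINT x|lebesgue. (u x - v x) \<bullet> grad \<phi> x) = 0" if \<phi>: "\<phi> \<in> Cc_inf UNIV" for \<phi> :: "R3 \<Rightarrow> real"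
  proof -
    have g: "grad \<phi> \<in> Lp 2"
    proof (rule Lp2_vec(1))
      show "(\<lambda>x. grad \<phi> x $ j) \<in> Lp 2" for j
        using Cc_inf_H1(1)[OF Cc_inf_pd[OF \<phi>, of j]] by (simp add: grad_def)
    qed
    have "(LINT x|lebesgue. u x \<bullet> grad \<phi> x) = 0" "(LINT x|lebesgue. v x \<bullet> grad \<phi> x) = 0"
      using u v \<phi> by (auto simp: L2_sigma_def)
    then show ?thesis using Lp2_inner(1)[OF L(1) g] Lp2_inner(1)[OF L(2) g] by (simp add: inner_diff_left)
  qed
  then show ?thesis using Lp2_diff[OF L] by (simp add: L2_sigma_def)
qed

lemma integrable_const_initial:
  fixes S :: real
  shows "integrable (lebesgue_on {0<..<S}) (\<lambda>t. a :: real)"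
proof -
  have "integrable lborel (\<lambda>t. indicator {0<..<S} t *\<^sub>R a)"
    by (cases "S \<ge> 0") (auto intro!: integrable_mult_left integrable_real_indicator)
  then show ?thesis by (subst lebesgue_on_integral(2)) auto
qed

section \<open>The relative energy of a competitor and the flow\<close>

context flow begin

lemma pd_slice_borel: "pd j (V t) \<in> borel_measurable borel"
  by (intro borel_measurable_continuous_onI slice_cont pd_cont)

text \<open>Inserting the force turns the right-hand side of the second claim into the squared norm
  of grad w plus the integral of (w \<bullet> grad) V \<bullet> W. In the latter W = w + V; the part
  with V vanishes by \<open>transport_zero\<close>, and the part with w is at least -3 C
  \<open>sqint w\<close>.\<close>

lemma weak_strong_pointwise:
  assumes t: "t \<notin> Z" and H: "W \<in> H1" and \<sigma>: "W \<in> L2_sigma"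
  defines "w \<equiv> \<lambda>x. W x - V t x"
  shows "sqint W + sqint (V t) - 2 * (LINT x|lebesgue. W x \<bullet> V t x) = sqint w"
    and "- (3 * C * sqint w) \<le> (sqint (wgrad W) - (LINT x|lebesgue. forceB t x \<bullet> W x))
      + (sqint (wgrad (V t)) - (LINT x|lebesgue. forceB t x \<bullet> V t x))
      - (- (LINT x|lebesgue. W x \<bullet> lapB t x) - (LINT x|lebesgue. (\<Sum>j\<in>UNIV. (W x $ j) *\<^sub>R pd j (V t) x) \<bullet> W x)
         - (LINT x|lebesgue. W x \<bullet> time_deriv V t x) - (LINT x|lebesgue. forceB t x \<bullet> V t x))"
proof -
  have W: "W \<in> Lp 2" using \<sigma> by (simp add: L2_sigma_def)
  have ws: "w \<in> L2_sigma" unfolding w_def by (rule L2_sigma_diff[OF \<sigma> V_sigma])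
  then have wL: "w \<in> Lp 2" by (simp add: L2_sigma_def)
  show "sqint W + sqint (V t) - 2 * (LINT x|lebesgue. W x \<bullet> V t x) = sqint w"
    unfolding w_def sqint_diff[OF W V_H1(1)] ..
  have lapB: "lapB t = lap (V t)" using t by (simp add: lapB_def fun_eq_iff)
  have fB: "forceB t = force t" using forceB[OF t] by (simp add: fun_eq_iff)
  have "(LINT x|lebesgue. wgrad W x \<bullet> wgrad (V t) x) = (LINT x|lebesgue. wgrad W x \<bullet> grad (V t) x)"
  proof (rule integral_cong_AE)
    show "(\<lambda>x. wgrad W x \<bullet> wgrad (V t) x) \<in> borel_measurable lebesgue"
      using Lp2_inner(1)[OF H1_D(4)[OF H] H1_D(4)[OF V_H1(2)]] by (rule borel_measurable_integrable)
    show "(\<lambda>x. wgrad W x \<bullet> grad (V t) x) \<in> borel_measurable lebesgue"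
      using H1_lap(2)[OF H V_test[OF t]] by (rule borel_measurable_integrable)
    show "AE x in lebesgue. wgrad W x \<bullet> wgrad (V t) x = wgrad W x \<bullet> grad (V t) x"
      using wgrad_eq_AE[OF weak_deriv_pd[OF V_slice[of t]]] by eventually_elim (simp add: grad_def)
  qed
  then have g: "0 \<le> sqint (wgrad W) + sqint (wgrad (V t)) + 2 * (LINT x|lebesgue. W x \<bullet> lap (V t) x)"
    using sqint_diff[OF H1_D(4)[OF H] H1_D(4)[OF V_H1(2)], of t] sqint_nonneg[of "\<lambda>x. wgrad W x - wgrad (V t) x"]
      H1_lap(1)[OF H V_test[OF t]] by linarith
  let ?q = "\<lambda>u x. \<Sum>j\<in>UNIV. (u x $ j) *\<^sub>R pd j (V t) x"
  note tb = transport_bound[OF _ pd_slice_borel pd_le]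
  have i: "integrable lebesgue (\<lambda>x. ?q W x \<bullet> W x)" "integrable lebesgue (\<lambda>x. ?q (V t) x \<bullet> W x)"
    "integrable lebesgue (\<lambda>x. ?q w x \<bullet> w x)" "integrable lebesgue (\<lambda>x. ?q w x \<bullet> V t x)"
    by (intro Lp2_inner(1) tb(1) W wL V_H1(1))+
  have "?q W x \<bullet> W x - ?q (V t) x \<bullet> W x = ?q w x \<bullet> w x + ?q w x \<bullet> V t x" for x
  proof -
    have e: "?q W x - ?q (V t) x = ?q w x" "W x = w x + V t x"
      by (simp_all add: w_def scaleR_diff_left sum_subtractf)
    have "?q W x \<bullet> W x - ?q (V t) x \<bullet> W x = (?q W x - ?q (V t) x) \<bullet> W x" by (rule inner_diff_left[symmetric])
    also have "\<dots> = ?q w x \<bullet> (w x + V t x)" by (rule arg_cong2[of _ _ _ _ inner, OF e])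
    also have "\<dots> = ?q w x \<bullet> w x + ?q w x \<bullet> V t x" by (rule inner_add_right)
    finally show ?thesis .
  qed
  then have "(LINT x|lebesgue. ?q W x \<bullet> W x - ?q (V t) x \<bullet> W x) = (LINT x|lebesgue. ?q w x \<bullet> w x + ?q w x \<bullet> V t x)"
    by simp
  then have q: "(LINT x|lebesgue. ?q W x \<bullet> W x) - (LINT x|lebesgue. ?q (V t) x \<bullet> W x) = (LINT x|lebesgue. ?q w x \<bullet> w x)"
    unfolding Bochner_Integration.integral_diff[OF i(1,2)] Bochner_Integration.integral_add[OF i(3,4)]
      transport_zero[OF t ws] by simp
  have t3: "\<bar>LINT x|lebesgue. ?q w x \<bullet> w x\<bar> \<le> 3 * C * sqint w" by (rule tb(3)[OF wL])
  have c: "(LINT x|lebesgue. W x \<bullet> u x) = (LINT x|lebesgue. u x \<bullet> W x)" for u :: "R3 \<Rightarrow> R3"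
    by (simp add: inner_commute)
  show "- (3 * C * sqint w) \<le> (sqint (wgrad W) - (LINT x|lebesgue. forceB t x \<bullet> W x))
      + (sqint (wgrad (V t)) - (LINT x|lebesgue. forceB t x \<bullet> V t x))
      - (- (LINT x|lebesgue. W x \<bullet> lapB t x) - (LINT x|lebesgue. (\<Sum>j\<in>UNIV. (W x $ j) *\<^sub>R pd j (V t) x) \<bullet> W x)
         - (LINT x|lebesgue. W x \<bullet> time_deriv V t x) - (LINT x|lebesgue. forceB t x \<bullet> V t x))"
    using t3 g q force_inner[OF t W] unfolding lapB fB c[of "lap (V t)"] c[of "time_deriv V t"] by linarith
qed

lemma F_integrable: "integrable (lebesgue_on {0<..<S}) F"
  and G_integrable: "integrable (lebesgue_on {0<..<S}) G"
proof -
  show F: "integrable (lebesgue_on {0<..<S}) F"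
    unfolding lebesgue_on_integral(2)[OF F_meas]
  proof (rule integrableI_bounded)
    have "ennreal (norm (indicator {0<..<S} t *\<^sub>R F t)) = ennreal (F t) * indicator {0<..<S} t" for t
      using F_nonneg[of t] by (simp add: indicator_def)
    then show "(\<integral>\<^sup>+ t. ennreal (norm (indicator {0<..<S} t *\<^sub>R F t)) \<partial>lborel) < \<infinity>" using F_int[of S] by simp
  qed measurable
  show "integrable (lebesgue_on {0<..<S}) G"
    unfolding G_def[abs_def] by (intro Bochner_Integration.integrable_add integrable_const_initial F)
qed

end

lemma Leray_Hopf_bounds:
  assumes LH: "Leray_Hopf S V0 f W"
  obtains K where "K \<ge> 0" "AE t in lebesgue_on {0<..<S}. W t \<in> L2_sigma \<and> W t \<in> H1 \<and> sqint (W t) \<le> K\<^sup>2"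
    and "(\<integral>\<^sup>+ t. ennreal (sqint (wgrad (W t))) \<partial>lebesgue_on {0<..<S}) < \<infinity>"
proof -
  let ?M = "lebesgue_on {0<..<S}"
  have W: "AE t in ?M. W t \<in> L2_sigma" "esssup ?M (\<lambda>t. Lp_norm 2 (W t)) < \<infinity>"
    "AE t in ?M. W t \<in> H1" "Lp_gauge 2 ?M (\<lambda>t. H1_norm (W t)) < \<infinity>"
    using LH unfolding Leray_Hopf_def Bochner_def Lp_gauge_def by auto
  define K where "K = enn2real (esssup ?M (\<lambda>t. Lp_norm 2 (W t)))"
  have K: "K \<ge> 0" "esssup ?M (\<lambda>t. Lp_norm 2 (W t)) = ennreal K"
    using W(2) by (auto simp: K_def less_top)
  have 1: "AE t in ?M. W t \<in> L2_sigma \<and> W t \<in> H1 \<and> sqint (W t) \<le> K\<^sup>2"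
    using W(1,3) esssup_AE[where M="?M" and f="\<lambda>t. Lp_norm 2 (W t)"] unfolding K(2)
  proof eventually_elim
    case (elim t)
    have L: "W t \<in> Lp 2" using elim(1) by (simp add: L2_sigma_def)
    have "sqrt (sqint (W t)) \<le> K" using elim(3) K(1) unfolding Lp2_norm(1)[OF L] by (simp add: ennreal_le_iff)
    then have "(sqrt (sqint (W t)))\<^sup>2 \<le> K\<^sup>2" using sqint_nonneg[of "W t"] by (intro power_mono) simp_all
    then show ?case using elim sqint_nonneg[of "W t"] by simp
  qed
  have "(\<integral>\<^sup>+ t. enn_powr (H1_norm (W t)) 2 \<partial>?M) < \<infinity>"
    using W(4) unfolding Lp_gauge_def by (simp add: enn_powr_less_top[unfolded infinity_ennreal_def])
  moreover have "(\<integral>\<^sup>+ t. ennreal (sqint (wgrad (W t))) \<partial>?M) \<le> (\<integral>\<^sup>+ t. enn_powr (H1_norm (W t)) 2 \<partial>?M)"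
  proof (rule nn_integral_mono_AE)
    show "AE t in ?M. ennreal (sqint (wgrad (W t))) \<le> enn_powr (H1_norm (W t)) 2"
      using W(3)
    proof eventually_elim
      case (elim t)
      have n: "sqint (W t) + sqint (wgrad (W t)) \<ge> 0" by (intro add_nonneg_nonneg sqint_nonneg)
      have "enn_powr (H1_norm (W t)) 2 = ennreal (sqrt (sqint (W t) + sqint (wgrad (W t))) powr 2)"
        unfolding H1_norm_eq[OF elim] by (rule enn_powr_ennreal) (use n in simp)
      also have "sqrt (sqint (W t) + sqint (wgrad (W t))) powr 2 = sqint (W t) + sqint (wgrad (W t))"
        using n by (simp add: powr_numeral)
      finally show ?case using sqint_nonneg[of "W t"] by (simp only:) (intro ennreal_leI, simp)
    qed
  qed
  ultimately have "(\<integral>\<^sup>+ t. ennreal (sqint (wgrad (W t))) \<partial>?M) < \<infinity>" by (rule le_less_trans[rotated])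
  with K(1) 1 show ?thesis by (rule that)
qed

lemma inner_ball_le:
  fixes w u :: "R3 \<Rightarrow> R3"
  assumes w: "w \<in> Lp 2" "sqint w \<le> K\<^sup>2" "K \<ge> 0" and u: "u \<in> Lp 2"
    and le: "\<And>x. norm (u x) \<le> H * indicator (cball a 1) x" and H: "H \<ge> 0"
  shows "\<bar>LINT x|lebesgue. w x \<bullet> u x\<bar> \<le> K * (H * sqrt vol1)"
proof -
  have "\<bar>LINT x|lebesgue. w x \<bullet> u x\<bar> \<le> sqrt (sqint w) * sqrt (sqint u)" by (rule Lp2_inner(2)[OF w(1) u])
  also have "\<dots> \<le> sqrt (K\<^sup>2) * sqrt (H\<^sup>2 * vol1)"
    by (intro mult_mono real_sqrt_le_mono w(2) sqint_le_ball[OF u le]) (simp_all add: sqint_nonneg)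
  also have "\<dots> = K * (H * sqrt vol1)" using w(3) H by (simp add: real_sqrt_mult)
  finally show ?thesis .
qed

lemma ball_tendsto:
  fixes u :: "nat \<Rightarrow> R3 \<Rightarrow> R3"
  assumes m: "\<And>n. u n \<in> borel_measurable lebesgue" "v \<in> borel_measurable lebesgue"
    and le: "\<And>n x. norm (u n x) \<le> H * indicator (cball a 1) x" "\<And>x. norm (v x) \<le> H * indicator (cball a 1) x"
    and lim: "\<And>x. (\<lambda>n. u n x) \<longlonglongrightarrow> v x"
  shows "(\<lambda>n. sqint (\<lambda>x. u n x - v x)) \<longlonglongrightarrow> 0"
proof (rule sqint_dominated)
  show "(\<lambda>x. u n x - v x) \<in> borel_measurable lebesgue" for n by (intro borel_measurable_diff m)
  have "integrable lborel (\<lambda>x. (2 * H)\<^sup>2 * indicator (cball a 1) x :: real)"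
    by (intro integrable_mult_right integrable_real_indicator) (auto simp: emeasure_unit_ball)
  then show "integrable lebesgue (\<lambda>x. (2 * H)\<^sup>2 * indicator (cball a 1) x :: real)"
    by (subst lebesgue_eq_lborel(2)) auto
  show "(norm (u n x - v x))\<^sup>2 \<le> (2 * H)\<^sup>2 * indicator (cball a 1) x" for n x
  proof -
    have "norm (u n x - v x) \<le> 2 * (H * indicator (cball a 1) x)"
      using norm_triangle_ineq4[of "u n x" "v x"] le(1)[of n x] le(2)[of x] by linarith
    then have "(norm (u n x - v x))\<^sup>2 \<le> (2 * (H * indicator (cball a 1) x))\<^sup>2" by (rule power_mono) simp
    then show ?thesis by (cases "x \<in> cball a 1") (simp_all add: power_mult_distrib)
  qed
  show "AE x in lebesgue. (\<lambda>n. u n x - v x) \<longlonglongrightarrow> 0"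
    by (intro AE_I2 LIM_zero lim)
qed

context flow begin

text \<open>The weak form of W tested with V, minus the force term, with derivatives moved onto V
  and without the time weight. W enters undifferentiated, so L^2 bounds on W suffice for limits in
  V.\<close>

definition pair_terms :: "(R3 \<Rightarrow> R3) \<Rightarrow> (R3 \<Rightarrow> R3) \<Rightarrow> real \<Rightarrow> real" where
  "pair_terms f W t = - (LINT x|lebesgue. W x \<bullet> lapB t x) - (LINT x|lebesgue. (\<Sum>j\<in>UNIV. (W x $ j) *\<^sub>R pd j (V t) x) \<bullet> W x)
         - (LINT x|lebesgue. W x \<bullet> time_deriv V t x) - (LINT x|lebesgue. f x \<bullet> V t x)"

lemma lapB_ball: "norm (lapB t x) \<le> F t * indicator (cball (c t) 1) x"
  unfolding lapB_def using ball_le[of "lap (V t)" x "F t" t, OF lap_le lap_supp] F_nonneg[of t] by (auto simp: indicator_def)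

lemma lapB_borel: "lapB t \<in> borel_measurable borel"
  by (rule slice_measurable[OF lapB_meas])

lemma lapB_Lp2: "lapB t \<in> Lp 2"
  using lap_Lp2[of t] zero_Lp2 by (cases "t \<in> Z") (auto simp: lapB_def[abs_def])

text \<open>The bounds involve only K, F, C and the bound on the force, so they hold with the same
  constants for every approximation in \<open>approx_flow\<close>.\<close>

lemma pair_bounds:
  assumes W: "W \<in> Lp 2" "sqint W \<le> K\<^sup>2" "K \<ge> 0"
    and f: "f \<in> Lp 2" "\<And>x. norm (f x) \<le> Gf * indicator (cball (c t) 1) x" "Gf \<ge> 0"
  shows "\<bar>LINT x|lebesgue. W x \<bullet> lapB t x\<bar> \<le> K * (F t * sqrt vol1)"
    "\<bar>LINT x|lebesgue. (\<Sum>j\<in>UNIV. (W x $ j) *\<^sub>R pd j (V t) x) \<bullet> W x\<bar> \<le> 3 * C * K\<^sup>2"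
    "\<bar>LINT x|lebesgue. W x \<bullet> time_deriv V t x\<bar> \<le> K * (C * sqrt vol1)"
    "\<bar>LINT x|lebesgue. W x \<bullet> V t x\<bar> \<le> K * (C * sqrt vol1)"
    "\<bar>LINT x|lebesgue. f x \<bullet> V t x\<bar> \<le> (C * sqrt vol1) * (Gf * sqrt vol1)"
proof -
  show "\<bar>LINT x|lebesgue. W x \<bullet> lapB t x\<bar> \<le> K * (F t * sqrt vol1)"
    by (rule inner_ball_le[OF W lapB_Lp2 lapB_ball F_nonneg])
  show "\<bar>LINT x|lebesgue. W x \<bullet> time_deriv V t x\<bar> \<le> K * (C * sqrt vol1)"
    by (rule inner_ball_le[OF W dt_Lp2 dt_ball C_nonneg])
  show "\<bar>LINT x|lebesgue. W x \<bullet> V t x\<bar> \<le> K * (C * sqrt vol1)"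
    by (rule inner_ball_le[OF W V_H1(1) V_ball C_nonneg])
  have "\<bar>LINT x|lebesgue. (\<Sum>j\<in>UNIV. (W x $ j) *\<^sub>R pd j (V t) x) \<bullet> W x\<bar> \<le> 3 * C * sqint W"
    by (rule transport_bound(3)[OF W(1) pd_slice_borel pd_le])
  also have "\<dots> \<le> 3 * C * K\<^sup>2" using C_nonneg W(2) by (intro mult_left_mono) simp_all
  finally show "\<bar>LINT x|lebesgue. (\<Sum>j\<in>UNIV. (W x $ j) *\<^sub>R pd j (V t) x) \<bullet> W x\<bar> \<le> 3 * C * K\<^sup>2" .
  have s: "sqint (V t) \<le> (C * sqrt vol1)\<^sup>2"
    using sqint_le_ball[OF V_H1(1) V_ball, of t] vol1_nonneg by (simp add: power_mult_distrib)
  have "\<bar>LINT x|lebesgue. V t x \<bullet> f x\<bar> \<le> (C * sqrt vol1) * (Gf * sqrt vol1)"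
    by (rule inner_ball_le[OF V_H1(1) s _ f]) (simp add: C_nonneg vol1_nonneg)
  then show "\<bar>LINT x|lebesgue. f x \<bullet> V t x\<bar> \<le> (C * sqrt vol1) * (Gf * sqrt vol1)" by (simp add: inner_commute)
qed

lemma pair_integrable:
  assumes Wb: "Wb \<in> borel_measurable (lborel \<Otimes>\<^sub>M lborel)"
    and W: "AE t in lebesgue_on {0<..<S}. AE x in lebesgue. W t x = Wb (x, t)"
    and K: "AE t in lebesgue_on {0<..<S}. W t \<in> L2_sigma \<and> W t \<in> H1 \<and> sqint (W t) \<le> K\<^sup>2" "K \<ge> 0"
    and f: "spacetime f \<in> borel_measurable (lborel \<Otimes>\<^sub>M lborel)" "\<And>t. f t \<in> Lp 2"
      "\<And>t x. norm (f t x) \<le> Gf t * indicator (cball (c t) 1) x" "\<And>t. Gf t \<ge> 0" "integrable (lebesgue_on {0<..<S}) Gf"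
  shows "integrable (lebesgue_on {0<..<S}) (\<lambda>t. pair_terms (f t) (W t) t)"
    "integrable (lebesgue_on {0<..<S}) (\<lambda>t. LINT x|lebesgue. W t x \<bullet> V t x)"
    "integrable (lebesgue_on {0<..<S}) (\<lambda>t. LINT x|lebesgue. f t x \<bullet> V t x)"
    "integrable (lebesgue_on {0<..<S}) (\<lambda>t. sqint (W t))"
proof -
  let ?M = "lebesgue_on {0<..<S}"
  note const = integrable_const_initial
  have W': "AE t in ?M. W t \<in> borel_measurable lebesgue \<and> (AE x in lebesgue. W t x = Wb (x, t))"
    using W K(1) by eventually_elim (auto simp: L2_sigma_def Lp2_iff)
  have bd: "AE t in ?M. P t (W t)" if "\<And>t w. w \<in> Lp 2 \<Longrightarrow> sqint w \<le> K\<^sup>2 \<Longrightarrow> P t w" for P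
    using K(1) by eventually_elim (auto simp: L2_sigma_def intro: that)
  have inner_int: "integrable ?M (\<lambda>t. LINT x|lebesgue. W t x \<bullet> u (x, t))"
    if [measurable]: "u \<in> borel_measurable (lborel \<Otimes>\<^sub>M lborel)" and D: "integrable ?M D"
      "AE t in ?M. \<bar>LINT x|lebesgue. W t x \<bullet> u (x, t)\<bar> \<le> D t" for u :: "R3 \<times> real \<Rightarrow> R3" and D
    by (rule slice_integral_integrable[where k = "\<lambda>z w. w \<bullet> u z", OF Wb W' _ D]) measurable
  have quad_int: "integrable ?M (\<lambda>t. LINT x|lebesgue. (\<Sum>j\<in>UNIV. (W t x $ j) *\<^sub>R u j (x, t)) \<bullet> W t x)"
    if u [measurable]: "\<And>j. u j \<in> borel_measurable (lborel \<Otimes>\<^sub>M lborel)" and D: "integrable ?M D"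
      "AE t in ?M. \<bar>LINT x|lebesgue. (\<Sum>j\<in>UNIV. (W t x $ j) *\<^sub>R u j (x, t)) \<bullet> W t x\<bar> \<le> D t"
    for u :: "3 \<Rightarrow> R3 \<times> real \<Rightarrow> R3" and D
    by (rule slice_integral_integrable[where k = "\<lambda>z w. (\<Sum>j\<in>UNIV. (w $ j) *\<^sub>R u j z) \<bullet> w", OF Wb W' _ D]) measurable
  have i1: "integrable ?M (\<lambda>t. LINT x|lebesgue. W t x \<bullet> lapB t x)"
    using inner_int[OF lapB_meas integrable_mult_right[OF integrable_mult_left[OF F_integrable[of S], of "sqrt vol1"], of K]] bd[of "\<lambda>t w. \<bar>LINT x|lebesgue. w x \<bullet> lapB t x\<bar> \<le> K * (F t * sqrt vol1)"]
      pair_bounds(1)[OF _ _ K(2) f(2,3,4)] by simp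
  have i2: "integrable ?M (\<lambda>t. LINT x|lebesgue. (\<Sum>j\<in>UNIV. (W t x $ j) *\<^sub>R pd j (V t) x) \<bullet> W t x)"
    using quad_int[OF pd_meas const[where a = "3 * C * K\<^sup>2"]] bd[of "\<lambda>t w. \<bar>LINT x|lebesgue. (\<Sum>j\<in>UNIV. (w x $ j) *\<^sub>R pd j (V t) x) \<bullet> w x\<bar> \<le> 3 * C * K\<^sup>2"]
      pair_bounds(2)[OF _ _ K(2) f(2,3,4)] by simp
  have i3: "integrable ?M (\<lambda>t. LINT x|lebesgue. W t x \<bullet> time_deriv V t x)"
    using inner_int[OF dt_meas const[where a = "K * (C * sqrt vol1)"]] bd[of "\<lambda>t w. \<bar>LINT x|lebesgue. w x \<bullet> time_deriv V t x\<bar> \<le> K * (C * sqrt vol1)"]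
      pair_bounds(3)[OF _ _ K(2) f(2,3,4)] by simp
  show i4: "integrable ?M (\<lambda>t. LINT x|lebesgue. W t x \<bullet> V t x)"
    using inner_int[OF V_meas const[where a = "K * (C * sqrt vol1)"]] bd[of "\<lambda>t w. \<bar>LINT x|lebesgue. w x \<bullet> V t x\<bar> \<le> K * (C * sqrt vol1)"]
      pair_bounds(4)[OF _ _ K(2) f(2,3,4)] by simp
  show i5: "integrable ?M (\<lambda>t. LINT x|lebesgue. f t x \<bullet> V t x)"
  proof -
    have m1: "AE t in ?M. f t \<in> borel_measurable lebesgue \<and> (AE x in lebesgue. f t x = spacetime f (x, t))"
      using f(2) by (simp add: Lp2_iff)
    have "(\<lambda>p. snd p \<bullet> g (fst p)) \<in> borel_measurable ((lborel \<Otimes>\<^sub>M lborel) \<Otimes>\<^sub>M borel)"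
      if [measurable]: "g \<in> borel_measurable (lborel \<Otimes>\<^sub>M lborel)" for g :: "R3 \<times> real \<Rightarrow> R3" by measurable
    note m2 = this[OF V_meas]
    have m3: "integrable ?M (\<lambda>t. (C * sqrt vol1) * (Gf t * sqrt vol1))"
      by (intro integrable_mult_right integrable_mult_left f(5))
    have m4: "AE t in ?M. \<bar>LINT x|lebesgue. f t x \<bullet> spacetime V (x, t)\<bar> \<le> (C * sqrt vol1) * (Gf t * sqrt vol1)"
      using pair_bounds(5)[OF zero_Lp2 _ _ f(2,3,4), of 0] by simp
    from slice_integral_integrable[where k = "\<lambda>z w. w \<bullet> spacetime V z" and W = f, OF f(1) m1 m2 m3 m4]
    show ?thesis by simp
  qed
  show "integrable ?M (\<lambda>t. pair_terms (f t) (W t) t)"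
    unfolding pair_terms_def by (intro Bochner_Integration.integrable_diff integrable_minus i1 i2 i3 i5)
  show "integrable ?M (\<lambda>t. sqint (W t))"
    by (rule slice_integral_integrable[where k = "\<lambda>z w. (norm w)\<^sup>2", OF Wb W' _ const[where a = "K\<^sup>2"]], measurable,
      rule bd, simp add: sqint_nonneg)
qed

end

section \<open>The time weight and passage to the limit in the test fields\<close>

lemma cutoff_deriv:
  "((\<lambda>t. exp (- \<kappa> * t) * flat 0 (a - t)) has_real_derivative
    - (\<kappa> * (exp (- \<kappa> * t) * flat 0 (a - t)) + exp (- \<kappa> * t) * flat 2 (a - t))) (at t)"
proof -
  have d1: "(flat 0 has_real_derivative flat 2 (a - t)) (at (a - t))"
    using flat_has_deriv[of 0 "a - t"] by (simp add: numeral_2_eq_2)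
  have d2: "((\<lambda>t. a - t) has_real_derivative - 1) (at t)" by (auto intro!: derivative_eq_intros)
  have f: "((\<lambda>t. flat 0 (a - t)) has_real_derivative flat 2 (a - t) * - 1) (at t)" by (rule DERIV_chain2[OF d1 d2])
  show ?thesis by (rule derivative_eq_intros f refl)+ (simp add: algebra_simps)
qed

lemma C_on_exp: "C_on k UNIV (\<lambda>t::real. exp (a * t))"
proof (induction k)
  case 0
  then show ?case by (auto intro: continuous_intros)
next
  case (Suc k)
  have "((\<lambda>t. exp (a * t)) has_real_derivative a * exp (a * t)) (at t)" for t
    by (auto intro!: derivative_eq_intros)
  from C_on_deriv_real[OF this C_on_mult[OF C_on_const Suc]] show ?case by simp
qed

lemma C_on_cutoff: "C_on k UNIV (\<lambda>t::real. exp (- \<kappa> * t) * flat 0 (a - t))"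
proof (rule C_on_mult[OF C_on_exp])
  show "C_on k UNIV (\<lambda>t. flat 0 (a - t))"
    by (rule C_on_compose[OF C_on_flat C_on_diff[OF C_on_const C_on_id]]) simp
qed

text \<open>V itself may be inadmissible in the weak form of a competitor: it can fail to be smooth
  at times in Z, and its support in space-time need not be bounded. The \<open>Vn n\<close> are
  smooth with bounded support and share c, F, C and t0 with V, which provides domination independent
  of n.\<close>

locale approx_flow = flow +
  fixes Vn :: "nat \<Rightarrow> real \<Rightarrow> R3 \<Rightarrow> R3"
  assumes approx: "flow (Vn n) {} c F C t0"
    and Vn_bsupp: "bsupp (spacetime (Vn n))"
    and Vn_tendsto: "t \<notin> Z \<Longrightarrow> (\<lambda>n. Vn n t x) \<longlonglongrightarrow> V t x"
      "t \<notin> Z \<Longrightarrow> (\<lambda>n. pd i (Vn n t) x) \<longlonglongrightarrow> pd i (V t) x"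
      "t \<notin> Z \<Longrightarrow> (\<lambda>n. lap (Vn n t) x) \<longlonglongrightarrow> lap (V t) x"
      "t \<notin> Z \<Longrightarrow> (\<lambda>n. time_deriv (Vn n) t x) \<longlonglongrightarrow> time_deriv V t x"
begin

abbreviation pair_n :: "nat \<Rightarrow> (R3 \<Rightarrow> R3) \<Rightarrow> (R3 \<Rightarrow> R3) \<Rightarrow> real \<Rightarrow> real" where
  "pair_n n \<equiv> flow.pair_terms (Vn n) {}"

lemma Vn_lapB: "flow.lapB (Vn n) {} t x = lap (Vn n t) x"
  by (simp add: flow.lapB_def[OF approx])

lemma pair_tendsto:
  assumes t: "t \<notin> Z" and W: "W \<in> Lp 2"
  shows "(\<lambda>n. pair_n n (forceB t) W t) \<longlonglongrightarrow> pair_terms (forceB t) W t"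
    and "(\<lambda>n. LINT x|lebesgue. W x \<bullet> Vn n t x) \<longlonglongrightarrow> (LINT x|lebesgue. W x \<bullet> V t x)"
proof -
  note lm = lebesgue_borel_measurable
  have m: "Vn n t \<in> borel_measurable borel" "time_deriv (Vn n) t \<in> borel_measurable borel" "V t \<in> borel_measurable borel"
    "time_deriv V t \<in> borel_measurable borel" for n
    by (rule slice_measurable[OF flow.V_meas[OF approx]] slice_measurable[OF flow.dt_meas[OF approx]]
        slice_measurable[OF V_meas] slice_measurable[OF dt_meas])+
  have sV: "(\<lambda>n. sqint (\<lambda>x. Vn n t x - V t x)) \<longlonglongrightarrow> 0"
    by (rule ball_tendsto[OF lm[OF m(1)] lm[OF m(3)] flow.V_ball[OF approx] V_ball Vn_tendsto(1)[OF t]])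
  have sdt: "(\<lambda>n. sqint (\<lambda>x. time_deriv (Vn n) t x - time_deriv V t x)) \<longlonglongrightarrow> 0"
    by (rule ball_tendsto[OF lm[OF m(2)] lm[OF m(4)] flow.dt_ball[OF approx] dt_ball Vn_tendsto(4)[OF t]])
  have lapB: "lapB t = lap (V t)" using t by (simp add: lapB_def fun_eq_iff)
  have "(\<lambda>n. flow.lapB (Vn n) {} t x) \<longlonglongrightarrow> lapB t x" for x
    unfolding Vn_lapB lapB by (rule Vn_tendsto(3)[OF t])
  from ball_tendsto[OF lm[OF flow.lapB_borel[OF approx]] lm[OF lapB_borel] flow.lapB_ball[OF approx] lapB_ball this]
  have slap: "(\<lambda>n. sqint (\<lambda>x. flow.lapB (Vn n) {} t x - lapB t x)) \<longlonglongrightarrow> 0" .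
  show lV: "(\<lambda>n. LINT x|lebesgue. W x \<bullet> Vn n t x) \<longlonglongrightarrow> (LINT x|lebesgue. W x \<bullet> V t x)"
    by (rule Lp2_inner_tendsto[OF W flow.V_H1(1)[OF approx] V_H1(1) sV])
  have quad: "(\<lambda>n. LINT x|lebesgue. (\<Sum>j\<in>UNIV. (W x $ j) *\<^sub>R pd j (Vn n t) x) \<bullet> W x)
      \<longlonglongrightarrow> (LINT x|lebesgue. (\<Sum>j\<in>UNIV. (W x $ j) *\<^sub>R pd j (V t) x) \<bullet> W x)"
  proof (rule integral_dominated_convergence)
    note tn = transport_bound[OF W flow.pd_slice_borel[OF approx] flow.pd_le[OF approx]]
    note tV = transport_bound[OF W pd_slice_borel pd_le]
    show "(\<lambda>x. (\<Sum>j\<in>UNIV. (W x $ j) *\<^sub>R pd j (V t) x) \<bullet> W x) \<in> borel_measurable lebesgue"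
      using Lp2_inner(1)[OF tV(1) W] by (rule borel_measurable_integrable)
    show "(\<lambda>x. (\<Sum>j\<in>UNIV. (W x $ j) *\<^sub>R pd j (Vn n t) x) \<bullet> W x) \<in> borel_measurable lebesgue" for n
      using Lp2_inner(1)[OF tn(1) W] by (rule borel_measurable_integrable)
    show "integrable lebesgue (\<lambda>x. 3 * C * (norm (W x))\<^sup>2)" using W by (simp add: Lp2_iff)
    show "AE x in lebesgue. (\<lambda>n. (\<Sum>j\<in>UNIV. (W x $ j) *\<^sub>R pd j (Vn n t) x) \<bullet> W x) \<longlonglongrightarrow> (\<Sum>j\<in>UNIV. (W x $ j) *\<^sub>R pd j (V t) x) \<bullet> W x"
      by (intro AE_I2 tendsto_inner tendsto_sum tendsto_scaleR tendsto_const Vn_tendsto(2)[OF t])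
    show "AE x in lebesgue. norm ((\<Sum>j\<in>UNIV. (W x $ j) *\<^sub>R pd j (Vn n t) x) \<bullet> W x) \<le> 3 * C * (norm (W x))\<^sup>2" for n
      by (intro AE_I2 tn(2))
  qed
  show "(\<lambda>n. pair_n n (forceB t) W t) \<longlonglongrightarrow> pair_terms (forceB t) W t"
    unfolding flow.pair_terms_def[OF approx] pair_terms_def
    by (intro tendsto_diff tendsto_minus quad
        Lp2_inner_tendsto[OF W flow.lapB_Lp2[OF approx] lapB_Lp2 slap]
        Lp2_inner_tendsto[OF W flow.dt_Lp2[OF approx] dt_Lp2 sdt]
        Lp2_inner_tendsto[OF forceB_Lp2 flow.V_H1(1)[OF approx] V_H1(1) sV])
qed

text \<open>\<theta> vanishes for t \<ge> a, and a < S keeps the support compact inside the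
  half-open strip; negative times are excluded by \<open>early\<close>.\<close>

lemma weighted_test:
  fixes \<kappa> :: real
  assumes S': "0 < a" "a < S"
  defines "\<theta> \<equiv> \<lambda>t. exp (- \<kappa> * t) * flat 0 (a - t)"
  shows "(\<lambda>t x. \<theta> t *\<^sub>R Vn n t x) \<in> test_fields S"
proof -
  interpret N: flow "Vn n" "{}" c F C t0 by (rule approx)
  have sm: "C_on k UNIV (\<lambda>z. \<theta> (snd z) *\<^sub>R spacetime (Vn n) z)" for k
  proof (rule C_on_scaleR)
    show "C_on k UNIV (\<lambda>z. \<theta> (snd z))"
      unfolding \<theta>_def by (rule C_on_compose[OF C_on_cutoff C_on_snd]) simp
    show "C_on k UNIV (spacetime (Vn n))" using N.V_smooth[of k] by simp
  qed
  have eq: "spacetime (\<lambda>t x. \<theta> t *\<^sub>R Vn n t x) = (\<lambda>z. \<theta> (snd z) *\<^sub>R spacetime (Vn n) z)" by auto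
  obtain R where R: "\<And>z. R < norm z \<Longrightarrow> spacetime (Vn n) z = 0"
    by (rule bsuppE[OF Vn_bsupp]) blast
  let ?K = "cball 0 (max R 0) \<inter> (UNIV \<times> {0..a}) :: (R3 \<times> real) set"
  have K: "compact ?K" by (intro compact_Int_closed compact_cball closed_Times) auto
  have out: "\<theta> (snd z) *\<^sub>R spacetime (Vn n) z = 0" if "z \<notin> ?K" for z
  proof -
    obtain x t where z: "z = (x, t)" by (cases z)
    have "R < norm z \<or> t < 0 \<or> t > a" using that by (auto simp: z)
    then show ?thesis using R[of z] N.early[of t x] t0 by (auto simp: z \<theta>_def flat_def)
  qed
  have "(\<lambda>z. \<theta> (snd z) *\<^sub>R spacetime (Vn n) z) \<in> Cc_inf (UNIV \<times> {0..<S})"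
    unfolding Cc_inf_def
  proof (intro CollectI conjI exI[of _ ?K] K allI impI out)
    show "smooth_on (UNIV \<times> {0..<S}) (\<lambda>z. \<theta> (snd z) *\<^sub>R spacetime (Vn n) z)"
      by (rule smooth_onI[OF C_on_subset[OF sm]]) simp
  qed (use S' in auto)
  moreover have "divg (\<lambda>x. \<theta> t *\<^sub>R Vn n t x) x = 0" for t x
  proof -
    have "divg (\<lambda>x. \<theta> t *\<^sub>R Vn n t x) x = \<theta> t * divg (Vn n t) x"
      unfolding divg_def by (simp add: pd_scaleR[OF N.V_slice] sum_distrib_left)
    then show ?thesis using N.divfree by simp
  qed
  ultimately show ?thesis by (simp add: test_fields_def eq)
qed

lemma weak_form_slice:
  assumes W: "W \<in> H1" "W \<in> L2_sigma" and d: "(\<theta> has_real_derivative \<theta>') (at t)"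
  shows "(LINT x|lebesgue. wgrad W x \<bullet> grad (\<lambda>x. \<theta> t *\<^sub>R Vn n t x) x + convect W x \<bullet> (\<theta> t *\<^sub>R Vn n t x)
      - W x \<bullet> time_deriv (\<lambda>t x. \<theta> t *\<^sub>R Vn n t x) t x)
    = \<theta> t * pair_n n (forceB t) W t - \<theta>' * (LINT x|lebesgue. W x \<bullet> Vn n t x)
      + \<theta> t * (LINT x|lebesgue. forceB t x \<bullet> Vn n t x)"
proof -
  interpret N: flow "Vn n" "{}" c F C t0 by (rule approx)
  have T: "Vn n t \<in> Cc_inf UNIV" by (rule N.V_test) simp
  have WL: "W \<in> Lp 2" using W(2) by (simp add: L2_sigma_def)
  have g: "grad (\<lambda>x. \<theta> t *\<^sub>R Vn n t x) x = \<theta> t *\<^sub>R grad (Vn n t) x" for x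
    unfolding grad_def by (simp add: vec_eq_iff pd_scaleR[OF N.V_slice])
  have td: "time_deriv (\<lambda>t x. \<theta> t *\<^sub>R Vn n t x) t x = \<theta> t *\<^sub>R time_deriv (Vn n) t x + \<theta>' *\<^sub>R Vn n t x" for x
    unfolding time_deriv_def[of "\<lambda>t x. \<theta> t *\<^sub>R Vn n t x"]
    by (rule vector_derivative_at has_vector_derivative_scaleR d N.dt(2))+
  have i: "integrable lebesgue (\<lambda>x. wgrad W x \<bullet> grad (Vn n t) x)" "integrable lebesgue (\<lambda>x. convect W x \<bullet> Vn n t x)"
    "integrable lebesgue (\<lambda>x. W x \<bullet> time_deriv (Vn n) t x)" "integrable lebesgue (\<lambda>x. W x \<bullet> Vn n t x)"
    by (rule H1_lap(2)[OF W(1) T] convect_by_parts(2)[OF W T] Lp2_inner(1)[OF WL N.dt_Lp2] Lp2_inner(1)[OF WL N.V_H1(1)])+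
  have "(LINT x|lebesgue. wgrad W x \<bullet> grad (\<lambda>x. \<theta> t *\<^sub>R Vn n t x) x + convect W x \<bullet> (\<theta> t *\<^sub>R Vn n t x)
      - W x \<bullet> time_deriv (\<lambda>t x. \<theta> t *\<^sub>R Vn n t x) t x)
    = (LINT x|lebesgue. \<theta> t * (wgrad W x \<bullet> grad (Vn n t) x) + \<theta> t * (convect W x \<bullet> Vn n t x)
       - (\<theta> t * (W x \<bullet> time_deriv (Vn n) t x) + \<theta>' * (W x \<bullet> Vn n t x)))"
    unfolding g td by (simp add: inner_add_right)
  also have "\<dots> = \<theta> t * (LINT x|lebesgue. wgrad W x \<bullet> grad (Vn n t) x) + \<theta> t * (LINT x|lebesgue. convect W x \<bullet> Vn n t x)
       - (\<theta> t * (LINT x|lebesgue. W x \<bullet> time_deriv (Vn n) t x) + \<theta>' * (LINT x|lebesgue. W x \<bullet> Vn n t x))"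
    using i by simp
  finally show ?thesis
    unfolding H1_lap(1)[OF W(1) T] convect_by_parts(1)[OF W T] N.pair_terms_def N.lapB_def by (simp add: algebra_simps)
qed

text \<open>The equation of W is tested with \<theta> \<open>Vn n\<close>, and n tends to infinity
  under a bound built from \<open>?D\<close>, which is free of n. The force is that of V for every
  n, since W solves the equation with the data of V.\<close>

lemma weighted_identity:
  fixes \<kappa> :: real
  assumes LH: "Leray_Hopf S (\<lambda>x. 0) forceB W" and S': "0 < a" "a < S"
  defines "\<theta> \<equiv> \<lambda>t. exp (- \<kappa> * t) * flat 0 (a - t)"
  assumes d: "\<And>t. (\<theta> has_real_derivative \<theta>' t) (at t)" and c': "continuous_on UNIV \<theta>'"
    and Wb: "Wb \<in> borel_measurable (lborel \<Otimes>\<^sub>M lborel)" "AE t in lebesgue_on {0<..<S}. AE x in lebesgue. W t x = Wb (x, t)"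
    and K: "AE t in lebesgue_on {0<..<S}. W t \<in> L2_sigma \<and> W t \<in> H1 \<and> sqint (W t) \<le> K\<^sup>2" "K \<ge> 0"
  shows "(LINT t|lebesgue_on {0<..<S}. \<theta> t * pair_terms (forceB t) (W t) t - \<theta>' t * (LINT x|lebesgue. W t x \<bullet> V t x)) = 0"
proof -
  let ?M = "lebesgue_on {0<..<S}"
  have c\<theta>: "continuous_on UNIV \<theta>" using d by (intro DERIV_continuous_on) auto
  have fp: "spacetime forceB \<in> borel_measurable (lborel \<Otimes>\<^sub>M lborel)" "\<And>t. forceB t \<in> Lp 2"
    "\<And>t x. norm (forceB t x) \<le> G t * indicator (cball (c t) 1) x" "\<And>t. G t \<ge> 0" "integrable ?M G"
    by (rule forceB_meas forceB_Lp2 forceB_le G_nonneg G_integrable)+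
  note pV = pair_integrable[OF Wb K fp]
  note pn = flow.pair_integrable[OF approx Wb K fp]
  let ?s = "\<lambda>n t. \<theta> t * pair_n n (forceB t) (W t) t - \<theta>' t * (LINT x|lebesgue. W t x \<bullet> Vn n t x)"
  let ?f = "\<lambda>t. \<theta> t * pair_terms (forceB t) (W t) t - \<theta>' t * (LINT x|lebesgue. W t x \<bullet> V t x)"
  have si: "integrable ?M (?s n)" for n
    by (intro Bochner_Integration.integrable_diff integrable_continuous_mult c\<theta> c' pn)
  have fi: "integrable ?M ?f"
    by (intro Bochner_Integration.integrable_diff integrable_continuous_mult c\<theta> c' pV)
  have z: "(LINT t|?M. ?s n t) = 0" for n
  proof -
    let ?\<phi> = "\<lambda>t x. \<theta> t *\<^sub>R Vn n t x"
    have e1: "AE t in ?M. (LINT x|lebesgue. wgrad (W t) x \<bullet> grad (?\<phi> t) x + convect (W t) x \<bullet> ?\<phi> t x - W t x \<bullet> time_deriv ?\<phi> t x)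
      = ?s n t + \<theta> t * (LINT x|lebesgue. forceB t x \<bullet> Vn n t x)"
      using K(1) by eventually_elim (rule weak_form_slice[OF _ _ d], auto)
    have e2: "pairing (forceB t) (?\<phi> t) = \<theta> t * (LINT x|lebesgue. forceB t x \<bullet> Vn n t x)" for t
    proof -
      have "?\<phi> t \<in> Cc_inf UNIV"
        by (rule Cc_inf_bounded_linear[OF bounded_linear_scaleR_right flow.V_test[OF approx]]) simp
      from pairing_Lp2[OF forceB_Lp2 Cc_inf_H1(2)[OF this]] show ?thesis by simp
    qed
    have lh: "\<forall>\<phi>\<in>test_fields S. (LINT t|?M. LINT x|lebesgue. wgrad (W t) x \<bullet> grad (\<phi> t) x + convect (W t) x \<bullet> \<phi> t x - W t x \<bullet> time_deriv \<phi> t x)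
        = (LINT t|?M. pairing (forceB t) (\<phi> t)) + (LINT x|lebesgue. 0 \<bullet> \<phi> 0 x)"
      using LH unfolding Leray_Hopf_def by (elim conjE)
    have tf: "?\<phi> \<in> test_fields S" unfolding \<theta>_def by (rule weighted_test[OF S'])
    have "(LINT t|?M. LINT x|lebesgue. wgrad (W t) x \<bullet> grad (?\<phi> t) x + convect (W t) x \<bullet> ?\<phi> t x - W t x \<bullet> time_deriv ?\<phi> t x)
        = (LINT t|?M. pairing (forceB t) (?\<phi> t)) + (LINT x|lebesgue. 0 \<bullet> ?\<phi> 0 x)"
      by (rule bspec[OF lh tf])
    moreover have "(LINT t|?M. LINT x|lebesgue. wgrad (W t) x \<bullet> grad (?\<phi> t) x + convect (W t) x \<bullet> ?\<phi> t x - W t x \<bullet> time_deriv ?\<phi> t x)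
        = (LINT t|?M. ?s n t + \<theta> t * (LINT x|lebesgue. forceB t x \<bullet> Vn n t x))"
      by (rule lebesgue_on_AE_cong(2)[OF _ e1]) (intro Bochner_Integration.integrable_add si integrable_continuous_mult c\<theta> pn)
    moreover have "\<dots> = (LINT t|?M. ?s n t) + (LINT t|?M. \<theta> t * (LINT x|lebesgue. forceB t x \<bullet> Vn n t x))"
      by (intro Bochner_Integration.integral_add si integrable_continuous_mult c\<theta> pn)
    ultimately show ?thesis unfolding e2 by simp
  qed
  let ?D = "\<lambda>t. K * (F t * sqrt vol1) + 3 * C * K\<^sup>2 + K * (C * sqrt vol1) + (C * sqrt vol1) * (G t * sqrt vol1)"
  note const = integrable_const_initial
  have ac: "continuous_on UNIV (\<lambda>t. \<bar>\<theta> t\<bar>)" "continuous_on UNIV (\<lambda>t. \<bar>\<theta>' t\<bar>)"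
    by (intro continuous_on_rabs c\<theta> c')+
  have "(\<lambda>n. LINT t|?M. ?s n t) \<longlonglongrightarrow> (LINT t|?M. ?f t)"
  proof (rule integral_dominated_convergence)
    show "?f \<in> borel_measurable ?M" "\<And>n. ?s n \<in> borel_measurable ?M" using fi si by (auto intro: borel_measurable_integrable)
    show "integrable ?M (\<lambda>t. \<bar>\<theta> t\<bar> * ?D t + \<bar>\<theta>' t\<bar> * (K * (C * sqrt vol1)))"
      by (intro Bochner_Integration.integrable_add integrable_continuous_mult ac const integrable_mult_right integrable_mult_left
          F_integrable G_integrable)
    have "AE t in ?M. t \<notin> Z" by (rule AE_lebesgue_on_countable[OF Z(2)])
    then show "AE t in ?M. (\<lambda>n. ?s n t) \<longlonglongrightarrow> ?f t"
      using K(1) by eventually_elim (intro tendsto_intros pair_tendsto, auto simp: L2_sigma_def)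
    show "AE t in ?M. norm (?s n t) \<le> \<bar>\<theta> t\<bar> * ?D t + \<bar>\<theta>' t\<bar> * (K * (C * sqrt vol1))" for n
      using K(1)
    proof eventually_elim
      case (elim t)
      have "W t \<in> Lp 2" "sqint (W t) \<le> K\<^sup>2" using elim by (auto simp: L2_sigma_def)
      note b = flow.pair_bounds[OF approx[of n] this K(2) fp(2)[of t] fp(3)[of t] fp(4)[of t]]
      have 1: "\<bar>pair_n n (forceB t) (W t) t\<bar> \<le> ?D t"
        unfolding flow.pair_terms_def[OF approx] using b(1,2,3,5) by linarith
      have "norm (?s n t) \<le> \<bar>\<theta> t\<bar> * \<bar>pair_n n (forceB t) (W t) t\<bar> + \<bar>\<theta>' t\<bar> * \<bar>LINT x|lebesgue. W t x \<bullet> Vn n t x\<bar>"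
        unfolding real_norm_def abs_mult[symmetric] by (rule abs_triangle_ineq4)
      also have "\<dots> \<le> \<bar>\<theta> t\<bar> * ?D t + \<bar>\<theta>' t\<bar> * (K * (C * sqrt vol1))"
        by (intro add_mono mult_left_mono 1 b(4)) simp_all
      finally show ?case .
    qed
  qed
  then have "(LINT t|?M. ?f t) = 0" unfolding z by (simp add: LIMSEQ_const_iff)
  then show ?thesis .
qed

end

lemma lebesgue_on_initial:
  fixes t S :: real
  assumes t: "t \<le> S"
  shows "integrable (lebesgue_on {0<..<S}) g \<Longrightarrow> integrable (lebesgue_on {0<..<t}) (g :: real \<Rightarrow> real)"
    and "AE s in lebesgue_on {0<..<S}. P s \<Longrightarrow> AE s in lebesgue_on {0<..<t}. P s"
proof -
  assume "integrable (lebesgue_on {0<..<S}) g"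
  then have g: "set_integrable lebesgue {0<..<S} g"
    unfolding set_integrable_def by (subst (asm) integrable_restrict_space) auto
  have "{0<..<t} \<subseteq> {0<..<S}" using t by auto
  from set_integrable_subset[OF g _ this] have "set_integrable lebesgue {0<..<t} g" by simp
  then show "integrable (lebesgue_on {0<..<t}) g"
    unfolding set_integrable_def by (subst integrable_restrict_space) auto
next
  assume "AE s in lebesgue_on {0<..<S}. P s"
  then have "AE s in lebesgue. s \<in> {0<..<S} \<longrightarrow> P s" by (subst (asm) AE_restrict_space_iff) auto
  then have "AE s in lebesgue. s \<in> {0<..<t} \<longrightarrow> P s" by eventually_elim (use t in auto)
  then show "AE s in lebesgue_on {0<..<t}. P s" by (subst AE_restrict_space_iff) auto
qed

lemma integral_combination:
  fixes f1 f2 f3 f4 f5 :: "'a \<Rightarrow> real"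
  assumes "integrable M f1" "integrable M f2" "integrable M f3" "integrable M f4" "integrable M f5"
  shows "(LINT t|M. (f1 t + f2 t) + (2 * f3 t + 2 * f4 t) - 2 * f5 t)
    = (LINT t|M. f1 t) + (LINT t|M. f2 t) + (2 * (LINT t|M. f3 t) + 2 * (LINT t|M. f4 t)) - 2 * (LINT t|M. f5 t)"
  using assms by simp

context flow begin

abbreviation dissipation :: "(real \<Rightarrow> R3 \<Rightarrow> R3) \<Rightarrow> real \<Rightarrow> real" where
  "dissipation U t \<equiv> sqint (wgrad (U t)) - (LINT x|lebesgue. forceB t x \<bullet> U t x)"

text \<open>Puts the energy inequality into the form required by \<open>weighted_energy\<close>,
  with \<open>pairing\<close> and \<open>L2_norm\<close> replaced by integrals; it is applied to the
  competitor and to V.\<close>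

lemma Leray_Hopf_energy:
  assumes LH: "Leray_Hopf S (\<lambda>x. 0) forceB U"
  shows "integrable (lebesgue_on {0<..<S}) (dissipation U)" "integrable (lebesgue_on {0<..<S}) (\<lambda>t. sqint (U t))"
    and "0 < t \<Longrightarrow> t < S \<Longrightarrow> sqint (U t) + 2 * (LINT s|lebesgue_on {0<..<t}. dissipation U s) \<le> 0"
proof -
  let ?M = "lebesgue_on {0<..<S}"
  obtain K where K: "K \<ge> 0" "AE t in ?M. U t \<in> L2_sigma \<and> U t \<in> H1 \<and> sqint (U t) \<le> K\<^sup>2"
    and fin: "(\<integral>\<^sup>+ t. ennreal (sqint (wgrad (U t))) \<partial>?M) < \<infinity>"
    by (rule Leray_Hopf_bounds[OF LH]) blast
  have m: "spacetime U \<in> borel_measurable (lebesgue_on (UNIV \<times> {0<..<S}))"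
    and en: "\<forall>t\<in>{0<..S}. U t \<in> Lp 2 \<and> energy_lhs U t \<le> energy_rhs (\<lambda>x. 0) forceB U t"
    using LH unfolding Leray_Hopf_def Bochner_def by blast+
  obtain Wb where Wb: "Wb \<in> borel_measurable (lborel \<Otimes>\<^sub>M lborel)" "AE t in ?M. AE x in lebesgue. U t x = Wb (x, t)"
    by (rule borel_version_spacetime[OF m]) blast
  have H: "AE t in ?M. U t \<in> H1" using K(2) by eventually_elim simp
  have gi: "integrable ?M (\<lambda>t. sqint (wgrad (U t)))" by (rule sqint_wgrad_integrable[OF Wb H fin])
  have U': "AE t in ?M. U t \<in> borel_measurable lebesgue \<and> (AE x in lebesgue. U t x = Wb (x, t))"
    using Wb(2) K(2) by eventually_elim (auto simp: L2_sigma_def Lp2_iff)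
  show "integrable ?M (\<lambda>t. sqint (U t))"
    by (rule pair_integrable(4)[OF Wb K(2,1) forceB_meas forceB_Lp2 forceB_le G_nonneg G_integrable])
  have fi: "integrable ?M (\<lambda>t. LINT x|lebesgue. forceB t x \<bullet> U t x)"
  proof -
    have m2: "(\<lambda>p. g (fst p) \<bullet> snd p) \<in> borel_measurable ((lborel \<Otimes>\<^sub>M lborel) \<Otimes>\<^sub>M borel)"
      if [measurable]: "g \<in> borel_measurable (lborel \<Otimes>\<^sub>M lborel)" for g :: "R3 \<times> real \<Rightarrow> R3" by measurable
    have D: "integrable ?M (\<lambda>t. K * (G t * sqrt vol1))"
      by (intro integrable_mult_right integrable_mult_left G_integrable)
    have le: "AE t in ?M. \<bar>LINT x|lebesgue. spacetime forceB (x, t) \<bullet> U t x\<bar> \<le> K * (G t * sqrt vol1)"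
      using K(2)
    proof eventually_elim
      case (elim t)
      have "\<bar>LINT x|lebesgue. U t x \<bullet> forceB t x\<bar> \<le> K * (G t * sqrt vol1)"
        by (rule inner_ball_le[OF _ _ K(1) forceB_Lp2 forceB_le G_nonneg]) (use elim in \<open>auto simp: L2_sigma_def\<close>)
      then show ?case by (simp add: inner_commute)
    qed
    from slice_integral_integrable[where k = "\<lambda>z w. spacetime forceB z \<bullet> w", OF Wb(1) U' m2[OF forceB_meas] D le]
    show ?thesis by simp
  qed
  show qi: "integrable ?M (dissipation U)" by (intro Bochner_Integration.integrable_diff gi fi)
  show "sqint (U t) + 2 * (LINT s|lebesgue_on {0<..<t}. dissipation U s) \<le> 0" if t: "0 < t" "t < S"
  proof -
    note init = lebesgue_on_initial[OF less_imp_le[OF t(2)]]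
    have p: "AE s in lebesgue_on {0<..<t}. pairing (forceB s) (U s) = (LINT x|lebesgue. forceB s x \<bullet> U s x)"
      using init(2)[OF H] by eventually_elim (rule pairing_Lp2[OF forceB_Lp2])
    have n: "AE s in lebesgue_on {0<..<t}. (L2_norm (wgrad (U s)))\<^sup>2 = sqint (wgrad (U s))"
      using init(2)[OF H] by eventually_elim (rule Lp2_norm(2)[OF H1_D(4)])
    have "U t \<in> Lp 2" "energy_lhs U t \<le> energy_rhs (\<lambda>x. 0) forceB U t" using en t by auto
    then have "sqint (U t) + 2 * (LINT s|lebesgue_on {0<..<t}. sqint (wgrad (U s)))
        \<le> 2 * (LINT s|lebesgue_on {0<..<t}. LINT x|lebesgue. forceB s x \<bullet> U s x)"
      unfolding energy_lhs_def energy_rhs_def lebesgue_on_AE_cong(2)[OF init(1)[OF fi] p]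
        lebesgue_on_AE_cong(2)[OF init(1)[OF gi] n] by (simp add: Lp2_norm(2) zero_Lp2)
    then show ?thesis using init(1)[OF gi] init(1)[OF fi] by simp
  qed
qed

end

context approx_flow begin

text \<open>h adds both weighted energy relations and subtracts twice the tested equation, so its
  integral is at most 0; yet h dominates \<theta> times the squared distance of W and V. Hence h = 0
  almost everywhere, and the two fields agree where \<theta> > 0, that is for t < a.\<close>

lemma unique_before:
  assumes LH: "Leray_Hopf S (\<lambda>x. 0) forceB W" and a: "0 < a" "a < S"
  shows "AE t in lebesgue_on {0<..<S}. t < a \<longrightarrow> (AE x in lebesgue. W t x = V t x)"
proof -
  let ?M = "lebesgue_on {0<..<S}"
  \<comment> \<open>6 C absorbs twice the loss 3 C of \<open>weak_strong_pointwise\<close>; the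
    extra 1 leaves \<theta> times the squared distance as lower bound.\<close>
  define \<kappa> where "\<kappa> = 6 * C + 1"
  define \<theta> where "\<theta> = (\<lambda>t. exp (- \<kappa> * t) * flat 0 (a - t))"
  define \<theta>' where "\<theta>' = (\<lambda>t. - (\<kappa> * (exp (- \<kappa> * t) * flat 0 (a - t)) + exp (- \<kappa> * t) * flat 2 (a - t)))"
  have d: "(\<theta> has_real_derivative \<theta>' t) (at t)" for t unfolding \<theta>_def \<theta>'_def by (rule cutoff_deriv)
  have fc: "continuous_on UNIV (\<lambda>t. flat k (a - t))" for k
    by (rule continuous_on_compose2[OF C_on_continuous[OF C_on_flat[of 0 k]]]) (auto intro: continuous_intros)
  have c': "continuous_on UNIV \<theta>'" unfolding \<theta>'_def by (intro continuous_intros fc)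
  have \<kappa>: "\<kappa> \<ge> 0" using C_nonneg by (simp add: \<kappa>_def)
  have \<theta>0: "\<theta> t \<ge> 0" for t by (simp add: \<theta>_def flat_nonneg)
  have \<theta>'le: "\<kappa> * \<theta> t \<le> - \<theta>' t" for t by (simp add: \<theta>_def \<theta>'_def flat_nonneg)
  have neg: "\<theta>' t \<le> 0" for t using \<theta>'le[of t] mult_nonneg_nonneg[OF \<kappa> \<theta>0[of t]] by linarith
  have \<theta>S: "\<theta> S = 0" using a by (simp add: \<theta>_def flat_def)
  obtain K where K: "K \<ge> 0" "AE t in ?M. W t \<in> L2_sigma \<and> W t \<in> H1 \<and> sqint (W t) \<le> K\<^sup>2"
    by (rule Leray_Hopf_bounds[OF LH]) blast
  have m: "spacetime W \<in> borel_measurable (lebesgue_on (UNIV \<times> {0<..<S}))"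
    using LH unfolding Leray_Hopf_def Bochner_def by blast
  obtain Wb where Wb: "Wb \<in> borel_measurable (lborel \<Otimes>\<^sub>M lborel)" "AE t in ?M. AE x in lebesgue. W t x = Wb (x, t)"
    by (rule borel_version_spacetime[OF m]) blast
  note eW = Leray_Hopf_energy[OF LH] and eV = Leray_Hopf_energy[OF V_Leray_Hopf[of S]]
  note wW = weighted_energy[OF eW(1,2,3) d c' neg \<theta>S] and wV = weighted_energy[OF eV(1,2,3) d c' neg \<theta>S]
  let ?P = "\<lambda>t. pair_terms (forceB t) (W t) t" let ?B = "\<lambda>t. LINT x|lebesgue. W t x \<bullet> V t x"
  have I: "(LINT t|?M. \<theta> t * ?P t - \<theta>' t * ?B t) = 0"
    unfolding \<theta>_def by (rule weighted_identity[OF LH a d[unfolded \<theta>_def] c' Wb K(2,1)])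
  note pV = pair_integrable[OF Wb K(2,1) forceB_meas forceB_Lp2 forceB_le G_nonneg G_integrable]
  have c\<theta>: "continuous_on UNIV \<theta>" using d by (intro DERIV_continuous_on) auto
  have Ii: "integrable ?M (\<lambda>t. \<theta> t * ?P t - \<theta>' t * ?B t)"
    by (intro Bochner_Integration.integrable_diff integrable_continuous_mult c\<theta> c' pV)
  define h where "h t = (- \<theta>' t * sqint (W t) + - \<theta>' t * sqint (V t))
    + (2 * (\<theta> t * dissipation W t) + 2 * (\<theta> t * dissipation V t)) - 2 * (\<theta> t * ?P t - \<theta>' t * ?B t)" for t
  note hints = Bochner_Integration.integrable_add[OF wW(2) wV(2)]
    Bochner_Integration.integrable_add[OF integrable_mult_right[OF wW(3), of 2] integrable_mult_right[OF wV(3), of 2]]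
  have hi: "integrable ?M h"
    unfolding h_def by (intro Bochner_Integration.integrable_diff Bochner_Integration.integrable_add hints integrable_mult_right Ii)
  have "(LINT t|?M. h t) = ((LINT t|?M. - \<theta>' t * sqint (W t)) + (LINT t|?M. - \<theta>' t * sqint (V t)))
      + (2 * (LINT t|?M. \<theta> t * dissipation W t) + 2 * (LINT t|?M. \<theta> t * dissipation V t)) - 2 * (LINT t|?M. \<theta> t * ?P t - \<theta>' t * ?B t)"
    unfolding h_def by (rule integral_combination[OF wW(2) wV(2) wW(3) wV(3) Ii])
  then have h0: "(LINT t|?M. h t) \<le> 0" using wW(1) wV(1) unfolding I by linarith
  have "AE t in ?M. t \<notin> Z" by (rule AE_lebesgue_on_countable[OF Z(2)])
  then have hge: "AE t in ?M. \<theta> t * sqint (\<lambda>x. W t x - V t x) \<le> h t"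
    using K(2)
  proof eventually_elim
    case (elim t)
    let ?s = "sqint (\<lambda>x. W t x - V t x)"
    have WH: "W t \<in> H1" "W t \<in> L2_sigma" using elim by auto
    note p = weak_strong_pointwise[OF elim(1) WH]
    have h: "h t = - \<theta>' t * ?s + 2 * (\<theta> t * (dissipation W t + dissipation V t - ?P t))"
      unfolding h_def p(1)[symmetric] by (simp add: algebra_simps)
    have "(\<kappa> * \<theta> t) * ?s \<le> - \<theta>' t * ?s" by (rule mult_right_mono[OF \<theta>'le sqint_nonneg])
    moreover have "\<theta> t * (- (3 * C * ?s)) \<le> \<theta> t * (dissipation W t + dissipation V t - ?P t)"
      by (rule mult_left_mono[OF _ \<theta>0]) (use p(2) in \<open>simp add: pair_terms_def\<close>)
    moreover have "(\<kappa> * \<theta> t) * ?s = 2 * (\<theta> t * (3 * C * ?s)) + \<theta> t * ?s" by (simp add: \<kappa>_def algebra_simps)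
    ultimately show ?case unfolding h by linarith
  qed
  then have hnn: "AE t in ?M. 0 \<le> h t"
    by eventually_elim (rule order_trans[OF mult_nonneg_nonneg[OF \<theta>0 sqint_nonneg]])
  have "(LINT t|?M. h t) = 0" using h0 integral_nonneg_AE[OF hnn] by linarith
  then have "AE t in ?M. h t = 0" using integral_nonneg_eq_0_iff_AE[OF hi hnn] by blast
  then show ?thesis
    using hge K(2)
  proof eventually_elim
    case (elim t)
    show ?case
    proof
      assume t: "t < a"
      have "\<theta> t > 0" using t by (simp add: \<theta>_def flat_def)
      then have "sqint (\<lambda>x. W t x - V t x) \<le> 0" using elim(1,2) by (simp add: mult_le_0_iff)
      then have s0: "sqint (\<lambda>x. W t x - V t x) = 0" by (rule antisym[OF _ sqint_nonneg])
      have "(\<lambda>x. W t x - V t x) \<in> Lp 2" by (rule Lp2_diff[OF _ V_H1(1)]) (use elim(3) in \<open>simp add: L2_sigma_def\<close>)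
      then have "integrable lebesgue (\<lambda>x. (norm (W t x - V t x))\<^sup>2)" by (simp add: Lp2_iff)
      from integral_nonneg_eq_0_iff_AE[OF this] s0 have "AE x in lebesgue. (norm (W t x - V t x))\<^sup>2 = 0" by simp
      then show "AE x in lebesgue. W t x = V t x" by eventually_elim simp
    qed
  qed
qed

theorem unique:
  assumes LH: "Leray_Hopf S (\<lambda>x. 0) forceB W" and S: "S > 0"
  shows "AE t in lebesgue_on {0<..<S}. AE x in lebesgue. W t x = V t x"
proof -
  \<comment> \<open>These times exhaust the interval; n + 2 instead of n + 1 keeps the first one
    positive.\<close>
  let ?a = "\<lambda>n. S * (1 - inverse (real n + 2))"
  have "AE t in lebesgue_on {0<..<S}. t < ?a n \<longrightarrow> (AE x in lebesgue. W t x = V t x)" for n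
    by (rule unique_before[OF LH]) (use S in \<open>auto simp: field_simps intro!: add_pos_nonneg\<close>)
  then have "AE t in lebesgue_on {0<..<S}. \<forall>n. t < ?a n \<longrightarrow> (AE x in lebesgue. W t x = V t x)"
    by (subst AE_all_countable) blast
  moreover have "AE t in lebesgue_on {0<..<S}. t < S" by (rule AE_I2) simp
  ultimately show ?thesis
  proof eventually_elim
    case (elim t)
    obtain n where "inverse (real (Suc n)) < (S - t) / S" using reals_Archimedean[of "(S - t) / S"] elim(2) S by auto
    moreover have "inverse (real n + 2) \<le> inverse (real (Suc n))" by (intro le_imp_inverse_le) auto
    ultimately have "inverse (real n + 2) < (S - t) / S" by (rule le_less_trans[rotated])
    then have "S * inverse (real n + 2) < S * ((S - t) / S)" using S by (rule mult_strict_left_mono)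
    then have "S * inverse (real n + 2) < S - t" using S by simp
    then have "t < ?a n" by (simp add: algebra_simps)
    then show ?case using elim(1) by blast
  qed
qed

end

subsection \<open>Superposition of bubbles\<close>

text \<open>A strict superlevel set of a continuous function is open, hence not negligible unless it
  is empty.\<close>

lemma Lp_norm_infinity_ge:
  fixes g :: "R3 \<Rightarrow> 'b::real_normed_vector"
  assumes g: "continuous_on UNIV g"
  shows "ennreal (norm (g x0)) \<le> Lp_norm \<infinity> g"
proof (rule ccontr)
  assume "\<not> ?thesis"
  then have lt: "Lp_norm \<infinity> g < ennreal (norm (g x0))" by simp
  then obtain e where e: "e \<ge> 0" "Lp_norm \<infinity> g = ennreal e"
    by (metis less_top_ennreal ennreal_less_top less_trans)
  have en: "e < norm (g x0)" using lt e by (simp add: ennreal_less_iff)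
  let ?U = "{x. e < norm (g x)}"
  have o: "open ?U" by (intro open_Collect_less continuous_intros g)
  have "AE x in lebesgue. ennreal (norm (g x)) \<le> ennreal e"
    using esssup_AE[of "\<lambda>x. ennreal (norm (g x))" lebesgue] e(2) by (simp add: Lp_norm_def Lp_gauge_def)
  then have "AE x in lebesgue. x \<notin> ?U" by eventually_elim (simp add: ennreal_le_iff e(1) not_less)
  moreover have "?U \<in> sets lebesgue" using borel_open[OF o] by simp
  ultimately have "?U \<in> null_sets lebesgue" by (subst AE_iff_null_sets) auto
  then have "negligible ?U" by (simp add: negligible_iff_null_sets)
  then show False using open_not_negligible[OF o] en by blast
qed

lemma bubble_slice: "C_on k UNIV (bubble \<gamma> s)"
proof -
  have "C_on k UNIV (\<lambda>y. swirl (dil \<gamma> s *\<^sub>R (y - 0)))" by (rule C_on_affine[OF swirl_smooth])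
  from C_on_scaleR[OF C_on_const[of k UNIV "amp s"] this] show ?thesis by (simp add: bubble_def[abs_def])
qed

lemma bubble_t_zero: "s = 0 \<or> 1 \<le> \<bar>s\<bar> \<Longrightarrow> bubble_t \<gamma> s y = 0"
proof -
  assume s: "s = 0 \<or> 1 \<le> \<bar>s\<bar>"
  have "1 - s\<^sup>2 \<le> 0" if "1 \<le> \<bar>s\<bar>" using power_mono[OF that, of 2] by simp
  then show ?thesis using s by (auto simp: bubble_t_def flat_def amp_def)
qed

locale profile =
  fixes T \<gamma> M :: real
  assumes T: "T > 0" and \<gamma>: "1 < \<gamma>" "\<gamma> \<le> 5 / 4"
    and M: "M > 0" "\<And>z. norm (swirl z) \<le> M" "\<And>i z. norm (pd i swirl z) \<le> M"
      "\<And>z. norm (lap swirl z) \<le> M" "\<And>z. norm (\<Sum>i\<in>UNIV. (z $ i) *\<^sub>R pd i swirl z) \<le> M"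
begin

lemma \<gamma>_half: "\<gamma> \<le> 3 / 2" "2 * \<gamma> - 2 \<le> 1 / 2" using \<gamma> by auto

text \<open>Time scale of bubble m. With \<open>tau m\<close> four scales before T it is active
  between T - 5 \<open>kap m\<close> and T - 3 \<open>kap m\<close>; since the scales halve and 5/2
  < 3, these intervals are disjoint. The first starts at 3T/8, hence after T/4.\<close>

definition kap :: "nat \<Rightarrow> real" where "kap m = T * (1 / 2) ^ (m + 3)"
definition tau :: "nat \<Rightarrow> real" where "tau m = T - 4 * kap m"
text \<open>Spacing 4 leaves room for a ball of radius 1/2 around any point that meets at most one
  of the unit balls about the centres.\<close>

definition xi :: "nat \<Rightarrow> R3" where "xi m = (4 * real m) *\<^sub>R axis 1 1"
definition sc :: "nat \<Rightarrow> real \<Rightarrow> real" where "sc m t = (t - tau m) / kap m"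

text \<open>The prefactor \<open>kap m\<close> cancels the 1 / \<open>kap m\<close> from the
  rescaled time, so time derivatives are bounded independently of m; lengths are not rescaled. The
  modulation a is 1 for the solution and a cut-off near s = 0 for its approximations.\<close>

definition U :: "(nat \<Rightarrow> real \<Rightarrow> real) \<Rightarrow> nat \<Rightarrow> real \<Rightarrow> R3 \<Rightarrow> R3" where
  "U a m t x = (kap m * a m (sc m t)) *\<^sub>R bubble \<gamma> (sc m t) (x - xi m)"

text \<open>Index by place, whereas \<open>mt\<close> is the index by time. Where no bubble
  qualifies the value is arbitrary, and the bubble it selects is zero there.\<close>

definition kx :: "R3 \<Rightarrow> nat" where "kx x = (SOME m. norm (x - xi m) < 1)"
definition mt :: "real \<Rightarrow> nat" where "mt t = (LEAST m. \<bar>sc m t\<bar> < 1)"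

definition Va :: "(nat \<Rightarrow> real \<Rightarrow> real) \<Rightarrow> real \<Rightarrow> R3 \<Rightarrow> R3" where "Va a t x = U a (kx x) t x"

lemma kap_pos: "kap m > 0" using T by (simp add: kap_def)

lemma kap_le: "kap m \<le> T / 8"
proof -
  have "(1 / 2 :: real) ^ (m + 3) \<le> (1 / 2) ^ 3" by (rule power_decreasing) auto
  then show ?thesis using T by (simp add: kap_def power3_eq_cube)
qed

lemma kap_half: "i < j \<Longrightarrow> kap j \<le> kap i / 2"
proof -
  assume "i < j"
  then have h: "(1 / 2 :: real) ^ (j + 3) \<le> (1 / 2) * (1 / 2) ^ (i + 3)"
    by (subst power_Suc[symmetric], intro power_decreasing) auto
  have "T * (1 / 2) ^ (j + 3) \<le> T * ((1 / 2) * (1 / 2) ^ (i + 3))"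
    by (rule mult_left_mono[OF h]) (use T in simp)
  also have "\<dots> = T * (1 / 2) ^ (i + 3) / 2" by simp
  finally show ?thesis unfolding kap_def .
qed

lemma sc_less: "\<bar>sc m t\<bar> < 1 \<longleftrightarrow> T - 5 * kap m < t \<and> t < T - 3 * kap m"
  using kap_pos[of m] by (auto simp: sc_def tau_def abs_less_iff field_simps)

lemma sc_disjoint:
  assumes "\<bar>sc i t\<bar> < 1" "\<bar>sc j t\<bar> < 1" shows "i = j"
  using assms kap_half[of i j] kap_half[of j i] kap_pos[of i] kap_pos[of j] unfolding sc_less
  by (cases i j rule: linorder_cases) auto

lemma mt_eq: "\<bar>sc m t\<bar> < 1 \<Longrightarrow> mt t = m"
  unfolding mt_def by (rule Least_equality) (use sc_disjoint in auto)

lemma xi_dist: "i \<noteq> j \<Longrightarrow> 4 \<le> norm (xi i - xi j)"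
proof -
  assume "i \<noteq> j"
  then have "1 \<le> \<bar>real i - real j\<bar>" by (cases "i < j") auto
  moreover have "xi i - xi j = (4 * (real i - real j)) *\<^sub>R axis 1 1" by (simp add: xi_def algebra_simps)
  ultimately show ?thesis by (simp add: norm_eq_sqrt_inner[of "axis 1 (1::real)"] inner_axis_axis)
qed

lemma U_zero: "1 \<le> \<bar>sc m t\<bar> \<Longrightarrow> U a m t x = 0" "1 \<le> norm (x - xi m) \<Longrightarrow> U a m t x = 0"
  using bubble_zero[of "sc m t"] bubble_supp[of "x - xi m" \<gamma>] \<gamma> by (auto simp: U_def)

lemma kx_eq: "norm (x - xi m) < 1 \<Longrightarrow> kx x = m"
proof -
  assume m: "norm (x - xi m) < 1"
  then have "norm (x - xi (kx x)) < 1" unfolding kx_def by (rule someI)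
  then have "norm (xi m - xi (kx x)) < 2" using m norm_triangle_ineq4[of "x - xi (kx x)" "x - xi m"] by simp
  then show ?thesis using xi_dist[of m "kx x"] by fastforce
qed

lemma Va_eq:
  assumes "\<And>j. j \<noteq> m \<Longrightarrow> 1 \<le> norm (x - xi j)"
  shows "Va a t x = U a m t x"
  unfolding Va_def using assms[of "kx x"] kx_eq[of x m] U_zero(2)[of x] by (cases "kx x = m") (auto simp: not_less[symmetric])

text \<open>If the two indices differ, the bubble selected by place is inactive at t and the one
  selected by time does not reach x, so both vanish. Indexing by place suits derivatives in time,
  indexing by time those in space.\<close>

lemma Va_mt: "Va a t = U a (mt t) t"
proof
  fix x
  show "Va a t x = U a (mt t) t x"
    unfolding Va_def
  proof (cases "kx x = mt t")
    case False
    have "\<not> \<bar>sc (kx x) t\<bar> < 1" "\<not> norm (x - xi (mt t)) < 1" using mt_eq[of "kx x" t] kx_eq[of x "mt t"] False by auto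
    then show "U a (kx x) t x = U a (mt t) t x"
      using U_zero(1)[of "kx x" t a x] U_zero(2)[of x "mt t" a t] by (simp add: not_less)
  qed simp
qed

text \<open>Centres have distance at least 4. If x0 is within 3/2 of one of them, the others are at
  least 4 - 3/2 - 1/2 from every point of the ball; otherwise all are at least 3/2 - 1/2
  away.\<close>

lemma local_index:
  obtains m where "\<And>x j. x \<in> ball x0 (1 / 2) \<Longrightarrow> j \<noteq> m \<Longrightarrow> 1 \<le> norm (x - xi j)"
proof (cases "\<exists>m. norm (x0 - xi m) < 3 / 2")
  case True
  then obtain m where m: "norm (x0 - xi m) < 3 / 2" by blast
  have "1 \<le> norm (x - xi j)" if x: "x \<in> ball x0 (1 / 2)" and j: "j \<noteq> m" for x j
  proof -
    have "norm (xi j - xi m) \<le> norm (x0 - xi m) + (norm (x - xi j) + norm (x0 - x))"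
      using norm_triangle_ineq4[of "x0 - xi m" "x0 - xi j"] norm_triangle_ineq[of "x0 - x" "x - xi j"] by simp
    then show ?thesis using m x xi_dist[OF j] by (simp add: dist_norm)
  qed
  then show ?thesis using that by blast
next
  case False
  have "1 \<le> norm (x - xi j)" if x: "x \<in> ball x0 (1 / 2)" for x j
  proof -
    have "3 / 2 \<le> norm (x0 - xi j)" using False not_less by blast
    then show ?thesis using x norm_triangle_ineq[of "x0 - x" "x - xi j"] by (simp add: dist_norm)
  qed
  then show ?thesis using that by blast
qed

lemma C_on_sc: "C_on k UNIV (sc m)"
proof -
  have "C_on k UNIV (\<lambda>t. (t - tau m) * (1 / kap m))" by (intro C_on_mult C_on_diff C_on_id C_on_const)
  then show ?thesis by (simp add: sc_def[abs_def])
qed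

lemma C_on_U:
  assumes a: "C_on k UNIV (a m)" and b: "C_on k B (spacetime (bubble \<gamma>))"
    and A: "\<And>z. z \<in> A \<Longrightarrow> (fst z - xi m, sc m (snd z)) \<in> B"
  shows "C_on k A (spacetime (U a m))"
proof -
  have s: "C_on k A (\<lambda>z. sc m (snd z))" by (rule C_on_compose[OF C_on_sc C_on_snd]) simp
  have p: "C_on k A (\<lambda>z. (fst z - xi m, sc m (snd z)))"
    by (rule C_on_Pair[OF C_on_diff[OF C_on_fst C_on_const] s])
  have 1: "C_on k A (\<lambda>z. spacetime (bubble \<gamma>) (fst z - xi m, sc m (snd z)))"
    by (rule C_on_compose[OF b p]) (use A in blast)
  have 2: "C_on k A (\<lambda>z. kap m * a m (sc m (snd z)))"
    by (rule C_on_mult[OF C_on_const]) (rule C_on_compose[OF a s], simp)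
  have "(\<lambda>z. (kap m * a m (sc m (snd z))) *\<^sub>R spacetime (bubble \<gamma>) (fst z - xi m, sc m (snd z))) = spacetime (U a m)"
    by (auto simp: U_def)
  with C_on_scaleR[OF 2 1] show ?thesis by simp
qed

text \<open>Near a given place only one bubble occurs, for all times at once. This covers
  neighbourhoods of t = T, where the instants \<open>tau m\<close> accumulate.\<close>

lemma C_on_Va:
  assumes A: "open A" and U: "\<And>m. C_on k A (spacetime (U a m))"
  shows "C_on k A (spacetime (Va a))"
proof (rule C_on_local[OF _ A])
  fix z0 :: "R3 \<times> real" assume z0: "z0 \<in> A"
  obtain m where m: "\<And>x j. x \<in> ball (fst z0) (1 / 2) \<Longrightarrow> j \<noteq> m \<Longrightarrow> 1 \<le> norm (x - xi j)"
    by (rule local_index) blast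
  have "C_on k (A \<inter> (ball (fst z0) (1 / 2) \<times> UNIV)) (spacetime (U a m))" by (rule C_on_subset[OF U]) simp
  then have "C_on k (A \<inter> (ball (fst z0) (1 / 2) \<times> UNIV)) (spacetime (Va a))"
    by (rule C_on_cong) (auto simp: Va_eq[OF m])
  moreover have "open (A \<inter> (ball (fst z0) (1 / 2) \<times> (UNIV :: real set)))"
    by (intro open_Int open_Times A) auto
  moreover have "z0 \<in> A \<inter> (ball (fst z0) (1 / 2) \<times> UNIV)" using z0 by (cases z0) auto
  ultimately show "\<exists>N. open N \<and> z0 \<in> N \<and> C_on k N (spacetime (Va a))" by blast
qed

abbreviation sing :: "(R3 \<times> real) set" where "sing \<equiv> range (\<lambda>m. (xi m, tau m))"

text \<open>The places are uniformly separated, so the singular points do not accumulate although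
  their times do.\<close>

lemma open_sing: "open (- sing)"
proof (subst open_subopen, intro ballI)
  fix z0 :: "R3 \<times> real" assume z0: "z0 \<in> - sing"
  obtain m where m: "\<And>x j. x \<in> ball (fst z0) (1 / 2) \<Longrightarrow> j \<noteq> m \<Longrightarrow> 1 \<le> norm (x - xi j)"
    by (rule local_index) blast
  let ?N = "ball (fst z0) (1 / 2) \<times> (UNIV :: real set) - {(xi m, tau m)}"
  have "(xi j, tau j) \<notin> ?N" for j using m[of "xi j" j] by (cases "j = m") auto
  moreover have "open ?N" by (intro open_Diff open_Times) auto
  moreover have "z0 \<in> ?N" using z0 by (cases z0) auto
  ultimately show "\<exists>N. open N \<and> z0 \<in> N \<and> N \<subseteq> - sing" by blast
qed

lemma Va_C1:
  assumes "\<And>m. C_on 1 UNIV (a m)"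
  shows "C_on 1 UNIV (spacetime (Va a))"
  by (rule C_on_Va[OF open_UNIV]) (rule C_on_U[OF assms C_on_1_bubble[OF less_imp_le[OF \<gamma>(1)] \<gamma>_half(1) M]], simp)

lemma Va_smooth:
  assumes a: "\<And>m. C_on k UNIV (a m)"
  shows "C_on k (- sing) (spacetime (Va a))"
proof (rule C_on_Va[OF open_sing])
  show "C_on k (- sing) (spacetime (U a m))" for m
  proof (rule C_on_U[OF a C_on_bubble])
    fix z assume "z \<in> - sing"
    then have "z \<noteq> (xi m, tau m)" by blast
    then show "(fst z - xi m, sc m (snd z)) \<in> - {(0, 0)}"
      using kap_pos[of m] by (cases z) (auto simp: sc_def)
  qed (use \<gamma> in simp)
qed

lemma pd_U: "pd i (U a m t) x = (kap m * a m (sc m t)) *\<^sub>R pd i (bubble \<gamma> (sc m t)) (x - xi m)"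
proof -
  have e: "U a m t = (\<lambda>x. (kap m * a m (sc m t)) *\<^sub>R bubble \<gamma> (sc m t) (1 *\<^sub>R (x - xi m)))" by (auto simp: U_def)
  show ?thesis unfolding e pd_scaleR[OF C_on_affine[OF bubble_slice[of "Suc 0"]]] pd_affine[OF bubble_slice[of "Suc 0"]] by simp
qed

lemma lap_U: "lap (U a m t) x = (kap m * a m (sc m t)) *\<^sub>R lap (bubble \<gamma> (sc m t)) (x - xi m)"
proof -
  have b: "C_on (Suc 0) UNIV (pd i (bubble \<gamma> (sc m t)))" for i by (rule C_on_pd[OF bubble_slice])
  have e: "pd i (U a m t) = (\<lambda>x. (kap m * a m (sc m t)) *\<^sub>R pd i (bubble \<gamma> (sc m t)) (1 *\<^sub>R (x - xi m)))" for i
    by (auto simp: pd_U)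
  have "pd i (pd i (U a m t)) x = (kap m * a m (sc m t)) *\<^sub>R pd i (pd i (bubble \<gamma> (sc m t))) (x - xi m)" for i
    unfolding e pd_scaleR[OF C_on_affine[OF b]] pd_affine[OF b] by simp
  then show ?thesis by (simp add: lap_def scaleR_sum_right)
qed

lemma U_dt:
  assumes "(a m has_real_derivative a') (at (sc m t))"
  shows "((\<lambda>s. U a m s x) has_vector_derivative
    a m (sc m t) *\<^sub>R bubble_t \<gamma> (sc m t) (x - xi m) + a' *\<^sub>R bubble \<gamma> (sc m t) (x - xi m)) (at t)"
proof -
  have s: "(sc m has_real_derivative 1 / kap m) (at t)"
    unfolding sc_def[abs_def] using kap_pos[of m] by (auto intro!: derivative_eq_intros)
  have "((\<lambda>s. bubble \<gamma> s (x - xi m)) has_vector_derivative bubble_D \<gamma> (x - xi m, sc m t) (0, 1)) (at (sc m t))"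
    using has_derivative_slice(2)[of "bubble \<gamma>" "bubble_D \<gamma> (x - xi m, sc m t)" "x - xi m" "sc m t" UNIV]
      bubble_deriv[OF less_imp_le[OF \<gamma>(1)] \<gamma>_half(1) M, of "(x - xi m, sc m t)"] by simp
  then have "((\<lambda>s. bubble \<gamma> s (x - xi m)) has_vector_derivative bubble_t \<gamma> (sc m t) (x - xi m)) (at (sc m t))"
    by (simp add: bubble_D_def)
  from vector_diff_chain_at[OF s[unfolded has_real_derivative_iff_has_vector_derivative] this]
  have b: "((\<lambda>s. bubble \<gamma> (sc m s) (x - xi m)) has_vector_derivative (1 / kap m) *\<^sub>R bubble_t \<gamma> (sc m t) (x - xi m)) (at t)"
    by (simp add: o_def)
  have k: "((\<lambda>s. kap m * a m (sc m s)) has_real_derivative kap m * (a' * (1 / kap m))) (at t)"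
    by (rule DERIV_cmult[OF DERIV_chain2[OF assms s]])
  from has_vector_derivative_scaleR[OF k b] show ?thesis using kap_pos[of m] by (simp add: U_def)
qed

section \<open>Uniform bounds for modulated superpositions\<close>

text \<open>The derivative of a modulation may be large near s = 0, where the bubble is of size s^2;
  only the product has to be bounded, and 6 is the constant that \<open>cutn_ok\<close>
  yields.\<close>

definition amp_ok :: "(nat \<Rightarrow> real \<Rightarrow> real) \<Rightarrow> (nat \<Rightarrow> real \<Rightarrow> real) \<Rightarrow> bool" where
  "amp_ok a a' \<longleftrightarrow> (\<forall>m s. 0 \<le> a m s \<and> a m s \<le> 1 \<and> (a m has_real_derivative a' m s) (at s) \<and> (\<bar>s\<bar> \<le> 1 \<longrightarrow> \<bar>a' m s\<bar> * s\<^sup>2 \<le> 6))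
     \<and> (\<forall>k m. C_on k UNIV (a m))"

lemma Va_dt:
  assumes "amp_ok a a'"
  shows "time_deriv (Va a) t x = a (kx x) (sc (kx x) t) *\<^sub>R bubble_t \<gamma> (sc (kx x) t) (x - xi (kx x))
    + a' (kx x) (sc (kx x) t) *\<^sub>R bubble \<gamma> (sc (kx x) t) (x - xi (kx x))"
  unfolding time_deriv_def Va_def
  by (rule vector_derivative_at, rule U_dt) (use assms in \<open>simp add: amp_ok_def\<close>)

text \<open>Majorant for the Laplacian of the one active bubble, zero when none is active; T
  replaces the smaller factor \<open>kap m\<close>.\<close>

definition Fb :: "real \<Rightarrow> real" where
  "Fb t = (if \<bar>sc (mt t) t\<bar> < 1 then T * M * \<bar>sc (mt t) t\<bar> powr (2 - 2 * \<gamma>) else 0)"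
text \<open>14 = 8 + 6 covers the two parts of the time derivative, from \<open>bubble_t_le\<close>
  and from \<open>amp_ok\<close>; M T covers the field and its gradient.\<close>

definition Cb :: real where "Cb = M * (T + 14)"

lemma sc_measurable [measurable]: "sc m \<in> borel_measurable borel"
  unfolding sc_def[abs_def] by measurable

lemma mt_measurable [measurable]: "mt \<in> measurable borel (count_space UNIV)"
  unfolding mt_def by measurable

lemma sc_mt_measurable [measurable]: "(\<lambda>t. sc (mt t) t) \<in> borel_measurable borel"
  by (rule measurable_compose_countable[of sc, OF sc_measurable mt_measurable])

lemma Fb_measurable [measurable]: "Fb \<in> borel_measurable borel"
  unfolding Fb_def[abs_def] by measurable

lemma Fb_nonneg: "Fb t \<ge> 0" using T M by (simp add: Fb_def)

text \<open>Each time interval contributes a multiple of its length, and the lengths are summable.\<close>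

lemma sc_integral: "(\<integral>\<^sup>+ t. ennreal (if \<bar>sc (mt t) t\<bar> < 1 then \<bar>sc (mt t) t\<bar> powr (- 1 / 2) else 0) \<partial>lborel) < \<infinity>"
proof -
  define g where "g u = indicator {0..1} u * u powr (- 1 / 2)" for u :: real
  \<comment> \<open>The two one-sided pieces majorise |s|^(-1/2) on (-1, 1); each has integral
    2.\<close>
  define h where "h u = ennreal (g u) + ennreal (g (- u))" for u
  have gm [measurable]: "g \<in> borel_measurable borel" unfolding g_def[abs_def] by measurable
  have hm [measurable]: "h \<in> borel_measurable borel" unfolding h_def[abs_def] by measurable
  have g1: "(\<integral>\<^sup>+ u. ennreal (g u) \<partial>lborel) = ennreal 2"
    using nn_integral_has_integral_lebesgue[OF _ has_integral_powr_from_0[of "- 1 / 2" 1]] by (simp add: g_def)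
  have g2: "(\<integral>\<^sup>+ u. ennreal (g (- u)) \<partial>lborel) = ennreal 2"
    using nn_integral_real_affine[of "\<lambda>u. ennreal (g u)" "- 1" 0] g1 by simp
  have h4: "(\<integral>\<^sup>+ u. h u \<partial>lborel) = ennreal 4"
    unfolding h_def by (subst nn_integral_add) (simp_all add: g1 g2 ennreal_plus[symmetric] del: ennreal_plus)
  have hs: "(\<integral>\<^sup>+ t. h (sc m t) \<partial>lborel) = ennreal (kap m * 4)" for m
  proof -
    have "(\<integral>\<^sup>+ t. h (sc m t) \<partial>lborel) = \<bar>kap m\<bar> * (\<integral>\<^sup>+ u. h (sc m (tau m + kap m * u)) \<partial>lborel)"
      by (rule nn_integral_real_affine) (use kap_pos[of m] in \<open>auto simp: less_imp_neq[symmetric]\<close>)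
    also have "(\<lambda>u. h (sc m (tau m + kap m * u))) = h" using kap_pos[of m] by (simp add: sc_def fun_eq_iff)
    finally show ?thesis using kap_pos[of m] by (simp add: h4 ennreal_mult)
  qed
  have "(\<integral>\<^sup>+ t. ennreal (if \<bar>sc (mt t) t\<bar> < 1 then \<bar>sc (mt t) t\<bar> powr (- 1 / 2) else 0) \<partial>lborel)
      \<le> (\<integral>\<^sup>+ t. (\<Sum>m. h (sc m t)) \<partial>lborel)"
  proof (rule nn_integral_mono)
    fix t
    have "ennreal (if \<bar>s\<bar> < 1 then \<bar>s\<bar> powr (- 1 / 2) else 0) \<le> h s" for s :: real
      by (cases "s \<ge> 0") (auto simp: h_def g_def indicator_def)
    also have "h (sc (mt t) t) \<le> (\<Sum>m. h (sc m t))"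
      using sum_le_suminf[of "\<lambda>m. h (sc m t)" "{mt t}"] by simp
    finally show "ennreal (if \<bar>sc (mt t) t\<bar> < 1 then \<bar>sc (mt t) t\<bar> powr (- 1 / 2) else 0) \<le> (\<Sum>m. h (sc m t))" .
  qed
  also have "\<dots> = (\<Sum>m. ennreal (kap m * 4))" by (subst nn_integral_suminf) (auto simp: hs)
  also have "\<dots> < \<infinity>"
  proof -
    have "summable (\<lambda>m. (T / 2) * (1 / 2 :: real) ^ m)" by (intro summable_mult summable_geometric) simp
    moreover have "(\<lambda>m. (T / 2) * (1 / 2 :: real) ^ m) = (\<lambda>m. kap m * 4)" by (simp add: kap_def power_add power3_eq_cube)
    ultimately have "summable (\<lambda>m. kap m * 4)" by (simp only:)
    then have "(\<Sum>m. ennreal (kap m * 4)) = ennreal (\<Sum>m. kap m * 4)"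
      by (intro suminf_ennreal2) (simp_all add: kap_pos less_imp_le)
    then show ?thesis by simp
  qed
  finally show ?thesis .
qed

text \<open>For |s| < 1 a larger exponent gives a smaller power, and the condition on r says that (2
  - 2 \<gamma>) r \<ge> -1/2.\<close>

lemma Fb_powr_le:
  assumes r: "r > 0" "r * (2 * \<gamma> - 2) \<le> 1 / 2"
  shows "Fb t powr r \<le> (T * M) powr r * (if \<bar>sc (mt t) t\<bar> < 1 then \<bar>sc (mt t) t\<bar> powr (- 1 / 2) else 0)"
proof (cases "\<bar>sc (mt t) t\<bar> < 1")
  case True
  let ?s = "\<bar>sc (mt t) t\<bar>"
  have "Fb t powr r = (T * M) powr r * ?s powr ((2 - 2 * \<gamma>) * r)"
    using True T M(1) by (simp add: Fb_def powr_mult powr_powr)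
  also have "\<dots> \<le> (T * M) powr r * ?s powr (- 1 / 2)"
    using True r by (intro mult_left_mono powr_mono') (auto simp: algebra_simps)
  finally show ?thesis using True by simp
qed (simp add: Fb_def)

lemma Fb_powr_int:
  assumes r: "r > 0" "r * (2 * \<gamma> - 2) \<le> 1 / 2"
  shows "(\<integral>\<^sup>+ t. ennreal (Fb t powr r) \<partial>lborel) < \<infinity>"
proof -
  let ?E = "\<lambda>t. if \<bar>sc (mt t) t\<bar> < 1 then \<bar>sc (mt t) t\<bar> powr (- 1 / 2) else 0"
  have "(\<integral>\<^sup>+ t. ennreal (Fb t powr r) \<partial>lborel) \<le> (\<integral>\<^sup>+ t. ennreal ((T * M) powr r) * ennreal (?E t) \<partial>lborel)"
    by (intro nn_integral_mono) (use Fb_powr_le[OF r] in \<open>simp add: ennreal_mult[symmetric]\<close>)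
  also have "\<dots> = ennreal ((T * M) powr r) * (\<integral>\<^sup>+ t. ennreal (?E t) \<partial>lborel)"
    by (rule nn_integral_cmult) measurable
  also have "\<dots> < \<infinity>" using sc_integral by (simp add: ennreal_mult_less_top)
  finally show ?thesis .
qed

end

context profile begin

text \<open>Stated for every admissible modulation, so that the solution and its approximations
  become flows with identical c, F, C and t0.\<close>

lemma flow_Va:
  assumes a: "amp_ok a a'" and Y: "closed Y" "countable Y" "\<And>k. C_on k (UNIV \<times> (- Y)) (spacetime (Va a))"
  shows "flow (Va a) Y (\<lambda>t. xi (mt t)) Fb Cb (T / 4)"
proof
  note \<gamma>' = less_imp_le[OF \<gamma>(1)] \<gamma>_half(1)
  have a01: "0 \<le> a m s" "a m s \<le> 1" and ak: "C_on k UNIV (a m)" for m s k using a by (auto simp: amp_ok_def)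
  have coef: "\<bar>kap m * a m s\<bar> \<le> T" for m s
  proof -
    have "kap m * a m s \<le> kap m * 1" "0 \<le> kap m * a m s" using kap_pos[of m] a01 by (auto intro!: mult_left_mono)
    then show ?thesis using kap_le[of m] T by linarith
  qed
  have scaled: "norm ((kap m * a m s) *\<^sub>R v) \<le> T * B" if "norm v \<le> B" for m s B and v :: R3
    unfolding norm_scaleR by (rule mult_mono[OF coef that]) (use T in auto)
  have CbT: "T * M \<le> Cb" using M(1) by (simp add: Cb_def algebra_simps)
  show "C_on 1 UNIV (spacetime (Va a))" by (rule Va_C1[OF ak])
  show "closed Y" "countable Y" by fact+
  show "C_on k (UNIV \<times> (- Y)) (spacetime (Va a))" for k by (rule Y(3))
  show "T / 4 > 0" using T by simp
  show "Va a t x = 0" if "t < T / 4" for t x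
  proof -
    have "\<not> \<bar>sc (mt t) t\<bar> < 1" unfolding sc_less using that kap_le[of "mt t"] T by auto
    then show ?thesis unfolding Va_mt using U_zero(1) by simp
  qed
  show "Va a t x = 0" if "1 < norm (x - xi (mt t))" for t x
    unfolding Va_mt using that by (intro U_zero(2)) simp
  show "time_deriv (Va a) t x = 0" if "1 < norm (x - xi (mt t))" for t x
  proof (cases "kx x = mt t")
    case True
    then have "Va a s x = 0" for s unfolding Va_def using that by (intro U_zero(2)) simp
    then show ?thesis by (simp add: time_deriv_def)
  next
    case False
    then have "1 \<le> \<bar>sc (kx x) t\<bar>" using mt_eq[of "kx x" t] by force
    then show ?thesis unfolding Va_dt[OF a] by (simp add: bubble_t_zero bubble_zero)
  qed
  have "(\<lambda>t. xi (mt t)) \<in> borel_measurable borel"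
    by (rule measurable_compose[OF mt_measurable]) simp
  then show "(\<lambda>t. xi (mt t)) \<in> borel_measurable borel" .
  have b0: "norm (bubble \<gamma> s y) \<le> M" for s y
  proof (cases "\<bar>s\<bar> < 1")
    case True
    have "M * s\<^sup>2 \<le> M * 1" using True M(1) by (intro mult_left_mono) (auto simp: abs_square_le_1)
    then show ?thesis using bubble_le[OF \<gamma>' M, of s y] by linarith
  next
    case False then show ?thesis using bubble_zero[of s \<gamma> y] M(1) by simp
  qed
  show "norm (Va a t x) \<le> Cb" for t x
    unfolding Va_mt U_def using scaled[OF b0] CbT by (rule order_trans)
  have b1: "norm (pd i (bubble \<gamma> s) y) \<le> M" for i s y
  proof (cases "\<bar>s\<bar> < 1")
    case True
    have "\<bar>s\<bar> powr (2 - \<gamma>) \<le> 1 powr (2 - \<gamma>)" using True \<gamma> by (intro powr_mono2) auto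
    then have "M * \<bar>s\<bar> powr (2 - \<gamma>) \<le> M * 1" using M(1) by (intro mult_left_mono) auto
    then show ?thesis using pd_bubble_le[OF \<gamma>' M, of i s y] by linarith
  next
    case False then show ?thesis using amp_bounds(3)[of s] M(1) by (simp add: pd_bubble)
  qed
  show "norm (pd i (Va a t) x) \<le> Cb" for i t x
    unfolding Va_mt pd_U using scaled[OF b1] CbT by (rule order_trans)
  show "norm (time_deriv (Va a) t x) \<le> Cb" for t x
  proof -
    let ?s = "sc (kx x) t" let ?y = "x - xi (kx x)"
    have "norm (a (kx x) ?s *\<^sub>R bubble_t \<gamma> ?s ?y + a' (kx x) ?s *\<^sub>R bubble \<gamma> ?s ?y) \<le> 8 * M + 6 * M"
    proof (cases "\<bar>?s\<bar> < 1")
      case True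
      have "norm (bubble_t \<gamma> ?s ?y) \<le> 8 * M"
        using bubble_t_le[OF \<gamma>' M, of ?s ?y] True M(1) mult_left_mono[of "\<bar>?s\<bar>" 1 "8 * M"] by linarith
      then have 1: "norm (a (kx x) ?s *\<^sub>R bubble_t \<gamma> ?s ?y) \<le> 1 * (8 * M)"
        unfolding norm_scaleR using a01 by (intro mult_mono) (auto simp: abs_of_nonneg)
      have 2: "\<bar>a' (kx x) ?s\<bar> * ?s\<^sup>2 \<le> 6" using a True by (simp add: amp_ok_def)
      have "norm (a' (kx x) ?s *\<^sub>R bubble \<gamma> ?s ?y) \<le> \<bar>a' (kx x) ?s\<bar> * (M * ?s\<^sup>2)"
        unfolding norm_scaleR by (intro mult_left_mono bubble_le[OF \<gamma>' M]) simp
      also have "\<dots> = (\<bar>a' (kx x) ?s\<bar> * ?s\<^sup>2) * M" by simp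
      also have "\<dots> \<le> 6 * M" using 2 M(1) by (intro mult_right_mono) auto
      finally show ?thesis using 1 norm_triangle_ineq[of "a (kx x) ?s *\<^sub>R bubble_t \<gamma> ?s ?y" "a' (kx x) ?s *\<^sub>R bubble \<gamma> ?s ?y"] by linarith
    next
      case False then show ?thesis using M(1) by (simp add: bubble_t_zero bubble_zero)
    qed
    moreover have "8 * M + 6 * M \<le> Cb" using M(1) T by (simp add: Cb_def algebra_simps)
    ultimately show ?thesis unfolding Va_dt[OF a] by linarith
  qed
  show "norm (lap (Va a t) x) \<le> Fb t" for t x
  proof (cases "\<bar>sc (mt t) t\<bar> < 1")
    case True
    show ?thesis unfolding Va_mt lap_U
      using scaled[OF lap_bubble_le[OF \<gamma>' M, of "sc (mt t) t" "x - xi (mt t)"], of "mt t" "sc (mt t) t"] True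
      by (simp add: Fb_def mult.assoc)
  next
    case False
    then show ?thesis unfolding Va_mt lap_U lap_bubble using amp_bounds(3)[of "sc (mt t) t"] by (simp add: Fb_def)
  qed
  show "Fb \<in> borel_measurable borel" by measurable
  show "Fb t \<ge> 0" for t by (rule Fb_nonneg)
  show "(\<integral>\<^sup>+ t. ennreal (Fb t) * indicator {0<..<S} t \<partial>lborel) < \<infinity>" for S
  proof -
    have "(\<integral>\<^sup>+ t. ennreal (Fb t) * indicator {0<..<S} t \<partial>lborel) \<le> (\<integral>\<^sup>+ t. ennreal (Fb t) \<partial>lborel)"
      by (intro nn_integral_mono) (auto simp: indicator_def)
    also have "\<dots> < \<infinity>" using Fb_powr_int[of 1] \<gamma>_half Fb_nonneg by simp
    finally show ?thesis .
  qed
  show "divg (Va a t) x = 0" for t x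
  proof -
    have "divg (Va a t) x = (kap (mt t) * a (mt t) (sc (mt t) t)) * divg (bubble \<gamma> (sc (mt t) t)) (x - xi (mt t))"
      unfolding divg_def Va_mt pd_U by (simp add: sum_distrib_left)
    then show ?thesis by (simp add: divg_bubble)
  qed
qed

section \<open>The solution and its smooth cut-offs\<close>

definition one :: "nat \<Rightarrow> real \<Rightarrow> real" where "one m s = 1"
text \<open>T is included as the limit of the \<open>tau m\<close>, which makes the set
  closed.\<close>

definition sing_times :: "real set" where "sing_times = insert T (range tau)"

lemma one_ok: "amp_ok one (\<lambda>m s. 0)"
  by (simp add: amp_ok_def one_def[abs_def] C_on_const)

lemma kap_tendsto: "kap \<longlonglongrightarrow> 0"
proof -
  have "(\<lambda>m. (T / 8) * (1 / 2 :: real) ^ m) \<longlonglongrightarrow> (T / 8) * 0" by (intro tendsto_mult tendsto_const LIMSEQ_realpow_zero) auto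
  moreover have "(T / 8) * (1 / 2 :: real) ^ m = kap m" for m by (simp add: kap_def power_add power3_eq_cube)
  ultimately show ?thesis by simp
qed

lemma sing_times: "closed sing_times" "countable sing_times"
proof -
  have "(\<lambda>m. T - 4 * kap m) \<longlonglongrightarrow> T - 4 * 0" by (intro tendsto_intros kap_tendsto)
  then have "tau \<longlonglongrightarrow> T" by (simp add: tau_def[abs_def])
  from compact_imp_closed[OF compact_sequence_with_limit[OF this]]
  show "closed sing_times" by (simp add: sing_times_def)
  show "countable sing_times" by (simp add: sing_times_def)
qed

lemma main_flow: "flow (Va one) sing_times (\<lambda>t. xi (mt t)) Fb Cb (T / 4)"
proof (rule flow_Va[OF one_ok sing_times])
  show "C_on k (UNIV \<times> - sing_times) (spacetime (Va one))" for k
  proof (rule C_on_subset[OF Va_smooth])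
    show "C_on k UNIV (one m)" for m by (simp add: one_def[abs_def] C_on_const)
  qed (auto simp: sing_times_def)
qed

text \<open>Removes the times with n s^2 \<le> 1, where the bubble loses smoothness, and every
  bubble of index above n, which bounds the support in space-time.\<close>

definition cutn :: "nat \<Rightarrow> nat \<Rightarrow> real \<Rightarrow> real" where
  "cutn n m s = (if m \<le> n then flat 0 (real n * s\<^sup>2 - 1) else 0)"
definition cutn' :: "nat \<Rightarrow> nat \<Rightarrow> real \<Rightarrow> real" where
  "cutn' n m s = (if m \<le> n then flat 2 (real n * s\<^sup>2 - 1) * (2 * real n * s) else 0)"

lemma cutn_ok: "amp_ok (cutn n) (cutn' n)"
  unfolding amp_ok_def
proof (intro conjI allI impI)
  fix m s k
  show "0 \<le> cutn n m s" by (simp add: cutn_def flat_nonneg)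
  show "cutn n m s \<le> 1" using flat_le[of 0 "real n * s\<^sup>2 - 1"] by (simp add: cutn_def)
  have d1: "(flat 0 has_real_derivative flat 2 (real n * s\<^sup>2 - 1)) (at (real n * s\<^sup>2 - 1))"
    using flat_has_deriv[of 0 "real n * s\<^sup>2 - 1"] by (simp add: numeral_2_eq_2)
  have d2: "((\<lambda>s. real n * s\<^sup>2 - 1) has_real_derivative 2 * real n * s) (at s)"
    by (auto intro!: derivative_eq_intros)
  show "(cutn n m has_real_derivative cutn' n m s) (at s)"
    unfolding cutn_def[abs_def] cutn'_def using DERIV_chain2[OF d1 d2] by (cases "m \<le> n") auto
  show "\<bar>cutn' n m s\<bar> * s\<^sup>2 \<le> 6" if s: "\<bar>s\<bar> \<le> 1"
  proof -
    let ?v = "real n * s\<^sup>2 - 1"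
    \<comment> \<open>The factor n of the chain rule and the weight s^2 combine to n s^2 = v + 1,
      and v \<open>flat 2 v\<close> = \<open>flat 1 v\<close> for v > 0; hence the bound 1! + 2! =
      3.\<close>
    have "flat 2 ?v * (?v + 1) \<le> 3"
    proof (cases "?v > 0")
      case True
      have "flat 2 ?v * ?v = flat 1 ?v" using True flat_Suc[of 1 ?v] by (simp add: numeral_2_eq_2)
      then have "flat 2 ?v * (?v + 1) = flat 1 ?v + flat 2 ?v" by (simp only: distrib_left mult_1_right)
      also have "\<dots> \<le> 1 + 2" using flat_le[of 1 ?v] flat_le[of 2 ?v] by (intro add_mono) (simp_all add: fact_numeral)
      finally show ?thesis by simp
    qed (simp add: flat_def)
    then have 1: "flat 2 ?v * (real n * s\<^sup>2) \<le> 3" by simp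
    have "\<bar>cutn' n m s\<bar> * s\<^sup>2 \<le> (2 * \<bar>s\<bar>) * (flat 2 ?v * (real n * s\<^sup>2))"
      using flat_nonneg[of 2 ?v] by (auto simp: cutn'_def abs_mult mult_ac)
    also have "\<dots> \<le> 2 * 3" using s 1 flat_nonneg[of 2 ?v] by (intro mult_mono) auto
    finally show ?thesis by simp
  qed
  have sm: "C_on k UNIV (\<lambda>s. flat 0 (real n * (s * s) - 1))"
    by (rule C_on_compose[OF C_on_flat]) (intro C_on_diff C_on_mult C_on_id C_on_const, simp)
  show "C_on k UNIV (cutn n m)"
    using sm by (cases "m \<le> n") (auto simp: cutn_def[abs_def] power2_eq_square C_on_const)
qed

text \<open>Near s = 0 the modulation is identically zero; elsewhere the bubble is smooth.\<close>

lemma C_on_U_cutn: "C_on k UNIV (spacetime (U (cutn n) m))"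
proof (rule C_on_local[OF _ open_UNIV])
  fix z0 :: "R3 \<times> real"
  have cs: "continuous_on UNIV (\<lambda>z::R3 \<times> real. sc m (snd z))"
    by (rule C_on_continuous[OF C_on_compose[OF C_on_sc[of 0] C_on_snd]]) simp
  have a: "C_on k UNIV (cutn n m)" using cutn_ok by (simp add: amp_ok_def)
  show "\<exists>N. open N \<and> z0 \<in> N \<and> C_on k N (spacetime (U (cutn n) m))"
  proof (cases "sc m (snd z0) = 0")
    case False
    let ?N = "{z::R3 \<times> real. sc m (snd z) \<noteq> 0}"
    have "open ?N" by (rule open_Collect_neq[OF cs continuous_on_const])
    moreover have "C_on k ?N (spacetime (U (cutn n) m))" by (rule C_on_U[of k "cutn n" m, OF a C_on_bubble_off]) simp
    ultimately show ?thesis using False by blast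
  next
    case True
    let ?N = "{z::R3 \<times> real. real n * (sc m (snd z))\<^sup>2 < 1}"
    have "open ?N" by (intro open_Collect_less continuous_intros cs)
    moreover have "C_on k ?N (spacetime (U (cutn n) m))"
      by (rule C_on_cong[OF C_on_const[of k ?N 0]]) (auto simp: U_def cutn_def flat_def)
    ultimately show ?thesis using True by (intro exI[of _ ?N]) simp
  qed
qed

lemma cutn_flow: "flow (Va (cutn n)) {} (\<lambda>t. xi (mt t)) Fb Cb (T / 4)"
proof (rule flow_Va[OF cutn_ok])
  show "C_on k (UNIV \<times> - {}) (spacetime (Va (cutn n)))" for k
    using C_on_Va[OF open_UNIV, of k "cutn n"] C_on_U_cutn by simp
qed auto

lemma xi_norm: "norm (xi m) = 4 * real m"
  by (simp add: xi_def norm_eq_sqrt_inner[of "axis 1 (1::real)"] inner_axis_axis)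

lemma cutn_bsupp: "bsupp (spacetime (Va (cutn n)))"
proof (rule bsuppI)
  fix z :: "R3 \<times> real" assume z: "4 * real n + 1 + T < norm z"
  obtain x t where xt: "z = (x, t)" by (cases z)
  show "spacetime (Va (cutn n)) z = 0"
  proof (rule ccontr)
    assume "spacetime (Va (cutn n)) z \<noteq> 0"
    then have nz: "U (cutn n) (kx x) t x \<noteq> 0" by (simp add: xt Va_def)
    then have n: "kx x \<le> n" by (auto simp: U_def cutn_def split: if_splits)
    have x: "norm (x - xi (kx x)) < 1" using nz U_zero(2) not_less by blast
    have "\<bar>sc (kx x) t\<bar> < 1" using nz U_zero(1) not_less by blast
    then have t: "\<bar>t\<bar> \<le> T" unfolding sc_less using kap_le[of "kx x"] kap_pos[of "kx x"] T by auto
    have "norm (xi (kx x)) \<le> 4 * real n" using n xi_norm[of "kx x"] by simp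
    then have "norm x \<le> 4 * real n + 1" using x norm_triangle_ineq2[of x "xi (kx x)"] by linarith
    then show False using z t norm_Pair_le[of x t] by (simp add: xt)
  qed
qed

text \<open>With v = n s^2 - 1 > 0 the derivative is at most 2 n |s| / v^2, and v grows linearly in
  n for fixed s \<noteq> 0.\<close>

lemma cutn_tendsto:
  assumes s: "s \<noteq> 0"
  shows "(\<lambda>n. cutn n m s) \<longlonglongrightarrow> 1" "(\<lambda>n. cutn' n m s) \<longlonglongrightarrow> 0"
proof -
  define u where "u = s\<^sup>2"
  have u: "u > 0" using s by (simp add: u_def)
  have at: "filterlim (\<lambda>n. - 1 + u * real n) at_top sequentially"
    by (intro filterlim_tendsto_add_at_top[OF tendsto_const] filterlim_tendsto_pos_mult_at_top[OF tendsto_const u]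
        filterlim_real_sequentially)
  then have v: "filterlim (\<lambda>n. real n * u - 1) at_top sequentially" by (simp add: mult.commute)
  have ev: "eventually (\<lambda>n. real n * u > 2 \<and> n \<ge> m) sequentially"
    using filterlim_at_top_dense[THEN iffD1, OF v, rule_format, of 1] eventually_ge_at_top[of m]
    by eventually_elim simp
  note iv = tendsto_inverse_0_at_top[OF v]
  have "(\<lambda>n. exp (- inverse (real n * u - 1))) \<longlonglongrightarrow> exp (- 0)" by (intro tendsto_exp tendsto_minus iv)
  then have "(\<lambda>n. exp (- 1 / (real n * u - 1))) \<longlonglongrightarrow> 1" by (simp add: inverse_eq_divide)
  then show "(\<lambda>n. cutn n m s) \<longlonglongrightarrow> 1"
    by (rule Lim_transform_eventually) (use ev in eventually_elim, auto simp: cutn_def flat_def u_def)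
  have "(\<lambda>n. 2 * \<bar>s\<bar> / u * (inverse (real n * u - 1) + (inverse (real n * u - 1))\<^sup>2)) \<longlonglongrightarrow> 2 * \<bar>s\<bar> / u * (0 + 0\<^sup>2)"
    by (intro tendsto_intros iv)
  then have "(\<lambda>n. 2 * \<bar>s\<bar> / u * (inverse (real n * u - 1) + (inverse (real n * u - 1))\<^sup>2)) \<longlonglongrightarrow> 0" by simp
  then have l: "(\<lambda>n. 2 * real n * \<bar>s\<bar> / (real n * u - 1)\<^sup>2) \<longlonglongrightarrow> 0"
  proof (rule Lim_transform_eventually)
    show "eventually (\<lambda>n. 2 * \<bar>s\<bar> / u * (inverse (real n * u - 1) + (inverse (real n * u - 1))\<^sup>2)
        = 2 * real n * \<bar>s\<bar> / (real n * u - 1)\<^sup>2) sequentially"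
      using ev
    proof eventually_elim
      case (elim n)
      define w where "w = real n * u - 1"
      have w: "w > 0" "real n = (w + 1) / u" using elim u by (simp_all add: w_def)
      have "2 * \<bar>s\<bar> / u * (inverse w + (inverse w)\<^sup>2) = 2 * ((w + 1) / u) * \<bar>s\<bar> / w\<^sup>2"
        using w(1) u by (simp add: field_simps power2_eq_square)
      then show ?case unfolding w_def[symmetric] w(2)[symmetric] .
    qed
  qed
  have le: "eventually (\<lambda>n. norm (cutn' n m s) \<le> 2 * real n * \<bar>s\<bar> / (real n * u - 1)\<^sup>2) sequentially"
    using ev
  proof eventually_elim
    case (elim n)
    let ?v = "real n * u - 1"
    have "flat 2 ?v \<le> 1 / ?v\<^sup>2" using elim by (simp add: flat_def divide_right_mono)
    then have "flat 2 ?v * (2 * real n * \<bar>s\<bar>) \<le> (1 / ?v\<^sup>2) * (2 * real n * \<bar>s\<bar>)" by (rule mult_right_mono) simp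
    then show ?case using elim flat_nonneg[of 2 ?v] by (simp add: cutn'_def u_def abs_mult)
  qed
  from tendsto_rabs_zero_cancel[OF tendsto_sandwich[OF _ le[unfolded real_norm_def] tendsto_const l]]
  show "(\<lambda>n. cutn' n m s) \<longlonglongrightarrow> 0" by simp
qed

lemma sc_nz: "t \<notin> sing_times \<Longrightarrow> sc m t \<noteq> 0"
  using kap_pos[of m] by (auto simp: sc_def sing_times_def)

lemma Va_tendsto:
  assumes t: "t \<notin> sing_times"
  shows "(\<lambda>n. Va (cutn n) t x) \<longlonglongrightarrow> Va one t x"
    "(\<lambda>n. pd i (Va (cutn n) t) x) \<longlonglongrightarrow> pd i (Va one t) x"
    "(\<lambda>n. lap (Va (cutn n) t) x) \<longlonglongrightarrow> lap (Va one t) x"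
    "(\<lambda>n. time_deriv (Va (cutn n)) t x) \<longlonglongrightarrow> time_deriv (Va one) t x"
proof -
  note l = cutn_tendsto[OF sc_nz[OF t]]
  have k: "(\<lambda>n. kap m * cutn n m (sc m t)) \<longlonglongrightarrow> kap m * one m (sc m t)" for m
    unfolding one_def by (intro tendsto_mult tendsto_const l)
  show "(\<lambda>n. Va (cutn n) t x) \<longlonglongrightarrow> Va one t x"
    unfolding Va_def U_def by (intro tendsto_scaleR tendsto_const k)
  show "(\<lambda>n. pd i (Va (cutn n) t) x) \<longlonglongrightarrow> pd i (Va one t) x"
    unfolding Va_mt pd_U by (intro tendsto_scaleR tendsto_const k)
  show "(\<lambda>n. lap (Va (cutn n) t) x) \<longlonglongrightarrow> lap (Va one t) x"
    unfolding Va_mt lap_U by (intro tendsto_scaleR tendsto_const k)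
  show "(\<lambda>n. time_deriv (Va (cutn n)) t x) \<longlonglongrightarrow> time_deriv (Va one) t x"
    unfolding Va_dt[OF cutn_ok] Va_dt[OF one_ok] one_def
    by (intro tendsto_add tendsto_scaleR tendsto_const l)
qed

text \<open>At \<open>tau m\<close> bubble m has s = 0 and every other bubble is inactive.\<close>

lemma Va_at_tau:
  "Va one (tau m) x = 0" "grad (Va one (tau m)) x = 0" "time_deriv (Va one) (tau m) x = 0"
proof -
  have s: "sc j (tau m) = 0 \<or> 1 \<le> \<bar>sc j (tau m)\<bar>" for j
    using sc_disjoint[of j "tau m" m] by (cases "j = m") (force simp: sc_def)+
  show z: "Va one (tau m) x = 0" for x
    unfolding Va_def U_def using s[of "kx x"] by (simp add: bubble_zero)
  have "Va one (tau m) = (\<lambda>x. 0)" using z by (simp add: fun_eq_iff)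
  then show "grad (Va one (tau m)) x = 0" by (simp add: grad_def pd_def vec_eq_iff)
  show "time_deriv (Va one) (tau m) x = 0"
    unfolding Va_dt[OF one_ok] using s[of "kx x"] by (simp add: bubble_t_zero)
qed

text \<open>The supremum is bounded below by the value at one moving point, the one that the
  dilation carries to a fixed y0 on the sphere of \<open>lap_swirl\<close>.\<close>

lemma blowup: "((\<lambda>t. Lp_norm \<infinity> (lap (Va one t))) \<longlongrightarrow> \<infinity>) (at (tau m))"
proof -
  have "((\<lambda>t. Lp_norm \<infinity> (lap (Va one t))) \<longlongrightarrow> top) (at (tau m))"
    unfolding tendsto_top_iff_ennreal
  proof (intro allI impI)
    fix l :: real assume l: "l \<ge> 0"
    define b where "b = 2 * \<gamma> - 2"
    have b: "b > 0" using \<gamma> by (simp add: b_def)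
    \<comment> \<open>20 is 40 times the lower bound 1/2 for \<open>norm (rot y0)\<close>; one
      factor exp(-2) stems from \<open>lap_swirl\<close>, the other bounds
      \<open>flat 0 (1 - s\<^sup>2)\<close> below for s^2 \<le> 1/2.\<close>
    define c where "c = 20 * kap m * (exp (- 2) * exp (- 2))"
    have c: "c > 0" using kap_pos by (simp add: c_def)
    \<comment> \<open>For 0 < |s| < d the lower bound c |s|^(-b) exceeds l + 1; the 1/2 keeps the
      bump factor of \<open>amp\<close> away from its zero at |s| = 1.\<close>
    define d where "d = min (1 / 2) ((c / (l + 1)) powr (1 / b))"
    have d: "d > 0" using c l by (simp add: d_def)
    have main: "ennreal l < Lp_norm \<infinity> (lap (Va one t))" if el: "dist t (tau m) < kap m * d" "t \<noteq> tau m" for t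
    proof -
      define s where "s = sc m t"
      have s: "\<bar>s\<bar> < d" "s \<noteq> 0" using el kap_pos[of m] by (auto simp: s_def sc_def dist_real_def field_simps)
      have s2: "\<bar>s\<bar> < 1 / 2" using s(1) by (simp add: d_def)
      have ss: "s\<^sup>2 \<le> 1 / 2"
      proof -
        have "\<bar>s\<bar>\<^sup>2 \<le> (1 / 2)\<^sup>2" by (rule power_mono) (use s2 in auto)
        then show ?thesis by (simp add: power2_eq_square)
      qed
      have mt: "mt t = m" by (rule mt_eq) (use s2 in \<open>simp add: s_def\<close>)
      define y0 :: R3 where "y0 = (1 / sqrt 2) *\<^sub>R axis 1 1"
      have yy: "y0 \<bullet> y0 = 1 / 2" by (simp add: y0_def inner_axis_axis)
      define A where "A = kap m * (amp s * (dil \<gamma> s)\<^sup>2)"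
      have lapV: "lap (Va one t) x = A *\<^sub>R lap swirl (dil \<gamma> s *\<^sub>R (x - xi m))" for x
        unfolding Va_mt mt lap_U lap_bubble one_def A_def s_def by simp
      have dil: "dil \<gamma> s > 0" using s(2) by (simp add: dil_eq)
      have "lap (Va one t) (xi m + (1 / dil \<gamma> s) *\<^sub>R y0) = A *\<^sub>R ((- 40 * exp (- 2)) *\<^sub>R rot y0)"
        unfolding lapV using dil lap_swirl[OF yy] by simp
      then have n: "norm (lap (Va one t) (xi m + (1 / dil \<gamma> s) *\<^sub>R y0)) = \<bar>A\<bar> * (40 * exp (- 2) * norm (rot y0))"
        by (simp add: abs_mult)
      have r: "1 / 2 \<le> norm (rot y0)"
      proof -
        have "\<bar>rot y0 $ 2\<bar> \<le> norm (rot y0)" by (rule component_le_norm_cart)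
        moreover have "rot y0 $ 2 = 1 / sqrt 2" by (simp add: rot_nth y0_def axis_def)
        moreover have "1 / 2 \<le> 1 / sqrt 2"
          by (rule divide_left_mono) (simp_all add: real_le_lsqrt)
        ultimately show ?thesis by linarith
      qed
      have fl: "exp (- 2) \<le> flat 0 (1 - s\<^sup>2)"
      proof -
        have "1 / (1 - s\<^sup>2) \<le> 2" using ss by (simp add: field_simps)
        then show ?thesis using ss by (simp add: flat_def)
      qed
      have pw: "s\<^sup>2 * (dil \<gamma> s)\<^sup>2 = \<bar>s\<bar> powr (- b)"
      proof -
        have e: "s\<^sup>2 = \<bar>s\<bar> powr 2" "(dil \<gamma> s)\<^sup>2 = \<bar>s\<bar> powr (- \<gamma>) * \<bar>s\<bar> powr (- \<gamma>)"
          using s(2) by (simp_all add: powr_numeral dil_eq power2_eq_square)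
        have "s\<^sup>2 * (dil \<gamma> s)\<^sup>2 = \<bar>s\<bar> powr 2 * (\<bar>s\<bar> powr (- \<gamma>) * \<bar>s\<bar> powr (- \<gamma>))" unfolding e(2) by (simp only: e(1))
        also have "\<dots> = \<bar>s\<bar> powr (2 + (- \<gamma> + - \<gamma>))" by (simp only: powr_add)
        also have "2 + (- \<gamma> + - \<gamma>) = - b" by (simp add: b_def)
        finally show ?thesis .
      qed
      have "A = kap m * flat 0 (1 - s\<^sup>2) * \<bar>s\<bar> powr (- b)"
        unfolding A_def amp_def pw[symmetric] by simp
      then have "kap m * exp (- 2) * \<bar>s\<bar> powr (- b) \<le> A"
        using fl kap_pos[of m] by (simp add: mult_left_mono mult_right_mono)
      then have "(kap m * exp (- 2) * \<bar>s\<bar> powr (- b)) * (40 * exp (- 2) * (1 / 2)) \<le> \<bar>A\<bar> * (40 * exp (- 2) * norm (rot y0))"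
        using r kap_pos[of m] by (intro mult_mono) auto
      then have n': "c * \<bar>s\<bar> powr (- b) \<le> norm (lap (Va one t) (xi m + (1 / dil \<gamma> s) *\<^sub>R y0))"
        unfolding n c_def by (simp add: mult_ac)
      have "\<bar>s\<bar> powr b < ((c / (l + 1)) powr (1 / b)) powr b"
        using s b by (intro powr_less_mono2) (auto simp: d_def)
      also have "\<dots> = c / (l + 1)" using b c l by (simp add: powr_powr)
      finally have "(l + 1) * \<bar>s\<bar> powr b < c" using l by (simp add: field_simps)
      then have "l + 1 < c * \<bar>s\<bar> powr (- b)" using s(2) by (simp add: powr_minus field_simps)
      then have "l < norm (lap (Va one t) (xi m + (1 / dil \<gamma> s) *\<^sub>R y0))" using n' by linarith
      then have "ennreal l < ennreal (norm (lap (Va one t) (xi m + (1 / dil \<gamma> s) *\<^sub>R y0)))" using l by (simp add: ennreal_less_iff)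
      also have "\<dots> \<le> Lp_norm \<infinity> (lap (Va one t))"
      proof (rule Lp_norm_infinity_ge)
        have "lap swirl \<in> Cc_inf UNIV" by (rule Cc_inf_lap[OF Cc_infI[OF swirl_smooth swirl_bsupp]])
        from C_on_continuous[OF C_on_scaleR[OF C_on_const C_on_affine[OF Cc_inf_smooth[OF this, of 0]]]]
        have "continuous_on UNIV (\<lambda>x. A *\<^sub>R lap swirl (dil \<gamma> s *\<^sub>R (x - xi m)))" .
        then show "continuous_on UNIV (lap (Va one t))" by (simp add: lapV[abs_def])
      qed
      finally show ?thesis .
    qed
    show "eventually (\<lambda>t. ennreal l < Lp_norm \<infinity> (lap (Va one t))) (at (tau m))"
      unfolding eventually_at
    proof (intro exI[of _ "kap m * d"] conjI ballI impI)
      show "0 < kap m * d" using kap_pos[of m] d by simp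
    qed (rule main, blast+)
  qed
  then show ?thesis by (simp only: infinity_ennreal_def)
qed

end

lemma (in profile) main_approx: "approx_flow (Va one) sing_times (\<lambda>t. xi (mt t)) Fb Cb (T / 4) (\<lambda>n. Va (cutn n))"
  by (intro approx_flow.intro main_flow approx_flow_axioms.intro cutn_flow cutn_bsupp Va_tendsto)

lemma tau_strict_mono: "strict_mono_on {1..} (\<lambda>m. profile.tau T (m - 1))" if "profile T \<gamma> M"
proof (rule strict_mono_onI)
  interpret profile T \<gamma> M by (rule that)
  fix i j :: nat assume "i \<in> {1..}" "j \<in> {1..}" "i < j"
  then have "i - 1 < j - 1" by auto
  then show "tau (i - 1) < tau (j - 1)"
    using kap_half[of "i - 1" "j - 1"] kap_pos[of "i - 1"] by (simp add: tau_def)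
qed

text \<open>The statement of the theorem counts instants from 1, the construction counts bubbles
  from 0.\<close>

lemma shifted_union: "(\<Union>m\<in>{1..}. {(f (m - 1), g (m - 1))}) = range (\<lambda>m::nat. (f m, g m))"
proof (intro set_eqI iffI)
  fix z assume "z \<in> range (\<lambda>m. (f m, g m))"
  then obtain m where "z = (f m, g m)" by blast
  then show "z \<in> (\<Union>m\<in>{1..}. {(f (m - 1), g (m - 1))})" by (intro UN_I[of "Suc m"]) auto
qed auto

text \<open>The sum is at most twice its larger term; this splits the bounded part of the force from
  the Laplacian part.\<close>

lemma powr_add_le:
  fixes x y r :: real
  assumes "0 \<le> x" "0 \<le> y" "r \<ge> 0"
  shows "(x + y) powr r \<le> (2 * x) powr r + (2 * y) powr r"
proof (cases "x \<le> y")
  case True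
  have "(x + y) powr r \<le> (2 * y) powr r" using assms True by (intro powr_mono2) auto
  then show ?thesis using powr_ge_zero[of "2 * x" r] by linarith
next
  case False
  have "(x + y) powr r \<le> (2 * x) powr r" using assms False by (intro powr_mono2) auto
  then show ?thesis using powr_ge_zero[of "2 * y" r] by linarith
qed

lemma zero_LrLq:
  assumes "r > 0" "q > 0"
  shows "(\<lambda>t x. 0) \<in> (LrLq (ennreal r) (ennreal q) S :: (real \<Rightarrow> R3 \<Rightarrow> 'b::euclidean_space) set)"
proof (rule LrLq_I[where H = "\<lambda>_. 0" and c = "\<lambda>_. 0"])
  show "spacetime (\<lambda>t x. 0 :: 'b) \<in> borel_measurable (lborel \<Otimes>\<^sub>M lborel)" by simp
qed (use assms in auto)

lemma zero_G_sigma: "(\<lambda>x. 0) \<in> G_sigma"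
proof -
  have pz: "pd i (\<lambda>x. 0 :: R3) = (\<lambda>x. 0)" for i by (simp add: pd_def fun_eq_iff)
  have w: "weak_deriv \<alpha> (\<lambda>x. 0 :: R3) (\<lambda>x. 0)" for \<alpha>
    by (simp add: weak_deriv_def L1_loc_continuous)
  have n: "Lp_norm q (\<lambda>x. 0 :: R3) < \<infinity>" for q
  proof (cases "q = \<infinity>")
    case True
    have "esssup lebesgue (\<lambda>x::R3. 0 :: ennreal) = 0" by (rule esssup_const) simp
    then show ?thesis using True by (simp add: Lp_norm_def Lp_gauge_def)
  qed (simp add: Lp_norm_def Lp_gauge_def enn_powr_def)
  have "(\<lambda>x. 0 :: R3) \<in> Sobolev k q" for k q
    unfolding Sobolev_def Lp_def using w n by (auto intro!: exI[of _ "\<lambda>x. 0"])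
  moreover have "smooth_on UNIV (\<lambda>x::R3. 0 :: R3)" by (rule smooth_onI[OF C_on_const])
  moreover have "divg (\<lambda>x. 0) x = 0" for x by (simp add: divg_def pz)
  ultimately show ?thesis by (simp add: G_sigma_def G_space_def)
qed

theorem theorem2p7:
  fixes T r q :: real
  assumes "T > 0" and "r \<ge> 1" and "q > 1"
  shows "\<exists>V0 \<in> G_sigma. \<exists>f \<in> LrLq (ennreal r) (ennreal q) T. \<exists>V.
    \<comment> \<open>(a)\<close>
    global_Leray_Hopf V0 f V \<and> V \<in> C0_L2 \<and>
    (\<forall>t>0. energy_lhs V t = energy_rhs V0 f V t) \<and>
    \<comment> \<open>(b)\<close>
    (\<exists>qbar>3. \<forall>s::real. s > qbar \<longrightarrow>
       V \<in> LrLq_loc (ennreal (2 * s / (s - 3))) (ennreal s)) \<and>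
    (\<forall>S>0. \<forall>W. Leray_Hopf S V0 f W \<longrightarrow>
       (AE t in lebesgue_on {0<..<S}. AE x in lebesgue. W t x = V t x)) \<and>
    \<comment> \<open>(c), (d)\<close>
    (\<exists>(\<tau> :: nat \<Rightarrow> real) (\<xi> :: nat \<Rightarrow> R3) (P :: real \<Rightarrow> R3 \<Rightarrow> real).
       strict_mono_on {1..} \<tau> \<and> (\<forall>m\<ge>1. 0 < \<tau> m \<and> \<tau> m < T) \<and>
       associated_pressure f V P \<and>
       C_on 1 (UNIV \<times> {0..}) (spacetime V) \<and>
       C_on 1 (UNIV \<times> {0..}) (spacetime P) \<and>
       smooth_on (UNIV \<times> {0..} - (\<Union>m\<in>{1..}. {(\<xi> m, \<tau> m)})) (spacetime V) \<and>
       smooth_on (UNIV \<times> {0..} - (\<Union>m\<in>{1..}. {(\<xi> m, \<tau> m)})) (spacetime P) \<and>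
       (\<forall>m\<ge>1.
          (\<forall>x. V (\<tau> m) x = 0 \<and> grad (V (\<tau> m)) x = 0 \<and> time_deriv V (\<tau> m) x = 0) \<and>
          ((\<lambda>t. Lp_norm \<infinity> (lap (V t))) \<longlongrightarrow> \<infinity>) (at (\<tau> m))) \<and>
       (\<forall>p::real. p \<ge> 1 \<longrightarrow> P \<in> LrLq_loc 2 (ennreal p)) \<and>
       (\<lambda>t. grad (P t)) \<in> LrLq_loc (ennreal r) (ennreal q))"
proof -
  obtain M where M: "M > 0" "\<And>z. norm (swirl z) \<le> M" "\<And>i z. norm (pd i swirl z) \<le> M"
    "\<And>z. norm (lap swirl z) \<le> M" "\<And>z. norm (\<Sum>i\<in>UNIV. (z $ i) *\<^sub>R pd i swirl z) \<le> M"
    by (rule swirl_bounds) blast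
  \<comment> \<open>Chosen so that r (2 \<gamma> - 2) = 1/2, which makes the r-th power of the
    Laplacian of order |s|^(-1/2); r \<ge> 1 gives \<gamma> \<le> 5/4.\<close>
  define \<gamma> where "\<gamma> = 1 + 1 / (4 * r)"
  have bd: "1 < \<gamma>" "\<gamma> \<le> 5 / 4" "r * (2 * \<gamma> - 2) \<le> 1 / 2" using assms by (auto simp: \<gamma>_def field_simps)
  have pr: "profile T \<gamma> M" by unfold_locales (use assms bd M in auto)
  interpret profile T \<gamma> M by (rule pr)
  let ?V = "Va one"
  interpret A: approx_flow ?V sing_times "\<lambda>t. xi (mt t)" Fb Cb "T / 4" "\<lambda>n. Va (cutn n)" by (rule main_approx)
  let ?f = "A.forceB" let ?Z = "\<lambda>x. 0 :: R3" let ?P = "\<lambda>t x. 0 :: real"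
  let ?\<tau> = "\<lambda>m. tau (m - 1)" let ?\<xi> = "\<lambda>m. xi (m - 1)"
  have f: "?f \<in> LrLq (ennreal r) (ennreal q) T"
  proof (rule LrLq_I[OF A.forceB_meas A.forceB_le A.G_nonneg A.G_meas])
    let ?K = "Cb + 3 * Cb\<^sup>2"
    have K: "?K \<ge> 0" using A.C_nonneg by simp
    have "A.G t powr r \<le> (2 * ?K) powr r + 2 powr r * Fb t powr r" for t
    proof -
      have "A.G t = ?K + Fb t" by (simp add: A.G_def)
      then show ?thesis using powr_add_le[OF K Fb_nonneg[of t], of r] assms Fb_nonneg[of t] by (simp add: powr_mult)
    qed
    then have le: "ennreal (A.G t powr r) * indicator {0<..<T} t
        \<le> ennreal ((2 * ?K) powr r) * indicator {0<..<T} t + ennreal (2 powr r) * ennreal (Fb t powr r)" for t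
      by (cases "t \<in> {0<..<T}") (simp_all add: ennreal_mult[symmetric] ennreal_plus[symmetric] del: ennreal_plus)
    have "(\<integral>\<^sup>+ t. ennreal (A.G t powr r) * indicator {0<..<T} t \<partial>lborel)
        \<le> (\<integral>\<^sup>+ t. ennreal ((2 * ?K) powr r) * indicator {0<..<T} t + ennreal (2 powr r) * ennreal (Fb t powr r) \<partial>lborel)"
      by (intro nn_integral_mono le)
    also have "\<dots> = (\<integral>\<^sup>+ t. ennreal ((2 * ?K) powr r) * indicator {0<..<T} t \<partial>lborel)
        + ennreal (2 powr r) * (\<integral>\<^sup>+ t. ennreal (Fb t powr r) \<partial>lborel)"
      by (subst nn_integral_add) (auto simp: nn_integral_cmult)
    also have "\<dots> < \<infinity>"
      using const_powr_int[where K = "2 * ?K" and r = r and S = T] Fb_powr_int[of r] bd(3) assms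
      by (simp add: ennreal_mult_less_top)
    finally show "(\<integral>\<^sup>+ t. ennreal (A.G t powr r) * indicator {0<..<T} t \<partial>lborel) < \<infinity>" .
  qed (use assms in auto)
  have sing: "(\<Union>m\<in>{1..}. {(?\<xi> m, ?\<tau> m)}) = sing" by (rule shifted_union)
  have sm: "C_on k (UNIV \<times> {0..} - sing) (spacetime ?V)" for k
  proof (rule C_on_subset[OF Va_smooth])
    show "C_on k UNIV (one m)" for m by (simp add: one_def[abs_def] C_on_const)
  qed auto
  have c0: "C_on k B (spacetime ?P)" for k B
    using C_on_const[of k B "0 :: real"] by (simp add: case_prod_unfold)
  have g0: "grad (\<lambda>x. 0 :: real) = (\<lambda>x. 0)" by (simp add: grad_def pd_def fun_eq_iff vec_eq_iff)
  have tb: "0 < tau m \<and> tau m < T" for m using kap_le[of m] kap_pos[of m] assms(1) by (simp add: tau_def)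
  show ?thesis
  proof (intro bexI[of _ ?Z] bexI[OF _ f] exI[of _ ?V] conjI)
    show "?Z \<in> G_sigma" by (rule zero_G_sigma)
    show "global_Leray_Hopf ?Z ?f ?V" unfolding global_Leray_Hopf_def using A.V_Leray_Hopf by blast
    show "?V \<in> C0_L2" by (rule A.V_C0)
    show "\<forall>t>0. energy_lhs ?V t = energy_rhs ?Z ?f ?V t" using A.energy_equality by blast
    show "\<exists>qbar>3. \<forall>s::real. s > qbar \<longrightarrow> ?V \<in> LrLq_loc (ennreal (2 * s / (s - 3))) (ennreal s)"
    \<comment> \<open>V is bounded with slices in unit balls, so it lies in all these spaces as soon
      as the exponent 2s/(s - 3) is positive; 4 is just a number above 3.\<close>
    proof (intro exI[of _ "4::real"] conjI allI impI CollectI)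
      fix s S :: real assume "4 < s"
      then show "?V \<in> LrLq (ennreal (2 * s / (s - 3))) (ennreal s) S" by (intro A.V_LrLq) auto
    qed simp
    show "\<forall>S>0. \<forall>W. Leray_Hopf S ?Z ?f W \<longrightarrow> (AE t in lebesgue_on {0<..<S}. AE x in lebesgue. W t x = ?V t x)"
      using A.unique by blast
    show "\<exists>(\<tau> :: nat \<Rightarrow> real) (\<xi> :: nat \<Rightarrow> R3) (P :: real \<Rightarrow> R3 \<Rightarrow> real).
       strict_mono_on {1..} \<tau> \<and> (\<forall>m\<ge>1. 0 < \<tau> m \<and> \<tau> m < T) \<and>
       associated_pressure ?f ?V P \<and>
       C_on 1 (UNIV \<times> {0..}) (spacetime ?V) \<and>
       C_on 1 (UNIV \<times> {0..}) (spacetime P) \<and>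
       smooth_on (UNIV \<times> {0..} - (\<Union>m\<in>{1..}. {(\<xi> m, \<tau> m)})) (spacetime ?V) \<and>
       smooth_on (UNIV \<times> {0..} - (\<Union>m\<in>{1..}. {(\<xi> m, \<tau> m)})) (spacetime P) \<and>
       (\<forall>m\<ge>1.
          (\<forall>x. ?V (\<tau> m) x = 0 \<and> grad (?V (\<tau> m)) x = 0 \<and> time_deriv ?V (\<tau> m) x = 0) \<and>
          ((\<lambda>t. Lp_norm \<infinity> (lap (?V t))) \<longlongrightarrow> \<infinity>) (at (\<tau> m))) \<and>
       (\<forall>p::real. p \<ge> 1 \<longrightarrow> P \<in> LrLq_loc 2 (ennreal p)) \<and>
       (\<lambda>t. grad (P t)) \<in> LrLq_loc (ennreal r) (ennreal q)"
    proof (intro exI[of _ ?\<tau>] exI[of _ ?\<xi>] exI[of _ ?P] conjI)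
      show "strict_mono_on {1..} ?\<tau>" by (rule tau_strict_mono[OF pr])
      show "\<forall>m\<ge>1. 0 < ?\<tau> m \<and> ?\<tau> m < T" using tb by blast
      show "associated_pressure ?f ?V ?P" by (rule A.V_pressure)
      show "C_on 1 (UNIV \<times> {0..}) (spacetime ?V)" by (rule C_on_subset[OF A.V_C1]) simp
      show "C_on 1 (UNIV \<times> {0..}) (spacetime ?P)" by (rule c0)
      show "smooth_on (UNIV \<times> {0..} - (\<Union>m\<in>{1..}. {(?\<xi> m, ?\<tau> m)})) (spacetime ?V)"
        unfolding sing by (rule smooth_onI[OF sm])
      show "smooth_on (UNIV \<times> {0..} - (\<Union>m\<in>{1..}. {(?\<xi> m, ?\<tau> m)})) (spacetime ?P)"
        by (rule smooth_onI[OF c0])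
      show "\<forall>m\<ge>1. (\<forall>x. ?V (?\<tau> m) x = 0 \<and> grad (?V (?\<tau> m)) x = 0 \<and> time_deriv ?V (?\<tau> m) x = 0) \<and>
          ((\<lambda>t. Lp_norm \<infinity> (lap (?V t))) \<longlongrightarrow> \<infinity>) (at (?\<tau> m))"
        using Va_at_tau blowup by blast
      show "\<forall>p::real. p \<ge> 1 \<longrightarrow> ?P \<in> LrLq_loc 2 (ennreal p)"
        using zero_LrLq[where r = 2 and 'b = real] by simp
      show "(\<lambda>t. grad (?P t)) \<in> LrLq_loc (ennreal r) (ennreal q)"
        unfolding g0 using zero_LrLq[where r = r and q = q and 'b = "real^3"] assms by simp
    qed
  qed
qed

end
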